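(* $$2\;\le\;\liminf_{N\to\infty}\,\frac{\dim(\mathcal{M}(\mathbb{C}P^N):\mathbb{C})}{N}\;\le\;\limsup_{N\to\infty}\,\frac{\dim(\mathcal{M}(\mathbb{C}P^N):\mathbb{C})}{N}\;\le\;4 .$$
   Context: Let $z=x+y\sqrt{-1}$ be the coordinate on $\mathbb{C}$ and $\Delta=\frac{\partial^2}{\partial x^2}+\frac{\partial^2}{\partial y^2}$. Brody curves. For a holomorphic map $f=[f_0:f_1:\cdots:f_N]:\mathbb{C}\to\mathbb{C}P^N$ (with $f_0,\dots,f_N$ holomorphic functions without common zeros), the pointwise norm $|df|\ge 0$ is defined by $|df|^2=\frac{1}{4\pi}\Delta\log(|f_0|^2+\cdots+|f_N|^2)$. The map $f$ is a Brody curve if $|df|\le 1$ on all of $\mathbb{C}$. $\mathcal{M}(\mathbb{C}P^N)$ is the space of Brody curves in $\mathbb{C}P^N$ with the compact-open topology; it is compact and metrizable, and $\mathbb{C}$ acts on it continuously by $(f(z),a)\mapsto f(z+a)$. Mean dimension. For a compact metric space $(X,d)$ and $\varepsilon>0$, a continuous map $f:X\to Y$ to a topological space is an $\varepsilon$-embedding if $\mathrm{Diam}\,f^{-1}(y)\le\varepsilon$ for all $y\in Y$; $\mathrm{Widim}_\varepsilon(X,d)$ is the minimum $n\ge 0$ such that there are an $n$-dimensional polyhedron $K$ and an $\varepsilon$-embedding $X\to K$. If $\mathbb{C}$ acts continuously on $X$, put, for $R>0$, $d_R(p,q)=\sup_{z\in\mathbb{C},|z|\le R}d(z.p,z.q)$,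 $\mathrm{Widim}_\varepsilon(X:\mathbb{C})=\lim_{R\to\infty}\frac{1}{\pi R^2}\mathrm{Widim}_\varepsilon(X,d_R)$ (the limit always exists), and $\dim(X:\mathbb{C})=\lim_{\varepsilon\to0}\mathrm{Widim}_\varepsilon(X:\mathbb{C})$. This does not depend on the choice of the metric $d$ compatible with the topology. *)

theory Defs
  imports "HOL-Analysis.Analysis"
begin

section \<open>Complex projective space\<close>

text \<open>
  The dimension \<open>N\<close> tends to infinity in the statement, so it has to be a term rather than a type.
  Accordingly \<open>\<complex>\<^bsup>N+1\<^esup>\<close> is the product of copies of \<open>\<complex>\<close> over the index set \<open>{..N}\<close>
  (its elements are extensional functions on \<open>{..N}\<close>), and a point of projective space is the set of
  all its homogeneous coordinate vectors.
\<close>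

definition quotient_topology :: "'a topology \<Rightarrow> ('a \<Rightarrow> 'b) \<Rightarrow> 'b topology" where
  "quotient_topology X q =
     topology (\<lambda>U. U \<subseteq> q ` topspace X \<and> openin X {x \<in> topspace X. q x \<in> U})"

lemma openin_quotient_topology:
  "openin (quotient_topology X q) U \<longleftrightarrow>
     U \<subseteq> q ` topspace X \<and> openin X {x \<in> topspace X. q x \<in> U}"
proof -
  have "istopology (\<lambda>U. U \<subseteq> q ` topspace X \<and> openin X {x \<in> topspace X. q x \<in> U})"
    unfolding istopology_def
  proof (intro conjI allI impI)
    fix S T
    assume "S \<subseteq> q ` topspace X \<and> openin X {x \<in> topspace X. q x \<in> S}"
      and "T \<subseteq> q ` topspace X \<and> openin X {x \<in> topspace X. q x \<in> T}"
    moreover have "{x \<in> topspace X. q x \<in> S \<inter> T} =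
        {x \<in> topspace X. q x \<in> S} \<inter> {x \<in> topspace X. q x \<in> T}" by auto
    ultimately show "S \<inter> T \<subseteq> q ` topspace X" "openin X {x \<in> topspace X. q x \<in> S \<inter> T}"
      by auto
  next
    fix \<K>
    assume *: "\<forall>K\<in>\<K>. K \<subseteq> q ` topspace X \<and> openin X {x \<in> topspace X. q x \<in> K}"
    have "{x \<in> topspace X. q x \<in> \<Union>\<K>} = (\<Union>K\<in>\<K>. {x \<in> topspace X. q x \<in> K})" by auto
    with * show "\<Union>\<K> \<subseteq> q ` topspace X" "openin X {x \<in> topspace X. q x \<in> \<Union>\<K>}"
      by auto
  qed
  then show ?thesis by (simp add: quotient_topology_def)
qed

lemma topspace_quotient_topology [simp]: "topspace (quotient_topology X q) = q ` topspace X"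
proof
  show "topspace (quotient_topology X q) \<subseteq> q ` topspace X"
    using iffD1[OF openin_quotient_topology openin_topspace] by (rule conjunct1)
  have "{x \<in> topspace X. q x \<in> q ` topspace X} = topspace X" by auto
  then have "openin (quotient_topology X q) (q ` topspace X)"
    by (simp add: openin_quotient_topology)
  then show "q ` topspace X \<subseteq> topspace (quotient_topology X q)" by (rule openin_subset)
qed

lemma quotient_map_quotient_topology: "quotient_map X (quotient_topology X q) q"
  unfolding quotient_map_def topspace_quotient_topology openin_quotient_topology
  by (simp cong: conj_cong)

definition punctured_vectors :: "nat \<Rightarrow> (nat \<Rightarrow> complex) topology" where
  "punctured_vectors N =
     subtopology (product_topology (\<lambda>_. euclidean) {..N}) {v. \<exists>i\<le>N. v i \<noteq> 0}"

definition proj_point :: "nat \<Rightarrow> (nat \<Rightarrow> complex) \<Rightarrow> (nat \<Rightarrow> complex) set" where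
  "proj_point N v = {w \<in> topspace (punctured_vectors N). \<exists>c. c \<noteq> 0 \<and> (\<forall>i\<le>N. w i = c * v i)}"

definition CP :: "nat \<Rightarrow> (nat \<Rightarrow> complex) set topology" where
  "CP N = quotient_topology (punctured_vectors N) (proj_point N)"


section \<open>Brody curves\<close>

definition partial_x :: "(complex \<Rightarrow> real) \<Rightarrow> complex \<Rightarrow> real" where
  "partial_x u z = deriv (\<lambda>t. u (z + complex_of_real t)) 0"

definition partial_y :: "(complex \<Rightarrow> real) \<Rightarrow> complex \<Rightarrow> real" where
  "partial_y u z = deriv (\<lambda>t. u (z + complex_of_real t * \<i>)) 0"

definition laplacian :: "(complex \<Rightarrow> real) \<Rightarrow> complex \<Rightarrow> real" where
  "laplacian u z = partial_x (partial_x u) z + partial_y (partial_y u) z"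

text \<open>\<open>f = [F 0 : \<dots> : F N]\<close> with entire functions \<open>F i\<close> without common zeros.\<close>

definition homogeneous_coords ::
  "nat \<Rightarrow> (nat \<Rightarrow> complex \<Rightarrow> complex) \<Rightarrow> (complex \<Rightarrow> (nat \<Rightarrow> complex) set) \<Rightarrow> bool" where
  "homogeneous_coords N F f \<longleftrightarrow>
     (\<forall>i\<le>N. F i holomorphic_on UNIV) \<and>
     (\<forall>z. \<exists>i\<le>N. F i z \<noteq> 0) \<and>
     (\<forall>z. f z = proj_point N (\<lambda>i\<in>{..N}. F i z))"

definition df_norm :: "nat \<Rightarrow> (nat \<Rightarrow> complex \<Rightarrow> complex) \<Rightarrow> complex \<Rightarrow> real" where
  "df_norm N F z = sqrt (1 / (4 * pi) * laplacian (\<lambda>w. ln (\<Sum>i\<le>N. (cmod (F i w))\<^sup>2)) z)"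

text \<open>
  Two choices of homogeneous coordinates differ by a nowhere vanishing entire factor \<open>g\<close>, and
  \<open>ln \<bar>g\<bar>\<^sup>2\<close> is harmonic; so \<^const>\<open>df_norm\<close> depends on the curve only, and the existential
  quantifier below could equally be a universal one over all homogeneous coordinates of a
  holomorphic map.
\<close>

definition brody_curve :: "nat \<Rightarrow> (complex \<Rightarrow> (nat \<Rightarrow> complex) set) \<Rightarrow> bool" where
  "brody_curve N f \<longleftrightarrow> (\<exists>F. homogeneous_coords N F f \<and> (\<forall>z. df_norm N F z \<le> 1))"

definition compact_open_topology :: "'b topology \<Rightarrow> ('a::topological_space \<Rightarrow> 'b) topology" where
  "compact_open_topology Y = topology_generated_by
     {{f. continuous_map euclidean Y f \<and> f ` K \<subseteq> U} | K U. compact K \<and> openin Y U}"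

lemma topspace_compact_open_topology [simp]:
  "topspace (compact_open_topology Y) = {f. continuous_map euclidean Y f}"
proof -
  let ?B = "{{f. continuous_map euclidean Y f \<and> f ` K \<subseteq> U} | (K :: 'a set) U. compact K \<and> openin Y U}"
  have "{f. continuous_map euclidean Y f \<and> f ` ({} :: 'a set) \<subseteq> {}} \<in> ?B"
    using compact_empty openin_empty by (intro CollectI exI conjI) (rule refl)
  then have "{f. continuous_map euclidean Y f} \<in> ?B"
    by (simp only: image_empty subset_refl simp_thms)
  moreover have "S \<subseteq> {f. continuous_map euclidean Y f}" if "S \<in> ?B" for S
    using that by blast
  ultimately have "\<Union>?B = {f. continuous_map euclidean Y f}"
    by (meson Union_least Union_upper subset_antisym)
  then show ?thesis
    by (simp only: compact_open_topology_def topology_generated_by_topspace)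
qed

definition brody_space :: "nat \<Rightarrow> (complex \<Rightarrow> (nat \<Rightarrow> complex) set) topology" where
  "brody_space N = subtopology (compact_open_topology (CP N)) {f. brody_curve N f}"

lemma continuous_map_homogeneous_coords:
  assumes "homogeneous_coords N F f"
  shows "continuous_map euclidean (CP N) f"
proof -
  have "continuous_map euclidean (punctured_vectors N) (\<lambda>z. \<lambda>i\<in>{..N}. F i z)"
    unfolding punctured_vectors_def continuous_map_in_subtopology
  proof
    show "continuous_map euclidean (product_topology (\<lambda>_. euclidean) {..N}) (\<lambda>z. \<lambda>i\<in>{..N}. F i z)"
      using assms by (auto simp: continuous_map_componentwise homogeneous_coords_def
          holomorphic_on_imp_continuous_on)
    show "(\<lambda>z. \<lambda>i\<in>{..N}. F i z) \<in> topspace euclidean \<rightarrow> {v. \<exists>i\<le>N. v i \<noteq> 0}"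
      using assms by (simp add: homogeneous_coords_def Pi_iff) (metis (lifting))
  qed
  moreover have "continuous_map (punctured_vectors N) (CP N) (proj_point N)"
    unfolding CP_def by (intro quotient_imp_continuous_map quotient_map_quotient_topology)
  ultimately have "continuous_map euclidean (CP N) (proj_point N \<circ> (\<lambda>z. \<lambda>i\<in>{..N}. F i z))"
    by (rule continuous_map_compose)
  moreover have "f = proj_point N \<circ> (\<lambda>z. \<lambda>i\<in>{..N}. F i z)"
    using assms by (auto simp: homogeneous_coords_def)
  ultimately show ?thesis by simp
qed

lemma topspace_brody_space: "topspace (brody_space N) = {f. brody_curve N f}"
  using continuous_map_homogeneous_coords by (auto simp: brody_space_def brody_curve_def)

definition translate :: "complex \<Rightarrow> (complex \<Rightarrow> 'b) \<Rightarrow> (complex \<Rightarrow> 'b)" where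
  "translate a f = (\<lambda>z. f (z + a))"


section \<open>Polyhedra and widim\<close>

text \<open>
  Polyhedra of arbitrary dimension have to be available in one type, so they are given as geometric
  realizations, in barycentric coordinates, of finite abstract simplicial complexes with vertices in
  \<open>\<nat>\<close>. The topology is the one induced from the product topology on \<open>nat \<Rightarrow> real\<close>; as only finitely
  many coordinates are nonzero on the realization, it is the usual one.
\<close>

definition abstract_complex :: "nat set set \<Rightarrow> bool" where
  "abstract_complex K \<longleftrightarrow>
     finite K \<and> K \<noteq> {} \<and> (\<forall>s\<in>K. finite s \<and> s \<noteq> {}) \<and> (\<forall>s\<in>K. \<forall>t. t \<subseteq> s \<and> t \<noteq> {} \<longrightarrow> t \<in> K)"

definition complex_dim :: "nat set set \<Rightarrow> nat" where
  "complex_dim K = Max ((\<lambda>s. card s - 1) ` K)"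

definition realization :: "nat set set \<Rightarrow> (nat \<Rightarrow> real) topology" where
  "realization K =
     top_of_set {x. (\<forall>i. 0 \<le> x i) \<and> {i. x i \<noteq> 0} \<in> K \<and> (\<Sum>i | x i \<noteq> 0. x i) = 1}"

text \<open>As \<^const>\<open>diameter\<close>, but for the abstract metric spaces of type \<open>'a metric\<close>.\<close>

definition metric_diameter :: "'a metric \<Rightarrow> 'a set \<Rightarrow> real" where
  "metric_diameter m S = (if S = {} then 0 else SUP (x, y) \<in> S \<times> S. mdist m x y)"

definition eps_embedding :: "real \<Rightarrow> 'a metric \<Rightarrow> 'b topology \<Rightarrow> ('a \<Rightarrow> 'b) \<Rightarrow> bool" where
  "eps_embedding \<epsilon> m Y g \<longleftrightarrow>
     continuous_map (mtopology_of m) Y g \<and>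
     (\<forall>y\<in>topspace Y. metric_diameter m {x \<in> mspace m. g x = y} \<le> \<epsilon>)"

definition Widim :: "real \<Rightarrow> 'a metric \<Rightarrow> nat" where
  "Widim \<epsilon> m = (LEAST n. \<exists>K g. abstract_complex K \<and> complex_dim K = n \<and>
                              eps_embedding \<epsilon> m (realization K) g)"


section \<open>Mean dimension\<close>

text \<open>
  For a continuous action on a compact space the supremum is finite and this is a metric. The value
  \<open>0\<close> outside the carrier is there because members of \<open>'a metric\<close> are nonnegative everywhere, which is
  not clear for an unbounded supremum.
\<close>

definition orbit_metric :: "(complex \<Rightarrow> 'a \<Rightarrow> 'a) \<Rightarrow> real \<Rightarrow> 'a metric \<Rightarrow> 'a metric" where
  "orbit_metric act R m = metric (mspace m,
     \<lambda>p q. if p \<in> mspace m \<and> q \<in> mspace m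
           then SUP z\<in>cball 0 R. mdist m (act z p) (act z q) else 0)"

definition Widim_rate :: "real \<Rightarrow> (complex \<Rightarrow> 'a \<Rightarrow> 'a) \<Rightarrow> 'a metric \<Rightarrow> ereal" where
  "Widim_rate \<epsilon> act m =
     Lim at_top (\<lambda>R::real. ereal (real (Widim \<epsilon> (orbit_metric act R m)) / (pi * R\<^sup>2)))"

definition metric_mean_dim :: "(complex \<Rightarrow> 'a \<Rightarrow> 'a) \<Rightarrow> 'a metric \<Rightarrow> ereal" where
  "metric_mean_dim act m = Lim (at_right 0) (\<lambda>\<epsilon>. Widim_rate \<epsilon> act m)"

text \<open>
  For a compact metrizable space with a continuous action of \<open>\<complex>\<close>, the value does not depend on the
  choice of the compatible metric.
\<close>

definition mean_dim :: "'a topology \<Rightarrow> (complex \<Rightarrow> 'a \<Rightarrow> 'a) \<Rightarrow> ereal" where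
  "mean_dim X act = metric_mean_dim act (SOME m. mtopology_of m = X)"

end

theory Submission
  imports Defs "HOL-Complex_Analysis.Complex_Analysis" "HOL-Real_Asymp.Real_Asymp"
begin

text \<open>
  Mean dimension counts real parameters per unit area, and both bounds come from the values of a
  Brody curve on a lattice \<open>t\<int> + \<i>\<int>\<close>, which has \<open>1/t\<close> points per unit area. A point of
  \<open>\<complex>P\<^sup>N\<close> has \<open>2N\<close> real parameters, so the values on such a lattice account for \<open>2N/t\<close> parameters
  per unit area. Density \<open>2\<close> is enough to determine a curve, which gives \<open>4N\<close>; density
  \<open>1\<close> can be prescribed up to an error that vanishes as \<open>N\<close> grows, which gives \<open>2N\<close>.

  Upper bound. Let \<open>F\<close> and \<open>G\<close> be homogeneous coordinates of two Brody curves. The cross terms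
  \<open>F\<^sub>i G\<^sub>j - F\<^sub>j G\<^sub>i\<close> are entire, vanish where the curves agree, and are bounded by \<open>2 \<bar>F\<bar> \<bar>G\<bar>\<close>, where
  \<open>log (\<bar>F\<bar>\<^sup>2 \<bar>G\<bar>\<^sup>2)\<close> has Laplacian at most \<open>8\<pi>\<close>. A product \<open>s\<close> of hyperbolic sines with simple zeros
  on a lattice of density \<open>1/t\<close> has size \<open>exp (\<pi> x\<^sup>2 / t)\<close>, and \<open>2 \<pi> x\<^sup>2 / t\<close> has Laplacian \<open>4\<pi> / t\<close>.
  If \<open>1/t > 2\<close>, the maximum principle for the cross term divided by \<open>s\<close> makes the cross term small
  inside a large rectangle of common values (\<open>cross_term_small\<close>). So agreement on the lattice points of
  a slightly larger disc forces two curves to be close on a disc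
  (\<open>brody_curves_agree_on_lattice\<close>). The values on \<open>n\<close> points form a set of box dimension at most
  \<open>2Nn\<close>, and box dimension bounds the dimension of a polyhedron that receives a map with small
  fibres (\<open>emb_dim_le_box_dim\<close>).

  Lower bound. For \<open>a < 1\<close> and large \<open>N\<close>, theta functions give a curve \<open>F\<close> with \<open>\<bar>F\<bar>\<close> comparable to
  \<open>exp (\<pi> a x\<^sup>2)\<close> and energy density strictly below the permitted one (\<open>theta_curve\<close>). For a lattice
  of density less than \<open>a\<close> there are entire functions which, relative to \<open>exp (\<pi> a x\<^sup>2)\<close>, decay
  like a Gaussian around one lattice point and vanish at the others. Adding small multiples of them to all
  coordinates but the largest one at each lattice point gives a cube of Brody curves with \<open>2N\<close>
  parameters per lattice point, opposite faces of which differ by a fixed amount at a lattice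
  point (\<open>perturbation_family\<close>). By the theorem of Poincare and Miranda such a cube has no map
  with small fibres into a polyhedron of smaller dimension (\<open>emb_dim_lower_bound\<close>).

  These estimates speak about the mean dimension because the space of Brody curves is compact and
  metrizable (\<open>mtopology_cdist\<close>, \<open>compact_brody_space\<close>) and because the number of parameters over a
  bounded set of translations is monotone, subadditive and translation invariant, so that the limit
  over discs exists (\<open>Ornstein_Weiss_disc\<close>).
\<close>

section \<open>Maps with small fibres into polyhedra\<close>

text \<open>
  Widim refers to fibres of diameter at most \<open>\<epsilon>\<close>. With an arbitrary relation \<open>E\<close> in place of a
  distance bound, pullbacks, conjunctions and changes of the metric are instances of one notion,
  and monotonicity in the dimension is built in.
\<close>

definition emb_dim_le :: "'a topology => ('a => 'a => bool) => nat => bool" where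
 "emb_dim_le X E n \<longleftrightarrow> (\<exists>K g. abstract_complex K & complex_dim K <= n &
   continuous_map X (realization K) g &
   (\<forall>x\<in>topspace X. \<forall>y\<in>topspace X. g x = g y --> E x y))"

lemma emb_dim_le_mono:
 assumes "emb_dim_le X E n" "n <= n'"
  and "!!x y. x \<in> topspace X ==> y \<in> topspace X ==> E x y ==> E' x y"
 shows "emb_dim_le X E' n'"
 using assms unfolding emb_dim_le_def by (meson order_trans)

lemma emb_dim_le_pullback:
 assumes "emb_dim_le X E n" "continuous_map Y X h"
 shows "emb_dim_le Y (%x y. E (h x) (h y)) n"
proof -
 obtain K g where K: "abstract_complex K" "complex_dim K <= n" "continuous_map X (realization K) g"
  "\<forall>x\<in>topspace X. \<forall>y\<in>topspace X. g x = g y --> E x y"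
  using assms(1) unfolding emb_dim_le_def by blast
 have "continuous_map Y (realization K) (g \<circ> h)"
  using assms(2) K(3) by (rule continuous_map_compose)
 moreover have "h x \<in> topspace X" if "x \<in> topspace Y" for x
  using assms(2) that by (auto simp: continuous_map_def)
 ultimately show ?thesis
  unfolding emb_dim_le_def using K by (intro exI[of _ K] exI[of _ "g \<circ> h"]) auto
qed

lemma abstract_complexD:
 assumes "abstract_complex K"
 shows "finite K" "K ~= {}" "s \<in> K ==> finite s" "s \<in> K ==> s ~= {}"
 using assms unfolding abstract_complex_def by blast+

lemma complex_dim_le_iff:
 assumes "abstract_complex K"
 shows "complex_dim K <= n \<longleftrightarrow> (\<forall>s\<in>K. card s <= Suc n)"
 unfolding complex_dim_def using abstract_complexD(1,2)[OF assms] by (subst Max_le_iff) auto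

lemma continuous_map_realization:
 "continuous_map X (realization K) g \<longleftrightarrow>
   (\<forall>i. continuous_map X euclideanreal (%x. g x i)) &
   (\<forall>x\<in>topspace X. (\<forall>i. 0 <= g x i) & {i. g x i ~= 0} \<in> K & (\<Sum>i | g x i ~= 0. g x i) = 1)"
proof -
 have "continuous_map X (euclidean :: (nat => real) topology) g \<longleftrightarrow>
   (\<forall>i. continuous_map X euclideanreal (%x. g x i))"
  unfolding euclidean_product_topology[symmetric] by (subst continuous_map_componentwise_UNIV) simp
 thus ?thesis
  unfolding realization_def continuous_map_in_subtopology by auto
qed

lemma sum_support_eq:
 fixes x :: "nat => real"
 assumes "{i. x i ~= 0} \<subseteq> {..<M}"
 shows "(\<Sum>i | x i ~= 0. x i) = (\<Sum>i<M. x i)"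
 using assms by (intro sum.mono_neutral_left) auto

lemma abstract_complex_vertex_bound:
 assumes "abstract_complex K"
 obtains M where "!!s. s \<in> K ==> s \<subseteq> {..<M}"
proof -
 have "finite (\<Union>K)" using abstract_complexD[OF assms] by auto
 then obtain M where M: "\<Union>K \<subseteq> {..<M}" by (meson finite_nat_iff_bounded)
 show thesis by (rule that[of M]) (use M in auto)
qed

text \<open>
  The normalised functions map \<open>X\<close> to the nerve of the cover by the sets where they are positive;
  the order of the cover bounds the dimension, and a common image puts two points into one such set.
\<close>

lemma emb_dim_le_nerve:
 fixes \<phi> :: "nat => 'a => real"
 assumes cont: "!!i. i < n ==> continuous_map X euclideanreal (\<phi> i)"
  and nonneg: "!!i x. i < n ==> x \<in> topspace X ==> 0 <= \<phi> i x"
  and cover: "!!x. x \<in> topspace X ==> \<exists>i<n. \<phi> i x > 0"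
  and order: "!!x. x \<in> topspace X ==> card {i. i < n & \<phi> i x > 0} <= Suc k"
  and small: "!!i x y. i < n ==> x \<in> topspace X ==> y \<in> topspace X ==>
         \<phi> i x > 0 ==> \<phi> i y > 0 ==> E x y"
 shows "emb_dim_le X E k"
proof -
 define K where "K = {s. s \<subseteq> {..n} & s ~= {} & card s <= Suc k}"
 define g where "g = (%x i. if i < n then \<phi> i x / (\<Sum>j<n. \<phi> j x) else 0)"
 have pos: "(\<Sum>j<n. \<phi> j x) > 0" if x: "x \<in> topspace X" for x
 proof -
  obtain i where "i < n" "\<phi> i x > 0" using cover[OF x] by blast
  thus ?thesis using nonneg x by (intro sum_pos2[of _ i]) auto
 qed
 have "finite K" by (rule finite_subset[of _ "Pow {..n}"]) (auto simp: K_def)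
 moreover have "{0} \<in> K" by (auto simp: K_def)
 moreover have "finite s" if "s \<in> K" for s using that by (auto simp: K_def intro: finite_subset)
 moreover have "t \<in> K" if "s \<in> K" "t \<subseteq> s" "t ~= {}" for s t
  using that card_mono[of s t] finite_subset[of s "{..n}"] unfolding K_def
  by (metis (mono_tags, lifting) dual_order.trans finite_atMost mem_Collect_eq)
 moreover have "s ~= {}" if "s \<in> K" for s using that by (simp add: K_def)
 ultimately have K: "abstract_complex K" unfolding abstract_complex_def by blast
 have supp: "{i. g x i ~= 0} = {i. i < n & \<phi> i x > 0}" if "x \<in> topspace X" for x
  using pos[OF that] nonneg[OF _ that] by (auto simp: g_def less_le)
 show ?thesis
  unfolding emb_dim_le_def
 proof (intro exI[of _ K] exI[of _ g] conjI ballI impI)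
  show "abstract_complex K" by (rule K)
  show "complex_dim K <= k" using complex_dim_le_iff[OF K] by (auto simp: K_def)
  show "continuous_map X (realization K) g"
   unfolding continuous_map_realization
  proof (intro conjI allI ballI)
   fix i
   have sumc: "continuous_map X euclideanreal (%x. \<Sum>j<n. \<phi> j x)"
    by (intro continuous_map_sum) (auto intro: cont)
   show "continuous_map X euclideanreal (%x. g x i)"
   proof (cases "i < n")
    case True
    have "continuous_map X euclideanreal (%x. \<phi> i x / (\<Sum>j<n. \<phi> j x))"
     by (intro continuous_map_real_divide cont True sumc) (use pos in force)
    thus ?thesis using True by (simp add: g_def)
   qed (simp add: g_def)
  next
   fix x i assume "x \<in> topspace X"
   thus "0 <= g x i" using pos[of x] nonneg[of i x] by (auto simp: g_def)
  next
   fix x assume x: "x \<in> topspace X"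
   show "{i. g x i ~= 0} \<in> K"
    unfolding supp[OF x] using cover[OF x] order[OF x] by (auto simp: K_def)
   have "(\<Sum>i | g x i ~= 0. g x i) = (\<Sum>i<n. g x i)"
    by (rule sum_support_eq) (use supp[OF x] in auto)
   also have "... = 1" using pos[OF x] by (simp add: g_def sum_divide_distrib[symmetric])
   finally show "(\<Sum>i | g x i ~= 0. g x i) = 1" .
  qed
 next
  fix x y assume xy: "x \<in> topspace X" "y \<in> topspace X" "g x = g y"
  obtain i where i: "i < n" "\<phi> i x > 0" using cover[OF xy(1)] by blast
  hence "i \<in> {i. g x i ~= 0}" using supp[OF xy(1)] by auto
  hence "\<phi> i y > 0" using supp[OF xy(2)] xy(3) by auto
  thus "E x y" using small i xy by blast
 qed
qed

text \<open>
  A point of a geometric realization is a probability distribution on the vertices.  The triangulated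
  product of two realizations is described by the monotone coupling of two such distributions:
  \<open>overlap a b i j\<close> is the length of the intersection of the \<open>i\<close>-th interval of the partition of
  \<open>[0, 1]\<close> with lengths \<open>a\<close> and the \<open>j\<close>-th interval of the one with lengths \<open>b\<close>.
\<close>

text \<open>
  A point of a geometric realization is a probability distribution on the vertices. The triangulated
  product of two realizations is described by the monotone coupling of two such distributions:
  \<open>overlap a b i j\<close> is the length of the intersection of the \<open>i\<close>-th interval of the partition of
  \<open>[0, 1]\<close> with lengths \<open>a\<close> and the \<open>j\<close>-th interval of the one with lengths \<open>b\<close>.
\<close>

definition overlap :: "(nat => real) => (nat => real) => nat => nat => real" where
 "overlap a b i j = max 0 (min (\<Sum>l\<le>i. a l) (\<Sum>l\<le>j. b l) - max (\<Sum>l<i. a l) (\<Sum>l<j. b l))"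

lemma overlap_commute: "overlap a b i j = overlap b a j i"
 by (simp add: overlap_def min.commute max.commute)

lemma sum_interval_overlap:
 fixes b :: "nat => real"
 assumes "0 <= p" "p <= q" "!!j. 0 <= b j"
 shows "(\<Sum>j<J. max 0 (min q (\<Sum>l\<le>j. b l) - max p (\<Sum>l<j. b l))) = max 0 (min q (\<Sum>l<J. b l) - p)"
proof (induction J)
 case 0
 thus ?case using assms by (simp add: min_def)
next
 case (Suc J)
 have step: "max 0 (min q B - p) + max 0 (min q B' - max p B) = max 0 (min q B' - p)"
  if "B <= B'" for B B'
  using that assms(2) by (simp add: max_def min_def)
 have "(\<Sum>l<J. b l) <= (\<Sum>l<Suc J. b l)" using assms(3)[of J] by simp
 from step[OF this] Suc.IH show ?case
  by (simp only: sum.lessThan_Suc lessThan_Suc_atMost[symmetric])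
qed

text \<open>
  The \<open>j\<close>-intervals cut the \<open>i\<close>-th interval of the other partition into pieces. Hence the coupling
  determines both distributions, which makes the map into the product injective.
\<close>

lemma overlap_marginal:
 assumes a: "!!i. 0 <= a i" "(\<Sum>l\<le>i. a l) <= 1" and b: "!!i. 0 <= b i" "(\<Sum>l<J. b l) = 1"
 shows "(\<Sum>j<J. overlap a b i j) = a i"
proof -
 have le: "(\<Sum>l<i. a l) <= (\<Sum>l\<le>i. a l)" by (intro sum_mono2) (auto intro: a)
 have "(\<Sum>j<J. overlap a b i j) = max 0 (min (\<Sum>l\<le>i. a l) (\<Sum>l<J. b l) - (\<Sum>l<i. a l))"
  unfolding overlap_def by (rule sum_interval_overlap) (auto intro: sum_nonneg a b le)
 also have "... = (\<Sum>l\<le>i. a l) - (\<Sum>l<i. a l)" using a(2) b(2) le by (simp add: min_def)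
 also have "... = a i" by (simp add: lessThan_Suc_atMost[symmetric])
 finally show ?thesis .
qed

lemma overlap_nonzeroD:
 assumes "overlap a b i j ~= 0" "!!i. 0 <= a i" "!!i. 0 <= b i"
 shows "a i ~= 0" "b j ~= 0"
proof -
 have "(\<Sum>l\<le>i. a l) = (\<Sum>l<i. a l) + a i" "(\<Sum>l\<le>j. b l) = (\<Sum>l<j. b l) + b j"
  by (simp_all add: lessThan_Suc_atMost[symmetric])
 thus "a i ~= 0" "b j ~= 0"
  using assms(1) by (auto simp: overlap_def max_def min_def split: if_splits)
qed

lemma overlap_chain:
 assumes "overlap a b i j ~= 0" "overlap a b i' j' ~= 0" "i < i'"
  and "!!i. 0 <= a i" "!!i. 0 <= b i"
 shows "j <= j'"
proof (rule ccontr)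
 assume "\<not> j <= j'"
 hence "(\<Sum>l\<le>j'. b l) <= (\<Sum>l<j. b l)" by (intro sum_mono2) (auto intro: assms)
 moreover have "(\<Sum>l\<le>i. a l) <= (\<Sum>l<i'. a l)" using assms(3) by (intro sum_mono2) (auto intro: assms)
 ultimately show False
  using assms(1,2) by (auto simp: overlap_def max_def min_def split: if_splits)
qed

definition chain2 :: "(nat \<times> nat) set => bool" where
 "chain2 c \<longleftrightarrow> (\<forall>p\<in>c. \<forall>q\<in>c. (fst p < fst q --> snd p <= snd q) & (snd p < snd q --> fst p <= fst q))"

text \<open>
  Along a chain in \<open>s \<times> t\<close> the sum of the two ranks increases strictly. This bounds the simplices of
  the triangulated product.
\<close>

lemma card_chain2_le:
 assumes "finite s" "finite t" "s ~= {}" "t ~= {}" "c \<subseteq> s \<times> t" "chain2 c"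
 shows "card c <= card s + card t - 1"
proof -
 define f where "f = (%(i, j). card {i'\<in>s. i' < i} + card {j'\<in>t. j' < (j :: nat)})"
 have strict: "card {i'\<in>u. i' < i} < card {i'\<in>u. i' < i2}" if "finite u" "i \<in> u" "i < i2"
  for u and i i2 :: nat
  using that by (intro psubset_card_mono) auto
 have mono: "card {i'\<in>u. i' < i} <= card {i'\<in>u. i' < i2}" if "finite u" "i <= i2"
  for u and i i2 :: nat
  using that by (intro card_mono) auto
 have lt: "card {i'\<in>u. i' < i} < card u" if "finite u" "i \<in> u" for u and i :: nat
  using that by (intro psubset_card_mono) auto
 have inj: "inj_on f c"
 proof (rule inj_onI)
  fix p q assume pq: "p \<in> c" "q \<in> c" "f p = f q"
  obtain i j i2 j2 where ij: "p = (i, j)" "q = (i2, j2)" by (metis prod.exhaust)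
  have mem: "i \<in> s" "i2 \<in> s" "j \<in> t" "j2 \<in> t" using pq ij assms(5) by auto
  have ch: "(i < i2 --> j <= j2) & (j < j2 --> i <= i2)" "(i2 < i --> j2 <= j) & (j2 < j --> i2 <= i)"
   using assms(6) pq ij unfolding chain2_def by fastforce+
  have eq: "card {i'\<in>s. i' < i} + card {j'\<in>t. j' < j} = card {i'\<in>s. i' < i2} + card {j'\<in>t. j' < j2}"
   using pq ij by (simp add: f_def)
  consider "i < i2" "j <= j2" | "i2 < i" "j2 <= j" | "j < j2" "i <= i2" | "j2 < j" "i2 <= i" | "i = i2" "j = j2"
   using ch by linarith
  thus "p = q"
  proof cases
   case 1 thus ?thesis using strict[OF assms(1) mem(1) 1(1)] mono[OF assms(2) 1(2)] eq by linarith
  next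
   case 2 thus ?thesis using strict[OF assms(1) mem(2) 2(1)] mono[OF assms(2) 2(2)] eq by linarith
  next
   case 3 thus ?thesis using strict[OF assms(2) mem(3) 3(1)] mono[OF assms(1) 3(2)] eq by linarith
  next
   case 4 thus ?thesis using strict[OF assms(2) mem(4) 4(1)] mono[OF assms(1) 4(2)] eq by linarith
  qed (simp add: ij)
 qed
 have "f p < card s + card t - 1" if "p \<in> c" for p
 proof -
  obtain i j where ij: "p = (i, j)" by (metis prod.exhaust)
  hence "i \<in> s" "j \<in> t" using that assms(5) by auto
  thus ?thesis using lt[OF assms(1), of i] lt[OF assms(2), of j] by (simp add: f_def ij)
 qed
 hence "f ` c \<subseteq> {..<card s + card t - 1}" by auto
 thus ?thesis using card_image[OF inj] by (metis card_lessThan card_mono finite_lessThan)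
qed

lemma realization_bounds:
 fixes x :: "nat => real"
 assumes "!!i. 0 <= x i" "{i. x i ~= 0} \<subseteq> {..<M}" "(\<Sum>i | x i ~= 0. x i) = 1"
 shows "(\<Sum>i<M. x i) = 1" "(\<Sum>l\<le>i. x l) <= 1"
proof -
 show s: "(\<Sum>i<M. x i) = 1" using sum_support_eq[OF assms(2)] assms(3) by simp
 have "(\<Sum>l\<le>i. x l) = (\<Sum>l\<in>{..i} \<inter> {..<M}. x l)"
  using assms(2) by (intro sum.mono_neutral_right) auto
 also have "... <= (\<Sum>i<M. x i)" by (intro sum_mono2) (auto intro: assms)
 finally show "(\<Sum>l\<le>i. x l) <= 1" using s by simp
qed

text \<open>
  The pair of the two given maps goes to the product of two polyhedra. Its standard triangulation has
  the chains in products of simplices as simplices, and in barycentric coordinates the pairing is the monotone coupling.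
  This is where the subadditivity of widim over sets of translations comes from.
\<close>

lemma emb_dim_le_conj:
 assumes "emb_dim_le X E1 n1" "emb_dim_le X E2 n2"
 shows "emb_dim_le X (%x y. E1 x y & E2 x y) (n1 + n2)"
proof -
 obtain K1 g1 where K1: "abstract_complex K1" "complex_dim K1 <= n1"
  and c1: "continuous_map X (realization K1) g1"
  and E1: "!!x y. x \<in> topspace X ==> y \<in> topspace X ==> g1 x = g1 y ==> E1 x y"
  using assms(1) unfolding emb_dim_le_def by blast
 obtain K2 g2 where K2: "abstract_complex K2" "complex_dim K2 <= n2"
  and c2: "continuous_map X (realization K2) g2"
  and E2: "!!x y. x \<in> topspace X ==> y \<in> topspace X ==> g2 x = g2 y ==> E2 x y"
  using assms(2) unfolding emb_dim_le_def by blast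
 obtain M1 where M1: "!!s. s \<in> K1 ==> s \<subseteq> {..<M1}" using abstract_complex_vertex_bound[OF K1(1)] by blast
 obtain M2 where M2: "!!s. s \<in> K2 ==> s \<subseteq> {..<M2}" using abstract_complex_vertex_bound[OF K2(1)] by blast
 note c1' = c1[unfolded continuous_map_realization] and c2' = c2[unfolded continuous_map_realization]
 define K where "K = {C. \<exists>s\<in>K1. \<exists>t\<in>K2. C ~= {} & C \<subseteq> prod_encode ` (s \<times> t) & chain2 (prod_decode ` C)}"
 define g where "g = (%x k. overlap (g1 x) (g2 x) (fst (prod_decode k)) (snd (prod_decode k)))"
 have dim: "card C <= Suc (n1 + n2) & finite C" if C: "C \<in> K" for C
 proof -
  obtain s t where st: "s \<in> K1" "t \<in> K2" "C ~= {}" "C \<subseteq> prod_encode ` (s \<times> t)" "chain2 (prod_decode ` C)"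
   using C unfolding K_def by blast
  have fin: "finite s" "finite t" "s ~= {}" "t ~= {}"
   using abstract_complexD(3,4)[OF K1(1) st(1)] abstract_complexD(3,4)[OF K2(1) st(2)] by auto
  have "prod_decode ` C \<subseteq> s \<times> t" using st(4) by force
  hence "card (prod_decode ` C) <= card s + card t - 1"
   using card_chain2_le fin st(5) by blast
  moreover have "card (prod_decode ` C) = card C" by (intro card_image inj_prod_decode)
  moreover have "card s <= Suc n1" "card t <= Suc n2"
   using complex_dim_le_iff[OF K1(1)] complex_dim_le_iff[OF K2(1)] K1(2) K2(2) st by auto
  moreover have "finite C" using fin st(4) by (meson finite_SigmaI finite_imageI finite_subset)
  ultimately show ?thesis by linarith
 qed
 have "abstract_complex K"
  unfolding abstract_complex_def
 proof (intro conjI ballI allI impI)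
  have "K \<subseteq> Pow (prod_encode ` (\<Union>K1 \<times> \<Union>K2))" unfolding K_def by blast
  moreover have "finite (\<Union>K1)" "finite (\<Union>K2)" using abstract_complexD(1,3)[OF K1(1)] abstract_complexD(1,3)[OF K2(1)] by auto
  ultimately show "finite K" by (meson finite_Pow_iff finite_SigmaI finite_imageI finite_subset)
  obtain s t where "s \<in> K1" "t \<in> K2" using abstract_complexD(2)[OF K1(1)] abstract_complexD(2)[OF K2(1)] by blast
  moreover from this obtain i j where "i \<in> s" "j \<in> t" using abstract_complexD(4)[OF K1(1)] abstract_complexD(4)[OF K2(1)] by blast
  ultimately have "{prod_encode (i, j)} \<in> K" unfolding K_def by (auto simp: chain2_def)
  thus "K ~= {}" by blast
 next
  fix C assume "C \<in> K" thus "finite C" "C ~= {}" using dim[of C] unfolding K_def by blast+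
 next
  fix C D assume C: "C \<in> K" and D: "D \<subseteq> C & D ~= {}"
  then obtain s t where "s \<in> K1" "t \<in> K2" "C \<subseteq> prod_encode ` (s \<times> t)" "chain2 (prod_decode ` C)"
   unfolding K_def by blast
  moreover have "chain2 (prod_decode ` D)" using calculation(4) D unfolding chain2_def by blast
  ultimately show "D \<in> K" using D unfolding K_def by blast
 qed
 have nn: "0 <= g1 x i" "0 <= g2 x i" if "x \<in> topspace X" for x i using c1' c2' that by auto
 have s1: "{i. g1 x i ~= 0} \<in> K1" and s2: "{i. g2 x i ~= 0} \<in> K2" if "x \<in> topspace X" for x
  using c1' c2' that by auto
 have b1: "(\<Sum>i<M1. g1 x i) = 1" "(\<Sum>l\<le>i. g1 x l) <= 1" if "x \<in> topspace X" for x i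
  using realization_bounds[of "g1 x" M1] nn(1)[OF that] M1[OF s1[OF that]] c1' that by auto
 have b2: "(\<Sum>i<M2. g2 x i) = 1" "(\<Sum>l\<le>i. g2 x l) <= 1" if "x \<in> topspace X" for x i
  using realization_bounds[of "g2 x" M2] nn(2)[OF that] M2[OF s2[OF that]] c2' that by auto
 have m1: "g1 x i = (\<Sum>j<M2. g x (prod_encode (i, j)))" if "x \<in> topspace X" for x i
  unfolding g_def using overlap_marginal[of "g1 x" i "g2 x" M2] nn[OF that] b1[OF that] b2[OF that] by simp
 have m2: "g2 x j = (\<Sum>i<M1. g x (prod_encode (i, j)))" if "x \<in> topspace X" for x j
  unfolding g_def using overlap_marginal[of "g2 x" j "g1 x" M1] nn[OF that] b1[OF that] b2[OF that]
  by (simp add: overlap_commute)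
 have supp: "{k. g x k ~= 0} \<subseteq> prod_encode ` ({i. g1 x i ~= 0} \<times> {j. g2 x j ~= 0})" if "x \<in> topspace X" for x
 proof
  fix k assume "k \<in> {k. g x k ~= 0}"
  hence "g1 x (fst (prod_decode k)) ~= 0" "g2 x (snd (prod_decode k)) ~= 0"
   unfolding g_def using overlap_nonzeroD nn[OF that] by blast+
  thus "k \<in> prod_encode ` ({i. g1 x i ~= 0} \<times> {j. g2 x j ~= 0})"
   by (metis (mono_tags, lifting) SigmaI imageI mem_Collect_eq prod.collapse prod_decode_inverse)
 qed
 show ?thesis
  unfolding emb_dim_le_def
 proof (intro exI[of _ K] exI[of _ g] conjI ballI impI)
  show "abstract_complex K" by fact
  thus "complex_dim K <= n1 + n2" using complex_dim_le_iff dim by blast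
  show "continuous_map X (realization K) g"
   unfolding continuous_map_realization
  proof (intro conjI allI ballI)
   fix k
   show "continuous_map X euclideanreal (%x. g x k)"
    unfolding g_def overlap_def using c1' c2'
    by (intro continuous_map_real_max continuous_map_real_min continuous_map_diff continuous_map_sum) auto
  next
   fix x k assume "x \<in> topspace X"
   show "0 <= g x k" by (simp add: g_def overlap_def)
  next
   fix x assume x: "x \<in> topspace X"
   let ?S = "{k. g x k ~= 0}"
   have "(\<Sum>i<M1. \<Sum>j<M2. g x (prod_encode (i, j))) = 1"
    using m1[OF x] b1(1)[OF x] by simp
   hence one: "(\<Sum>k\<in>prod_encode ` ({..<M1} \<times> {..<M2}). g x k) = 1"
    by (subst sum.reindex[OF inj_prod_encode]) (simp add: sum.cartesian_product)
   have "?S \<subseteq> prod_encode ` ({..<M1} \<times> {..<M2})"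
    using supp[OF x] M1[OF s1[OF x]] M2[OF s2[OF x]] by blast
   hence "(\<Sum>k\<in>?S. g x k) = (\<Sum>k\<in>prod_encode ` ({..<M1} \<times> {..<M2}). g x k)"
    by (intro sum.mono_neutral_left) auto
   thus sum1: "(\<Sum>k\<in>?S. g x k) = 1" using one by simp
   have "?S ~= {}" using sum1 by (metis sum.empty zero_neq_one)
   moreover have "chain2 (prod_decode ` ?S)"
    unfolding chain2_def
   proof (intro ballI conjI impI)
    fix p q assume "p \<in> prod_decode ` ?S" "q \<in> prod_decode ` ?S"
    hence o: "overlap (g1 x) (g2 x) (fst p) (snd p) ~= 0" "overlap (g1 x) (g2 x) (fst q) (snd q) ~= 0"
     by (auto simp: g_def)
    show "snd p <= snd q" if "fst p < fst q" using overlap_chain[OF o that] nn[OF x] by blast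
    show "fst p <= fst q" if "snd p < snd q"
     using overlap_chain[of "g2 x" "g1 x" "snd p" "fst p" "snd q" "fst q"] that o nn[OF x]
     by (simp add: overlap_commute)
   qed
   ultimately show "?S \<in> K" using supp[OF x] s1[OF x] s2[OF x] unfolding K_def by blast
  qed
 next
  fix x y assume xy: "x \<in> topspace X" "y \<in> topspace X" "g x = g y"
  have "g1 x = g1 y" using m1[OF xy(1)] m1[OF xy(2)] xy(3) by auto
  moreover have "g2 x = g2 y" using m2[OF xy(1)] m2[OF xy(2)] xy(3) by auto
  ultimately show "E1 x y" "E2 x y" using E1 E2 xy by auto
 qed
qed

section \<open>Box dimension and polyhedra\<close>

text \<open>
  The sets on which the code \<open>\<kappa>\<close> is constant form a cover by at most \<open>C q^k\<close> sets of diameter at most \<open>C/q\<close>.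
  A single constant for all scales is more than an upper box dimension of \<open>k\<close> provides; polyhedra
  and projective spaces have finitely many Lipschitz charts, for which it is available.
\<close>

definition box_dim_le :: "'a set => ('a => 'a => real) => nat => bool" where
 "box_dim_le S \<rho> k \<longleftrightarrow> (\<exists>C. \<forall>q::nat. 1 <= q --> (\<exists>\<kappa> :: 'a => nat. finite (\<kappa> ` S) &
   real (card (\<kappa> ` S)) <= C * real q ^ k &
   (\<forall>x\<in>S. \<forall>y\<in>S. \<kappa> x = \<kappa> y --> \<rho> x y <= C / real q)))"

lemma box_dim_leI:
 fixes \<kappa> :: "nat => 'a => 'b"
 assumes "!!q. 1 <= q ==> finite (T q) & \<kappa> q ` S \<subseteq> T q & real (card (T q)) <= C1 * real q ^ k"
  and "!!q x y. 1 <= q ==> x \<in> S ==> y \<in> S ==> \<kappa> q x = \<kappa> q y ==> \<rho> x y <= C2 / real q"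
 shows "box_dim_le S \<rho> k"
 unfolding box_dim_le_def
proof (intro exI[of _ "max C1 C2"] allI impI)
 fix q :: nat assume q: "1 <= q"
 have T: "finite (T q)" "\<kappa> q ` S \<subseteq> T q" "real (card (T q)) <= C1 * real q ^ k"
  using assms(1)[OF q] by auto
 have fin: "finite (\<kappa> q ` S)" using T(1,2) finite_subset by blast
 obtain e :: "'b => nat" where e: "inj_on e (\<kappa> q ` S)"
  using finite_imp_inj_to_nat_seg[OF fin] by blast
 have "real (card ((e \<circ> \<kappa> q) ` S)) = real (card (\<kappa> q ` S))"
  unfolding image_comp[symmetric] using card_image[OF e] by simp
 also have "... <= real (card (T q))" using T card_mono by (metis of_nat_mono)
 also have "... <= max C1 C2 * real q ^ k"
  using T(3) by (rule order_trans) (intro mult_right_mono, auto)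
 finally have "real (card ((e \<circ> \<kappa> q) ` S)) <= max C1 C2 * real q ^ k" .
 moreover have "\<rho> x y <= max C1 C2 / real q" if xy: "x \<in> S" "y \<in> S" "(e \<circ> \<kappa> q) x = (e \<circ> \<kappa> q) y" for x y
 proof -
  have "\<kappa> q x = \<kappa> q y" using xy e by (auto simp: inj_on_def)
  hence "\<rho> x y <= C2 / real q" using assms(2) q xy by blast
  also have "... <= max C1 C2 / real q" by (intro divide_right_mono) auto
  finally show ?thesis .
 qed
 ultimately show "\<exists>\<kappa>' :: 'a => nat. finite (\<kappa>' ` S) & real (card (\<kappa>' ` S)) <= max C1 C2 * real q ^ k &
   (\<forall>x\<in>S. \<forall>y\<in>S. \<kappa>' x = \<kappa>' y --> \<rho> x y <= max C1 C2 / real q)"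
  using finite_imageI[OF fin, of e] by (intro exI[of _ "e \<circ> \<kappa> q"]) (auto simp: image_image)
qed

text \<open>
  For fixed \<open>j\<close> and \<open>I\<close> the vectors \<open>(H j i x)\<^sub>i\<^sub>\<in>\<^sub>I\<close> lie in a Lipschitz image of a space of box dimension
  \<open>k\<close> in \<open>\<real>\<^bsup>k+1\<^esup>\<close>, which has measure zero. So almost every shift vector keeps a positive distance
  from all of them. The proof counts on a grid: each code class of \<open>S\<close> excludes few shift vectors.
\<close>

lemma generic_shifts:
 fixes H :: "nat => nat => 'a => real"
 assumes lip: "!!i j x y. i < n ==> j < n ==> x \<in> S ==> y \<in> S ==> \<bar>H j i x - H j i y\<bar> <= 2 * \<rho> x y"
  and box: "box_dim_le S \<rho> k" and \<theta>: "0 < \<theta>"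
 obtains c \<eta> where "0 < \<eta>" "!!i. i < n ==> 0 <= c i & c i <= \<theta>"
  and "!!j I x. j < n ==> I \<subseteq> {..<n} - {j} ==> card I = Suc k ==> x \<in> S ==>
      \<exists>i\<in>I. \<bar>H j i x - (c i - c j)\<bar> >= (\<eta>::real)"
proof -
 obtain C0 where C0: "!!q::nat. 1 <= q ==> \<exists>\<kappa> :: 'a => nat. finite (\<kappa> ` S) &
   real (card (\<kappa> ` S)) <= C0 * real q ^ k &
   (\<forall>x\<in>S. \<forall>y\<in>S. \<kappa> x = \<kappa> y --> \<rho> x y <= C0 / real q)"
  using box unfolding box_dim_le_def by blast
 define C where "C = max C0 1"
 define D where "D = nat \<lceil>8 * C / \<theta>\<rceil>"
 have C: "C >= 1" "C >= C0" by (auto simp: C_def)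
 have D: "real D >= 8 * C / \<theta>" unfolding D_def using C \<theta> by (simp add: of_nat_ceiling)
 have "8 * C / \<theta> > 0" using C \<theta> by simp
 hence D1: "D >= 1" using D by linarith
 define PP where "PP = {(j, I). j < n & I \<subseteq> {..<n} - {j} & card I = Suc k}"
 have finPP: "finite PP"
  by (rule finite_subset[of _ "{..<n} \<times> Pow {..<n}"]) (auto simp: PP_def)
 define Q where "Q = nat \<lceil>real (card PP) * (C * real D ^ k)\<rceil> + 1"
 have Q: "real Q > real (card PP) * (C * real D ^ k)" "Q >= 1"
  unfolding Q_def by (auto simp: add_strict_increasing2) linarith
 define q where "q = D * Q"
 have q1: "1 <= q" using D1 Q(2) by (simp add: q_def)
 obtain \<kappa> :: "'a => nat" where \<kappa>: "finite (\<kappa> ` S)" "real (card (\<kappa> ` S)) <= C0 * real q ^ k"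
   "!!x y. x \<in> S ==> y \<in> S ==> \<kappa> x = \<kappa> y ==> \<rho> x y <= C0 / real q"
  using C0[OF q1] by blast
 define \<eta> where "\<eta> = \<theta> / (8 * real Q)"
 have \<eta>: "\<eta> > 0" using \<theta> Q(2) by (simp add: \<eta>_def)
 define c where "c = (%(t :: nat => nat) i. \<theta> * real (t i) / real Q)"
 have Cq: "2 * (C0 / real q) <= \<theta> / (4 * real Q)"
 proof -
  have "2 * (C0 / real q) <= 2 * (C / real q)" using C(2) q1 by (simp add: divide_right_mono)
  also have "... <= \<theta> / (4 * real Q)"
   using D \<theta> D1 Q(2) by (simp add: q_def field_simps)
  finally show ?thesis .
 qed
 define Bad where "Bad = (%(j, I) a. {t \<in> {..<n} \<rightarrow>\<^sub>E {..<Q}. \<exists>x\<in>S. \<kappa> x = a &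
   (\<forall>i\<in>I. \<bar>H j i x - (c t i - c t j)\<bar> < \<eta>)})"
 have finE: "finite ({..<n} \<rightarrow>\<^sub>E {..<Q})" by (intro finite_PiE) auto
 have card_bad: "card (Bad p a) <= Q ^ (n - Suc k)" if p: "p \<in> PP" for p a
 proof -
  obtain j I where jI: "p = (j, I)" "j < n" "I \<subseteq> {..<n} - {j}" "card I = Suc k"
   using p by (auto simp: PP_def)
  let ?r = "%t. restrict t ({..<n} - I)"
  have "inj_on ?r (Bad p a)"
  proof (rule inj_onI)
   fix t t' assume t: "t \<in> Bad p a" "t' \<in> Bad p a" "?r t = ?r t'"
   obtain x where x: "x \<in> S" "\<kappa> x = a" "\<forall>i\<in>I. \<bar>H j i x - (c t i - c t j)\<bar> < \<eta>"
    using t(1) by (auto simp: Bad_def jI)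
   obtain y where y: "y \<in> S" "\<kappa> y = a" "\<forall>i\<in>I. \<bar>H j i y - (c t' i - c t' j)\<bar> < \<eta>"
    using t(2) by (auto simp: Bad_def jI)
   have out: "t i = t' i" if i: "i < n" "i \<notin> I" for i
    using fun_cong[OF t(3), of i] i by simp
   have "j \<notin> I" using jI by auto
   have inn: "t i = t' i" if i: "i \<in> I" for i
   proof -
    have iI: "i < n" using jI i by auto
    have "\<bar>H j i x - H j i y\<bar> <= 2 * (C0 / real q)"
     using lip[OF iI jI(2) x(1) y(1)] \<kappa>(3)[OF x(1) y(1)] x y by auto
    moreover have "c t j = c t' j" using out[OF jI(2) \<open>j \<notin> I\<close>] by (simp add: c_def)
    ultimately have "\<bar>c t i - c t' i\<bar> < 2 * \<eta> + \<theta> / (4 * real Q)"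
     using x(3) y(3) i Cq by (smt (verit))
    also have "... < \<theta> / real Q" using \<theta> Q(2) by (simp add: \<eta>_def field_simps)
    finally have "\<bar>\<theta> * (real (t i) - real (t' i)) / real Q\<bar> < \<theta> / real Q"
     by (simp add: c_def diff_divide_distrib right_diff_distrib)
    hence "\<bar>real (t i) - real (t' i)\<bar> < 1"
     using \<theta> Q(2) by (simp add: abs_mult divide_less_cancel)
    thus ?thesis by linarith
   qed
   show "t = t'"
   proof
    fix i
    have "t \<in> {..<n} \<rightarrow>\<^sub>E {..<Q}" "t' \<in> {..<n} \<rightarrow>\<^sub>E {..<Q}" using t by (auto simp: Bad_def jI)
    thus "t i = t' i" using out inn by (cases "i < n") (auto simp: PiE_def extensional_def)
   qed
  qed
  hence "card (Bad p a) = card (?r ` Bad p a)" by (simp add: card_image)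
  also have "... <= card (({..<n} - I) \<rightarrow>\<^sub>E {..<Q})"
   by (intro card_mono finite_PiE) (auto simp: Bad_def jI PiE_def Pi_def)
  also have "... = Q ^ (n - Suc k)"
  proof -
   have "finite I" using jI finite_subset by blast
   hence "card ({..<n} - I) = n - Suc k" using jI by (subst card_Diff_subset) auto
   thus ?thesis by (simp add: card_PiE)
  qed
  finally show ?thesis .
 qed
 have "\<exists>t\<in>{..<n} \<rightarrow>\<^sub>E {..<Q}. \<forall>p\<in>PP. \<forall>a\<in>\<kappa> ` S. t \<notin> Bad p a"
 proof (cases "PP = {}")
  case True
  have "{..<n} \<rightarrow>\<^sub>E {..<Q} ~= {}" using Q(2) by (auto simp: PiE_eq_empty_iff lessThan_empty_iff)
  thus ?thesis using True by auto
 next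
  case False
  then obtain j I where jI: "j < n" "I \<subseteq> {..<n} - {j}" "card I = Suc k" by (auto simp: PP_def)
  hence "card I <= card ({..<n} - {j})" by (intro card_mono) auto
  hence nk: "Suc k < n" using jI by auto
  let ?B = "\<Union>p\<in>PP. \<Union>a\<in>\<kappa> ` S. Bad p a"
  have "card ?B <= (\<Sum>p\<in>PP. \<Sum>a\<in>\<kappa> ` S. card (Bad p a))"
   by (intro order_trans[OF card_UN_le] finPP sum_mono card_UN_le \<kappa>)
  also have "... <= (\<Sum>p\<in>PP. \<Sum>a\<in>\<kappa> ` S. Q ^ (n - Suc k))"
   by (intro sum_mono card_bad)
  finally have "real (card ?B) <= real (card PP) * (real (card (\<kappa> ` S)) * real Q ^ (n - Suc k))"
   by (simp flip: of_nat_mult of_nat_power)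
  also have "... <= real (card PP) * ((C * real q ^ k) * real Q ^ (n - Suc k))"
   by (intro mult_left_mono mult_right_mono order_trans[OF \<kappa>(2)] C) auto
  also have "... = (real (card PP) * (C * real D ^ k)) * (real Q ^ k * real Q ^ (n - Suc k))"
   by (simp add: q_def power_mult_distrib)
  also have "... < real Q * (real Q ^ k * real Q ^ (n - Suc k))"
   using Q by (intro mult_strict_right_mono) auto
  also have "... = real Q ^ n"
   using nk by (simp flip: power_add power_Suc)
  finally have "card ?B < Q ^ n" by (simp flip: of_nat_power)
  moreover have "card ({..<n} \<rightarrow>\<^sub>E {..<Q}) = Q ^ n" by (simp add: card_PiE)
  moreover have "finite ?B" using finPP \<kappa>(1) finE by (auto simp: Bad_def intro: finite_subset)
  ultimately have "\<not> {..<n} \<rightarrow>\<^sub>E {..<Q} \<subseteq> ?B" using card_mono by (metis not_less)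
  thus ?thesis by blast
 qed
 then obtain t where t: "t \<in> {..<n} \<rightarrow>\<^sub>E {..<Q}" "\<forall>p\<in>PP. \<forall>a\<in>\<kappa> ` S. t \<notin> Bad p a" by blast
 show thesis
 proof (rule that[of \<eta> "c t"])
  show "0 < \<eta>" by (rule \<eta>)
  fix i assume "i < n"
  hence "t i < Q" using t(1) by auto
  thus "0 <= c t i & c t i <= \<theta>" using \<theta> by (simp add: c_def field_simps)
 next
  fix j I x assume "j < n" "I \<subseteq> {..<n} - {j}" "card I = Suc k" "x \<in> S"
  hence "(j, I) \<in> PP" by (simp add: PP_def)
  hence "t \<notin> Bad (j, I) (\<kappa> x)" using t(2) \<open>x \<in> S\<close> by blast
  thus "\<exists>i\<in>I. \<bar>H j i x - (c t i - c t j)\<bar> >= \<eta>"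
   using t(1) \<open>x \<in> S\<close> by (auto simp: Bad_def not_less)
 qed
qed

lemma continuous_map_Max:
 fixes f :: "'i => 'a => real"
 assumes "finite I" "I ~= {}" "!!i. i \<in> I ==> continuous_map X euclideanreal (f i)"
 shows "continuous_map X euclideanreal (%x. Max ((%i. f i x) ` I))"
 using assms
proof (induction I rule: finite_ne_induct)
 case (insert i I)
 thus ?case by (simp add: continuous_map_real_max)
qed simp

lemma continuous_map_Min:
 fixes f :: "'i => 'a => real"
 assumes "finite I" "I ~= {}" "!!i. i \<in> I ==> continuous_map X euclideanreal (f i)"
 shows "continuous_map X euclideanreal (%x. Min ((%i. f i x) ` I))"
 using assms
proof (induction I rule: finite_ne_induct)
 case (insert i I)
 thus ?case by (simp add: continuous_map_real_min)
qed simp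

text \<open>
  Take a fine net \<open>p\<close> and the functions \<open>h i = r/2 - \<rho> x (p i) + c i\<close> with generic shifts \<open>c\<close>.
  By genericity no point has \<open>k + 2\<close> equal values among the largest ones, so the functions \<open>\<phi> i\<close>, which are positive
  where \<open>h i\<close> exceeds \<open>r/8\<close> and is not the minimum of any \<open>k + 2\<close> of the \<open>h\<close>, still cover \<open>X\<close>, at most
  \<open>k + 1\<close> of them being positive at each point. The nerve of this cover is the polyhedron.
\<close>

theorem emb_dim_le_box_dim:
 fixes X :: "'a topology"
 assumes cont: "!!p. p \<in> topspace X ==> continuous_map X euclideanreal (%x. \<rho> x p)"
  and sym: "!!x y. x \<in> topspace X ==> y \<in> topspace X ==> \<rho> x y = \<rho> y x"
  and tri: "!!x y z. x \<in> topspace X ==> y \<in> topspace X ==> z \<in> topspace X ==> \<rho> x z <= \<rho> x y + \<rho> y z"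
  and box: "box_dim_le (topspace X) \<rho> k" and r: "0 < r"
 shows "emb_dim_le X (%x y. \<rho> x y <= r) k"
proof -
 obtain C where C: "!!q::nat. 1 <= q ==> \<exists>\<kappa> :: 'a => nat. finite (\<kappa> ` topspace X) &
   real (card (\<kappa> ` topspace X)) <= C * real q ^ k &
   (\<forall>x\<in>topspace X. \<forall>y\<in>topspace X. \<kappa> x = \<kappa> y --> \<rho> x y <= C / real q)"
  using box unfolding box_dim_le_def by blast
 define q where "q = nat \<lceil>4 * \<bar>C\<bar> / r\<rceil> + 1"
 have q: "1 <= q" by (simp add: q_def)
 have "4 * \<bar>C\<bar> / r <= real q" unfolding q_def using r by linarith
 hence Cq: "C / real q <= r / 4" using r q by (simp add: field_simps abs_le_iff)
 obtain \<kappa> :: "'a => nat" where \<kappa>: "finite (\<kappa> ` topspace X)"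
   "!!x y. x \<in> topspace X ==> y \<in> topspace X ==> \<kappa> x = \<kappa> y ==> \<rho> x y <= C / real q"
  using C[OF q] by blast
 obtain P where P: "P \<subseteq> topspace X" "finite P" "\<kappa> ` P = \<kappa> ` topspace X"
  using finite_subset_image[OF \<kappa>(1) subset_refl] by metis
 obtain n p where np: "P = p ` {i::nat. i < n}" using finite_imp_nat_seg_image_inj_on[OF P(2)] by blast
 have p: "p i \<in> topspace X" if "i < n" for i using np P(1) that by blast
 have net: "\<exists>i<n. \<rho> x (p i) <= r / 4" if x: "x \<in> topspace X" for x
 proof -
  have "\<kappa> x \<in> \<kappa> ` P" using P(3) x by blast
  then obtain i where "i < n" "\<kappa> x = \<kappa> (p i)" using np by auto
  hence "\<rho> x (p i) <= r / 4" using \<kappa>(2)[OF x p[of i]] Cq by linarith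
  thus ?thesis using \<open>i < n\<close> by blast
 qed
 define H where "H = (%j i x. \<rho> x (p i) - \<rho> x (p j))"
 have lip: "\<bar>H j i x - H j i y\<bar> <= 2 * \<rho> x y"
  if "i < n" "j < n" "x \<in> topspace X" "y \<in> topspace X" for i j x y
  using tri[OF that(3,4) p[OF that(1)]] tri[OF that(4,3) p[OF that(1)]]
   tri[OF that(3,4) p[OF that(2)]] tri[OF that(4,3) p[OF that(2)]] sym[OF that(3,4)]
  unfolding H_def by linarith
 obtain c \<eta> where \<eta>: "0 < \<eta>" and c: "!!i. i < n ==> 0 <= c i & c i <= r / 16"
  and gen: "!!j I x. j < n ==> I \<subseteq> {..<n} - {j} ==> card I = Suc k ==> x \<in> topspace X ==>
      \<exists>i\<in>I. \<bar>H j i x - (c i - c j)\<bar> >= \<eta>"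
 proof (rule generic_shifts[where S="topspace X" and n=n and H=H and \<rho>=\<rho> and k=k and \<theta>="r / 16"])
  show "0 < r / 16" using r by simp
 qed (use lip box in blast)+
 define h where "h = (%i x. r / 2 - \<rho> x (p i) + c i)"
 define \<I> where "\<I> = (%i. {I. I \<subseteq> {..<n} & card I = Suc k & i \<notin> I})"
 define top where "top = (%i I x. Max ((%j. h i x - h j x) ` I))"
 define \<phi> where "\<phi> = (%i x. max 0 (min (h i x - r / 8) (Min (insert (h i x) ((%I. top i I x) ` \<I> i)))))"
 have fin\<I>: "finite (\<I> i)" for i by (rule finite_subset[of _ "Pow {..<n}"]) (auto simp: \<I>_def)
 have I_props: "finite I" "I ~= {}" "I \<subseteq> {..<n}" "card I = Suc k" "i \<notin> I" if "I \<in> \<I> i" for i I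
  using that by (auto simp: \<I>_def intro: finite_subset)
 have hc: "continuous_map X euclideanreal (h i)" if "i < n" for i
  unfolding h_def by (intro continuous_map_add continuous_map_diff cont p that) auto
 have \<phi>_pos: "\<phi> i x > 0 \<longleftrightarrow> h i x > r / 8 & (\<forall>I\<in>\<I> i. \<exists>j\<in>I. h j x < h i x)" for i x
 proof -
  have "top i I x > 0 \<longleftrightarrow> (\<exists>j\<in>I. h j x < h i x)" if "I \<in> \<I> i" for I
   using I_props[OF that] unfolding top_def by (subst Max_gr_iff) auto
  thus ?thesis using r fin\<I>[of i] by (auto simp: \<phi>_def less_max_iff_disj)
 qed
 show ?thesis
 proof (rule emb_dim_le_nerve[of n X \<phi>])
  fix i assume i: "i < n"
  have "continuous_map X euclideanreal (%x. Min ((%I. top i I x) ` \<I> i))" if "\<I> i ~= {}"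
  proof (rule continuous_map_Min[OF fin\<I> that])
   fix I assume I: "I \<in> \<I> i"
   show "continuous_map X euclideanreal (top i I)"
    unfolding top_def
    by (rule continuous_map_Max) (use I_props[OF I] i in \<open>auto intro!: continuous_map_diff hc\<close>)
  qed
  hence "continuous_map X euclideanreal (%x. Min (insert (h i x) ((%I. top i I x) ` \<I> i)))"
   using hc[OF i] fin\<I>[of i] by (cases "\<I> i = {}") (auto intro: continuous_map_real_min)
  thus "continuous_map X euclideanreal (\<phi> i)"
   unfolding \<phi>_def by (intro continuous_map_real_max continuous_map_real_min continuous_map_diff hc i) auto
 next
  fix i x assume "i < n" "x \<in> topspace X"
  show "0 <= \<phi> i x" by (simp add: \<phi>_def)
 next
  fix x assume x: "x \<in> topspace X"
  obtain i0 where i0: "i0 < n" "\<rho> x (p i0) <= r / 4" using net[OF x] by blast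
  have "{..<n} ~= {}" using i0 by auto
  then obtain i where i: "i < n" "!!j. j < n ==> h j x <= h i x"
  proof -
   assume nonempty: "{..<n} ~= {}" and
    *: "!!i. i < n ==> (!!j. j < n ==> h j x <= h i x) ==> thesis"
   have "Max ((%i. h i x) ` {..<n}) \<in> (%i. h i x) ` {..<n}"
    using nonempty by (intro Max_in) auto
   then obtain i where "i < n" "h i x = Max ((%i. h i x) ` {..<n})" by auto
   thus thesis by (intro *[of i]) auto
  qed
  have "h i x >= h i0 x" using i i0 by blast
  hence "h i x > r / 8" using i0 c[OF i0(1)] r unfolding h_def by linarith
  moreover have "\<exists>j\<in>I. h j x < h i x" if I: "I \<in> \<I> i" for I
  proof (rule ccontr)
   assume "\<not> (\<exists>j\<in>I. h j x < h i x)"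
   hence eq: "h j x = h i x" if "j \<in> I" for j
    using i(2)[of j] that I_props(3)[OF I] by (metis leD lessThan_iff linorder_cases subsetD)
   have "I \<subseteq> {..<n} - {i}" using I_props[OF I] by auto
   from gen[OF i(1) this I_props(4)[OF I] x] obtain j where "j \<in> I" "\<bar>H i j x - (c j - c i)\<bar> >= \<eta>" by blast
   thus False using eq[of j] \<eta> by (simp add: H_def h_def)
  qed
  ultimately show "\<exists>i<n. 0 < \<phi> i x" using \<phi>_pos i(1) by blast
 next
  fix x assume x: "x \<in> topspace X"
  let ?S = "{i. i < n & 0 < \<phi> i x}"
  show "card ?S <= Suc k"
  proof (rule ccontr)
   assume "\<not> card ?S <= Suc k"
   hence big: "card ?S >= Suc (Suc k)" by simp
   have finS: "finite ?S" by simp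
   have "?S ~= {}"
   proof
    assume "?S = {}"
    thus False using big by (simp only: card.empty)
   qed
   hence "Min ((%i. h i x) ` ?S) \<in> (%i. h i x) ` ?S" using finS by (intro Min_in) auto
   then obtain i where iS: "i \<in> ?S" and iM: "h i x = Min ((%i. h i x) ` ?S)" by auto
   have imin: "h i x <= h j x" if "j \<in> ?S" for j unfolding iM using that finS by (intro Min_le) auto
   note i = iS imin
   have "card (?S - {i}) >= Suc k" using big by (subst card_Diff_singleton[OF iS]) linarith
   from ex_card[OF this]
   obtain I where I: "I \<subseteq> ?S - {i}" "card I = Suc k" by (elim exE conjE)
   have "I \<subseteq> {..<n}" "i \<notin> I" using I(1) by blast+
   hence "I \<in> \<I> i" using I(2) by (simp add: \<I>_def)
   then obtain j where j: "j \<in> I" "h j x < h i x" using iS \<phi>_pos by blast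
   hence "j \<in> ?S" using I by blast
   thus False using imin[of j] j by linarith
  qed
 next
  fix i x y assume i: "i < n" and x: "x \<in> topspace X" and y: "y \<in> topspace X"
   and "0 < \<phi> i x" "0 < \<phi> i y"
  hence "h i x > r / 8" "h i y > r / 8" using \<phi>_pos by auto
  hence "\<rho> x (p i) <= r / 2" "\<rho> y (p i) <= r / 2" using c[OF i] r unfolding h_def by linarith+
  thus "\<rho> x y <= r" using tri[OF x p[OF i] y] sym[OF y p[OF i]] by linarith
 qed
qed

section \<open>Continuous pseudometrics and widim\<close>

definition cont_pmet :: "'a topology => ('a => 'a => real) => bool" where
 "cont_pmet X d \<longleftrightarrow>
   (\<forall>x\<in>topspace X. \<forall>y\<in>topspace X. \<forall>z\<in>topspace X. d x z <= d x y + d y z) &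
   (\<forall>x\<in>topspace X. \<forall>y\<in>topspace X. d x y = d y x & 0 <= d x y) &
   (\<forall>x\<in>topspace X. d x x = 0) &
   (\<forall>p\<in>topspace X. continuous_map X euclideanreal (%x. d x p))"

lemma cont_pmetD:
 assumes "cont_pmet X d"
 shows "x \<in> topspace X ==> y \<in> topspace X ==> z \<in> topspace X ==> d x z <= d x y + d y z"
  and "x \<in> topspace X ==> y \<in> topspace X ==> d x y = d y x"
  and "x \<in> topspace X ==> y \<in> topspace X ==> 0 <= d x y"
  and "x \<in> topspace X ==> d x x = 0"
  and "p \<in> topspace X ==> continuous_map X euclideanreal (%x. d x p)"
 using assms unfolding cont_pmet_def by blast+

lemma cont_pmet_mdist: "cont_pmet (mtopology_of m) (mdist m)"
 unfolding cont_pmet_def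
 by (auto simp: mdist_triangle mdist_commute intro!: continuous_map_mdist)

lemma cont_pmet_pullback:
 assumes "cont_pmet X d" "continuous_map Y X h"
 shows "cont_pmet Y (%x y. d (h x) (h y))"
proof -
 have h: "h x \<in> topspace X" if "x \<in> topspace Y" for x
  using assms(2) that by (auto simp: continuous_map_def)
 have "continuous_map Y euclideanreal ((%x. d x (h p)) \<circ> h)" if "p \<in> topspace Y" for p
  using assms(2) cont_pmetD(5)[OF assms(1) h[OF that]] by (rule continuous_map_compose)
 thus ?thesis
  unfolding cont_pmet_def using cont_pmetD(1-4)[OF assms(1)] h by (simp add: o_def)
qed

lemma cont_pmet_sum:
 assumes "finite I" "!!i. i \<in> I ==> cont_pmet X (d i)"
 shows "cont_pmet X (%x y. \<Sum>i\<in>I. d i x y)"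
 unfolding cont_pmet_def
proof (intro conjI ballI)
 fix x y z assume "x \<in> topspace X" "y \<in> topspace X" "z \<in> topspace X"
 thus "(\<Sum>i\<in>I. d i x z) <= (\<Sum>i\<in>I. d i x y) + (\<Sum>i\<in>I. d i y z)"
  unfolding sum.distrib[symmetric] using cont_pmetD(1)[OF assms(2)] by (intro sum_mono)
next
 fix x y assume "x \<in> topspace X" "y \<in> topspace X"
 thus "(\<Sum>i\<in>I. d i x y) = (\<Sum>i\<in>I. d i y x)" "0 <= (\<Sum>i\<in>I. d i x y)"
  using cont_pmetD(2,3)[OF assms(2)] by (auto intro!: sum.cong sum_nonneg)
next
 fix x assume "x \<in> topspace X"
 thus "(\<Sum>i\<in>I. d i x x) = 0" using cont_pmetD(4)[OF assms(2)] by simp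
next
 fix p assume "p \<in> topspace X"
 thus "continuous_map X euclideanreal (%x. \<Sum>i\<in>I. d i x p)"
  using cont_pmetD(5)[OF assms(2)] assms(1) by (intro continuous_map_sum) auto
qed

lemma cont_pmet_real:
 assumes "continuous_map X euclideanreal f"
 shows "cont_pmet X (%x y. \<bar>f x - f y\<bar>)"
 unfolding cont_pmet_def using assms
 by (auto intro!: continuous_map_real_abs continuous_map_diff)

text \<open>
  The set of pairs with \<open>d x y \<ge> \<epsilon>'\<close> is a compact subset of \<open>X \<times> X\<close> on which the continuous function
  \<open>r\<close> has no zero.
\<close>

lemma cont_pmet_fibre_uniform:
 fixes X :: "'a topology"
 assumes X: "compact_space X" and d: "cont_pmet X d" and r: "cont_pmet X r"
  and fib: "!!x y. x \<in> topspace X ==> y \<in> topspace X ==> r x y = 0 ==> d x y <= \<epsilon>"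
  and "\<epsilon> < \<epsilon>'"
 obtains \<delta> where "0 < \<delta>" "!!x y. x \<in> topspace X ==> y \<in> topspace X ==> r x y < \<delta> ==> d x y < \<epsilon>'"
proof -
 let ?T = "topspace X"
 define \<U> where "\<U> = {W. openin (prod_topology X X) W &
   (\<exists>\<delta>>0. \<forall>x y. (x, y) \<in> W --> r x y < \<delta> --> d x y < \<epsilon>')}"
 define B where "B = (%(e :: 'a => 'a => real) p t. {x \<in> topspace X. e x p \<in> {..<t::real}})"
 have openB: "openin X (B e p t)" if "cont_pmet X e" "p \<in> ?T" for e p t
  unfolding B_def using cont_pmetD(5)[OF that] by (rule openin_continuous_map_preimage) auto
 have cover: "\<exists>W\<in>\<U>. (x, y) \<in> W" if x: "x \<in> ?T" and y: "y \<in> ?T" for x y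
 proof (cases "r x y = 0")
  case True
  hence "d x y < \<epsilon>'" using fib x y assms(5) by force
  define t where "t = (\<epsilon>' - d x y) / 2"
  have t: "t > 0" using \<open>d x y < \<epsilon>'\<close> by (simp add: t_def)
  have "d x' y' < \<epsilon>'" if "x' \<in> B d x t" "y' \<in> B d y t" for x' y'
  proof -
   have *: "x' \<in> ?T" "y' \<in> ?T" "d x' x < t" "d y' y < t" using that by (auto simp: B_def)
   have "d x' y' <= d x' x + d x y + d y y'"
    using cont_pmetD(1)[OF d *(1) x *(2)] cont_pmetD(1)[OF d x y *(2)] by linarith
   thus ?thesis using * cont_pmetD(2)[OF d y *(2)] by (simp add: t_def field_simps)
  qed
  hence "B d x t \<times> B d y t \<in> \<U>"
   unfolding \<U>_def using openB[OF d x] openB[OF d y]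
   by (auto simp: openin_prod_Times_iff intro: exI[of _ 1])
  moreover have "(x, y) \<in> B d x t \<times> B d y t"
   using x y t cont_pmetD(4)[OF d] by (auto simp: B_def)
  ultimately show ?thesis by (intro bexI)
 next
  case False
  define t where "t = r x y / 3"
  have t: "t > 0" using False cont_pmetD(3)[OF r x y] by (simp add: t_def)
  have "t <= r x' y'" if "x' \<in> B r x t" "y' \<in> B r y t" for x' y'
  proof -
   have *: "x' \<in> ?T" "y' \<in> ?T" "r x' x < t" "r y' y < t" using that by (auto simp: B_def)
   have "r x y <= r x x' + r x' y' + r y' y"
    using cont_pmetD(1)[OF r x *(1) y] cont_pmetD(1)[OF r *(1,2) y] by linarith
   thus ?thesis using * cont_pmetD(2)[OF r x *(1)] by (simp add: t_def field_simps)
  qed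
  hence "\<forall>x' y'. (x', y') \<in> B r x t \<times> B r y t --> r x' y' < t --> d x' y' < \<epsilon>'" by force
  hence "B r x t \<times> B r y t \<in> \<U>"
   unfolding \<U>_def using openB[OF r x] openB[OF r y] t
   by (simp add: openin_prod_Times_iff) blast
  moreover have "(x, y) \<in> B r x t \<times> B r y t"
   using x y t cont_pmetD(4)[OF r] by (auto simp: B_def)
  ultimately show ?thesis by (intro bexI)
 qed
 have cs: "compact_space (prod_topology X X)" using X by (simp add: compact_space_prod_topology)
 have "topspace (prod_topology X X) \<subseteq> \<Union>\<U>"
 proof
  fix p assume p: "p \<in> topspace (prod_topology X X)"
  hence "fst p \<in> ?T" "snd p \<in> ?T" by auto
  from cover[OF this] show "p \<in> \<Union>\<U>" by (simp only: prod.collapse) blast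
 qed
 moreover have "\<forall>U\<in>\<U>. openin (prod_topology X X) U" by (simp add: \<U>_def)
 ultimately obtain \<F> where \<F>': "finite \<F> & \<F> \<subseteq> \<U> & topspace (prod_topology X X) \<subseteq> \<Union>\<F>"
  using cs[unfolded compact_space_alt, THEN spec, of \<U>] by (elim impE exE) (rule conjI)
 note \<F> = \<F>'[THEN conjunct1] \<F>'[THEN conjunct2, THEN conjunct1] \<F>'[THEN conjunct2, THEN conjunct2]
 have "\<exists>\<delta>>0. \<forall>x y. (x, y) \<in> W --> r x y < \<delta> --> d x y < \<epsilon>'" if "W \<in> \<F>" for W
  using subsetD[OF \<F>(2) that] unfolding \<U>_def mem_Collect_eq by (rule conjunct2)
 hence "\<forall>W\<in>\<F>. \<exists>\<delta>. \<delta> > 0 & (\<forall>x y. (x, y) \<in> W --> r x y < \<delta> --> d x y < \<epsilon>')" by (rule ballI)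
 from bchoice[OF this] obtain D where
  D': "\<forall>W\<in>\<F>. D W > 0 & (\<forall>x y. (x, y) \<in> W --> r x y < D W --> d x y < \<epsilon>')" ..
 have D: "!!W. W \<in> \<F> ==> D W > 0"
  "!!W x y. W \<in> \<F> ==> (x, y) \<in> W ==> r x y < D W ==> d x y < \<epsilon>'" using D' by blast+
 show thesis
 proof (rule that[of "Min (insert 1 (D ` \<F>))"])
  show "0 < Min (insert 1 (D ` \<F>))" using \<F>(1) D(1) by (subst Min_gr_iff) auto
  fix x y assume xy: "x \<in> ?T" "y \<in> ?T" "r x y < Min (insert 1 (D ` \<F>))"
  hence "(x, y) \<in> \<Union>\<F>" using \<F>(3) by auto
  then obtain W where W: "W \<in> \<F>" "(x, y) \<in> W" by (elim UnionE)
  have "Min (insert 1 (D ` \<F>)) <= D W" using \<F>(1) W by (intro Min_le) auto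
  thus "d x y < \<epsilon>'" using D(2)[OF W] xy(3) by linarith
 qed
qed

lemma metric_diameter_le_iff:
 assumes "compact_space (mtopology_of m)" "S \<subseteq> mspace m" "0 <= \<epsilon>"
 shows "metric_diameter m S <= \<epsilon> \<longleftrightarrow> (\<forall>x\<in>S. \<forall>y\<in>S. mdist m x y <= \<epsilon>)"
proof -
 interpret Metric_space "mspace m" "mdist m" by simp
 have "mbounded (mspace m)"
  using assms(1) compactin_imp_mbounded[of "mspace m"]
  by (simp add: compact_space_def mtopology_of_def)
 then obtain B where B: "!!x y. x \<in> mspace m ==> y \<in> mspace m ==> mdist m x y <= B"
  unfolding mbounded_alt by blast
 have bdd: "bdd_above ((%(x, y). mdist m x y) ` (S \<times> S))"
  using B assms(2) by (intro bdd_aboveI[of _ B]) auto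
 show ?thesis
 proof (cases "S = {}")
  case False
  hence "S \<times> S ~= {}" by auto
  thus ?thesis
   unfolding metric_diameter_def using False cSUP_le_iff[OF _ bdd] by auto
 qed (simp add: metric_diameter_def assms(3))
qed

lemma eps_embedding_iff:
 assumes "compact_space (mtopology_of m)" "0 <= \<epsilon>"
 shows "eps_embedding \<epsilon> m (realization K) g \<longleftrightarrow>
   continuous_map (mtopology_of m) (realization K) g &
   (\<forall>x\<in>mspace m. \<forall>y\<in>mspace m. g x = g y --> mdist m x y <= \<epsilon>)"
proof -
 have "metric_diameter m {x \<in> mspace m. g x = y} <= \<epsilon> \<longleftrightarrow>
   (\<forall>x\<in>mspace m. \<forall>x'\<in>mspace m. g x = y --> g x' = y --> mdist m x x' <= \<epsilon>)" for y
  by (subst metric_diameter_le_iff[OF assms(1) _ assms(2)]) auto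
 thus ?thesis
  unfolding eps_embedding_def by (auto simp: continuous_map_def Pi_iff)
qed

text \<open>
  Widim is the least exact dimension of a polyhedron; since it is attained once any dimension is,
  upper bounds can be stated with polyhedra of dimension at most \<open>n\<close>.
\<close>

lemma Widim_le_iff:
 assumes "compact_space (mtopology_of m)" "0 <= \<epsilon>"
  and ex: "emb_dim_le (mtopology_of m) (%x y. mdist m x y <= \<epsilon>) n0"
 shows "Widim \<epsilon> m <= n \<longleftrightarrow> emb_dim_le (mtopology_of m) (%x y. mdist m x y <= \<epsilon>) n"
proof -
 let ?P = "%n. \<exists>K g. abstract_complex K & complex_dim K = n & eps_embedding \<epsilon> m (realization K) g"
 have iff: "emb_dim_le (mtopology_of m) (%x y. mdist m x y <= \<epsilon>) n \<longleftrightarrow> (\<exists>n'\<le>n. ?P n')" for n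
  unfolding emb_dim_le_def eps_embedding_iff[OF assms(1,2)] by auto
 have "?P (Widim \<epsilon> m)"
 proof -
  have "\<exists>n. ?P n" using ex unfolding iff by blast
  from LeastI_ex[OF this] show ?thesis unfolding Widim_def .
 qed
 moreover have "Widim \<epsilon> m <= n'" if P: "?P n'" for n'
  unfolding Widim_def by (rule Least_le[of ?P, OF P])
 ultimately show ?thesis unfolding iff by (metis order_trans)
qed

section \<open>Lower bounds from cubes\<close>

definition cube :: "nat => (nat => real) set" where
 "cube n = {a. \<forall>i<n. 0 <= a i & a i <= 1}"

text \<open>
  An approximate version of the theorem, obtained directly from the combinatorial lemma of Kuhn: two
  neighbours of one grid cell carry different labels, that is, different signs of \<open>G i\<close>.
  The cube consists of functions on \<open>\<nat>\<close> because its dimension is not fixed.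
\<close>

lemma Poincare_Miranda:
 fixes G :: "nat => (nat => real) => real"
 assumes unif: "!!\<delta>. \<delta> > 0 ==> \<exists>\<tau>>0. \<forall>a\<in>cube n. \<forall>b\<in>cube n.
          (\<forall>j<n. \<bar>a j - b j\<bar> < \<tau>) --> (\<forall>i<n. \<bar>G i a - G i b\<bar> < \<delta>)"
  and lo: "!!i a. i < n ==> a \<in> cube n ==> a i = 0 ==> G i a < 0"
  and hi: "!!i a. i < n ==> a \<in> cube n ==> a i = 1 ==> 0 <= G i a"
  and "\<delta> > 0"
 shows "\<exists>a\<in>cube n. \<forall>i<n. \<bar>G i a\<bar> < \<delta>"
proof -
 obtain \<tau> where \<tau>: "\<tau> > 0" "!!a b i. a \<in> cube n ==> b \<in> cube n ==>
   (!!j. j < n ==> \<bar>a j - b j\<bar> < \<tau>) ==> i < n ==> \<bar>G i a - G i b\<bar> < \<delta>"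
  using unif[OF \<open>\<delta> > 0\<close>] by metis
 define p where "p = nat \<lceil>1 / \<tau>\<rceil> + 1"
 have p: "0 < p" "1 / real p < \<tau>"
 proof -
  show "0 < p" by (simp add: p_def)
  moreover have "1 / \<tau> < real p" unfolding p_def by linarith
  ultimately show "1 / real p < \<tau>" using \<tau>(1) by (simp add: field_simps)
 qed
 define pt where "pt = (%(x :: nat => nat) i. real (x i) / real p)"
 have pt_cube: "pt x \<in> cube n" if "\<forall>i<n. x i <= p" for x
  using that p by (auto simp: cube_def pt_def field_simps)
 \<comment> \<open>Labels are signs, and the conditions on opposite faces make them admissible.\<close>
 define label where "label = (%x i. if G i (pt x) < 0 then 0 else 1 :: nat)"
 obtain q where q: "\<forall>i<n. q i < p"
  "\<forall>i<n. \<exists>r s. (\<forall>j<n. q j <= r j & r j <= q j + 1) & (\<forall>j<n. q j <= s j & s j <= q j + 1) & label r i ~= label s i"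
 proof (rule kuhn_lemma[OF p(1), of n label])
  show "\<forall>x. (\<forall>i<n. x i <= p) --> (\<forall>i<n. label x i = 0 \<or> label x i = 1)" by (simp add: label_def)
  show "\<forall>x. (\<forall>i<n. x i <= p) --> (\<forall>i<n. x i = 0 --> label x i = 0)"
   using lo pt_cube by (auto simp: label_def pt_def)
  show "\<forall>x. (\<forall>i<n. x i <= p) --> (\<forall>i<n. x i = p --> label x i = 1)"
  proof (intro allI impI)
   fix x i assume "\<forall>i<n. x i <= p" "i < n" "x i = p"
   hence "0 <= G i (pt x)" using p(1) by (intro hi pt_cube) (auto simp: pt_def)
   thus "label x i = 1" by (simp add: label_def)
  qed
 qed blast
 have qc: "pt q \<in> cube n" using q(1) by (intro pt_cube) (auto simp: less_imp_le)
 have "\<bar>G i (pt q)\<bar> < \<delta>" if i: "i < n" for i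
 proof -
  have near: "\<bar>G i (pt q) - G i (pt r)\<bar> < \<delta>" if r: "\<forall>j<n. q j <= r j & r j <= q j + 1" for r
  proof (rule \<tau>(2)[OF qc _ _ i])
   have "r j <= p" if "j < n" for j using spec[OF r, of j] spec[OF q(1), of j] that by linarith
   thus "pt r \<in> cube n" by (intro pt_cube) auto
   fix j assume j: "j < n"
   have "real (q j) <= real (r j)" "real (r j) <= real (q j) + 1"
    using r j by (metis of_nat_1 of_nat_add of_nat_mono)+
   hence "\<bar>real (q j) - real (r j)\<bar> <= 1" by linarith
   hence "\<bar>pt q j - pt r j\<bar> <= 1 / real p"
    using p(1) by (simp add: pt_def flip: diff_divide_distrib) (simp add: divide_right_mono)
   thus "\<bar>pt q j - pt r j\<bar> < \<tau>" using p(2) by linarith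
  qed
  obtain r s where rs: "\<forall>j<n. q j <= r j & r j <= q j + 1" "\<forall>j<n. q j <= s j & s j <= q j + 1"
   "label r i ~= label s i" using q(2) i by blast
  hence "G i (pt r) < 0 & 0 <= G i (pt s) \<or> G i (pt s) < 0 & 0 <= G i (pt r)"
   by (auto simp: label_def split: if_splits)
  thus ?thesis using near[OF rs(1)] near[OF rs(2)] by linarith
 qed
 thus ?thesis using qc by blast
qed

text \<open>
  On an open simplex with \<open>d + 1\<close> vertices all barycentric coordinates but one determine the point, so \<open>d\<close>
  rounded numbers are a code.
\<close>

lemma box_dim_le_realization:
 assumes K: "abstract_complex K" "complex_dim K <= k"
  and M: "!!s. s \<in> K ==> s \<subseteq> {..<M}"
 shows "box_dim_le (topspace (realization K)) (%x y. \<Sum>v<M. \<bar>x v - y v\<bar>) k"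
proof -
 let ?S = "topspace (realization K)"
 have S: "x \<in> ?S \<longleftrightarrow> (\<forall>i. 0 <= x i) & {i. x i ~= 0} \<in> K & (\<Sum>i | x i ~= 0. x i) = 1" for x
  by (simp add: realization_def)
 define supp where "supp = (%x :: nat => real. {i. x i ~= 0})"
 define \<kappa> where "\<kappa> = (%q x. (supp x, \<lambda>i\<in>supp x - {Max (supp x)}. nat \<lfloor>real q * x i\<rfloor>))"
 define T where "T = (%q::nat. SIGMA s:K. (s - {Max s}) \<rightarrow>\<^sub>E {..q})"
 note D = abstract_complexD[OF K(1)]
 show ?thesis
 proof (rule box_dim_leI[where \<kappa>=\<kappa> and T=T and ?C1.0="real (card K) * 2 ^ k" and ?C2.0="2 * real M"])
  fix q :: nat assume q: "1 <= q"
  have "finite (T q)"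
   unfolding T_def using D(1,3) by (intro finite_SigmaI finite_PiE) auto
  moreover have "\<kappa> q ` ?S \<subseteq> T q"
  proof (intro image_subsetI)
   fix x assume x: "x \<in> ?S"
   have "x i <= 1" for i
   proof -
    have "x i <= (\<Sum>l\<le>i. x l)" using x unfolding S by (intro member_le_sum) auto
    also have "... <= 1" using realization_bounds(2)[of x M i] x M unfolding S by blast
    finally show ?thesis .
   qed
   hence "nat \<lfloor>real q * x i\<rfloor> <= q" for i
    using mult_left_le[of "x i" "real q"] by (simp add: nat_le_iff floor_le_iff)
   thus "\<kappa> q x \<in> T q" using x unfolding S by (auto simp: \<kappa>_def T_def supp_def)
  qed
  moreover have "real (card (T q)) <= real (card K) * 2 ^ k * real q ^ k"
  proof -
   have "card (T q) = (\<Sum>s\<in>K. card ((s - {Max s}) \<rightarrow>\<^sub>E {..q}))"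
    unfolding T_def using D(1,3) by (intro card_SigmaI) (auto intro!: finite_PiE)
   also have "... <= (\<Sum>s\<in>K. (2 * q) ^ k)"
   proof (rule sum_mono)
    fix s assume s: "s \<in> K"
    have "card ((s - {Max s}) \<rightarrow>\<^sub>E {..q}) = (q + 1) ^ (card s - 1)"
     using D(3,4)[OF s] by (simp add: card_PiE)
    also have "... <= (2 * q) ^ (card s - 1)" using q by (intro power_mono) auto
    also have "... <= (2 * q) ^ k"
    proof -
     have "card s <= Suc k" using complex_dim_le_iff[OF K(1)] K(2) s by blast
     thus ?thesis using q by (intro power_increasing) auto
    qed
    finally show "card ((s - {Max s}) \<rightarrow>\<^sub>E {..q}) <= (2 * q) ^ k" .
   qed
   finally have "card (T q) <= card K * (2 * q) ^ k" by simp
   hence "real (card (T q)) <= real (card K * (2 * q) ^ k)" by linarith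
   thus ?thesis by (simp add: power_mult_distrib mult.assoc)
  qed
  ultimately show "finite (T q) & \<kappa> q ` ?S \<subseteq> T q & real (card (T q)) <= real (card K) * 2 ^ k * real q ^ k"
   by blast
 next
  fix q :: nat and x y assume q: "1 <= q" and xy: "x \<in> ?S" "y \<in> ?S" "\<kappa> q x = \<kappa> q y"
  let ?s = "supp x" and ?m = "Max (supp x)"
  have ss: "supp y = supp x" using xy(3) by (simp add: \<kappa>_def)
  have sK: "?s \<in> K" using xy(1) unfolding S supp_def by blast
  have fin: "finite ?s" "?s ~= {}" using D(3,4)[OF sK] by auto
  have m: "?m \<in> ?s" using fin by simp
  have close: "\<bar>x i - y i\<bar> <= 1 / real q" if i: "i \<in> ?s - {?m}" for i
  proof -
   have "nat \<lfloor>real q * x i\<rfloor> = nat \<lfloor>real q * y i\<rfloor>"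
   proof -
    have "snd (\<kappa> q x) i = snd (\<kappa> q y) i" using xy(3) by simp
    thus ?thesis using i ss by (simp add: \<kappa>_def)
   qed
   moreover have "0 <= real q * x i" "0 <= real q * y i" using xy unfolding S by auto
   ultimately have "\<bar>real q * x i - real q * y i\<bar> <= 1" by linarith
   hence "real q * \<bar>x i - y i\<bar> <= 1" by (simp flip: right_diff_distrib abs_mult add: abs_mult)
   thus ?thesis using q by (simp add: field_simps)
  qed
  have sum1: "(\<Sum>i\<in>?s - {?m}. x i) + x ?m = 1" "(\<Sum>i\<in>?s - {?m}. y i) + y ?m = 1"
   using xy(1,2) ss m fin unfolding S by (auto simp: supp_def sum_diff1)
  have sumc: "(\<Sum>i\<in>?s - {?m}. \<bar>x i - y i\<bar>) <= real M / real q"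
  proof -
   have "(\<Sum>i\<in>?s - {?m}. \<bar>x i - y i\<bar>) <= (\<Sum>i\<in>?s - {?m}. 1 / real q)" by (intro sum_mono close)
   also have "... = real (card (?s - {?m})) / real q" by simp
   also have "card (?s - {?m}) <= card {..<M}" using M[OF sK] by (intro card_mono) auto
   hence "real (card (?s - {?m})) / real q <= real M / real q" by (intro divide_right_mono) auto
   finally show ?thesis .
  qed
  have "(\<Sum>v<M. \<bar>x v - y v\<bar>) = (\<Sum>v\<in>?s. \<bar>x v - y v\<bar>)"
   using M[OF sK] ss by (intro sum.mono_neutral_right) (auto simp: supp_def)
  also have "... = (\<Sum>v\<in>?s - {?m}. \<bar>x v - y v\<bar>) + \<bar>x ?m - y ?m\<bar>"
   using m fin by (simp add: sum_diff1)
  also have "x ?m - y ?m = - (\<Sum>v\<in>?s - {?m}. x v - y v)" using sum1 by (simp add: sum_subtractf)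
  also have "\<bar>...\<bar> <= (\<Sum>v\<in>?s - {?m}. \<bar>x v - y v\<bar>)" by simp
  finally show "(\<Sum>v<M. \<bar>x v - y v\<bar>) <= 2 * real M / real q" using sumc by simp
 qed
qed

lemma abs_INF_diff_le:
 fixes f g :: "'i => real"
 assumes "A ~= {}" "!!a. a \<in> A ==> 0 <= f a" "!!a. a \<in> A ==> 0 <= g a"
  and "!!a. a \<in> A ==> \<bar>f a - g a\<bar> <= L"
 shows "\<bar>(INF a\<in>A. f a) - (INF a\<in>A. g a)\<bar> <= L"
proof -
 have bdd: "bdd_below (f ` A)" "bdd_below (g ` A)" using assms by (auto intro!: bdd_belowI[of _ 0])
 have "(INF a\<in>A. f a) - L <= g a" if "a \<in> A" for a
  using cINF_lower[OF bdd(1) that] assms(4)[OF that] by linarith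
 hence "(INF a\<in>A. f a) - L <= (INF a\<in>A. g a)" by (intro cINF_greatest assms(1))
 moreover have "(INF a\<in>A. g a) - L <= f a" if "a \<in> A" for a
  using cINF_lower[OF bdd(2) that] assms(4)[OF that] by linarith
 hence "(INF a\<in>A. g a) - L <= (INF a\<in>A. f a)" by (intro cINF_greatest assms(1))
 ultimately show ?thesis by linarith
qed

text \<open>
  Suppose the cube maps with small fibres to a polyhedron of dimension \<open>k < n\<close>. The images of
  opposite faces have positive distance \<open>\<delta>\<close>, by compactness, so the differences \<open>H i\<close> of the
  distances to them change sign across the cube and are Lipschitz on the polyhedron. For generic small shifts of \<open>k + 1\<close> of
  them no point of the \<open>k\<close>-dimensional polyhedron is a common zero, contrary to the theorem of
  Poincare and Miranda.
\<close>

lemma emb_dim_lower_bound: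
 fixes c :: "(nat => real) => 'a"
 assumes comp: "compact_space (mtopology_of m)"
  and c: "!!a. a \<in> cube n ==> c a \<in> mspace m"
  and unif: "!!\<delta>. \<delta> > 0 ==> \<exists>\<tau>>0. \<forall>a\<in>cube n. \<forall>b\<in>cube n.
         (\<forall>j<n. \<bar>a j - b j\<bar> < \<tau>) --> mdist m (c a) (c b) < \<delta>"
  and d: "!!i. i < n ==> cont_pmet (mtopology_of m) (d i)"
  and E: "!!i x y. i < n ==> x \<in> mspace m ==> y \<in> mspace m ==> E x y ==> d i x y <= \<epsilon>"
  and sep: "!!i a b. i < n ==> a \<in> cube n ==> b \<in> cube n ==> a i = 0 ==> b i = 1 ==>
        \<epsilon>' <= d i (c a) (c b)"
  and "\<epsilon> < \<epsilon>'" and emb: "emb_dim_le (mtopology_of m) E k"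
 shows "n <= k"
proof (rule ccontr)
 assume "\<not> n <= k"
 hence kn: "k < n" by simp
 let ?X = "mtopology_of m"
 obtain K g where K: "abstract_complex K" "complex_dim K <= k"
  and g: "continuous_map ?X (realization K) g"
  and gE: "\<forall>x\<in>topspace ?X. \<forall>y\<in>topspace ?X. g x = g y --> E x y"
  using emb unfolding emb_dim_le_def by (elim exE conjE)
 obtain M where M: "!!s. s \<in> K ==> s \<subseteq> {..<M}" using abstract_complex_vertex_bound[OF K(1)] by metis
 define \<rho> where "\<rho> = (%(p :: nat => real) q. \<Sum>v<M. \<bar>p v - q v\<bar>)"
 have \<rho>: "0 <= \<rho> p q" "\<rho> p p = 0" "\<rho> p q = \<rho> q p" "\<rho> p s <= \<rho> p q + \<rho> q s" for p q s
  by (auto simp: \<rho>_def sum_nonneg abs_minus_commute sum.distrib[symmetric] intro!: sum_mono)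
 define r where "r = (%x y. \<rho> (g x) (g y))"
 note g' = g[unfolded continuous_map_realization]
 have r: "cont_pmet ?X r"
  unfolding r_def \<rho>_def using g' by (intro cont_pmet_sum cont_pmet_real) auto
 have r0: "E x y" if "x \<in> mspace m" "y \<in> mspace m" "r x y = 0" for x y
 proof -
  have "g x v = g y v" for v
  proof (cases "v < M")
   case True
   thus ?thesis using that(3) by (auto simp: r_def \<rho>_def sum_nonneg_eq_0_iff)
  next
   case False
   have "v \<notin> {i. g x i ~= 0}" "v \<notin> {i. g y i ~= 0}"
    using M[of "{i. g x i ~= 0}"] M[of "{i. g y i ~= 0}"] g' that False by auto
   thus ?thesis by simp
  qed
  hence "g x = g y" by (rule ext)
  thus ?thesis using gE that by simp
 qed
 have "\<exists>\<delta>. 0 < \<delta> & (\<forall>x\<in>mspace m. \<forall>y\<in>mspace m. r x y < \<delta> --> d i x y < \<epsilon>')" if i: "i < n" for i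
 proof -
  obtain \<delta> where "0 < \<delta>" "!!x y. x \<in> topspace ?X ==> y \<in> topspace ?X ==> r x y < \<delta> ==> d i x y < \<epsilon>'"
   by (rule cont_pmet_fibre_uniform[OF comp d[OF i] r _ \<open>\<epsilon> < \<epsilon>'\<close>])
    (use r0 E[OF i] in \<open>auto simp del: mdist_zero\<close>)
  thus ?thesis by (intro exI[of _ \<delta>]) auto
 qed
 then obtain \<Delta> where \<Delta>: "!!i. i < n ==> 0 < \<Delta> i"
  "!!i x y. i < n ==> x \<in> mspace m ==> y \<in> mspace m ==> r x y < \<Delta> i ==> d i x y < \<epsilon>'"
  by metis
 define \<delta> where "\<delta> = Min (insert 1 (\<Delta> ` {..<n}))"
 have \<delta>: "\<delta> > 0" unfolding \<delta>_def using \<Delta>(1) by (subst Min_gr_iff) auto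
 have \<delta>\<Delta>: "\<delta> <= \<Delta> i" if "i < n" for i unfolding \<delta>_def using that by (intro Min_le) auto
 have far: "\<delta> <= r (c a) (c b)" if "i < n" "a \<in> cube n" "b \<in> cube n" "a i = 0" "b i = 1" for i a b
  using sep[OF that] \<Delta>(2)[OF that(1) c[OF that(2)] c[OF that(3)]] \<delta>\<Delta>[OF that(1)] by linarith
 define A where "A = (%i (t::real). {a \<in> cube n. a i = t})"
 have A: "A i 0 ~= {}" "A i 1 ~= {}" for i
 proof -
  have "(%_. 0) \<in> A i 0" "(%_. 1) \<in> A i 1" by (auto simp: A_def cube_def)
  thus "A i 0 ~= {}" "A i 1 ~= {}" by blast+
 qed
 define D where "D = (%i t p. INF a\<in>A i t. \<rho> p (g (c a)))"
 define H where "H = (%i p. D i 0 p - D i 1 p)"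
 have D_lip: "\<bar>D i t p - D i t q\<bar> <= \<rho> p q" if "A i t ~= {}" for i t p q
  unfolding D_def
 proof (rule abs_INF_diff_le[OF that])
  fix a show "\<bar>\<rho> p (g (c a)) - \<rho> q (g (c a))\<bar> <= \<rho> p q"
   using \<rho>(4)[of p "g (c a)" q] \<rho>(4)[of q "g (c a)" p] \<rho>(3)[of p q] by linarith
 qed (simp_all add: \<rho>)
 have H_lip: "\<bar>H i p - H i q\<bar> <= 2 * \<rho> p q" for i p q
  using D_lip[OF A(1), of i p q] D_lip[OF A(2), of i p q] unfolding H_def by linarith
 have D0: "D i t (g (c a)) <= 0" if "a \<in> A i t" for i t a
 proof -
  have "D i t (g (c a)) <= \<rho> (g (c a)) (g (c a))"
   unfolding D_def by (rule cINF_lower[OF _ that]) (auto simp: \<rho> intro!: bdd_belowI[of _ 0])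
  thus ?thesis by (simp add: \<rho>)
 qed
 have lo: "H i (g (c a)) <= - \<delta>" if "i < n" "a \<in> A i 0" for i a
 proof -
  have "\<delta> <= D i 1 (g (c a))"
   unfolding D_def using that far[of i a] by (intro cINF_greatest A) (auto simp: A_def r_def)
  thus ?thesis using D0[OF that(2)] by (simp add: H_def)
 qed
 have hi: "\<delta> <= H i (g (c a))" if "i < n" "a \<in> A i 1" for i a
 proof -
  have "\<delta> <= D i 0 (g (c a))"
   unfolding D_def using that far[of i _ a] \<rho>(3) by (intro cINF_greatest A) (auto simp: A_def r_def)
  thus ?thesis using D0[OF that(2)] by (simp add: H_def)
 qed
 have box: "box_dim_le (topspace (realization K)) \<rho> k"
  unfolding \<rho>_def by (rule box_dim_le_realization[OF K M])
 obtain sh \<eta> where \<eta>: "0 < \<eta>" and sh: "!!i. i < Suc (Suc k) ==> 0 <= sh i & sh i <= \<delta> / 2"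
  and gen: "!!j I p. j < Suc (Suc k) ==> I \<subseteq> {..<Suc (Suc k)} - {j} ==> card I = Suc k ==>
    p \<in> topspace (realization K) ==> \<exists>i\<in>I. \<bar>H i p - (sh i - sh j)\<bar> >= \<eta>"
 proof (rule generic_shifts[where S="topspace (realization K)" and n="Suc (Suc k)" and H="%_. H"
    and \<rho>=\<rho> and k=k and \<theta>="\<delta> / 2"])
  show "0 < \<delta> / 2" using \<delta> by simp
  show "box_dim_le (topspace (realization K)) \<rho> k" by (rule box)
 qed (use H_lip in blast)+
 \<comment> \<open>Genericity is about differences of shifts, so one more shift serves as the base point.\<close>
 define s where "s = (%i. if i <= k then sh i - sh (Suc k) else 0)"
 have s: "\<bar>s i\<bar> <= \<delta> / 2" for i
 proof (cases "i <= k")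
  case True
  have "0 <= sh i & sh i <= \<delta> / 2" "0 <= sh (Suc k) & sh (Suc k) <= \<delta> / 2" using sh True by simp_all
  moreover have "s i = sh i - sh (Suc k)" using True by (simp add: s_def)
  ultimately show ?thesis by linarith
 qed (use \<delta> in \<open>simp add: s_def\<close>)
 define G where "G = (%i a. H i (g (c a)) - s i)"
 have "\<exists>a\<in>cube n. \<forall>i<n. \<bar>G i a\<bar> < \<eta>"
 proof (rule Poincare_Miranda)
  fix \<delta>' :: real assume "\<delta>' > 0"
  obtain \<delta>1 where \<delta>1: "0 < \<delta>1" "!!x y. x \<in> topspace ?X ==> y \<in> topspace ?X ==> mdist m x y < \<delta>1 ==> r x y < \<delta>' / 2"
  proof (rule cont_pmet_fibre_uniform[OF comp r cont_pmet_mdist, of 0 "\<delta>' / 2"])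
   fix x y assume "x \<in> topspace ?X" "y \<in> topspace ?X" "mdist m x y = 0"
   thus "r x y <= 0" by (simp add: r_def \<rho>)
  qed (use \<open>\<delta>' > 0\<close> in auto)
  obtain \<tau> where \<tau>: "\<tau> > 0" "\<forall>a\<in>cube n. \<forall>b\<in>cube n. (\<forall>j<n. \<bar>a j - b j\<bar> < \<tau>) --> mdist m (c a) (c b) < \<delta>1"
   using unif[OF \<delta>1(1)] by (elim exE conjE)
  have "\<bar>G i a - G i b\<bar> < \<delta>'" if "a \<in> cube n" "b \<in> cube n" "\<forall>j<n. \<bar>a j - b j\<bar> < \<tau>" for a b i
  proof -
   have "mdist m (c a) (c b) < \<delta>1" using \<tau>(2) that by simp
   hence "r (c a) (c b) < \<delta>' / 2" using \<delta>1(2) c[OF that(1)] c[OF that(2)] by simp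
   thus ?thesis using H_lip[of i "g (c a)" "g (c b)"] unfolding G_def r_def by linarith
  qed
  thus "\<exists>\<tau>>0. \<forall>a\<in>cube n. \<forall>b\<in>cube n. (\<forall>j<n. \<bar>a j - b j\<bar> < \<tau>) --> (\<forall>i<n. \<bar>G i a - G i b\<bar> < \<delta>')"
   using \<tau>(1) by (intro exI[of _ \<tau>]) simp
 next
  fix i a assume "i < n" "a \<in> cube n" "a i = 0"
  thus "G i a < 0" using lo[of i a] s[of i] \<delta> by (auto simp: G_def A_def abs_le_iff)
 next
  fix i a assume "i < n" "a \<in> cube n" "a i = 1"
  thus "0 <= G i a" using hi[of i a] s[of i] \<delta> by (auto simp: G_def A_def abs_le_iff)
 qed (rule \<eta>)
 then obtain a where a: "a \<in> cube n" "\<forall>i<n. \<bar>G i a\<bar> < \<eta>" by (elim bexE)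
 have "g (c a) \<in> topspace (realization K)"
  using g c[OF a(1)] by (auto simp: continuous_map_def)
 hence "\<exists>i\<in>{..k}. \<bar>H i (g (c a)) - (sh i - sh (Suc k))\<bar> >= \<eta>"
  by (intro gen) auto
 then obtain i where i: "i <= k" "\<bar>H i (g (c a)) - (sh i - sh (Suc k))\<bar> >= \<eta>" by auto
 have "\<bar>G i a\<bar> < \<eta>" using a(2) i(1) kn by simp
 thus False using i by (simp add: G_def s_def)
qed

section \<open>Lattice points in discs and subadditive limits\<close>

definition lattice_disc :: "real => real => real => (int \<times> int) set" where
 "lattice_disc a b R = {(i, j). cmod (Complex (a * of_int i) (b * of_int j)) <= R}"

lemma finite_lattice_disc:
 assumes "0 < a" "0 < b"
 shows "finite (lattice_disc a b R)"
proof -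
 have bd: "\<bar>i\<bar> <= \<lceil>\<bar>R\<bar> / c\<rceil>" if "0 < c" "\<bar>c * of_int i\<bar> <= R" for c i
 proof -
  have "\<bar>of_int i :: real\<bar> <= \<bar>R\<bar> / c"
   using that by (simp add: abs_mult field_simps)
  hence "of_int \<bar>i\<bar> <= \<bar>R\<bar> / c" by simp
  thus ?thesis by linarith
 qed
 have "lattice_disc a b R \<subseteq> {- \<lceil>\<bar>R\<bar> / a\<rceil>..\<lceil>\<bar>R\<bar> / a\<rceil>} \<times> {- \<lceil>\<bar>R\<bar> / b\<rceil>..\<lceil>\<bar>R\<bar> / b\<rceil>}"
 proof (clarsimp simp: lattice_disc_def)
  fix i j assume *: "cmod (Complex (a * of_int i) (b * of_int j)) <= R"
  have "\<bar>a * of_int i\<bar> <= R" "\<bar>b * of_int j\<bar> <= R"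
   using order_trans[OF abs_Re_le_cmod *] order_trans[OF abs_Im_le_cmod *] by auto
  thus "- \<lceil>\<bar>R\<bar> / a\<rceil> <= i & i <= \<lceil>\<bar>R\<bar> / a\<rceil> & - \<lceil>\<bar>R\<bar> / b\<rceil> <= j & j <= \<lceil>\<bar>R\<bar> / b\<rceil>"
   using bd[OF assms(1), of i] bd[OF assms(2), of j] by linarith
 qed
 thus ?thesis by (rule finite_subset) auto
qed

definition grid_cell :: "real => real => int \<times> int => complex set" where
 "grid_cell a b = (%(i, j). cbox (Complex (a * of_int i) (b * of_int j)) (Complex (a * of_int (i + 1)) (b * of_int (j + 1))))"

lemma grid_cell_near_corner:
 assumes "0 < a" "0 < b" "z \<in> grid_cell a b (i, j)"
 shows "cmod (z - Complex (a * of_int i) (b * of_int j)) <= a + b"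
proof -
 have "0 <= Re z - a * of_int i" "Re z - a * of_int i <= a" "0 <= Im z - b * of_int j" "Im z - b * of_int j <= b"
  using assms(3) by (auto simp: grid_cell_def in_cbox_complex_iff algebra_simps)
 hence "\<bar>Re (z - Complex (a * of_int i) (b * of_int j))\<bar> <= a" "\<bar>Im (z - Complex (a * of_int i) (b * of_int j))\<bar> <= b" by auto
 thus ?thesis by (intro order_trans[OF cmod_le]) linarith
qed

lemma in_grid_cell_floor:
 assumes "0 < a" "0 < b"
 shows "z \<in> grid_cell a b (\<lfloor>Re z / a\<rfloor>, \<lfloor>Im z / b\<rfloor>)"
proof -
 have *: "c * of_int \<lfloor>x / c\<rfloor> <= x & x <= c * of_int (\<lfloor>x / c\<rfloor> + 1)" if "0 < c" for c x :: real
 proof -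
  have "of_int \<lfloor>x / c\<rfloor> <= x / c" "x / c <= of_int (\<lfloor>x / c\<rfloor> + 1)" by linarith+
  from this[THEN mult_left_mono, of c] show ?thesis using that by simp
 qed
 show ?thesis using *[OF assms(1)] *[OF assms(2)] by (auto simp: grid_cell_def in_cbox_complex_iff)
qed

lemma content_cbox_complex:
 assumes "a <= c" "b <= d"
 shows "measure lborel (cbox (Complex a b) (Complex c d)) = (c - a) * (d - b)"
  and "measure lborel (box (Complex a b) (Complex c d)) = (c - a) * (d - b)"
 using assms by (auto simp: Basis_complex_def measure_lborel_box_eq measure_lborel_cbox_eq)

text \<open>
  The cells attached to these lattice points are disjoint up to null sets; their union contains the disc of radius
  \<open>R - (a + b)\<close> and lies in the one of radius \<open>R + (a + b)\<close>.
\<close>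

lemma card_lattice_disc:
 assumes ab: "0 < a" "0 < b"
 shows "R >= a + b ==> pi * (R - (a + b))^2 <= a * b * real (card (lattice_disc a b R))"
  and "R >= 0 ==> a * b * real (card (lattice_disc a b R)) <= pi * (R + (a + b))^2"
proof -
 let ?S = "lattice_disc a b R"
 note fin = finite_lattice_disc[OF ab, of R]
 have disc: "measure lborel (cball (0::complex) r) = pi * r^2" if "r >= 0" for r
  using content_cball[OF that, of "0::complex"] by (simp add: unit_ball_vol_2)
 have cell: "measure lborel (grid_cell a b p) = a * b" for p
  using ab by (cases p) (simp add: grid_cell_def content_cbox_complex algebra_simps)
 define C where "C = (%(i, j). box (Complex (a * of_int i) (b * of_int j)) (Complex (a * of_int (i + 1)) (b * of_int (j + 1))))"
 have C: "measure lborel (C p) = a * b" for p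
  using ab by (cases p) (simp add: C_def content_cbox_complex algebra_simps)
 show "pi * (R - (a + b))^2 <= a * b * real (card ?S)" if R: "R >= a + b"
 proof -
  have "cball 0 (R - (a + b)) \<subseteq> (\<Union>p\<in>?S. grid_cell a b p)"
  proof
   fix z :: complex assume z: "z \<in> cball 0 (R - (a + b))"
   let ?i = "\<lfloor>Re z / a\<rfloor>" and ?j = "\<lfloor>Im z / b\<rfloor>"
   have cell: "z \<in> grid_cell a b (?i, ?j)" by (rule in_grid_cell_floor[OF ab])
   have "cmod (Complex (a * of_int ?i) (b * of_int ?j)) <= cmod z + cmod (z - Complex (a * of_int ?i) (b * of_int ?j))"
    by (metis norm_minus_commute norm_triangle_sub)
   also have "... <= R" using z grid_cell_near_corner[OF ab cell] by simp
   finally show "z \<in> (\<Union>p\<in>?S. grid_cell a b p)" using cell by (intro UN_I) (auto simp: lattice_disc_def)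
  qed
  hence "measure lborel (cball (0::complex) (R - (a + b))) <= measure lborel (\<Union>p\<in>?S. grid_cell a b p)"
   using fin by (intro measure_mono_fmeasurable fmeasurable.finite_UN) (auto simp: grid_cell_def)
  also have "... <= (\<Sum>p\<in>?S. measure lborel (grid_cell a b p))"
   using fin by (intro measure_UNION_le) (auto simp: grid_cell_def)
  also have "... = a * b * real (card ?S)" by (simp add: cell)
  finally show ?thesis using R by (simp add: disc)
 qed
 show "a * b * real (card ?S) <= pi * (R + (a + b))^2" if R: "R >= 0"
 proof -
  have disj: "pairwise (%p q. disjnt (C p) (C q)) ?S"
  proof (rule pairwiseI, unfold disjnt_iff, intro allI notI)
   fix p q z assume pq: "p \<in> ?S" "q \<in> ?S" "p ~= q" "z \<in> C p & z \<in> C q"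
   have *: "i = \<lfloor>Re z / a\<rfloor> & j = \<lfloor>Im z / b\<rfloor>" if "z \<in> C (i, j)" for i j
   proof -
    have "of_int i < Re z / a" "Re z / a < of_int (i + 1)" "of_int j < Im z / b" "Im z / b < of_int (j + 1)"
     using that ab by (auto simp: C_def in_box_complex_iff field_simps)
    thus ?thesis by (auto intro!: floor_unique[symmetric])
   qed
   show False using *[of "fst p" "snd p"] *[of "fst q" "snd q"] pq(3,4) by (simp add: prod_eq_iff)
  qed
  have "a * b * real (card ?S) = (\<Sum>p\<in>?S. measure lborel (C p))" by (simp add: C)
  also have "... = measure lborel (\<Union>p\<in>?S. C p)"
   using fin disj by (intro measure_UNION'[symmetric]) (auto simp: C_def)
  also have "... <= measure lborel (cball (0::complex) (R + (a + b)))"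
  proof (intro measure_mono_fmeasurable UN_least)
   fix p assume p: "p \<in> ?S"
   show "C p \<subseteq> cball 0 (R + (a + b))"
   proof
    fix z assume z: "z \<in> C p"
    obtain i j where ij: "p = (i, j)" by (metis prod.exhaust)
    have "z \<in> grid_cell a b (i, j)"
     using z ij box_subset_cbox unfolding C_def grid_cell_def by force
    from grid_cell_near_corner[OF ab this]
    have "cmod z <= cmod (Complex (a * of_int i) (b * of_int j)) + (a + b)"
     by (smt (verit) norm_triangle_sub)
    thus "z \<in> cball 0 (R + (a + b))" using p ij by (simp add: lattice_disc_def)
   qed
  qed (use fin in \<open>auto simp: C_def intro!: sets.finite_UN fmeasurableI emeasure_lborel_cball_finite\<close>)
  also have "... = pi * (R + (a + b))^2" using R ab by (simp add: disc)
  finally show ?thesis .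
 qed
qed

text \<open>
  For squares of side \<open>s\<close> the quotients \<open>v s\<close> have the infimum \<open>L\<close>. Covering a disc by small
  squares gives the upper estimate. For the lower one, a large square is covered by the inscribed disc and
  small squares near its corners; since the latter are charged with \<open>v s\<close>, close to \<open>L\<close>, the disc
  must contribute its full share of \<open>L\<close>.
\<close>

lemma Ornstein_Weiss_disc:
 fixes W :: "complex set => nat"
 assumes mono: "!!A B. A \<subseteq> B ==> bounded B ==> W A <= W B"
  and empty: "W {} = 0"
  and subadd: "!!A B. bounded A ==> bounded B ==> W (A \<union> B) <= W A + W B"
  and shift: "!!A c. bounded A ==> W ((+) c ` A) <= W A"
 obtains L where "0 <= L" "((%R. real (W (cball 0 R)) / (pi * R^2)) \<longlongrightarrow> L) at_top"
proof -
 define sq where "sq = (%s. cbox 0 (Complex s s))"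
 have bsq: "bounded (sq s)" for s by (simp add: sq_def)
 define v where "v = (%s. real (W (sq s)) / s^2)"
 define L where "L = (INF s\<in>{0<..}. v s)"
 have bdd: "bdd_below (v ` {0<..})" by (intro bdd_belowI[of _ 0]) (auto simp: v_def)
 have L0: "0 <= L" unfolding L_def by (intro cINF_greatest) (auto simp: v_def)
 have cell_sq: "grid_cell s s p \<subseteq> (+) (Complex (s * of_int (fst p)) (s * of_int (snd p))) ` sq s" for s p
 proof
  fix z assume z: "z \<in> grid_cell s s p"
  let ?c = "Complex (s * of_int (fst p)) (s * of_int (snd p))"
  have "z - ?c \<in> sq s"
   using z by (cases p) (auto simp: grid_cell_def sq_def in_cbox_complex_iff algebra_simps)
  thus "z \<in> (+) ?c ` sq s" by (intro image_eqI[of _ _ "z - ?c"]) auto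
 qed
 have Wcell: "W (grid_cell s s p) <= W (sq s)" for s p
  using mono[OF cell_sq bounded_translation[OF bsq]] shift[OF bsq] order_trans by blast
 have Wunion: "W (\<Union>p\<in>S. grid_cell s s p) <= card S * W (sq s)" if "finite S" for S s
  using that
 proof induction
  case (insert p S)
  have "bounded (\<Union>p\<in>S. grid_cell s s p)" using insert(1) by (auto simp: grid_cell_def)
  hence "W (\<Union>p\<in>insert p S. grid_cell s s p) <= W (grid_cell s s p) + W (\<Union>p\<in>S. grid_cell s s p)"
   unfolding UN_insert by (intro subadd) (auto simp: grid_cell_def split: prod.split)
  also have "... <= W (sq s) + card S * W (sq s)" using Wcell insert.IH by (intro add_mono)
  finally show ?case using insert by simp
 qed (simp add: empty)
 have upper: "real (W (cball 0 R)) <= pi * (R + 4 * s)^2 * v s" if s: "0 < s" and R: "0 <= R" for s R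
 proof -
  let ?S = "lattice_disc s s (R + 2 * s)"
  have fin: "finite ?S" by (rule finite_lattice_disc[OF s s])
  have "cball 0 R \<subseteq> (\<Union>p\<in>?S. grid_cell s s p)"
  proof
   fix z :: complex assume z: "z \<in> cball 0 R"
   let ?i = "\<lfloor>Re z / s\<rfloor>" and ?j = "\<lfloor>Im z / s\<rfloor>"
   have cell: "z \<in> grid_cell s s (?i, ?j)" by (rule in_grid_cell_floor[OF s s])
   have "cmod (Complex (s * of_int ?i) (s * of_int ?j)) <= cmod z + cmod (z - Complex (s * of_int ?i) (s * of_int ?j))"
    by (metis norm_minus_commute norm_triangle_sub)
   also have "... <= R + 2 * s" using z grid_cell_near_corner[OF s s cell] by simp
   finally show "z \<in> (\<Union>p\<in>?S. grid_cell s s p)" using cell by (intro UN_I) (auto simp: lattice_disc_def)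
  qed
  hence "W (cball 0 R) <= card ?S * W (sq s)"
   using fin by (intro order_trans[OF mono Wunion]) (auto simp: grid_cell_def)
  hence "real (W (cball 0 R)) <= real (card ?S) * real (W (sq s))" by (metis of_nat_mono of_nat_mult)
  also have "... = (s * s * real (card ?S)) * v s" using s by (simp add: v_def power2_eq_square)
  also have "... <= pi * (R + 4 * s)^2 * v s"
   using card_lattice_disc(2)[OF s s, of "R + 2 * s"] s R by (intro mult_right_mono) (auto simp: v_def algebra_simps)
  finally show ?thesis .
 qed
 have lower: "4 * R^2 * L - ((2 * R + 2 * s)^2 - pi * (R - 4 * s)^2) * v s <= real (W (cball 0 R))"
  if s: "0 < s" and R: "4 * s < R" for s R
 proof -
  let ?m = "\<lfloor>- R / s\<rfloor>" and ?M = "\<lfloor>R / s\<rfloor>"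
  define U where "U = {?m..?M} \<times> {?m..?M}"
  define I where "I = lattice_disc s s (R - 2 * s)"
  have finI: "finite I" unfolding I_def by (rule finite_lattice_disc[OF s s])
  have finU: "finite U" by (simp add: U_def)
  have fm: "?m <= i & i <= ?M" if "\<bar>s * of_int i\<bar> <= R" for i
  proof -
   have "of_int i <= R / s" "- R / s <= of_int i" using that s by (auto simp: field_simps abs_le_iff)
   thus ?thesis by linarith
  qed
  have IU: "I \<subseteq> U"
  proof
   fix p assume "p \<in> I"
   moreover obtain i j where ij: "p = (i, j)" by (metis prod.exhaust)
   ultimately have *: "cmod (Complex (s * of_int i) (s * of_int j)) <= R - 2 * s" by (simp add: I_def lattice_disc_def)
   have "\<bar>s * of_int i\<bar> <= R - 2 * s" "\<bar>s * of_int j\<bar> <= R - 2 * s"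
    using order_trans[OF abs_Re_le_cmod *] order_trans[OF abs_Im_le_cmod *] by auto
   hence "\<bar>s * of_int i\<bar> <= R" "\<bar>s * of_int j\<bar> <= R" using s by linarith+
   thus "p \<in> U" using fm ij by (simp add: U_def)
  qed
  have cardU: "s * s * real (card U) <= (2 * R + 2 * s)^2"
  proof -
   have mM: "?m <= ?M" using s R by (intro floor_mono) (simp add: field_simps)
   have "card U = nat (?M - ?m + 1) * nat (?M - ?m + 1)" by (simp add: U_def card_cartesian_product)
   hence "real (card U) = (real_of_int (?M - ?m + 1))^2" using mM by (simp add: power2_eq_square)
   hence "s * s * real (card U) = (s * real_of_int (?M - ?m + 1))^2" by (simp add: power2_eq_square)
   also have "... <= (2 * R + 2 * s)^2"
   proof (rule power_mono)
    have "real_of_int (?M - ?m + 1) <= R / s + R / s + 2" by linarith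
    hence "s * real_of_int (?M - ?m + 1) <= s * (R / s + R / s + 2)" using s by (intro mult_left_mono) auto
    also have "... = 2 * R + 2 * s" using s by (simp add: field_simps)
    finally show "s * real_of_int (?M - ?m + 1) <= 2 * R + 2 * s" .
    show "0 <= s * real_of_int (?M - ?m + 1)" using s mM by simp
   qed
   finally show ?thesis .
  qed
  have "(+) (Complex (- R) (- R)) ` sq (2 * R) \<subseteq> cball 0 R \<union> (\<Union>p\<in>U - I. grid_cell s s p)"
  proof
   fix z assume "z \<in> (+) (Complex (- R) (- R)) ` sq (2 * R)"
   hence z: "- R <= Re z" "Re z <= R" "- R <= Im z" "Im z <= R"
    by (auto simp: sq_def in_cbox_complex_iff)
   let ?i = "\<lfloor>Re z / s\<rfloor>" and ?j = "\<lfloor>Im z / s\<rfloor>"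
   have cell: "z \<in> grid_cell s s (?i, ?j)" by (rule in_grid_cell_floor[OF s s])
   have U: "(?i, ?j) \<in> U" proof -
    have "- R / s <= Re z / s" "Re z / s <= R / s" "- R / s <= Im z / s" "Im z / s <= R / s"
     using z s by (auto intro!: divide_right_mono simp del: minus_divide_left[symmetric])
    thus ?thesis unfolding U_def by (auto intro!: floor_mono simp del: minus_divide_left)
   qed
   show "z \<in> cball 0 R \<union> (\<Union>p\<in>U - I. grid_cell s s p)"
   proof (cases "(?i, ?j) \<in> I")
    case True
    have "cmod z <= cmod (Complex (s * of_int ?i) (s * of_int ?j)) + (s + s)"
     using grid_cell_near_corner[OF s s cell] by (smt (verit) norm_triangle_sub)
    thus ?thesis using True by (simp add: I_def lattice_disc_def)
   next
    case False
    thus ?thesis using U cell by blast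
   qed
  qed
  moreover have bU: "bounded (\<Union>p\<in>U - I. grid_cell s s p)" using finU by (auto simp: grid_cell_def)
  ultimately have "W ((+) (Complex (- R) (- R)) ` sq (2 * R)) <= W (cball 0 R) + W (\<Union>p\<in>U - I. grid_cell s s p)"
   by (intro order_trans[OF mono subadd]) auto
  moreover have "W (sq (2 * R)) <= W ((+) (Complex (- R) (- R)) ` sq (2 * R))"
  proof -
   have "sq (2 * R) = (+) (Complex R R) ` ((+) (Complex (- R) (- R)) ` sq (2 * R))"
   proof -
    have "Complex R R + Complex (- R) (- R) = 0" by (simp add: complex_eq_iff)
    thus ?thesis by (simp add: image_image flip: add.assoc)
   qed
   thus ?thesis using shift[OF bounded_translation[OF bsq]] by metis
  qed
  moreover have "W (\<Union>p\<in>U - I. grid_cell s s p) <= card (U - I) * W (sq s)"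
   using finU by (intro Wunion) auto
  ultimately have "W (sq (2 * R)) <= W (cball 0 R) + card (U - I) * W (sq s)" by linarith
  hence 1: "real (W (sq (2 * R))) <= real (W (cball 0 R)) + real (card (U - I)) * real (W (sq s))"
   by (metis of_nat_add of_nat_mono of_nat_mult)
  have "L <= v (2 * R)" unfolding L_def using s R by (intro cINF_lower bdd) auto
  hence 2: "4 * R^2 * L <= real (W (sq (2 * R)))" using s R by (simp add: v_def field_simps)
  have "card (U - I) = card U - card I" using IU finI by (intro card_Diff_subset)
  moreover have "card I <= card U" using IU finU by (intro card_mono)
  ultimately have "s * s * real (card (U - I)) = s * s * real (card U) - s * s * real (card I)"
   by (simp add: right_diff_distrib)
  also have "... <= (2 * R + 2 * s)^2 - pi * (R - 4 * s)^2"
   using cardU card_lattice_disc(1)[OF s s, of "R - 2 * s"] R s unfolding I_def by (simp add: algebra_simps)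
  finally have "(s * s * real (card (U - I))) * v s <= ((2 * R + 2 * s)^2 - pi * (R - 4 * s)^2) * v s"
   by (intro mult_right_mono) (auto simp: v_def)
  moreover have "(s * s * real (card (U - I))) * v s = real (card (U - I)) * real (W (sq s))"
   using s by (simp add: v_def power2_eq_square)
  ultimately show ?thesis using 1 2 by linarith
 qed
 have "((%R. real (W (cball 0 R)) / (pi * R^2)) \<longlongrightarrow> L) at_top"
 proof (rule order_tendstoI)
  fix y assume "L < y"
  then obtain s where s: "0 < s" "v s < y"
   unfolding L_def by (subst (asm) cINF_less_iff[OF _ bdd]) auto
  have "((%R. (1 + 4 * s / R)^2 * v s) \<longlongrightarrow> (1 + 0)^2 * v s) at_top"
   by (intro tendsto_intros tendsto_divide_0[OF tendsto_const] filterlim_at_top_imp_at_infinity filterlim_ident)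
  hence "eventually (%R. (1 + 4 * s / R)^2 * v s < y) at_top"
   using s(2) by (intro order_tendstoD(2)) auto
  thus "eventually (%R. real (W (cball 0 R)) / (pi * R^2) < y) at_top"
   using eventually_gt_at_top[of 0]
  proof eventually_elim
   case (elim R)
   have "real (W (cball 0 R)) / (pi * R^2) <= pi * (R + 4 * s)^2 * v s / (pi * R^2)"
    using upper[OF s(1), of R] elim by (intro divide_right_mono) auto
   also have "... = ((R + 4 * s) / R)^2 * v s" using elim by (simp add: power_divide)
   also have "(R + 4 * s) / R = 1 + 4 * s / R" using elim by (simp add: field_simps)
   finally show ?case using elim by linarith
  qed
 next
  fix y assume y: "y < L"
  define \<epsilon> where "\<epsilon> = L - y"
  have "L < L + \<epsilon>" using y by (simp add: \<epsilon>_def)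
  then obtain s where s: "0 < s" "v s < L + \<epsilon>"
   unfolding L_def by (subst (asm) cINF_less_iff[OF _ bdd]) auto
  have "((%R. (4 * L - ((2 + 2 * s / R)^2 - pi * (1 - 4 * s / R)^2) * v s) / pi)
    \<longlongrightarrow> (4 * L - ((2 + 0)^2 - pi * (1 - 0)^2) * v s) / pi) at_top"
   by (intro tendsto_intros tendsto_divide_0[OF tendsto_const] filterlim_at_top_imp_at_infinity filterlim_ident) auto
  moreover have "y < (4 * L - ((2 + 0)^2 - pi * (1 - 0)^2) * v s) / pi"
  proof -
   have pi: "pi < 4" "3 < pi" using pi_less_4 pi_gt3 by auto
   have "(4 - pi) * v s < (4 - pi) * (L + \<epsilon>)" using s(2) pi by (intro mult_strict_left_mono) auto
   hence "4 * L - (4 - pi) * v s > pi * L - (4 - pi) * \<epsilon>" by (simp add: algebra_simps)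
   moreover have "(4 - pi) * \<epsilon> <= pi * \<epsilon>" using pi y by (intro mult_right_mono) (auto simp: \<epsilon>_def)
   ultimately have "4 * L - (4 - pi) * v s > pi * y" by (simp add: \<epsilon>_def algebra_simps)
   thus ?thesis by (simp add: field_simps)
  qed
  ultimately have "eventually (%R. y < (4 * L - ((2 + 2 * s / R)^2 - pi * (1 - 4 * s / R)^2) * v s) / pi) at_top"
   by (rule order_tendstoD(1))
  thus "eventually (%R. y < real (W (cball 0 R)) / (pi * R^2)) at_top"
   using eventually_gt_at_top[of "4 * s"]
  proof eventually_elim
   case (elim R)
   have R: "R > 0" using elim s by linarith
   have e: "2 + 2 * s / R = (2 * R + 2 * s) / R" "1 - 4 * s / R = (R - 4 * s) / R" using R by (auto simp: field_simps)
   have "(4 * L - ((2 + 2 * s / R)^2 - pi * (1 - 4 * s / R)^2) * v s) / pi =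
     (4 * R^2 * L - ((2 * R + 2 * s)^2 - pi * (R - 4 * s)^2) * v s) / (pi * R^2)"
    unfolding e power_divide using R by (simp add: field_simps)
   also have "... <= real (W (cball 0 R)) / (pi * R^2)"
    using lower[OF s(1) elim(2)] by (intro divide_right_mono) auto
   finally show ?case using elim by linarith
  qed
 qed
 thus thesis using that L0 by blast
qed

section \<open>Laplacians and the energy density\<close>

text \<open>
  The operators \<open>partial_x\<close> and \<open>partial_y\<close> are built from \<open>deriv\<close>, which has a default value where no
  derivative exists. This relation asserts existence, and is therefore additive and sees local maxima.
\<close>

definition second_deriv :: "(real => real) => real => bool" where
 "second_deriv f a \<longleftrightarrow> (\<exists>p. (\<forall>\<^sub>F t in nhds 0. (f has_real_derivative p t) (at t)) & (p has_real_derivative a) (at 0))"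

definition has_laplacian :: "(complex => real) => complex => real => bool" where
 "has_laplacian u z L \<longleftrightarrow> (\<exists>a b. second_deriv (%t. u (z + of_real t)) a & second_deriv (%t. u (z + of_real t * \<i>)) b & L = a + b)"

lemma second_derivI:
 "\<forall>\<^sub>F t in nhds 0. (f has_real_derivative p t) (at t) ==> (p has_real_derivative a) (at 0) ==> second_deriv f a"
 unfolding second_deriv_def by blast

lemma second_deriv_add:
 assumes "second_deriv f a" "second_deriv g b"
 shows "second_deriv (%t. f t + g t) (a + b)"
proof -
 obtain p q where "\<forall>\<^sub>F t in nhds 0. (f has_real_derivative p t) (at t)" "(p has_real_derivative a) (at 0)"
  "\<forall>\<^sub>F t in nhds 0. (g has_real_derivative q t) (at t)" "(q has_real_derivative b) (at 0)"
  using assms unfolding second_deriv_def by (elim exE conjE)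
 thus ?thesis
  by (intro second_derivI[where p="%t. p t + q t"]) (auto elim: eventually_elim2 intro: DERIV_add)
qed

lemma second_deriv_minus:
 assumes "second_deriv f a"
 shows "second_deriv (%t. - f t) (- a)"
proof -
 obtain p where "\<forall>\<^sub>F t in nhds 0. (f has_real_derivative p t) (at t)" "(p has_real_derivative a) (at 0)"
  using assms unfolding second_deriv_def by (elim exE conjE)
 thus ?thesis
  by (intro second_derivI[where p="%t. - p t"]) (auto elim: eventually_mono intro: DERIV_minus)
qed

lemma deriv_deriv_line:
 fixes f :: "real => real"
 assumes "second_deriv f a"
 shows "deriv (%t. deriv (%s. f (t + s)) 0) 0 = a"
proof -
 obtain p where p: "\<forall>\<^sub>F t in nhds 0. (f has_real_derivative p t) (at t)" "(p has_real_derivative a) (at 0)"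
  using assms unfolding second_deriv_def by (elim exE conjE)
 have "\<forall>\<^sub>F t in nhds 0. deriv (%s. f (t + s)) 0 = p t"
  using p(1)
 proof eventually_elim
  case (elim t)
  hence "((%s. f (t + s)) has_real_derivative p t) (at 0)"
   using DERIV_shift[of f "p t" 0 t] by (simp add: add.commute)
  thus ?case by (rule DERIV_imp_deriv)
 qed
 hence "deriv (%t. deriv (%s. f (t + s)) 0) 0 = deriv p 0" by (intro deriv_cong_ev) auto
 also have "... = a" using p(2) by (rule DERIV_imp_deriv)
 finally show ?thesis .
qed

lemma laplacian_eqI:
 assumes "has_laplacian u z L"
 shows "laplacian u z = L"
proof -
 obtain a b where *: "second_deriv (%t. u (z + of_real t)) a" "second_deriv (%t. u (z + of_real t * \<i>)) b" "L = a + b"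
  using assms unfolding has_laplacian_def by (elim exE conjE)
 have "partial_x (partial_x u) z = a"
  using deriv_deriv_line[OF *(1)] by (simp add: partial_x_def add.assoc)
 moreover have "partial_y (partial_y u) z = b"
  using deriv_deriv_line[OF *(2)] by (simp add: partial_y_def add.assoc distrib_right)
 ultimately show ?thesis by (simp add: laplacian_def *(3))
qed

lemma has_laplacian_add: "has_laplacian u z L ==> has_laplacian v z M ==> has_laplacian (%w. u w + v w) z (L + M)"
 unfolding has_laplacian_def
 by (elim exE conjE, intro exI conjI, erule (1) second_deriv_add, erule (1) second_deriv_add) simp

lemma has_laplacian_minus: "has_laplacian u z L ==> has_laplacian (%w. - u w) z (- L)"
 unfolding has_laplacian_def
 by (elim exE conjE, intro exI conjI, erule second_deriv_minus, erule second_deriv_minus) simp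

lemma second_derivative_local_max:
 fixes f :: "real => real"
 assumes sd: "second_deriv f a" and max: "\<forall>\<^sub>F t in nhds 0. f t <= f 0"
 shows "a <= 0"
proof (rule ccontr)
 obtain p where f: "\<forall>\<^sub>F t in nhds 0. (f has_real_derivative p t) (at t)" and p: "(p has_real_derivative a) (at 0)"
  using sd unfolding second_deriv_def by (elim exE conjE)
 assume "\<not> a <= 0"
 hence "0 < a" by simp
 obtain d1 where d1: "d1 > 0" "!!t. \<bar>t\<bar> < d1 ==> (f has_real_derivative p t) (at t) & f t <= f 0"
  using eventually_conj[OF f max] unfolding eventually_nhds_metric by (auto simp: dist_real_def)
 have "p 0 = 0"
  using DERIV_local_max[of f "p 0" 0 d1] d1 by simp
 moreover obtain d2 where d2: "d2 > 0" "!!h. 0 < h ==> h < d2 ==> p 0 < p (0 + h)"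
  using DERIV_pos_inc_right[OF p \<open>0 < a\<close>] by blast
 define t where "t = min d1 d2 / 2"
 have t: "0 < t" "t < d1" "t < d2" using d1(1) d2(1) by (auto simp: t_def)
 obtain s where s: "0 < s" "s < t" "f t - f 0 = (t - 0) * p s"
  using MVT2[OF t(1), of f p] d1(2) t by auto
 hence "0 < p s" using d2(2)[of s] \<open>p 0 = 0\<close> t by simp
 hence "f 0 < f t" using s(3) t by (metis diff_gt_0_iff_gt diff_zero mult_pos_pos)
 thus False using d1(2)[of t] t by simp
qed

lemma eventually_nhds_line:
 fixes z v :: complex
 assumes "eventually P (nhds z)"
 shows "\<forall>\<^sub>F t in nhds (0::real). P (z + of_real t * v)"
proof -
 obtain U where U: "open U" "z \<in> U" "!!w. w \<in> U ==> P w"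
  using assms unfolding eventually_nhds by blast
 have "open ((%t::real. z + of_real t * v) -` U)" by (intro open_vimage U continuous_intros)
 hence "\<forall>\<^sub>F t in nhds 0. t \<in> (%t::real. z + of_real t * v) -` U"
  using U(2) by (intro eventually_nhds_in_open) auto
 thus ?thesis by eventually_elim (use U(3) in auto)
qed

text \<open>
  This is the maximum principle used below: both second derivatives are nonpositive at a maximum.
\<close>

lemma has_laplacian_local_max:
 assumes "has_laplacian u z L" "\<forall>\<^sub>F w in nhds z. u w <= u z"
 shows "L <= 0"
proof -
 obtain a b where *: "second_deriv (%t. u (z + of_real t)) a" "second_deriv (%t. u (z + of_real t * \<i>)) b" "L = a + b"
  using assms(1) unfolding has_laplacian_def by (elim exE conjE)
 have "a <= 0"
  by (rule second_derivative_local_max[OF *(1)]) (use eventually_nhds_line[OF assms(2), of 1] in simp)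
 moreover have "b <= 0"
  by (rule second_derivative_local_max[OF *(2)]) (use eventually_nhds_line[OF assms(2), of \<i>] in simp)
 ultimately show ?thesis using *(3) by simp
qed

definition nsq :: "nat => (nat => complex => complex) => complex => real" where
 "nsq N F z = (\<Sum>i\<le>N. (cmod (F i z))^2)"

definition dinner :: "nat => (nat => complex => complex) => complex => complex" where
 "dinner N F z = (\<Sum>i\<le>N. deriv (F i) z * cnj (F i z))"

text \<open>
  The Fubini-Study energy density: \<open>\<pi>\<close> times the square of the norm in the definition of a Brody curve
  (see \<open>has_laplacian_log_nsq\<close>), so that Brody curves are the curves with density at most \<open>\<pi>\<close>.
\<close>

definition fs_density :: "nat => (nat => complex => complex) => complex => real" where
 "fs_density N F z =
   ((\<Sum>i\<le>N. (cmod (deriv (F i) z))^2) * nsq N F z - (cmod (dinner N F z))^2) / (nsq N F z)^2"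

lemma nsq_pos_iff: "0 < nsq N F z \<longleftrightarrow> (\<exists>i\<le>N. F i z ~= 0)"
proof -
 have "0 <= nsq N F z" by (simp add: nsq_def sum_nonneg)
 moreover have "nsq N F z = 0 \<longleftrightarrow> (\<forall>i\<le>N. F i z = 0)"
  by (auto simp: nsq_def sum_nonneg_eq_0_iff)
 ultimately show ?thesis by (metis less_le)
qed

lemma has_vector_derivative_line:
 assumes "f holomorphic_on U" "open U" "z + of_real t * v \<in> U"
 shows "((%t. f (z + of_real t * v)) has_vector_derivative v * deriv f (z + of_real t * v)) (at t)"
proof -
 have f: "(f has_field_derivative deriv f (z + of_real t * v)) (at (z + of_real t * v))"
  using assms holomorphic_derivI by blast
 have "((%t. z + of_real t * v) has_vector_derivative v) (at t)"
  by (auto intro!: derivative_eq_intros simp: has_vector_derivative_def scaleR_conv_of_real)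
 from field_vector_diff_chain_at[OF this f] show ?thesis by (simp add: o_def)
qed

lemma has_vector_derivative_cnj':
 "(f has_vector_derivative f') F ==> ((%t. cnj (f t)) has_vector_derivative cnj f') F"
 by (rule bounded_linear.has_vector_derivative[OF bounded_linear_cnj])

lemma eventually_line_in_open:
 fixes z v :: complex
 assumes "open U" "z \<in> U"
 shows "\<forall>\<^sub>F t in nhds 0. z + of_real t * v \<in> U"
 by (rule eventually_nhds_line[OF eventually_nhds_in_open[OF assms]])

lemma has_real_derivative_nsq_line:
 assumes F: "!!i. i <= N ==> F i holomorphic_on U" and U: "open U" "z + of_real t * v \<in> U"
 shows "((%t. nsq N F (z + of_real t * v)) has_real_derivative 2 * Re (v * dinner N F (z + of_real t * v))) (at t)"
proof -
 let ?w = "z + of_real t * v"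
 have "((%t. \<Sum>i\<le>N. F i (z + of_real t * v) * cnj (F i (z + of_real t * v))) has_vector_derivative
   (\<Sum>i\<le>N. F i ?w * cnj (v * deriv (F i) ?w) + v * deriv (F i) ?w * cnj (F i ?w))) (at t)"
  by (intro has_vector_derivative_sum has_vector_derivative_mult has_vector_derivative_cnj'
    has_vector_derivative_line[OF F U]) auto
 from bounded_linear.has_vector_derivative[OF bounded_linear_Re this]
 have "((%t. nsq N F (z + of_real t * v)) has_vector_derivative
   Re (\<Sum>i\<le>N. F i ?w * cnj (v * deriv (F i) ?w) + v * deriv (F i) ?w * cnj (F i ?w))) (at t)"
  by (simp add: nsq_def complex_norm_square[symmetric] flip: power2_eq_square)
 also have "Re (\<Sum>i\<le>N. F i ?w * cnj (v * deriv (F i) ?w) + v * deriv (F i) ?w * cnj (F i ?w)) =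
   2 * Re (v * dinner N F ?w)"
  by (simp add: dinner_def sum_distrib_left algebra_simps flip: sum.distrib)
 finally show ?thesis by (simp add: has_real_derivative_iff_has_vector_derivative)
qed

lemma has_real_derivative_log_nsq_line:
 assumes F: "!!i. i <= N ==> F i holomorphic_on U" and U: "open U" "z \<in> U"
  and pos: "!!w. w \<in> U ==> 0 < nsq N F w"
 defines "p \<equiv> %v t. 2 * Re (v * dinner N F (z + of_real t * v)) / nsq N F (z + of_real t * v)"
  and "B \<equiv> (\<Sum>i\<le>N. deriv (deriv (F i)) z * cnj (F i z))"
  and "D \<equiv> (\<Sum>i\<le>N. (cmod (deriv (F i) z))^2)"
 shows "\<forall>\<^sub>F t in nhds 0. ((%t. ln (nsq N F (z + of_real t * v))) has_real_derivative p v t) (at t)"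
  and "(p v has_real_derivative
      (2 * Re (v^2 * B) + 2 * (cmod v)^2 * D) / nsq N F z - (2 * Re (v * dinner N F z))^2 / (nsq N F z)^2) (at 0)"
proof -
 show "\<forall>\<^sub>F t in nhds 0. ((%t. ln (nsq N F (z + of_real t * v))) has_real_derivative p v t) (at t)"
  using eventually_line_in_open[OF U, of v]
 proof eventually_elim
  case (elim t)
  show ?case
   unfolding p_def using has_real_derivative_nsq_line[where F=F and N=N, OF F U(1) elim] pos[OF elim]
   by (auto intro!: derivative_eq_intros)
 qed
 have F': "deriv (F i) holomorphic_on U" if "i <= N" for i
  using F[OF that] U(1) by (rule holomorphic_deriv)
 have z0: "z + of_real 0 * v \<in> U" using U by simp
 have "((%t. v * dinner N F (z + of_real t * v)) has_vector_derivative
   v * (\<Sum>i\<le>N. deriv (F i) z * cnj (v * deriv (F i) z) + v * deriv (deriv (F i)) z * cnj (F i z))) (at 0)"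
  unfolding dinner_def
  by (rule has_vector_derivative_mult_right, rule has_vector_derivative_sum, rule has_vector_derivative_mult[THEN has_vector_derivative_eq_rhs],
    rule has_vector_derivative_line[OF F' U(1) z0], simp, rule has_vector_derivative_cnj',
    rule has_vector_derivative_line[OF F U(1) z0], simp, simp)
 from bounded_linear.has_vector_derivative[OF bounded_linear_Re this]
 have A: "((%t. Re (v * dinner N F (z + of_real t * v))) has_real_derivative
   Re (v * (\<Sum>i\<le>N. deriv (F i) z * cnj (v * deriv (F i) z) + v * deriv (deriv (F i)) z * cnj (F i z)))) (at 0)"
  by (simp add: has_real_derivative_iff_has_vector_derivative)
 have "v * (\<Sum>i\<le>N. deriv (F i) z * cnj (v * deriv (F i) z) + v * deriv (deriv (F i)) z * cnj (F i z)) =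
   v * cnj v * (\<Sum>i\<le>N. deriv (F i) z * cnj (deriv (F i) z)) + v^2 * B"
  by (simp add: B_def sum_distrib_left sum.distrib algebra_simps power2_eq_square)
 also have "... = of_real ((cmod v)^2 * D) + v^2 * B"
  by (simp only: D_def of_real_mult of_real_sum complex_norm_square)
 finally have e: "Re (v * (\<Sum>i\<le>N. deriv (F i) z * cnj (v * deriv (F i) z) + v * deriv (deriv (F i)) z * cnj (F i z)))
   = (cmod v)^2 * D + Re (v^2 * B)" by simp
 have S: "((%t. nsq N F (z + of_real t * v)) has_real_derivative 2 * Re (v * dinner N F z)) (at 0)"
  using has_real_derivative_nsq_line[where F=F and N=N, OF F U(1) z0] by simp
 have S0: "nsq N F z ~= 0" using pos[OF U(2)] by simp
 define X where "X = Re (v * dinner N F z)"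
 have "(p v has_real_derivative (2 * ((cmod v)^2 * D + Re (v^2 * B)) * nsq N F z - 2 * X * (2 * X)) / (nsq N F z * nsq N F z)) (at 0)"
  unfolding p_def using DERIV_divide[OF DERIV_cmult[OF A, of 2] S] S0 unfolding e X_def by simp
 moreover have "(2 * ((cmod v)^2 * D + Re (v^2 * B)) * nsq N F z - 2 * X * (2 * X)) / (nsq N F z * nsq N F z) =
   (2 * Re (v^2 * B) + 2 * (cmod v)^2 * D) / nsq N F z - (2 * X)^2 / (nsq N F z)^2"
  using S0 by (simp add: diff_divide_distrib power2_eq_square distrib_left add.commute mult.assoc)
 ultimately show "(p v has_real_derivative
      (2 * Re (v^2 * B) + 2 * (cmod v)^2 * D) / nsq N F z - (2 * Re (v * dinner N F z))^2 / (nsq N F z)^2) (at 0)"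
  unfolding X_def by simp
qed

text \<open>
  The terms with second derivatives of \<open>F\<close> cancel in the sum over the coordinate directions,
  because the directions \<open>1\<close> and \<open>\<i>\<close> have squares of opposite sign.
\<close>

theorem has_laplacian_log_nsq:
 assumes F: "!!i. i <= N ==> F i holomorphic_on U" and U: "open U" "z \<in> U"
  and pos: "!!w. w \<in> U ==> 0 < nsq N F w"
 shows "has_laplacian (%w. ln (nsq N F w)) z (4 * fs_density N F z)"
proof -
 note 1 = has_real_derivative_log_nsq_line[where F=F and N=N, OF F U pos]
 define B where "B = (\<Sum>i\<le>N. deriv (deriv (F i)) z * cnj (F i z))"
 define D where "D = (\<Sum>i\<le>N. (cmod (deriv (F i) z))^2)"
 let ?a = "%v. (2 * Re (v^2 * B) + 2 * (cmod v)^2 * D) / nsq N F z - (2 * Re (v * dinner N F z))^2 / (nsq N F z)^2"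
 have S: "nsq N F z ~= 0" using pos[OF U(2)] by simp
 have "(cmod (dinner N F z))^2 = (Re (dinner N F z))^2 + (Im (dinner N F z))^2" by (rule cmod_power2)
 hence "4 * fs_density N F z = 4 * ((D * nsq N F z - ((Re (dinner N F z))^2 + (Im (dinner N F z))^2)) / (nsq N F z)^2)"
  unfolding fs_density_def D_def[symmetric] by simp
 also have "... = ((2 * Re B + 2 * D) / nsq N F z - (2 * Re (dinner N F z))^2 / (nsq N F z)^2) +
   ((- 2 * Re B + 2 * D) / nsq N F z - (2 * Im (dinner N F z))^2 / (nsq N F z)^2)"
  using S by (simp add: diff_divide_distrib add_divide_distrib power2_eq_square)
 also have "... = ?a 1 + ?a \<i>" by simp
 finally have eq: "4 * fs_density N F z = ?a 1 + ?a \<i>" .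
 show ?thesis
  unfolding has_laplacian_def
 proof (intro exI conjI)
  show "second_deriv (%t. ln (nsq N F (z + of_real t))) (?a 1)"
   using second_derivI[OF 1[of 1]] unfolding B_def D_def by simp
  show "second_deriv (%t. ln (nsq N F (z + of_real t * \<i>))) (?a \<i>)"
   using second_derivI[OF 1[of \<i>]] unfolding B_def D_def .
 qed (rule eq)
qed

lemma norm_diff_line_le:
 fixes f :: "complex => complex"
 assumes "!!z v. cmod v = 1 ==> \<exists>f'. ((%t. f (z + of_real t * v)) has_vector_derivative f') (at 0) & cmod f' <= B"
 shows "cmod (f z - f w) <= B * cmod (z - w)"
proof (cases "z = w")
 case False
 define l where "l = cmod (w - z)"
 define v where "v = (w - z) / of_real l"
 have l: "l > 0" and v: "cmod v = 1" using False by (auto simp: l_def v_def norm_divide)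
 have "\<exists>f'. ((%t. f (z + of_real t * v)) has_vector_derivative f') (at t) & cmod f' <= B" for t
 proof -
  obtain f' where f': "((%s. f ((z + of_real t * v) + of_real s * v)) has_vector_derivative f') (at 0)" "cmod f' <= B"
   using assms[OF v, of "z + of_real t * v"] by blast
  have "((%s. s - t) has_vector_derivative 1) (at t)" by (auto intro!: derivative_eq_intros)
  from vector_diff_chain_at[OF this, of "%s. f ((z + of_real t * v) + of_real s * v)" f'] f'(1)
  have "((%s. f (z + of_real s * v)) has_vector_derivative f') (at t)"
   by (simp add: o_def algebra_simps)
  thus ?thesis using f'(2) by blast
 qed
 then obtain f' where f': "!!t. ((%t. f (z + of_real t * v)) has_vector_derivative f' t) (at t)" "!!t. cmod (f' t) <= B"
  by metis
 have "cmod (f (z + of_real l * v) - f (z + of_real 0 * v)) <= B * norm (l - 0)"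
 proof (rule differentiable_bound[where f="%t. f (z + of_real t * v)" and S="{0..l}" and f'="%t h. h *\<^sub>R f' t"])
  fix t show "((%t. f (z + of_real t * v)) has_derivative (%h. h *\<^sub>R f' t)) (at t within {0..l})"
   using f'(1)[of t] unfolding has_vector_derivative_def by (rule has_derivative_at_withinI)
  show "onorm (%h. h *\<^sub>R f' t) <= B"
  proof (rule onorm_le)
   fix h show "norm (h *\<^sub>R f' t) <= B * norm h"
    using mult_right_mono[OF f'(2)[of t] norm_ge_zero[of h]] by (simp add: mult.commute)
  qed
 qed (use l in auto)
 moreover have "z + of_real l * v = w" using l by (simp add: v_def)
 ultimately show ?thesis using l by (simp add: l_def norm_minus_commute)
qed simp

text \<open>
  Only the component of \<open>F'\<close> orthogonal to \<open>F\<close> moves the point of projective space.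
\<close>

lemma fs_density_eq_tangential:
 assumes "0 < nsq N F z"
 shows "fs_density N F z = (\<Sum>i\<le>N. (cmod (deriv (F i) z - F i z * dinner N F z / of_real (nsq N F z)))^2) / nsq N F z"
proof -
 define D where "D = (%i. deriv (F i) z - F i z * dinner N F z / of_real (nsq N F z))"
 note S = assms
 have "(\<Sum>k\<le>N. (cmod (D k))^2) = nsq N F z * fs_density N F z"
 proof -
   have "complex_of_real (\<Sum>k\<le>N. (cmod (D k))^2) = (\<Sum>k\<le>N. D k * cnj (D k))" by (simp only: of_real_sum complex_norm_square)
   also have "... = (\<Sum>k\<le>N. deriv (F k) z * cnj (deriv (F k) z) - deriv (F k) z * cnj (F k z) * (cnj (dinner N F z) / of_real (nsq N F z))
      - cnj (deriv (F k) z * cnj (F k z)) * ((dinner N F z) / of_real (nsq N F z)) + F k z * cnj (F k z) * ((dinner N F z) * cnj (dinner N F z) / (of_real (nsq N F z))^2))"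
    by (intro sum.cong refl) (simp add: D_def algebra_simps power2_eq_square)
   also have "... = (\<Sum>k\<le>N. deriv (F k) z * cnj (deriv (F k) z)) - (dinner N F z) * (cnj (dinner N F z) / of_real (nsq N F z))
      - cnj (dinner N F z) * ((dinner N F z) / of_real (nsq N F z)) + of_real (nsq N F z) * ((dinner N F z) * cnj (dinner N F z) / (of_real (nsq N F z))^2)"
    by (simp only: sum.distrib sum_subtractf sum_distrib_right[symmetric] dinner_def[symmetric] cnj_sum[symmetric])
     (simp only: nsq_def of_real_sum complex_norm_square)
   also have "... = (\<Sum>k\<le>N. deriv (F k) z * cnj (deriv (F k) z)) - (dinner N F z) * cnj (dinner N F z) / of_real (nsq N F z)"
    using S by (simp add: field_simps power2_eq_square)
   also have "... = of_real ((\<Sum>k\<le>N. (cmod (deriv (F k) z))^2) - (cmod (dinner N F z))^2 / (nsq N F z))"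
    by (simp only: of_real_diff of_real_divide of_real_sum complex_norm_square)
   finally have "(\<Sum>k\<le>N. (cmod (D k))^2) = (\<Sum>k\<le>N. (cmod (deriv (F k) z))^2) - (cmod (dinner N F z))^2 / (nsq N F z)"
    using of_real_eq_iff by blast
   thus ?thesis
    unfolding fs_density_def using S by (simp only:) (simp add: diff_divide_distrib right_diff_distrib power2_eq_square)
 qed
 thus ?thesis using S by (simp add: D_def)
qed

text \<open>
  The entries of the orthogonal projector on the line spanned by \<open>F\<close> are global coordinates of
  projective space. Their derivative is controlled by the tangential part of \<open>F'\<close>.
\<close>

theorem projector_Lipschitz:
 assumes F: "!!i. i <= N ==> F i holomorphic_on UNIV" and pos: "!!w. 0 < nsq N F w"
  and K: "!!w. fs_density N F w <= pi" and ij: "i <= N" "j <= N"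
 shows "cmod (F i z * cnj (F j z) / of_real (nsq N F z) - F i w * cnj (F j w) / of_real (nsq N F w)) <= 4 * cmod (z - w)"
proof (rule norm_diff_line_le[where f="%z. F i z * cnj (F j z) / of_real (nsq N F z)"])
 fix z v :: complex assume v: "cmod v = 1"
 let ?S = "nsq N F z" and ?A = "dinner N F z"
 define D where "D = (%i. deriv (F i) z - F i z * ?A / of_real ?S)"
 have S: "?S > 0" by (rule pos)
 have U: "z + of_real 0 * v \<in> UNIV" by simp
 have d1: "((%t. F i (z + of_real t * v) * cnj (F j (z + of_real t * v))) has_vector_derivative
   F i z * cnj (v * deriv (F j) z) + v * deriv (F i) z * cnj (F j z)) (at 0)"
  using has_vector_derivative_mult[OF has_vector_derivative_line[OF F[OF ij(1)] open_UNIV U]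
    has_vector_derivative_cnj'[OF has_vector_derivative_line[OF F[OF ij(2)] open_UNIV U]]] by simp
 have d2: "((%t. 1 / nsq N F (z + of_real t * v)) has_field_derivative - (2 * Re (v * ?A)) / ?S^2) (at 0)"
  using has_real_derivative_nsq_line[where F=F and N=N, OF F open_UNIV U] S
  by (auto intro!: derivative_eq_intros simp: power2_eq_square field_simps)
 define f' where "f' = (v * D i * cnj (F j z) + F i z * cnj (v * D j)) / of_real ?S"
 have f'_eq: "(1 / ?S) *\<^sub>R (F i z * cnj (v * deriv (F j) z) + v * deriv (F i) z * cnj (F j z)) +
    (- (2 * Re (v * ?A)) / ?S^2) *\<^sub>R (F i z * cnj (F j z)) = f'"
 proof -
  have two: "complex_of_real (2 * Re (v * ?A)) = v * ?A + cnj (v * ?A)" by (simp only: complex_add_cnj)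
  have "complex_of_real (- (2 * Re (v * ?A)) / ?S^2) = - (v * ?A + cnj (v * ?A)) / (of_real ?S)^2"
   by (simp only: of_real_divide of_real_minus of_real_power two)
  thus ?thesis using S
   unfolding f'_def D_def scaleR_conv_of_real
   by (simp only:) (simp add: field_simps power2_eq_square)
 qed
 have "((%t. F i (z + of_real t * v) * cnj (F j (z + of_real t * v)) / of_real (nsq N F (z + of_real t * v)))
   has_vector_derivative f') (at 0)"
  using has_vector_derivative_scaleR[OF d2 d1] f'_eq by (simp add: scaleR_conv_of_real)
 moreover have "cmod f' <= 4"
 proof -
  have "(\<Sum>k\<le>N. (cmod (D k))^2) = ?S * fs_density N F z"
   unfolding D_def using S by (simp add: fs_density_eq_tangential)
  hence sumD: "(\<Sum>k\<le>N. (cmod (D k))^2) <= ?S * 4"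
   using K[of z] S pi_less_4 by (simp add: mult_left_mono)
  have Dk: "cmod (D k) <= 2 * sqrt ?S" if "k <= N" for k
  proof -
   have "(cmod (D k))^2 <= ?S * 4" using sumD that by (intro order_trans[OF member_le_sum[of k] sumD]) auto
   hence "cmod (D k) <= sqrt (?S * 4)" by (rule real_le_rsqrt)
   thus ?thesis by (simp add: real_sqrt_mult)
  qed
  have Fk: "cmod (F k z) <= sqrt ?S" if "k <= N" for k
  proof -
   have "(cmod (F k z))^2 <= ?S" unfolding nsq_def using that by (intro member_le_sum) auto
   thus ?thesis by (rule real_le_rsqrt)
  qed
  have "cmod (v * D i * cnj (F j z) + F i z * cnj (v * D j)) <= cmod (D i) * cmod (F j z) + cmod (F i z) * cmod (D j)"
   by (rule order_trans[OF norm_triangle_ineq]) (simp add: norm_mult v)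
  also have "... <= 2 * sqrt ?S * sqrt ?S + sqrt ?S * (2 * sqrt ?S)"
   using S by (intro add_mono mult_mono Dk Fk ij) auto
  also have "... = 4 * ?S" using S by simp
  finally show ?thesis using S by (simp add: f'_def norm_divide field_simps)
 qed
 ultimately show "\<exists>f'. ((%t. F i (z + of_real t * v) * cnj (F j (z + of_real t * v)) / of_real (nsq N F (z + of_real t * v)))
   has_vector_derivative f') (at 0) & cmod f' <= 4" by blast
qed

section \<open>A metric on projective space and on the space of Brody curves\<close>

lemma topspace_punctured_vectors:
 "v \<in> topspace (punctured_vectors N) \<longleftrightarrow> v \<in> extensional {..N} & (\<exists>i\<le>N. v i ~= 0)"
 by (auto simp: punctured_vectors_def PiE_def)

definition vnsq :: "nat => (nat => complex) => real" where
 "vnsq N v = (\<Sum>k\<le>N. (cmod (v k))^2)"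

text \<open>
  The entries of the orthogonal projector on the line \<open>p\<close>; they do not depend on the chosen
  representative and embed projective space into the Hermitian matrices.
\<close>

definition pcoord :: "nat => (nat => complex) set => nat => nat => complex" where
 "pcoord N p i j = (let v = SOME v. v \<in> p in v i * cnj (v j) / of_real (vnsq N v))"

lemma pcoord_proj_point:
 assumes v: "\<exists>i\<le>N. v i ~= 0" and ij: "i <= N" "j <= N"
 shows "pcoord N (proj_point N v) i j = v i * cnj (v j) / of_real (vnsq N v)"
proof -
 have "restrict v {..N} \<in> proj_point N v"
 proof -
  have "restrict v {..N} \<in> topspace (punctured_vectors N)"
   unfolding topspace_punctured_vectors using v by auto
  thus ?thesis unfolding proj_point_def by (auto intro!: exI[of _ 1])
 qed
 hence "(SOME w. w \<in> proj_point N v) \<in> proj_point N v"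
  by (rule someI[of "%w. w \<in> proj_point N v"])
 then obtain c where c: "c ~= 0" "!!k. k <= N ==> (SOME w. w \<in> proj_point N v) k = c * v k"
  unfolding proj_point_def mem_Collect_eq by blast
 define w where "w = (SOME w. w \<in> proj_point N v)"
 have w: "w k = c * v k" if "k <= N" for k using c(2)[OF that] by (simp add: w_def)
 have "pcoord N (proj_point N v) i j = w i * cnj (w j) / of_real (vnsq N w)"
  by (simp add: pcoord_def w_def Let_def)
 also have "vnsq N w = (cmod c)^2 * vnsq N v"
  by (simp add: vnsq_def w norm_mult power_mult_distrib sum_distrib_left)
 also have "w i * cnj (w j) = of_real ((cmod c)^2) * (v i * cnj (v j))"
  unfolding complex_norm_square by (simp add: w ij)
 also have "of_real ((cmod c)^2) * (v i * cnj (v j)) / complex_of_real ((cmod c)^2 * vnsq N v) =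
   v i * cnj (v j) / of_real (vnsq N v)"
  using c(1) by (simp del: of_real_power)
 finally show ?thesis .
qed

lemma vec_norm_pos:
 fixes v :: "nat => complex"
 assumes "\<exists>i\<le>N. v i ~= 0"
 shows "0 < vnsq N v"
proof -
 obtain i where "i <= N" "v i ~= 0" using assms by (elim exE conjE)
 thus ?thesis unfolding vnsq_def by (intro sum_pos2[of _ i]) auto
qed

lemma CP_cases:
 assumes "p \<in> topspace (CP N)"
 obtains v where "v \<in> extensional {..N}" "\<exists>i\<le>N. v i ~= 0" "p = proj_point N v"
  "!!i j. i <= N ==> j <= N ==> pcoord N p i j = v i * cnj (v j) / of_real (vnsq N v)"
proof -
 obtain v where v: "v \<in> topspace (punctured_vectors N)" "p = proj_point N v"
  using assms by (auto simp: CP_def)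
 note v' = v(1)[unfolded topspace_punctured_vectors]
 show thesis
  by (rule that[of v]) (use v v' pcoord_proj_point in auto)
qed

lemma proj_point_scale:
 assumes "c ~= 0" "!!i. i <= N ==> w i = c * v i"
 shows "proj_point N w = proj_point N v"
proof -
 have "(\<exists>d. d ~= 0 & (\<forall>i\<le>N. x i = d * w i)) \<longleftrightarrow> (\<exists>d. d ~= 0 & (\<forall>i\<le>N. x i = d * v i))" for x
 proof
  assume "\<exists>d. d ~= 0 & (\<forall>i\<le>N. x i = d * w i)"
  then obtain d where "d ~= 0" "\<forall>i\<le>N. x i = d * w i" by (elim exE conjE)
  thus "\<exists>d. d ~= 0 & (\<forall>i\<le>N. x i = d * v i)" using assms by (intro exI[of _ "d * c"]) auto
 next
  assume "\<exists>d. d ~= 0 & (\<forall>i\<le>N. x i = d * v i)"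
  then obtain d where "d ~= 0" "\<forall>i\<le>N. x i = d * v i" by (elim exE conjE)
  thus "\<exists>d. d ~= 0 & (\<forall>i\<le>N. x i = d * w i)" using assms by (intro exI[of _ "d / c"]) auto
 qed
 thus ?thesis by (simp add: proj_point_def)
qed

lemma proj_point_section:
 assumes "p \<in> topspace (CP N)" "j <= N" "pcoord N p j j ~= 0"
 shows "proj_point N (\<lambda>i\<in>{..N}. pcoord N p i j / pcoord N p j j) = p"
proof -
 obtain v where v: "v \<in> extensional {..N}" "\<exists>i\<le>N. v i ~= 0" "p = proj_point N v"
  "!!i j. i <= N ==> j <= N ==> pcoord N p i j = v i * cnj (v j) / of_real (vnsq N v)"
  using assms(1) by (rule CP_cases) (rule that)
 have vj: "v j ~= 0" using assms(2,3) v(4) by auto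
 have "proj_point N (\<lambda>i\<in>{..N}. pcoord N p i j / pcoord N p j j) = proj_point N v"
 proof (rule proj_point_scale[of "1 / v j"])
  show "1 / v j ~= 0" using vj by simp
  fix i assume "i <= N"
  thus "(\<lambda>i\<in>{..N}. pcoord N p i j / pcoord N p j j) i = 1 / v j * v i"
   using vec_norm_pos[OF v(2)] vj assms(2) by (simp add: v(4) field_simps)
 qed
 thus ?thesis using v(3) by simp
qed

lemma CP_eqI:
 assumes pq: "p \<in> topspace (CP N)" "q \<in> topspace (CP N)"
  and eq: "!!i j. i <= N ==> j <= N ==> pcoord N p i j = pcoord N q i j"
 shows "p = q"
proof -
 obtain v where v: "\<exists>i\<le>N. v i ~= 0"
  "!!i j. i <= N ==> j <= N ==> pcoord N p i j = v i * cnj (v j) / of_real (vnsq N v)"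
  using pq(1) by (rule CP_cases) (rule that)
 obtain j where j: "j <= N" "v j ~= 0" using v(1) by (elim exE conjE)
 have pj: "pcoord N p j j ~= 0" using v(2)[OF j(1) j(1)] j(2) vec_norm_pos[OF v(1)] by simp
 hence qj: "pcoord N q j j ~= 0" using eq j by simp
 have "(\<lambda>i\<in>{..N}. pcoord N p i j / pcoord N p j j) = (\<lambda>i\<in>{..N}. pcoord N q i j / pcoord N q j j)"
  using eq j(1) by (intro restrict_ext) auto
 from arg_cong[where f="proj_point N", OF this] show ?thesis
  unfolding proj_point_section[OF pq(1) j(1) pj] proj_point_section[OF pq(2) j(1) qj] .
qed

lemma norm_pcoord_le:
 assumes "p \<in> topspace (CP N)" "i <= N" "j <= N"
 shows "cmod (pcoord N p i j) <= 1"
proof -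
 obtain v where v: "\<exists>i\<le>N. v i ~= 0"
  "!!i j. i <= N ==> j <= N ==> pcoord N p i j = v i * cnj (v j) / of_real (vnsq N v)"
  using assms(1) by (rule CP_cases) (rule that)
 let ?S = "vnsq N v"
 have S: "0 < ?S" by (rule vec_norm_pos[OF v(1)])
 have le: "cmod (v k) <= sqrt ?S" if "k <= N" for k
  unfolding vnsq_def by (rule real_le_rsqrt) (use that in \<open>intro member_le_sum, auto\<close>)
 have "cmod (v i) * cmod (v j) <= sqrt ?S * sqrt ?S" using assms le S by (intro mult_mono) auto
 hence "cmod (v i) * cmod (v j) <= ?S" using S by simp
 moreover have "cmod (pcoord N p i j) = cmod (v i) * cmod (v j) / ?S"
  using S by (simp add: v(2) assms norm_divide norm_mult)
 ultimately show ?thesis using S by simp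
qed

lemma pcoord_trace:
 assumes "p \<in> topspace (CP N)"
 shows "(\<Sum>i\<le>N. pcoord N p i i) = 1"
proof -
 obtain v where v: "\<exists>i\<le>N. v i ~= 0"
  "!!i j. i <= N ==> j <= N ==> pcoord N p i j = v i * cnj (v j) / of_real (vnsq N v)"
  using assms(1) by (rule CP_cases) (rule that)
 have "(\<Sum>i\<le>N. pcoord N p i i) = (\<Sum>i\<le>N. v i * cnj (v i)) / of_real (vnsq N v)"
  by (simp add: v(2) sum_divide_distrib)
 also have "(\<Sum>i\<le>N. v i * cnj (v i)) = of_real (vnsq N v)"
  by (simp only: vnsq_def of_real_sum complex_norm_square)
 finally show ?thesis using vec_norm_pos[OF v(1)] by simp
qed

definition pdist :: "nat => (nat => complex) set => (nat => complex) set => real" where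
 "pdist N p q = (\<Sum>i\<le>N. \<Sum>j\<le>N. cmod (pcoord N p i j - pcoord N q i j))"

lemma pdist_metric:
 "0 <= pdist N p q" "pdist N p p = 0" "pdist N p q = pdist N q p" "pdist N p r <= pdist N p q + pdist N q r"
proof -
 show "pdist N p r <= pdist N p q + pdist N q r"
  unfolding pdist_def sum.distrib[symmetric]
  by (intro sum_mono) (metis dist_norm dist_triangle)
qed (auto simp: pdist_def norm_minus_commute intro!: sum_nonneg)

lemma pdist_eq_0D:
 assumes "p \<in> topspace (CP N)" "q \<in> topspace (CP N)" "pdist N p q = 0"
 shows "p = q"
proof (rule CP_eqI[OF assms(1,2)])
 fix i j assume "i <= N" "j <= N"
 have "(\<Sum>j\<le>N. cmod (pcoord N p i j - pcoord N q i j)) = 0" if "i <= N" for i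
  using assms(3) that unfolding pdist_def by (subst (asm) sum_nonneg_eq_0_iff) (auto intro: sum_nonneg)
 from this[OF \<open>i <= N\<close>] show "pcoord N p i j = pcoord N q i j"
  using \<open>j <= N\<close> by (subst (asm) sum_nonneg_eq_0_iff) auto
qed

lemma pcoord_diff_le_pdist:
 assumes "i <= N" "j <= N"
 shows "cmod (pcoord N p i j - pcoord N q i j) <= pdist N p q"
proof -
 have "cmod (pcoord N p i j - pcoord N q i j) <= (\<Sum>j\<le>N. cmod (pcoord N p i j - pcoord N q i j))"
  using assms by (intro member_le_sum) auto
 also have "... <= pdist N p q"
  unfolding pdist_def using assms by (intro member_le_sum[of i]) (auto intro: sum_nonneg)
 finally show ?thesis .
qed

lemma pdist_leI:
 assumes "!!i j. i <= N ==> j <= N ==> cmod (pcoord N p i j - pcoord N q i j) <= e"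
 shows "pdist N p q <= (real N + 1)^2 * e"
proof -
 have "pdist N p q <= (\<Sum>i\<le>N. \<Sum>j\<le>N. e)" unfolding pdist_def using assms by (intro sum_mono) auto
 thus ?thesis by (simp add: power2_eq_square algebra_simps)
qed

lemma pdist_le_const:
 assumes "p \<in> topspace (CP N)" "q \<in> topspace (CP N)"
 shows "pdist N p q <= (real N + 1)^2 * 2"
 by (rule pdist_leI, rule order_trans[OF norm_triangle_ineq4])
  (use norm_pcoord_le[OF assms(1)] norm_pcoord_le[OF assms(2)] in fastforce)

lemma continuous_map_pcoord:
 assumes "i <= N" "j <= N"
 shows "continuous_map (CP N) euclidean (%p. pcoord N p i j)"
 unfolding CP_def
proof (rule continuous_compose_quotient_map[OF quotient_map_quotient_topology])
 have c: "continuous_map (punctured_vectors N) euclidean (%v. v k)" if "k <= N" for k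
  unfolding punctured_vectors_def using that
  by (intro continuous_map_from_subtopology continuous_map_product_projection) auto
 have n: "continuous_map (punctured_vectors N) euclideanreal (vnsq N)"
  unfolding vnsq_def using c by (intro continuous_map_sum continuous_map_real_pow continuous_map_norm) auto
 have "continuous_map (punctured_vectors N) (prod_topology (prod_topology euclidean euclidean) euclidean)
   (%v. ((v i, v j), vnsq N v))"
  by (intro continuous_map_pairedI c n assms)
 hence "continuous_map (punctured_vectors N) (top_of_set {p. snd p ~= 0}) (%v. ((v i, v j), vnsq N v))"
  unfolding continuous_map_in_subtopology using vec_norm_pos[of N]
  by (fastforce simp: topspace_punctured_vectors simp flip: euclidean_product_topology)
 moreover have "continuous_map (top_of_set {p. snd p ~= 0}) euclidean
   (%p. fst (fst p) * cnj (snd (fst p)) / complex_of_real (snd p))"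
  by (simp add: continuous_map_iff_continuous) (intro continuous_intros, auto)
 ultimately have "continuous_map (punctured_vectors N) euclidean
   ((%p. fst (fst p) * cnj (snd (fst p)) / complex_of_real (snd p)) \<circ> (%v. ((v i, v j), vnsq N v)))"
  by (rule continuous_map_compose)
 hence "continuous_map (punctured_vectors N) euclidean (%v. v i * cnj (v j) / complex_of_real (vnsq N v))"
  by (simp add: o_def)
 thus "continuous_map (punctured_vectors N) euclidean ((%p. pcoord N p i j) \<circ> proj_point N)"
  by (rule continuous_map_eq) (use assms pcoord_proj_point in \<open>auto simp: topspace_punctured_vectors\<close>)
qed

lemma openin_CP_pball:
 "openin (CP N) {q \<in> topspace (CP N). pdist N p q < r}"
proof -
 have "continuous_map (CP N) euclideanreal (%q. pdist N p q)"
  unfolding pdist_def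
  by (intro continuous_map_sum continuous_map_norm continuous_map_diff continuous_map_pcoord) auto
 from openin_continuous_map_preimage[OF this, of "{..<r}"] show ?thesis by simp
qed

text \<open>
  With \<open>openin_CP_pball\<close> this identifies the quotient topology of projective space with the metric topology of \<open>pdist\<close>.
  A point with projector close to that of \<open>v\<close> has a representative close to \<open>v\<close>, namely
  the projection of \<open>v\<close>, up to a factor.
\<close>

lemma openin_CP_contains_pball:
 assumes U: "openin (CP N) U" and p: "p \<in> U"
 shows "\<exists>r>0. \<forall>q\<in>topspace (CP N). pdist N p q < r --> q \<in> U"
proof (rule ccontr)
 assume "\<not> (\<exists>r>0. \<forall>q\<in>topspace (CP N). pdist N p q < r --> q \<in> U)"
 hence "\<exists>q. q \<in> topspace (CP N) & pdist N p q < inverse (real (Suc n)) & q \<notin> U" for n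
  by (metis inverse_positive_iff_positive of_nat_0_less_iff zero_less_Suc)
 then obtain q where q: "!!n. q n \<in> topspace (CP N)" "!!n. pdist N p (q n) < inverse (real (Suc n))" "!!n. q n \<notin> U"
  by metis
 have pC: "p \<in> topspace (CP N)" using U p openin_subset by blast
 obtain v where v: "\<exists>i\<le>N. v i ~= 0"
  "!!i j. i <= N ==> j <= N ==> pcoord N p i j = v i * cnj (v j) / of_real (vnsq N v)"
  using pC by (rule CP_cases) (rule that)
 obtain j where j: "j <= N" "v j ~= 0" using v(1) by (elim exE conjE)
 have pj: "pcoord N p j j ~= 0" using v(2)[OF j(1) j(1)] j(2) vec_norm_pos[OF v(1)] by simp
 define s where "s = (%p. \<lambda>i\<in>{..N}. pcoord N p i j / pcoord N p j j)"
 have "(%n. pdist N p (q n)) \<longlonglongrightarrow> 0"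
  by (rule tendsto_sandwich[OF _ _ tendsto_const LIMSEQ_inverse_real_of_nat])
   (use q(2) pdist_metric(1) in \<open>auto intro!: always_eventually less_imp_le\<close>)
 note lim0 = this
 have lim: "(%n. pcoord N (q n) i j) \<longlonglongrightarrow> pcoord N p i j" if "i <= N" for i
 proof (rule LIM_zero_cancel, rule Lim_null_comparison[OF always_eventually lim0], rule allI)
  fix n show "cmod (pcoord N (q n) i j - pcoord N p i j) <= pdist N p (q n)"
   using pcoord_diff_le_pdist[OF that j(1), of p "q n"] by (simp add: norm_minus_commute)
 qed
 have nz: "\<forall>\<^sub>F n in sequentially. pcoord N (q n) j j ~= 0"
  using tendsto_imp_eventually_ne[OF lim[OF j(1)] pj] .
 have "limitin (product_topology (%_. euclidean) {..N}) (%n. s (q n)) (s p) sequentially"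
  unfolding limitin_componentwise
  by (auto simp: s_def intro!: tendsto_divide lim j(1) pj)
 moreover have sp: "s p j = 1" using pj j by (simp add: s_def)
 moreover have "\<forall>\<^sub>F n in sequentially. s (q n) \<in> {v. \<exists>i\<le>N. v i ~= 0}"
  using nz by eventually_elim (use j in \<open>auto simp: s_def intro!: exI[of _ j]\<close>)
 ultimately have limp: "limitin (punctured_vectors N) (%n. s (q n)) (s p) sequentially"
  unfolding punctured_vectors_def limitin_subtopology using j(1) by (auto intro!: exI[of _ j])
 let ?V = "{x \<in> topspace (punctured_vectors N). proj_point N x \<in> U}"
 have "openin (punctured_vectors N) ?V" using U by (simp add: CP_def openin_quotient_topology)
 moreover have "s p \<in> ?V"
  using limp proj_point_section[OF pC j(1) pj] p by (auto simp: limitin_def s_def)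
 ultimately have "\<forall>\<^sub>F n in sequentially. s (q n) \<in> ?V" using limp unfolding limitin_def by blast
 with nz have "\<forall>\<^sub>F n in sequentially. q n \<in> U"
 proof eventually_elim
  case (elim n)
  thus ?case using proj_point_section[OF q(1) j(1), of n] by (simp add: s_def)
 qed
 thus False using q(3) by (simp add: eventually_sequentially)
qed

text \<open>
  Uniform convergence on discs, with a weight that makes distant points negligible. The weight
  \<open>exp (-\<bar>z\<bar>)\<close> changes under a translation by \<open>a\<close> by a factor of at most \<open>exp \<bar>a\<bar>\<close>, so translations are Lipschitz. The value
  off the set of Brody curves is there to have nonnegative values everywhere.
\<close>

definition cdist :: "nat => (complex => (nat => complex) set) => (complex => (nat => complex) set) => real" where
 "cdist N f g = (if brody_curve N f & brody_curve N g
   then SUP z. exp (- cmod z) * pdist N (f z) (g z) else 0)"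

lemma brody_curve_in_CP:
 assumes "brody_curve N f"
 shows "f z \<in> topspace (CP N)"
proof -
 have "continuous_map euclidean (CP N) f"
  using assms continuous_map_homogeneous_coords by (auto simp: brody_curve_def)
 thus ?thesis by (auto simp: continuous_map_def)
qed

lemma homogeneous_coords_pcoord:
 assumes "homogeneous_coords N F f" "i <= N" "j <= N"
 shows "pcoord N (f z) i j = F i z * cnj (F j z) / of_real (nsq N F z)"
proof -
 have "\<exists>i\<le>N. (\<lambda>i\<in>{..N}. F i z) i ~= 0" using assms(1) by (auto simp: homogeneous_coords_def)
 hence "pcoord N (proj_point N (\<lambda>i\<in>{..N}. F i z)) i j = F i z * cnj (F j z) / of_real (nsq N F z)"
  using assms(2,3) by (subst pcoord_proj_point) (auto simp: nsq_def vnsq_def)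
 thus ?thesis using assms(1) by (simp add: homogeneous_coords_def)
qed

lemma homogeneous_coords_props:
 assumes "homogeneous_coords N F f"
 shows "!!i. i <= N ==> F i holomorphic_on UNIV" "!!z. 0 < nsq N F z"
 using assms by (auto simp: homogeneous_coords_def nsq_pos_iff)

lemma df_norm_le_1_iff:
 assumes "!!i. i <= N ==> F i holomorphic_on UNIV" "!!z. 0 < nsq N F z"
 shows "df_norm N F z <= 1 \<longleftrightarrow> fs_density N F z <= pi"
proof -
 have "laplacian (%w. ln (nsq N F w)) z = 4 * fs_density N F z"
  using assms by (intro laplacian_eqI has_laplacian_log_nsq[of N F UNIV]) auto
 hence "df_norm N F z = sqrt (fs_density N F z / pi)"
  unfolding df_norm_def nsq_def[symmetric] by simp
 thus ?thesis by (simp add: pos_divide_le_eq)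
qed

text \<open>
  The Laplacian of the logarithm has become an algebraic expression in \<open>F\<close> and \<open>F'\<close>, which passes to limits.
\<close>

lemma brody_curve_iff:
 "brody_curve N f \<longleftrightarrow> (\<exists>F. homogeneous_coords N F f & (\<forall>z. fs_density N F z <= pi))"
 unfolding brody_curve_def using df_norm_le_1_iff homogeneous_coords_props by meson

lemma brody_curve_pcoord_Lipschitz:
 assumes "brody_curve N f" "i <= N" "j <= N"
 shows "cmod (pcoord N (f z) i j - pcoord N (f w) i j) <= 4 * cmod (z - w)"
proof -
 obtain F where F: "homogeneous_coords N F f" "\<forall>z. fs_density N F z <= pi"
  using assms(1) unfolding brody_curve_iff by (elim exE conjE)
 show ?thesis
  unfolding homogeneous_coords_pcoord[OF F(1) assms(2,3)]
  using projector_Lipschitz[of N F] homogeneous_coords_props[OF F(1)] F(2) assms by blast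
qed

lemma brody_curve_pdist_Lipschitz:
 assumes "brody_curve N f"
 shows "pdist N (f z) (f w) <= (real N + 1)^2 * (4 * cmod (z - w))"
 by (rule pdist_leI) (rule brody_curve_pcoord_Lipschitz[OF assms])

lemma cdist_bdd:
 assumes "brody_curve N f" "brody_curve N g"
 shows "bdd_above (range (%z. exp (- cmod z) * pdist N (f z) (g z)))"
proof (rule bdd_aboveI2)
 fix z
 have "exp (- cmod z) * pdist N (f z) (g z) <= 1 * ((real N + 1)^2 * 2)"
  using pdist_le_const[OF brody_curve_in_CP[OF assms(1)] brody_curve_in_CP[OF assms(2)]]
  by (intro mult_mono) (auto simp: pdist_metric)
 thus "exp (- cmod z) * pdist N (f z) (g z) <= (real N + 1)^2 * 2" by simp
qed

lemma le_cdist: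
 assumes "brody_curve N f" "brody_curve N g"
 shows "exp (- cmod z) * pdist N (f z) (g z) <= cdist N f g"
 using cSUP_upper[OF UNIV_I cdist_bdd[OF assms], of z] assms by (simp add: cdist_def)

lemma cdist_le:
 assumes "brody_curve N f" "brody_curve N g" "!!z. exp (- cmod z) * pdist N (f z) (g z) <= e"
 shows "cdist N f g <= e"
 using cSUP_least[of UNIV "%z. exp (- cmod z) * pdist N (f z) (g z)" e] assms by (simp add: cdist_def)

lemma pdist_le_cdist:
 assumes "brody_curve N f" "brody_curve N g"
 shows "pdist N (f z) (g z) <= exp (cmod z) * cdist N f g"
proof -
 have "exp (cmod z) * (exp (- cmod z) * pdist N (f z) (g z)) <= exp (cmod z) * cdist N f g"
  using le_cdist[OF assms] by (intro mult_left_mono) auto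
 thus ?thesis by (simp add: mult.assoc[symmetric] exp_minus)
qed

lemma Metric_space_cdist: "Metric_space {f. brody_curve N f} (cdist N)"
proof
 fix f g
 show "0 <= cdist N f g"
 proof (cases "brody_curve N f & brody_curve N g")
  case True
  have "0 <= exp (- cmod 0) * pdist N (f 0) (g 0)" by (simp add: pdist_metric)
  also have "... <= cdist N f g" using True by (intro le_cdist) auto
  finally show ?thesis .
 qed (auto simp: cdist_def)
 have "(%z. exp (- cmod z) * pdist N (f z) (g z)) = (%z. exp (- cmod z) * pdist N (g z) (f z))"
  by (rule ext) (subst pdist_metric(3), rule refl)
 thus "cdist N f g = cdist N g f"
  unfolding cdist_def by (simp only: conj_commute[of "brody_curve N f"])
next
 fix f g assume f: "f \<in> {f. brody_curve N f}" and g: "g \<in> {f. brody_curve N f}"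
 have "f z = g z" if 0: "cdist N f g = 0" for z
 proof -
  have "pdist N (f z) (g z) <= 0" using pdist_le_cdist[of N f g z] f g 0 by simp
  hence "pdist N (f z) (g z) = 0" using pdist_metric(1)[of N "f z" "g z"] by linarith
  thus ?thesis using f g by (intro pdist_eq_0D brody_curve_in_CP) auto
 qed
 moreover have "cdist N f f = 0" by (simp add: cdist_def pdist_metric)
 ultimately show "cdist N f g = 0 \<longleftrightarrow> f = g" by auto
next
 fix f g h assume fgh: "f \<in> {f. brody_curve N f}" "g \<in> {f. brody_curve N f}" "h \<in> {f. brody_curve N f}"
 show "cdist N f h <= cdist N f g + cdist N g h"
 proof (rule cdist_le)
  show "brody_curve N f" "brody_curve N h" using fgh by simp_all
  fix z
  have "exp (- cmod z) * pdist N (f z) (h z) <= exp (- cmod z) * pdist N (f z) (g z) + exp (- cmod z) * pdist N (g z) (h z)"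
   unfolding distrib_left[symmetric] by (intro mult_left_mono pdist_metric) auto
  thus "exp (- cmod z) * pdist N (f z) (h z) <= cdist N f g + cdist N g h"
   using le_cdist[of N f g z] le_cdist[of N g h z] fgh by simp
 qed
qed

section \<open>Entire functions without common zeros\<close>

lemma analytic_at_congD:
 assumes "f analytic_on {z}" "\<forall>\<^sub>F w in nhds z. f w = g w"
 shows "g analytic_on {z}"
 using assms(1) analytic_at_cong[of f g z z, OF assms(2) refl] by simp

text \<open>
  The Weierstrass factorization of the meromorphic function \<open>g/f\<close> gives numerator and denominator
  without common zeros; the remaining factor is entire because it is a quotient in two ways.
\<close>

lemma entire_gcd2:
 assumes f: "f holomorphic_on UNIV" and g: "g holomorphic_on UNIV"
 obtains e a b where "e holomorphic_on UNIV" "a holomorphic_on UNIV" "b holomorphic_on UNIV"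
  "!!z. f z = e z * a z" "!!z. g z = e z * b z" "!!z. a z ~= 0 \<or> b z ~= 0"
proof (cases "\<forall>z. f z = 0")
 case True
 show thesis by (rule that[of g "%_. 0" "%_. 1"]) (use True g in auto)
next
 case False
 define m where "m = remove_sings (%z. g z / f z)"
 have "(%z. g z / f z) meromorphic_on UNIV"
  by (intro meromorphic_on_divide analytic_on_imp_meromorphic_on) (use f g in \<open>simp_all add: analytic_on_open\<close>)
 hence "m nicely_meromorphic_on UNIV" unfolding m_def by (rule remove_sings_nicely_meromorphic)
 from weierstrass_factorization_meromorphic_UNIV[OF this]
 obtain h f1 f2 where h: "h holomorphic_on UNIV" "f1 holomorphic_on UNIV" "f2 holomorphic_on UNIV"
  and f1: "\<forall>z. f1 z = 0 \<longleftrightarrow> \<not> is_pole m z & m z = 0" and f2: "\<forall>z. f2 z = 0 \<longleftrightarrow> is_pole m z"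
  and hz: "\<forall>z. h z ~= 0" and m: "\<forall>z. m z = h z * f1 z / f2 z"
  by metis
 have id1: "g z * f2 z - f z * (h z * f1 z) = 0" if "f z ~= 0" for z
 proof -
  have an: "(%z. g z / f z) analytic_on {z}"
   by (intro analytic_on_divide) (use f g that in \<open>auto intro: analytic_on_subset[of _ UNIV] simp: analytic_on_open\<close>)
  hence "m z = g z / f z" unfolding m_def by (rule remove_sings_at_analytic)
  moreover have "\<not> is_pole m z"
  proof -
   have "isolated_singularity_at (%z. g z / f z) z" "not_essential (%z. g z / f z) z"
    using an isolated_singularity_at_analytic not_essential_analytic by blast+
   moreover have "\<not> is_pole (%z. g z / f z) z" using an analytic_at_imp_no_pole by blast
   ultimately show ?thesis unfolding m_def by (simp add: is_pole_remove_sings_iff)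
  qed
  ultimately show ?thesis using f2 m that by (simp add: field_simps)
 qed
 have fo: "open {z. f z ~= 0}"
  using holomorphic_on_imp_continuous_on[OF f] by (intro open_Collect_neq continuous_on_const) auto
 obtain z0 where z0: "f z0 ~= 0" using False by blast
 have ident: "g z * f2 z = f z * (h z * f1 z)" for z
 proof -
  have "(%z. g z * f2 z - f z * (h z * f1 z)) holomorphic_on UNIV" by (intro holomorphic_intros f g h)
  from analytic_continuation_open[of "{z. f z ~= 0}" UNIV, OF fo open_UNIV _ connected_UNIV subset_UNIV this
    holomorphic_on_const[of 0] _ UNIV_I]
  have "g z * f2 z - f z * (h z * f1 z) = 0" using id1 z0 by auto
  thus ?thesis by simp
 qed
 define e where "e = (%z. if f2 z ~= 0 then f z / f2 z else g z / (h z * f1 z))"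
 have nz: "h z * f1 z ~= 0" if "f2 z = 0" for z using f1 f2 hz that by simp
 have e1: "f z = e z * f2 z" for z
  using ident[of z] nz[of z] by (cases "f2 z = 0") (auto simp: e_def)
 have e2: "g z = e z * (h z * f1 z)" for z
  using ident[of z] nz[of z] by (cases "f2 z = 0") (auto simp: e_def field_simps)
 have "e analytic_on {z}" for z
 proof (cases "f2 z = 0")
  case True
  have "(%w. g w / (h w * f1 w)) analytic_on {z}"
   using nz[OF True] f g h by (intro analytic_intros) (auto intro: analytic_on_subset[of _ UNIV] simp: analytic_on_open)
  moreover have "\<forall>\<^sub>F w in nhds z. h w * f1 w ~= 0"
  proof (rule eventually_nhds_in_open[of "{w. h w * f1 w ~= 0}", simplified mem_Collect_eq])
   show "open {w. h w * f1 w ~= 0}"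
    using h[THEN holomorphic_on_imp_continuous_on] by (intro open_Collect_neq continuous_intros) auto
  qed (use nz[OF True] in auto)
  hence "\<forall>\<^sub>F w in nhds z. g w / (h w * f1 w) = e w"
   by eventually_elim (use e2 in \<open>simp add: field_simps\<close>)
  ultimately show ?thesis by (rule analytic_at_congD)
 next
  case False
  have "(%w. f w / f2 w) analytic_on {z}"
   using False f h by (intro analytic_intros) (auto intro: analytic_on_subset[of _ UNIV] simp: analytic_on_open)
  moreover have "\<forall>\<^sub>F w in nhds z. f2 w ~= 0"
  proof (rule eventually_nhds_in_open[of "{w. f2 w ~= 0}", simplified mem_Collect_eq])
   show "open {w. f2 w ~= 0}"
    using h[THEN holomorphic_on_imp_continuous_on] by (intro open_Collect_neq continuous_intros) auto
  qed (use False in auto)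
  hence "\<forall>\<^sub>F w in nhds z. f w / f2 w = e w"
   by eventually_elim (simp add: e_def)
  ultimately show ?thesis by (rule analytic_at_congD)
 qed
 hence eh: "e holomorphic_on UNIV" using analytic_on_analytic_at[of e UNIV] by (simp add: analytic_on_open)
 show thesis
  by (rule that[of e f2 "%z. h z * f1 z"]) (use eh h e1 e2 nz in \<open>auto intro!: holomorphic_intros\<close>)
qed

lemma entire_gcd:
 fixes F :: "nat => complex => complex"
 assumes "!!i. i <= N ==> F i holomorphic_on UNIV"
 shows "\<exists>e G. e holomorphic_on UNIV & (\<forall>i\<le>N. G i holomorphic_on UNIV & (\<forall>z. F i z = e z * G i z)) &
   (\<forall>z. \<exists>i\<le>N. G i z ~= 0)"
 using assms
proof (induction N)
 case 0
 thus ?case by (intro exI[of _ "F 0"] exI[of _ "%_ _. 1"]) auto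
next
 case (Suc N)
 obtain e G where e: "e holomorphic_on UNIV" "\<forall>i\<le>N. G i holomorphic_on UNIV & (\<forall>z. F i z = e z * G i z)"
   "\<forall>z. \<exists>i\<le>N. G i z ~= 0"
 proof -
  have "\<exists>e G. e holomorphic_on UNIV & (\<forall>i\<le>N. G i holomorphic_on UNIV & (\<forall>z. F i z = e z * G i z)) &
    (\<forall>z. \<exists>i\<le>N. G i z ~= 0)"
   by (rule Suc.IH) (use Suc.prems in simp)
  thus ?thesis by (elim exE conjE) (rule that)
 qed
 have "F (Suc N) holomorphic_on UNIV" using Suc.prems by simp
 then obtain e' a b where e': "e' holomorphic_on UNIV" "a holomorphic_on UNIV" "b holomorphic_on UNIV"
  "!!z. e z = e' z * a z" "!!z. F (Suc N) z = e' z * b z" "!!z. a z ~= 0 \<or> b z ~= 0"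
  by (rule entire_gcd2[OF e(1)]) (rule that)
 define G' where "G' = (%i z. if i <= N then a z * G i z else b z)"
 have "G' i holomorphic_on UNIV & (\<forall>z. F i z = e' z * G' i z)" if "i <= Suc N" for i
 proof (cases "i <= N")
  case True
  hence "G' i = (%z. a z * G i z)" by (auto simp: G'_def)
  thus ?thesis using e(2) e' True by (auto intro!: holomorphic_intros)
 next
  case False
  hence "i = Suc N" using that by simp
  moreover have "G' (Suc N) = b" by (auto simp: G'_def)
  ultimately show ?thesis using e' by simp
 qed
 moreover have "\<exists>i\<le>Suc N. G' i z ~= 0" for z
 proof (cases "b z = 0")
  case True
  hence "a z ~= 0" using e'(6)[of z] by simp
  moreover obtain i where "i <= N" "G i z ~= 0" using e(3) by blast
  ultimately show ?thesis by (intro exI[of _ i]) (simp add: G'_def)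
 next
  case False
  thus ?thesis by (intro exI[of _ "Suc N"]) (simp add: G'_def)
 qed
 ultimately show ?case using e'(1) by blast
qed

text \<open>
  A limit of Brody curves is known through its projectors \<open>Q\<close>, which are locally given by holomorphic
  affine coordinates. Global homogeneous coordinates are needed: the ratios \<open>m i\<close> to one coordinate
  that is not identically zero are meromorphic on \<open>\<complex>\<close>; writing them with a common denominator
  and removing the common zeros gives entire functions, which have the projectors \<open>Q\<close> first on a dense set and then everywhere.
\<close>

lemma holomorphic_lift:
 fixes Q :: "complex => nat => nat => complex"
 assumes rank1: "!!z. \<exists>v. (\<exists>i\<le>N. v i ~= 0) & (\<forall>i\<le>N. \<forall>j\<le>N. Q z i j = v i * cnj (v j) / of_real (vnsq N v))"
  and cont: "!!i j. i <= N ==> j <= N ==> continuous_on UNIV (%z. Q z i j)"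
  and loc: "!!z0. \<exists>j\<le>N. \<exists>r>0. (\<forall>z\<in>ball z0 r. Q z j j ~= 0) &
        (\<forall>i\<le>N. (%z. Q z i j / Q z j j) holomorphic_on ball z0 r)"
 obtains F where "!!i. i <= N ==> F i holomorphic_on UNIV" "!!z. \<exists>i\<le>N. F i z ~= 0"
  "!!z i j. i <= N ==> j <= N ==> Q z i j = F i z * cnj (F j z) / of_real (nsq N F z)"
proof -
 obtain v where v: "!!z. \<exists>i\<le>N. v z i ~= 0"
  "!!z i j. i <= N ==> j <= N ==> Q z i j = v z i * cnj (v z j) / of_real (vnsq N (v z))"
  using rank1 by metis
 have vp: "vnsq N (v z) > 0" for z by (rule vec_norm_pos[OF v(1)])
 have quot: "Q z i j / Q z j j = v z i / v z j" if "i <= N" "j <= N" for z i j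
  using vp[of z] by (cases "v z j = 0") (simp_all add: v(2) that)
 have Q0: "Q z j j = 0 \<longleftrightarrow> v z j = 0" if "j <= N" for z j using vp[of z] that by (simp add: v(2))
 obtain j0 where j0: "j0 <= N" "v 0 j0 ~= 0" using v(1) by blast
 define A where "A = {z. Q z j0 j0 ~= 0}"
 have A0: "0 \<in> A" using j0 Q0 by (simp add: A_def)
 define m where "m = (%i z. v z i / v z j0)"
 have local: "\<exists>j r. j <= N & 0 < r & (\<forall>z\<in>ball z0 r. v z j ~= 0) & (\<forall>i\<le>N. (%z. v z i / v z j) holomorphic_on ball z0 r)" for z0
 proof -
  obtain j r where jr: "j <= N" "0 < r" "\<forall>z\<in>ball z0 r. Q z j j ~= 0" "\<forall>i\<le>N. (%z. Q z i j / Q z j j) holomorphic_on ball z0 r"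
   using loc[of z0] by blast
  thus ?thesis using quot Q0 by (intro exI[of _ j] exI[of _ r]) auto
 qed
 have dense: "closure A = UNIV"
 proof -
  let ?Z = "interior (- A)"
  have "closed ?Z"
   unfolding closed_limpt
  proof (intro allI impI)
   fix z0 assume lim: "z0 islimpt ?Z"
   obtain j r where jr: "j <= N" "0 < r" "\<forall>z\<in>ball z0 r. v z j ~= 0" "\<forall>i\<le>N. (%z. v z i / v z j) holomorphic_on ball z0 r"
    using local[of z0] by blast
   have ne: "?Z \<inter> ball z0 r ~= {}"
    using islimptE[OF lim, of "ball z0 r"] jr(2) by (metis IntI centre_in_ball empty_iff open_ball)
   have on: "v z j0 / v z j = 0" if "z \<in> ?Z \<inter> ball z0 r" for z
   proof -
    have "z \<notin> A" using interior_subset that by blast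
    thus ?thesis using Q0[OF j0(1)] by (simp add: A_def)
   qed
   have "v z j0 / v z j = 0" if "z \<in> ball z0 r" for z
    using analytic_continuation_open[of "?Z \<inter> ball z0 r" "ball z0 r" "%z. v z j0 / v z j" "%_. 0" z]
     ne on that jr j0(1) by (simp add: open_Int)
   hence "ball z0 r \<subseteq> - A" using jr(3) Q0[OF j0(1)] by (auto simp: A_def)
   thus "z0 \<in> ?Z" using jr(2) by (meson centre_in_ball interior_maximal open_ball subsetD)
  qed
  hence "?Z = {} \<or> ?Z = UNIV" using clopen[of ?Z] by simp
  moreover have "0 \<notin> ?Z" using A0 interior_subset by blast
  ultimately have "?Z = {}" by auto
  thus ?thesis by (auto simp: interior_complement)
 qed
 have mer: "m i meromorphic_on UNIV" if i: "i <= N" for i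
 proof (subst meromorphic_on_meromorphic_at, intro ballI)
  fix z0
  obtain j r where jr: "j <= N" "0 < r" "\<forall>z\<in>ball z0 r. v z j ~= 0" "\<forall>i\<le>N. (%z. v z i / v z j) holomorphic_on ball z0 r"
   using local[of z0] by blast
  have an: "(%z. v z k / v z j) meromorphic_on ball z0 r" if "k <= N" for k
   using jr(4) that by (intro analytic_on_imp_meromorphic_on) (simp add: analytic_on_open)
  have "(%z. (v z i / v z j) / (v z j0 / v z j)) meromorphic_on {z0}"
   by (rule meromorphic_on_subset[OF meromorphic_on_divide[OF an[OF i] an[OF j0(1)]]]) (use jr(2) in simp)
  moreover have "\<forall>\<^sub>F z in at z0. (v z i / v z j) / (v z j0 / v z j) = m i z"
   using eventually_at_in_open'[of "ball z0 r" z0] jr(2)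
   by (auto elim!: eventually_mono simp: m_def jr(3))
  ultimately show "m i meromorphic_on {z0}" by (subst (asm) meromorphic_on_cong) auto
 qed
 have anA: "m i analytic_on {z}" if "i <= N" "z \<in> A" for i z
 proof -
  obtain j r where jr: "j <= N" "0 < r" "\<forall>w\<in>ball z r. v w j ~= 0" "\<forall>i\<le>N. (%w. v w i / v w j) holomorphic_on ball z r"
   using local[of z] by blast
  have an: "(%w. v w k / v w j) analytic_on {z}" if "k <= N" for k
   by (rule analytic_on_subset[of _ "ball z r"]) (use jr that in \<open>simp_all add: analytic_on_open\<close>)
  moreover have "v z j0 / v z j ~= 0" using jr that Q0 j0 by (simp add: A_def)
  ultimately have "(%w. (v w i / v w j) / (v w j0 / v w j)) analytic_on {z}"
   by (intro analytic_on_divide[OF an[OF that(1)] an[OF j0(1)]]) simp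
  moreover have "\<forall>\<^sub>F w in nhds z. (v w i / v w j) / (v w j0 / v w j) = m i w"
   using eventually_nhds_in_open[of "ball z r" z] jr(2)
   by (auto elim!: eventually_mono simp: m_def jr(3))
  ultimately show ?thesis by (rule analytic_at_congD)
 qed
 have "\<exists>n d. n holomorphic_on UNIV & d holomorphic_on UNIV & (\<forall>z\<in>A. d z ~= 0 & m i z = n z / d z)" if i: "i <= N" for i
 proof -
  have "remove_sings (m i) nicely_meromorphic_on UNIV" using mer[OF i] by (rule remove_sings_nicely_meromorphic)
  from weierstrass_factorization_meromorphic_UNIV[OF this]
  obtain h f1 f2 where h: "h holomorphic_on UNIV" "f1 holomorphic_on UNIV" "f2 holomorphic_on UNIV"
   and f2: "\<forall>z. f2 z = 0 \<longleftrightarrow> is_pole (remove_sings (m i)) z"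
   and eq: "\<forall>z. remove_sings (m i) z = h z * f1 z / f2 z"
   by metis
  have "f2 z ~= 0 & m i z = h z * f1 z / f2 z" if z: "z \<in> A" for z
  proof -
   have an: "m i analytic_on {z}" by (rule anA[OF i z])
   have "isolated_singularity_at (m i) z" "not_essential (m i) z"
    using an isolated_singularity_at_analytic not_essential_analytic by blast+
   moreover have "\<not> is_pole (m i) z" using an analytic_at_imp_no_pole by blast
   ultimately have "\<not> is_pole (remove_sings (m i)) z" by (simp add: is_pole_remove_sings_iff)
   thus ?thesis using f2 eq remove_sings_at_analytic[OF an] by metis
  qed
  thus ?thesis using h by (intro exI[of _ "%z. h z * f1 z"] exI[of _ f2]) (auto intro!: holomorphic_intros)
 qed
 then obtain n d where nd: "!!i. i <= N ==> n i holomorphic_on UNIV" "!!i. i <= N ==> d i holomorphic_on UNIV"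
  "!!i z. i <= N ==> z \<in> A ==> d i z ~= 0" "!!i z. i <= N ==> z \<in> A ==> m i z = n i z / d i z"
  by metis
 define E where "E = (%i z. n i z * (\<Prod>k\<in>{..N} - {i}. d k z))"
 have Eh: "E i holomorphic_on UNIV" if "i <= N" for i
  unfolding E_def using that nd by (intro holomorphic_intros) auto
 have EA: "E i z = m i z * (\<Prod>k\<le>N. d k z)" if "i <= N" "z \<in> A" for i z
 proof -
  have "(\<Prod>k\<le>N. d k z) = d i z * (\<Prod>k\<in>{..N} - {i}. d k z)" using that by (intro prod.remove) auto
  thus ?thesis using nd(3,4)[OF that] by (simp add: E_def)
 qed
 obtain e F where eF: "e holomorphic_on UNIV" "\<forall>i\<le>N. F i holomorphic_on UNIV & (\<forall>z. E i z = e z * F i z)"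
   "\<forall>z. \<exists>i\<le>N. F i z ~= 0"
  using entire_gcd[of N E] Eh by blast
 have pos: "0 < nsq N F z" for z using eF(3) by (simp add: nsq_pos_iff)
 have QA: "Q z i j = F i z * cnj (F j z) / of_real (nsq N F z)" if z: "z \<in> A" and ij: "i <= N" "j <= N" for z i j
 proof -
  have P: "(\<Prod>k\<le>N. d k z) ~= 0" using nd(3) z by simp
  have vj0: "v z j0 ~= 0" using z Q0[OF j0(1)] by (simp add: A_def)
  have e0: "e z ~= 0"
  proof
   assume "e z = 0"
   hence "E j0 z = 0" using eF(2) j0(1) by simp
   thus False using EA[OF j0(1) z] P vj0 by (simp add: m_def)
  qed
  define c where "c = (\<Prod>k\<le>N. d k z) / (v z j0 * e z)"
  have c: "c ~= 0" using P vj0 e0 by (simp add: c_def)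
  have F: "F k z = c * v z k" if "k <= N" for k
  proof -
   have "e z * F k z = v z k / v z j0 * (\<Prod>k\<le>N. d k z)"
    using eF(2) that EA[OF that z] by (simp add: m_def)
   thus ?thesis using e0 vj0 by (simp add: c_def field_simps)
  qed
  have "proj_point N (%k. F k z) = proj_point N (v z)" by (rule proj_point_scale[OF c F])
  hence "pcoord N (proj_point N (%k. F k z)) i j = pcoord N (proj_point N (v z)) i j" by simp
  thus ?thesis
   using pcoord_proj_point[of N "%k. F k z" i j] pcoord_proj_point[of N "v z" i j] eF(3) v ij
   by (simp add: nsq_def vnsq_def)
 qed
 have "Q z i j = F i z * cnj (F j z) / of_real (nsq N F z)" if ij: "i <= N" "j <= N" for z i j
 proof -
  have Fc: "continuous_on UNIV (F k)" if "k <= N" for k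
   using eF(2) that by (auto intro: holomorphic_on_imp_continuous_on)
  have "continuous_on UNIV (%z. of_real (nsq N F z) :: complex)"
   unfolding nsq_def by (intro continuous_intros Fc) auto
  hence "closed {z. Q z i j = F i z * cnj (F j z) / of_real (nsq N F z)}"
   using pos by (intro closed_Collect_eq cont ij continuous_intros Fc) (auto simp: less_le)
  moreover have "A \<subseteq> {z. Q z i j = F i z * cnj (F j z) / of_real (nsq N F z)}" using QA ij by auto
  ultimately have "closure A \<subseteq> {z. Q z i j = F i z * cnj (F j z) / of_real (nsq N F z)}" by (intro closure_minimal)
  thus ?thesis using dense by auto
 qed
 thus thesis using that eF by blast
qed

section \<open>Compactness of the space of Brody curves\<close>

text \<open>
  Brody curves are uniformly Lipschitz, so a fine net of a large disc controls the weighted distance.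
\<close>

lemma cdist_less_criterion:
 assumes "0 < e"
 shows "\<exists>Z \<delta>. finite Z & 0 < \<delta> &
  (\<forall>f g. brody_curve N f --> brody_curve N g --> (\<forall>z\<in>Z. pdist N (f z) (g z) < \<delta>) --> cdist N f g < e)"
proof -
 define M where "M = (real N + 1)^2"
 have M: "M > 0" by (simp add: M_def)
 define B where "B = \<bar>ln (8 * M / e)\<bar>"
 have "exp (- B) <= exp (- ln (8 * M / e))" by (simp add: B_def)
 also have "... = e / (8 * M)" using assms M by (simp add: exp_minus)
 finally have B: "exp (- B) * (M * 2) <= e / 4" using M by (simp add: field_simps)
 define \<eta> where "\<eta> = e / (32 * M)"
 have \<eta>: "\<eta> > 0" using assms M by (simp add: \<eta>_def)
 obtain Z :: "complex set" where Z: "finite Z" "cball 0 B \<subseteq> (\<Union>x\<in>Z. ball x \<eta>)"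
  using compact_cball[of "0::complex" B] \<eta> unfolding compact_eq_totally_bounded by blast
 show ?thesis
 proof (intro exI[of _ Z] exI[of _ "e / 4"] conjI allI impI)
  fix f g assume f: "brody_curve N f" and g: "brody_curve N g" and small': "\<forall>z\<in>Z. pdist N (f z) (g z) < e / 4"
  have small: "pdist N (f z) (g z) < e / 4" if "z \<in> Z" for z using small' that by (rule bspec)
  have "cdist N f g <= e / 2"
  proof (rule cdist_le[OF f g])
   fix z
   show "exp (- cmod z) * pdist N (f z) (g z) <= e / 2"
   proof (cases "cmod z <= B")
    case True
    then obtain w where w: "w \<in> Z" "cmod (w - z) < \<eta>" using Z(2) by (auto simp: dist_norm subset_iff)
    have "M * (4 * cmod (w - z)) <= M * (4 * \<eta>)" using w(2) M by (intro mult_left_mono) auto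
    hence "pdist N (f z) (f w) <= M * (4 * \<eta>)" "pdist N (g w) (g z) <= M * (4 * \<eta>)"
     using brody_curve_pdist_Lipschitz[OF f, of z w] brody_curve_pdist_Lipschitz[OF g, of w z]
     unfolding M_def norm_minus_commute[of z w] by linarith+
    moreover have "M * (4 * \<eta>) = e / 8" using M by (simp add: \<eta>_def)
    moreover have "pdist N (f z) (g z) <= pdist N (f z) (f w) + (pdist N (f w) (g w) + pdist N (g w) (g z))"
     using pdist_metric(4)[of N "f z" "g z" "f w"] pdist_metric(4)[of N "f w" "g z" "g w"] by linarith
    ultimately have le: "pdist N (f z) (g z) <= e / 2" using small[OF w(1)] by linarith
    have "exp (- cmod z) * pdist N (f z) (g z) <= 1 * (e / 2)"
     using le by (intro mult_mono) (auto simp: pdist_metric)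
    thus ?thesis by simp
   next
    case False
    have "exp (- cmod z) * pdist N (f z) (g z) <= exp (- B) * (M * 2)"
     using False pdist_le_const[OF brody_curve_in_CP[OF f] brody_curve_in_CP[OF g], of z z] unfolding M_def
     by (intro mult_mono) (auto simp: pdist_metric)
    thus ?thesis using B assms by linarith
   qed
  qed
  thus "cdist N f g < e" using assms by linarith
 qed (use Z assms in auto)
qed

lemma uniform_pball_in_open:
 assumes f: "brody_curve N f" and K: "compact K" and V: "openin (CP N) V" "f ` K \<subseteq> V"
 shows "\<exists>r>0. \<forall>z\<in>K. \<forall>q\<in>topspace (CP N). pdist N (f z) q < r --> q \<in> V"
proof -
 define M where "M = (real N + 1)^2"
 have M: "M > 0" by (simp add: M_def)
 have "\<exists>r>0. \<forall>q\<in>topspace (CP N). pdist N (f z) q < r --> q \<in> V" if "z \<in> K" for z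
  using openin_CP_contains_pball[OF V(1), of "f z"] V(2) that by blast
 then obtain r where r: "!!z. z \<in> K ==> r z > 0"
  "!!z q. z \<in> K ==> q \<in> topspace (CP N) ==> pdist N (f z) q < r z ==> q \<in> V"
  by metis
 define U where "U = (%z. ball z (r z / (8 * M)))"
 have "K \<subseteq> (\<Union>z\<in>K. U z)" using r(1) M by (fastforce simp: U_def)
 then obtain C where C: "C \<subseteq> K" "finite C" "K \<subseteq> (\<Union>z\<in>C. U z)"
  using compactE_image[OF K, of K U] by (auto simp: U_def)
 define \<rho> where "\<rho> = Min (insert 1 ((%z. r z / 2) ` C))"
 have "\<rho> > 0" unfolding \<rho>_def using C r(1) by (subst Min_gr_iff) auto
 moreover have "q \<in> V" if z: "z \<in> K" and q: "q \<in> topspace (CP N)" "pdist N (f z) q < \<rho>" for z q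
 proof -
  obtain w where w: "w \<in> C" "z \<in> U w" using C(3) z by blast
  have wK: "w \<in> K" using C w by blast
  have "cmod (w - z) < r w / (8 * M)" using w(2) by (simp add: U_def dist_norm)
  hence "M * (4 * cmod (w - z)) <= r w / 2" using M by (simp add: field_simps)
  hence "pdist N (f w) (f z) <= r w / 2"
   using brody_curve_pdist_Lipschitz[OF f, of w z] by (simp add: M_def)
  moreover have "\<rho> <= r w / 2" unfolding \<rho>_def using C w by (intro Min_le) auto
  ultimately have "pdist N (f w) q < r w"
   using pdist_metric(4)[of N "f w" q "f z"] q(2) by linarith
  thus ?thesis using r(2)[OF wK q(1)] by blast
 qed
 ultimately show ?thesis by blast
qed

text \<open>
  On an equicontinuous set of maps the compact-open topology is the topology of convergence
  at points, so finitely many subbasic sets at single points suffice for a ball.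
\<close>

theorem mtopology_cdist: "mtopology_of (metric ({f. brody_curve N f}, cdist N)) = brody_space N"
proof -
 interpret Metric_space "{f. brody_curve N f}" "cdist N" by (rule Metric_space_cdist)
 let ?B = "{f. brody_curve N f}"
 let ?S = "{{f. continuous_map euclidean (CP N) f & f ` K \<subseteq> U} | (K :: complex set) U. compact K & openin (CP N) U}"
 have contB: "continuous_map euclidean (CP N) f" if "brody_curve N f" for f
  using that continuous_map_homogeneous_coords by (auto simp: brody_curve_def)
 have subset: "?B \<subseteq> topspace (compact_open_topology (CP N))" using contB by auto
 have "continuous_map mtopology (compact_open_topology (CP N)) (%f. f)"
  unfolding compact_open_topology_def
 proof (rule continuous_on_generated_topo)
  fix W assume "W \<in> ?S"
  then obtain K V where W: "W = {f. continuous_map euclidean (CP N) f & f ` K \<subseteq> V}" "compact K" "openin (CP N) V"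
   by (elim CollectE exE conjE) (rule that)
  have "(%f. f) -` W \<inter> topspace mtopology = {f\<in>?B. f ` K \<subseteq> V}"
   using contB by (auto simp: W)
  moreover have "openin mtopology {f\<in>?B. f ` K \<subseteq> V}"
   unfolding openin_mtopology
  proof (intro conjI allI impI)
   fix f assume f: "f \<in> {f\<in>?B. f ` K \<subseteq> V}"
   obtain r where r: "r > 0" "\<forall>z\<in>K. \<forall>q\<in>topspace (CP N). pdist N (f z) q < r --> q \<in> V"
   proof -
    have "brody_curve N f" "f ` K \<subseteq> V" using f by auto
    from uniform_pball_in_open[OF this(1) W(2,3) this(2)] show ?thesis by (elim exE conjE) (rule that)
   qed
   obtain b where b: "!!z. z \<in> K ==> cmod z <= b"
    using compact_imp_bounded[OF W(2)] unfolding bounded_iff by blast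
   have "mball f (r * exp (- b)) \<subseteq> {f\<in>?B. f ` K \<subseteq> V}"
   proof
    fix g assume "g \<in> mball f (r * exp (- b))"
    hence fg: "brody_curve N f" "brody_curve N g" "cdist N f g < r * exp (- b)" by auto
    have "g z \<in> V" if "z \<in> K" for z
    proof -
     have "pdist N (f z) (g z) <= exp (cmod z) * cdist N f g" by (rule pdist_le_cdist[OF fg(1,2)])
     also have "... <= exp b * cdist N f g" using b[OF that] nonneg[of f g] by (intro mult_right_mono) auto
     also have "... < exp b * (r * exp (- b))" using fg(3) by (intro mult_strict_left_mono) auto
     also have "... = r" by (simp add: exp_minus)
     finally show ?thesis using r(2) that brody_curve_in_CP[OF fg(2)] by blast
    qed
    thus "g \<in> {f\<in>?B. f ` K \<subseteq> V}" using fg by auto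
   qed
   thus "\<exists>r>0. mball f r \<subseteq> {f\<in>?B. f ` K \<subseteq> V}" using r(1) by (intro exI[of _ "r * exp (- b)"]) auto
  qed auto
  ultimately show "openin mtopology ((%f. f) -` W \<inter> topspace mtopology)" by simp
 next
  have "\<Union>?S = topspace (compact_open_topology (CP N))"
   unfolding compact_open_topology_def topology_generated_by_topspace ..
  thus "(%f. f) ` topspace mtopology \<subseteq> \<Union>?S" using subset by simp
 qed
 hence cont: "continuous_map mtopology (brody_space N) (%f. f)"
  unfolding brody_space_def continuous_map_in_subtopology by auto
 have "openin mtopology U = openin (brody_space N) U" for U
 proof
  assume U: "openin (brody_space N) U"
  hence "U \<subseteq> ?B" using openin_subset topspace_brody_space by blast
  hence "{f \<in> topspace mtopology. f \<in> U} = U" by auto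
  thus "openin mtopology U" using openin_continuous_map_preimage[OF cont U] by simp
 next
  assume U: "openin mtopology U"
  show "openin (brody_space N) U"
  proof (subst openin_subopen, intro ballI)
   fix f assume fU: "f \<in> U"
   have fB: "brody_curve N f" using U fU openin_subset by fastforce
   obtain e where e: "e > 0" "mball f e \<subseteq> U" using U fU unfolding openin_mtopology by blast
   obtain Z \<delta> where Z: "finite Z" "0 < \<delta>"
    "\<forall>f g. brody_curve N f --> brody_curve N g --> (\<forall>z\<in>Z. pdist N (f z) (g z) < \<delta>) --> cdist N f g < e"
    using cdist_less_criterion[OF e(1), of N] by (elim exE conjE) (rule that)
   define O' where "O' = (%z. {g. continuous_map euclidean (CP N) g & g ` {z} \<subseteq> {q \<in> topspace (CP N). pdist N (f z) q < \<delta>}})"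
   have O': "openin (compact_open_topology (CP N)) (O' z)" for z
    unfolding compact_open_topology_def O'_def
    by (rule topology_generated_by_Basis, rule CollectI, rule exI[of _ "{z}"],
      rule exI[of _ "{q \<in> topspace (CP N). pdist N (f z) q < \<delta>}"]) (auto simp: openin_CP_pball)
   let ?\<O> = "insert (topspace (compact_open_topology (CP N))) (O' ` Z)"
   have "openin (compact_open_topology (CP N)) (\<Inter>?\<O>)"
    using Z(1) O' openin_topspace[of "compact_open_topology (CP N)"]
    by (intro openin_Inter) (auto simp del: topspace_compact_open_topology)
   hence "openin (brody_space N) (?B \<inter> \<Inter>?\<O>)"
    unfolding brody_space_def by (rule openin_subtopology_Int2)
   moreover have "f \<in> ?B \<inter> \<Inter>?\<O>"
    using fB contB[OF fB] brody_curve_in_CP[OF fB] Z(2) by (auto simp: O'_def pdist_metric)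
   moreover have "?B \<inter> \<Inter>?\<O> \<subseteq> U"
   proof
    fix g assume g: "g \<in> ?B \<inter> \<Inter>?\<O>"
    hence "pdist N (f z) (g z) < \<delta>" if "z \<in> Z" for z using that by (auto simp: O'_def)
    hence "cdist N f g < e" using Z(3)[rule_format, OF fB, of g] g by blast
    hence "g \<in> mball f e" using fB g by simp
    thus "g \<in> U" using e(2) by blast
   qed
   ultimately show "\<exists>T. openin (brody_space N) T & f \<in> T & T \<subseteq> U" by blast
  qed
 qed
 thus ?thesis by (simp add: topology_eq)
qed

lemma pcoord_rank1:
 assumes "p \<in> topspace (CP N)" "i <= N" "j <= N" "k <= N" "l <= N"
 shows "pcoord N p i j * pcoord N p k l = pcoord N p i l * pcoord N p k j"
  and "pcoord N p j i = cnj (pcoord N p i j)"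
proof -
 obtain v where v: "!!i j. i <= N ==> j <= N ==> pcoord N p i j = v i * cnj (v j) / of_real (vnsq N v)"
  using assms(1) by (rule CP_cases) (rule that)
 show "pcoord N p i j * pcoord N p k l = pcoord N p i l * pcoord N p k j" "pcoord N p j i = cnj (pcoord N p i j)"
  using assms(2-) by (simp_all add: v)
qed

lemma uniform_limit_Lipschitz_pointwise:
 fixes h :: "nat => complex => complex"
 assumes lip: "!!n z w. cmod (h n z - h n w) <= C * cmod (z - w)"
  and lim: "!!z. (%n. h n z) \<longlonglongrightarrow> H z" and S: "compact S"
 shows "uniform_limit S h H sequentially"
proof (rule uniform_limitI)
 fix e :: real assume e: "e > 0"
 have C: "0 <= C" using order_trans[OF norm_ge_zero lip[of 0 1 0]] by simp
 have lipH: "cmod (H z - H w) <= C * cmod (z - w)" for z w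
 proof (rule LIMSEQ_le_const2)
  show "(%n. cmod (h n z - h n w)) \<longlonglongrightarrow> cmod (H z - H w)" by (intro tendsto_intros lim)
 qed (use lip in auto)
 define \<eta> where "\<eta> = e / (3 * (C + 1))"
 have \<eta>: "\<eta> > 0" "C * \<eta> <= e / 3" using e C by (auto simp: \<eta>_def field_simps)
 obtain Z where Z: "finite Z" "S \<subseteq> (\<Union>x\<in>Z. ball x \<eta>)"
  using S \<eta>(1) unfolding compact_eq_totally_bounded by blast
 have "\<forall>\<^sub>F n in sequentially. \<forall>w\<in>Z. dist (h n w) (H w) < e / 3"
  using Z(1) e by (intro eventually_ball_finite ballI tendstoD[OF lim]) auto
 thus "\<forall>\<^sub>F n in sequentially. \<forall>z\<in>S. dist (h n z) (H z) < e"
 proof eventually_elim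
  case (elim n)
  show ?case
  proof
   fix z assume "z \<in> S"
   then obtain w where w: "w \<in> Z" "cmod (w - z) < \<eta>" using Z(2) by (auto simp: dist_norm)
   have "C * cmod (w - z) <= e / 3" using w(2) \<eta>(2) C by (meson less_imp_le mult_left_mono order_trans)
   hence "dist (h n z) (h n w) <= e / 3" "dist (H w) (H z) <= e / 3"
    using lip[of n z w] lipH[of w z] by (auto simp: dist_norm norm_minus_commute)
   moreover have "dist (h n w) (H w) < e / 3" using elim w by blast
   ultimately show "dist (h n z) (H z) < e"
    using dist_triangle[of "h n z" "H z" "h n w"] dist_triangle[of "h n w" "H z" "H w"] by linarith
  qed
 qed
qed

text \<open>
  A common factor moves along the line and does not change the curve; this compares affine with
  homogeneous coordinates.
\<close>

lemma fs_density_scale: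
 assumes U: "open U" "z \<in> U" and \<phi>: "\<phi> holomorphic_on U" "\<phi> z ~= 0"
  and G: "!!i. i <= N ==> G i holomorphic_on U" "0 < nsq N G z"
  and F: "!!i w. i <= N ==> w \<in> U ==> F i w = \<phi> w * G i w"
 shows "fs_density N F z = fs_density N G z"
proof -
 let ?S = "nsq N G z" and ?A = "dinner N G z"
 have dF: "deriv (F i) z = deriv \<phi> z * G i z + \<phi> z * deriv (G i) z" if "i <= N" for i
 proof (rule DERIV_imp_deriv)
  have "((%w. \<phi> w * G i w) has_field_derivative deriv \<phi> z * G i z + \<phi> z * deriv (G i) z) (at z)"
   using holomorphic_derivI[OF \<phi>(1) U] holomorphic_derivI[OF G(1)[OF that] U]
   by (auto intro!: derivative_eq_intros)
  thus "(F i has_field_derivative deriv \<phi> z * G i z + \<phi> z * deriv (G i) z) (at z)"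
   using U by (rule has_field_derivative_transform_within_open) (simp add: F that)
 qed
 have Fz: "F i z = \<phi> z * G i z" if "i <= N" for i using F[OF that U(2)] .
 have SF: "nsq N F z = (cmod (\<phi> z))^2 * ?S"
  by (simp add: nsq_def Fz norm_mult power_mult_distrib sum_distrib_left)
 have SFc: "complex_of_real (nsq N F z) = \<phi> z * cnj (\<phi> z) * of_real ?S"
  unfolding SF by (simp only: of_real_mult complex_norm_square)
 have Sc: "complex_of_real ?S = (\<Sum>i\<le>N. G i z * cnj (G i z))"
  by (simp only: nsq_def of_real_sum complex_norm_square)
 have AF: "dinner N F z = deriv \<phi> z * cnj (\<phi> z) * of_real ?S + \<phi> z * cnj (\<phi> z) * ?A"
  unfolding Sc by (simp add: dinner_def dF Fz sum_distrib_left sum.distrib algebra_simps)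
 have D: "deriv (F i) z - F i z * dinner N F z / of_real (nsq N F z) = \<phi> z * (deriv (G i) z - G i z * ?A / of_real ?S)"
  if "i <= N" for i
  unfolding dF[OF that] Fz[OF that] AF SFc using \<phi>(2) G(2) by (simp add: field_simps)
 have "0 < nsq N F z" using SF \<phi>(2) G(2) by simp
 hence "fs_density N F z = (\<Sum>i\<le>N. (cmod (\<phi> z * (deriv (G i) z - G i z * ?A / of_real ?S)))^2) / nsq N F z"
  by (subst fs_density_eq_tangential) (simp_all add: D)
 also have "... = (\<Sum>i\<le>N. (cmod (deriv (G i) z - G i z * ?A / of_real ?S))^2) / ?S"
  unfolding SF norm_mult power_mult_distrib sum_distrib_left[symmetric] using \<phi>(2) by simp
 also have "... = fs_density N G z" by (rule fs_density_eq_tangential[OF G(2), symmetric])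
 finally show ?thesis .
qed

lemma continuous_on_of_Lipschitz:
 fixes h :: "complex => complex"
 assumes "!!z w. cmod (h z - h w) <= C * cmod (z - w)"
 shows "continuous_on UNIV h"
proof (rule continuous_at_imp_continuous_on, intro ballI)
 fix z
 have "((%w. h w - h z) \<longlongrightarrow> 0) (at z)"
 proof (rule Lim_null_comparison)
  show "\<forall>\<^sub>F w in at z. cmod (h w - h z) <= C * cmod (w - z)" using assms by (intro always_eventually) auto
  have "((%w. C * cmod (w - z)) \<longlongrightarrow> C * cmod (z - z)) (at z)" by (intro tendsto_intros)
  thus "((%w. C * cmod (w - z)) \<longlongrightarrow> 0) (at z)" by simp
 qed
 thus "isCont h z" unfolding isCont_def by (rule LIM_zero_cancel)
qed

text \<open>
  Projectors of a sequence of Brody curves are bounded and uniformly Lipschitz, so a subsequence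
  converges. The limit matrices are again projectors of rank one, locally with holomorphic affine coordinates, so they lift to
  entire homogeneous coordinates; derivatives converge as well, hence so does the energy density.
\<close>

theorem compact_brody_space: "compact_space (brody_space N)"
proof -
 interpret Metric_space "{f. brody_curve N f}" "cdist N" by (rule Metric_space_cdist)
 have "compact_space mtopology"
  unfolding compact_space_sequentially
 proof (intro allI impI)
  fix \<sigma> :: "nat => complex => (nat => complex) set" assume "range \<sigma> \<subseteq> {f. brody_curve N f}"
  hence \<sigma>: "brody_curve N (\<sigma> n)" for n by blast
  obtain D :: "complex set" where D: "countable D" "!!X. open X ==> X ~= {} ==> \<exists>d\<in>D. d \<in> X"
   using countable_dense_setE by blast
  define P where "P = (%n (z, i, j). pcoord N (\<sigma> n z) i j)"
  have "countable (D \<times> {..N} \<times> {..N})" using D(1) by (intro countable_SIGMA) auto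
  moreover have "norm (P n x) <= 1" if "x \<in> D \<times> {..N} \<times> {..N}" for n x
   using that norm_pcoord_le[OF brody_curve_in_CP[OF \<sigma>]] by (auto simp: P_def)
  ultimately have "\<exists>k :: nat => nat. strict_mono k & (\<forall>x\<in>D \<times> {..N} \<times> {..N}. \<exists>l. (%n. P (k n) x) \<longlonglongrightarrow> l)"
   using function_convergent_subsequence[where f=P and M=1 and S="D \<times> {..N} \<times> {..N}"] by metis
  then obtain k where k: "strict_mono (k :: nat => nat)"
   "\<forall>x\<in>D \<times> {..N} \<times> {..N}. \<exists>l. (%n. P (k n) x) \<longlonglongrightarrow> l"
   by (elim exE conjE) (rule that)
  define p where "p = (%n z. pcoord N (\<sigma> (k n) z))"
  have inCP: "\<sigma> (k n) z \<in> topspace (CP N)" for n z by (rule brody_curve_in_CP[OF \<sigma>])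
  have lip: "cmod (p n z i j - p n w i j) <= 4 * cmod (z - w)" if "i <= N" "j <= N" for n z w i j
   unfolding p_def by (rule brody_curve_pcoord_Lipschitz[OF \<sigma> that])
  have conv: "convergent (%n. p n z i j)" if ij: "i <= N" "j <= N" for z i j
  proof (rule Cauchy_convergent, rule metric_CauchyI)
   fix e :: real assume e: "e > 0"
   obtain d where d: "d \<in> D" "d \<in> ball z (e / 16)" using D(2)[of "ball z (e / 16)"] e by auto
   have "\<exists>l. (%n. p n d i j) \<longlonglongrightarrow> l" using k(2)[rule_format, of "(d, i, j)"] d(1) ij by (simp add: P_def p_def)
   hence "Cauchy (%n. p n d i j)" by (auto intro: LIMSEQ_imp_Cauchy)
   then obtain M where M: "!!m n. m >= M ==> n >= M ==> dist (p m d i j) (p n d i j) < e / 2"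
    using e unfolding Cauchy_def by (meson half_gt_zero)
   have near: "dist (p n z i j) (p n d i j) <= e / 4" for n
    using lip[OF ij, of n z d] d(2) by (simp add: dist_norm)
   have "dist (p m z i j) (p n z i j) < e" if "m >= M" "n >= M" for m n
    using near[of m] near[of n] M[OF that] dist_triangle[of "p m z i j" "p n z i j" "p m d i j"]
     dist_triangle[of "p m d i j" "p n z i j" "p n d i j"] dist_commute[of "p n d i j" "p n z i j"] by linarith
   thus "\<exists>M. \<forall>m\<ge>M. \<forall>n\<ge>M. dist (p m z i j) (p n z i j) < e" by blast
  qed
  define Q where "Q = (%z i j. lim (%n. p n z i j))"
  have Q: "(%n. p n z i j) \<longlonglongrightarrow> Q z i j" if "i <= N" "j <= N" for z i j
   unfolding Q_def using conv[OF that] by (simp only: convergent_LIMSEQ_iff)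
  have Qlip: "cmod (Q z i j - Q w i j) <= 4 * cmod (z - w)" if ij: "i <= N" "j <= N" for z w i j
  proof (rule LIMSEQ_le_const2)
   show "(%n. cmod (p n z i j - p n w i j)) \<longlonglongrightarrow> cmod (Q z i j - Q w i j)" by (intro tendsto_intros Q ij)
  qed (use lip[OF ij] in auto)
  have Qtrace: "(\<Sum>i\<le>N. Q z i i) = 1" for z
  proof (rule LIMSEQ_unique)
   show "(%n. \<Sum>i\<le>N. p n z i i) \<longlonglongrightarrow> (\<Sum>i\<le>N. Q z i i)" by (intro tendsto_sum Q) auto
   show "(%n. \<Sum>i\<le>N. p n z i i) \<longlonglongrightarrow> 1" unfolding p_def pcoord_trace[OF inCP] by simp
  qed
  have pr1: "p n z i j * p n z a b = p n z i b * p n z a j" if "i <= N" "j <= N" "a <= N" "b <= N" for n z i j a b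
   unfolding p_def by (rule pcoord_rank1(1)[OF inCP that])
  have Qr1: "Q z i j * Q z a b = Q z i b * Q z a j" if "i <= N" "j <= N" "a <= N" "b <= N" for z i j a b
  proof (rule LIMSEQ_unique)
   show "(%n. p n z i j * p n z a b) \<longlonglongrightarrow> Q z i j * Q z a b" by (intro tendsto_mult Q that)
   show "(%n. p n z i j * p n z a b) \<longlonglongrightarrow> Q z i b * Q z a j"
    unfolding pr1[OF that] by (intro tendsto_mult Q that)
  qed
  have ph: "p n z j i = cnj (p n z i j)" if "i <= N" "j <= N" for n z i j
   unfolding p_def by (rule pcoord_rank1(2)[OF inCP that that])
  have Qh: "Q z j i = cnj (Q z i j)" if "i <= N" "j <= N" for z i j
  proof (rule LIMSEQ_unique)
   show "(%n. p n z j i) \<longlonglongrightarrow> Q z j i" by (intro Q that)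
   show "(%n. p n z j i) \<longlonglongrightarrow> cnj (Q z i j)"
    unfolding ph[OF that] by (intro tendsto_cnj Q that)
  qed
  define \<kappa> where "\<kappa> = 1 / (real N + 1)"
  have \<kappa>: "\<kappa> > 0" by (simp add: \<kappa>_def)
  have big: "\<exists>j\<le>N. \<kappa> <= cmod (Q z j j)" for z
  proof (rule ccontr)
   assume "\<not> (\<exists>j\<le>N. \<kappa> <= cmod (Q z j j))"
   hence "(\<Sum>i\<le>N. cmod (Q z i i)) < (\<Sum>i\<le>N. \<kappa>)" by (intro sum_strict_mono) auto
   moreover have "1 <= (\<Sum>i\<le>N. cmod (Q z i i))" using norm_sum[of "%i. Q z i i" "{..N}"] Qtrace[of z] by simp
   moreover have "(\<Sum>i\<le>N. \<kappa>) = 1" by (simp add: \<kappa>_def field_simps)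
   ultimately show False by linarith
  qed
  have rank1: "\<exists>v. (\<exists>i\<le>N. v i ~= 0) & (\<forall>i\<le>N. \<forall>j\<le>N. Q z i j = v i * cnj (v j) / of_real (vnsq N v))" for z
  proof -
   obtain j where j: "j <= N" "\<kappa> <= cmod (Q z j j)" using big by blast
   hence jn: "Q z j j ~= 0" using \<kappa> by auto
   have "complex_of_real (vnsq N (%i. Q z i j)) = (\<Sum>i\<le>N. Q z i j * Q z j i)"
    unfolding vnsq_def of_real_sum complex_norm_square
   proof (intro sum.cong refl)
    fix i assume "i \<in> {..N}"
    hence "cnj (Q z i j) = Q z j i" using Qh[of i j z] j(1) by simp
    thus "Q z i j * cnj (Q z i j) = Q z i j * Q z j i" by simp
   qed
   also have "... = (\<Sum>i\<le>N. Q z i i) * Q z j j"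
    unfolding sum_distrib_right
   proof (intro sum.cong refl)
    fix i assume "i \<in> {..N}"
    thus "Q z i j * Q z j i = Q z i i * Q z j j" using Qr1[of i j j i z] j(1) by simp
   qed
   finally have S: "complex_of_real (vnsq N (%i. Q z i j)) = Q z j j" by (simp add: Qtrace)
   have eq: "Q z i l = Q z i j * cnj (Q z l j) / of_real (vnsq N (%i. Q z i j))" if "i <= N" "l <= N" for i l
    using Qr1[OF that(1) j(1) j(1) that(2), of z] Qh[OF that(2) j(1), of z] jn unfolding S by (simp add: field_simps)
   show ?thesis
   proof (intro exI[of _ "%i. Q z i j"] conjI allI impI)
    show "\<exists>i\<le>N. Q z i j ~= 0" using j(1) jn by (intro exI[of _ j] conjI)
   qed (rule eq)
  qed
  have "\<exists>F. homogeneous_coords N F (\<sigma> (k n)) & (\<forall>z. fs_density N F z <= pi)" for n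
   using \<sigma>[of "k n"] unfolding brody_curve_iff .
  then obtain FF where FF: "!!n. homogeneous_coords N (FF n) (\<sigma> (k n))" "!!n z. fs_density N (FF n) z <= pi"
   by metis
  define r where "r = \<kappa> / 16"
  have r: "r > 0" using \<kappa> by (simp add: r_def)
  define g where "g = (%j n i z. p n z i j / p n z j j)"
  define G where "G = (%j i z. Q z i j / Q z j j)"
  have loc: "\<exists>j\<le>N. (\<forall>z\<in>cball z0 r. Q z j j ~= 0) & (\<forall>i\<le>N. G j i holomorphic_on ball z0 r) &
    fs_density N (G j) z0 <= pi" for z0
  proof -
   obtain j where j: "j <= N" "\<kappa> <= cmod (Q z0 j j)" using big by blast
   have Qbig: "\<kappa> / 2 <= cmod (Q z j j)" if "z \<in> cball z0 r" for z
    using Qlip[OF j(1) j(1), of z0 z] norm_triangle_ineq2[of "Q z0 j j" "Q z j j"] j(2) that \<kappa>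
    by (simp add: r_def dist_norm)
   have Qnz: "Q z j j ~= 0" if "z \<in> cball z0 r" for z using Qbig[OF that] \<kappa> by auto
   have ul: "uniform_limit (cball z0 r) (%n z. p n z i j) (%z. Q z i j) sequentially" if "i <= N" for i
    by (rule uniform_limit_Lipschitz_pointwise[where C=4]) (use lip Q that j(1) in auto)
   have ulg: "uniform_limit (cball z0 r) (%n. g j n i) (G j i) sequentially" if i: "i <= N" for i
    unfolding g_def G_def
   proof (rule uniform_lim_divide[OF ul[OF i] ul[OF j(1)] _ Qbig])
    have "continuous_on (cball z0 r) (%z. Q z i j)"
    proof (rule uniform_limit_theorem[OF _ ul[OF i]])
     have "continuous_on UNIV (%z. p n z i j)" for n
      by (rule continuous_on_of_Lipschitz[where C=4]) (rule lip[OF i j(1)])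
     thus "\<forall>\<^sub>F n in sequentially. continuous_on (cball z0 r) (%z. p n z i j)"
      by (intro always_eventually allI) (rule continuous_on_subset, auto)
    qed simp
    thus "bounded ((%z. Q z i j) ` cball z0 r)" by (intro compact_imp_bounded compact_continuous_image) auto
   qed (use \<kappa> in auto)
   have "\<forall>\<^sub>F n in sequentially. dist (p n z0 j j) (Q z0 j j) < \<kappa> / 4"
    using tendstoD[OF Q[OF j(1) j(1), of z0], of "\<kappa> / 4"] \<kappa> by simp
   hence ev: "\<forall>\<^sub>F n in sequentially. \<forall>z\<in>cball z0 r. p n z j j ~= 0"
   proof eventually_elim
    case (elim n)
    show ?case
    proof
     fix z assume "z \<in> cball z0 r"
     hence "cmod (p n z0 j j - p n z j j) <= \<kappa> / 4"
      using lip[OF j(1) j(1), of n z0 z] by (simp add: r_def dist_norm)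
     thus "p n z j j ~= 0"
      using elim j(2) \<kappa> norm_triangle_ineq2[of "Q z0 j j" "Q z0 j j - p n z0 j j"]
      by (auto simp: dist_norm norm_minus_commute)
    qed
   qed
   have gF: "g j n i z = FF n i z / FF n j z" if "i <= N" for n i z
    unfolding g_def p_def homogeneous_coords_pcoord[OF FF(1) that j(1)] homogeneous_coords_pcoord[OF FF(1) j(1) j(1)]
    using homogeneous_coords_props(2)[OF FF(1)[of n], of z] by (cases "FF n j z = 0") auto
   have Fnz: "FF n j z ~= 0" if "p n z j j ~= 0" for n z
    using that unfolding p_def homogeneous_coords_pcoord[OF FF(1) j(1) j(1)] by auto
   have Fhol: "FF n i holomorphic_on A" if "i <= N" for n i A
    using homogeneous_coords_props(1)[OF FF(1) that] holomorphic_on_subset by blast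
   have evhol: "\<forall>\<^sub>F n in sequentially. \<forall>i\<le>N. g j n i holomorphic_on cball z0 r"
    using ev
   proof eventually_elim
    case (elim n)
    have "(%z. FF n i z / FF n j z) holomorphic_on cball z0 r" if "i <= N" for i
     using elim Fnz by (intro holomorphic_intros Fhol that j(1)) auto
    thus ?case using gF by (auto cong: holomorphic_cong)
   qed
   have Ghol: "G j i holomorphic_on ball z0 r" if i: "i <= N" for i
   proof (rule holomorphic_uniform_limit[OF _ ulg[OF i]])
    show "\<forall>\<^sub>F n in sequentially. continuous_on (cball z0 r) (g j n i) & g j n i holomorphic_on ball z0 r"
     using evhol
    proof eventually_elim
     case (elim n)
     hence "g j n i holomorphic_on cball z0 r" using i by blast
     thus ?case using holomorphic_on_imp_continuous_on holomorphic_on_subset[of _ "cball z0 r" "ball z0 r"] by auto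
    qed
   qed auto
   have dlim: "(%n. deriv (g j n i) z0) \<longlonglongrightarrow> deriv (G j i) z0" if i: "i <= N" for i
   proof (rule deriv_complex_uniform_limit[where A="ball z0 r"])
    show "uniform_limit (ball z0 r) (%n. g j n i) (G j i) sequentially"
     by (rule uniform_limit_on_subset[OF ulg[OF i]]) auto
    show "\<forall>\<^sub>F n in sequentially. g j n i holomorphic_on ball z0 r"
     using evhol
    proof eventually_elim
     case (elim n)
     hence "g j n i holomorphic_on cball z0 r" using i by blast
     thus ?case by (rule holomorphic_on_subset) auto
    qed
   qed (use r in auto)
   have z0: "z0 \<in> cball z0 r" using r by simp
   have vlim: "(%n. g j n i z0) \<longlonglongrightarrow> G j i z0" if i: "i <= N" for i
    unfolding g_def G_def by (intro tendsto_divide Q i j(1) Qnz z0)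
   have Gj: "G j j z0 = 1" using Qnz[OF z0] by (simp add: G_def)
   have SG: "0 < nsq N (G j) z0" unfolding nsq_pos_iff using Gj j(1) by (intro exI[of _ j]) simp
   have "(%n. fs_density N (g j n) z0) \<longlonglongrightarrow> fs_density N (G j) z0"
    using SG unfolding fs_density_def dinner_def nsq_def by (intro tendsto_intros dlim vlim) auto
   moreover have "\<forall>\<^sub>F n in sequentially. fs_density N (g j n) z0 <= pi"
    using ev evhol
   proof eventually_elim
    case (elim n)
    have gj: "g j n j z0 = 1" using elim(1) z0 by (simp add: g_def)
    have "fs_density N (FF n) z0 = fs_density N (g j n) z0"
    proof (rule fs_density_scale[of "ball z0 r" z0 "FF n j"])
     show "0 < nsq N (g j n) z0" unfolding nsq_pos_iff using gj j(1) by (intro exI[of _ j]) simp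
     show "g j n i holomorphic_on ball z0 r" if "i <= N" for i
      using elim(2) that holomorphic_on_subset[of "g j n i" "cball z0 r" "ball z0 r"] by auto
     show "FF n i w = FF n j w * g j n i w" if "i <= N" "w \<in> ball z0 r" for i w
      using Fnz elim(1) that by (auto simp: gF[OF that(1)])
     show "FF n j z0 ~= 0" using Fnz elim(1) z0 by blast
    qed (use r Fhol j(1) in auto)
    thus ?case using FF(2)[of n z0] by simp
   qed
   ultimately have "fs_density N (G j) z0 <= pi"
    by (rule tendsto_upperbound) auto
   thus ?thesis using j(1) Qnz Ghol by (intro exI[of _ j]) auto
  qed
  obtain F where F: "!!i. i <= N ==> F i holomorphic_on UNIV" "!!z. \<exists>i\<le>N. F i z ~= 0"
   "!!z i j. i <= N ==> j <= N ==> Q z i j = F i z * cnj (F j z) / of_real (nsq N F z)"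
  proof (rule holomorphic_lift[of N Q])
   show "\<exists>v. (\<exists>i\<le>N. v i ~= 0) & (\<forall>i\<le>N. \<forall>j\<le>N. Q z i j = v i * cnj (v j) / of_real (vnsq N v))" for z
    by (rule rank1)
   show "continuous_on UNIV (%z. Q z i j)" if "i <= N" "j <= N" for i j
    by (rule continuous_on_of_Lipschitz[where C=4]) (rule Qlip[OF that])
   show "\<exists>j\<le>N. \<exists>r>0. (\<forall>z\<in>ball z0 r. Q z j j ~= 0) & (\<forall>i\<le>N. (%z. Q z i j / Q z j j) holomorphic_on ball z0 r)" for z0
   proof -
    obtain j where "j <= N" "\<forall>z\<in>cball z0 r. Q z j j ~= 0" "\<forall>i\<le>N. G j i holomorphic_on ball z0 r"
     using loc[of z0] by blast
    thus ?thesis using r unfolding G_def by (intro exI[of _ j] exI[of _ r] conjI) auto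
   qed
  qed (rule that)
  have Fpos: "0 < nsq N F z" for z using F(2) by (simp add: nsq_pos_iff)
  define f where "f = (%z. proj_point N (\<lambda>i\<in>{..N}. F i z))"
  have hf: "homogeneous_coords N F f" using F(1,2) by (simp add: homogeneous_coords_def f_def)
  have "fs_density N F z0 <= pi" for z0
  proof -
   obtain j where j: "j <= N" "\<forall>z\<in>cball z0 r. Q z j j ~= 0" "\<forall>i\<le>N. G j i holomorphic_on ball z0 r"
    "fs_density N (G j) z0 <= pi" using loc[of z0] by blast
   have Fj: "F j z ~= 0" if "z \<in> cball z0 r" for z using j(1,2) that F(3) by auto
   have GF: "G j i z = F i z / F j z" if "i <= N" "z \<in> cball z0 r" for i z
    using Fpos[of z] Fj[OF that(2)] j(1) that(1) by (simp add: G_def F(3))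
   have "fs_density N F z0 = fs_density N (G j) z0"
   proof (rule fs_density_scale[of "ball z0 r" z0 "F j"])
    have "G j j z0 ~= 0" using GF[OF j(1), of z0] Fj[of z0] r by simp
    thus "0 < nsq N (G j) z0" unfolding nsq_pos_iff using j(1) by blast
    show "F j holomorphic_on ball z0 r" using F(1)[OF j(1)] by (rule holomorphic_on_subset) auto
    show "F i w = F j w * G j i w" if "i <= N" "w \<in> ball z0 r" for i w
     using Fj[of w] GF[OF that(1), of w] that(2) by simp
   qed (use r j Fj in auto)
   thus ?thesis using j(4) by simp
  qed
  hence fB: "brody_curve N f" unfolding brody_curve_iff using hf by blast
  have lim: "(%n. pdist N (f z) (\<sigma> (k n) z)) \<longlonglongrightarrow> 0" for z
  proof -
   have "(%n. \<Sum>i\<le>N. \<Sum>j\<le>N. cmod (Q z i j - p n z i j)) \<longlonglongrightarrow> (\<Sum>i\<le>N. \<Sum>j\<le>N. cmod (Q z i j - Q z i j))"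
    by (intro tendsto_intros Q) auto
   thus ?thesis by (simp add: pdist_def p_def homogeneous_coords_pcoord[OF hf] F(3))
  qed
  have "limitin mtopology (\<sigma> \<circ> k) f sequentially"
   unfolding limitin_metric
  proof (intro conjI allI impI)
   show "f \<in> {f. brody_curve N f}" using fB by simp
   fix e :: real assume "e > 0"
   obtain Z \<delta> where Z: "finite Z" "0 < \<delta>"
    "\<forall>f g. brody_curve N f --> brody_curve N g --> (\<forall>z\<in>Z. pdist N (f z) (g z) < \<delta>) --> cdist N f g < e"
    using cdist_less_criterion[OF \<open>e > 0\<close>, of N] by (elim exE conjE) (rule that)
   have "\<forall>\<^sub>F n in sequentially. \<forall>z\<in>Z. pdist N (f z) (\<sigma> (k n) z) < \<delta>"
    using Z(1,2) lim by (intro eventually_ball_finite ballI order_tendstoD(2)[of _ 0]) auto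
   thus "\<forall>\<^sub>F n in sequentially. (\<sigma> \<circ> k) n \<in> {f. brody_curve N f} & cdist N ((\<sigma> \<circ> k) n) f < e"
   proof eventually_elim
    case (elim n)
    hence "cdist N f (\<sigma> (k n)) < e" using Z(3)[rule_format, OF fB \<sigma>] by blast
    thus ?case using \<sigma> commute[of f "\<sigma> (k n)"] by simp
   qed
  qed
  thus "\<exists>l r. l \<in> {f. brody_curve N f} & strict_mono r & limitin mtopology (\<sigma> \<circ> r) l sequentially"
   using fB k(1) by blast
 qed
 thus ?thesis using mtopology_cdist[of N] by simp
qed

section \<open>Products of hyperbolic sines with prescribed zeros\<close>

lemma sum_geometric_le:
 fixes q :: real
 assumes "0 <= q" "q < 1" "finite J"
 shows "(\<Sum>j\<in>J. q ^ j) <= 1 / (1 - q)"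
proof -
 have "(\<Sum>j\<in>J. q ^ j) <= (\<Sum>j. q ^ j)"
  using assms by (intro sum_le_suminf summable_geometric) auto
 also have "... = 1 / (1 - q)" using assms by (intro suminf_geometric) auto
 finally show ?thesis .
qed

lemma sum_exp_dist_le:
 fixes S :: "int set" and b X :: real
 assumes b: "0 < b" and S: "finite S"
 shows "(\<Sum>n\<in>S. exp (- \<bar>b * of_int n - X\<bar>)) <= 2 / (1 - exp (- b))"
proof -
 define q where "q = exp (- b)"
 have q: "0 <= q" "q < 1" using b by (auto simp: q_def)
 define k where "k = \<lfloor>X / b\<rfloor>"
 have k: "b * of_int k <= X" "X <= b * (of_int k + 1)"
 proof -
  have "of_int k <= X / b" "X / b <= of_int k + 1" unfolding k_def by linarith+
  thus "b * of_int k <= X" "X <= b * (of_int k + 1)" using b by (auto simp: field_simps)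
 qed
 let ?A = "{n\<in>S. n <= k}" and ?B = "{n\<in>S. k < n}"
 have A: "(\<Sum>n\<in>?A. exp (- \<bar>b * of_int n - X\<bar>)) <= 1 / (1 - q)"
 proof -
  have "(\<Sum>n\<in>?A. exp (- \<bar>b * of_int n - X\<bar>)) <= (\<Sum>n\<in>?A. q ^ nat (k - n))"
  proof (rule sum_mono)
   fix n assume n: "n \<in> ?A"
   have "q ^ nat (k - n) = exp (- (b * of_int (k - n)))"
    unfolding q_def exp_of_nat_mult[symmetric] using n by simp
   moreover have "b * of_int (k - n) <= \<bar>b * of_int n - X\<bar>" using k by (simp add: algebra_simps)
   ultimately show "exp (- \<bar>b * of_int n - X\<bar>) <= q ^ nat (k - n)" by simp
  qed
  also have "... = (\<Sum>j\<in>(%n. nat (k - n)) ` ?A. q ^ j)"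
   by (subst sum.reindex) (auto simp: inj_on_def)
  also have "... <= 1 / (1 - q)" using S by (intro sum_geometric_le q) auto
  finally show ?thesis .
 qed
 have B: "(\<Sum>n\<in>?B. exp (- \<bar>b * of_int n - X\<bar>)) <= 1 / (1 - q)"
 proof -
  have "(\<Sum>n\<in>?B. exp (- \<bar>b * of_int n - X\<bar>)) <= (\<Sum>n\<in>?B. q ^ nat (n - k - 1))"
  proof (rule sum_mono)
   fix n assume n: "n \<in> ?B"
   have "q ^ nat (n - k - 1) = exp (- (b * of_int (n - k - 1)))"
    unfolding q_def exp_of_nat_mult[symmetric] using n by simp
   moreover have "b * of_int (n - k - 1) <= \<bar>b * of_int n - X\<bar>" using k by (simp add: algebra_simps)
   ultimately show "exp (- \<bar>b * of_int n - X\<bar>) <= q ^ nat (n - k - 1)" by simp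
  qed
  also have "... = (\<Sum>j\<in>(%n. nat (n - k - 1)) ` ?B. q ^ j)"
   by (subst sum.reindex) (auto simp: inj_on_def)
  also have "... <= 1 / (1 - q)" using S by (intro sum_geometric_le q) auto
  finally show ?thesis .
 qed
 have "(\<Sum>n\<in>S. exp (- \<bar>b * of_int n - X\<bar>)) =
   (\<Sum>n\<in>?A. exp (- \<bar>b * of_int n - X\<bar>)) + (\<Sum>n\<in>?B. exp (- \<bar>b * of_int n - X\<bar>))"
  using S by (subst sum.union_disjoint[symmetric]) (auto intro!: sum.cong)
 thus ?thesis using A B by (simp add: q_def)
qed

lemma sum_exp_dist_nat_le:
 fixes b X :: real
 assumes "0 < b"
 shows "(\<Sum>l\<in>{1..L}. exp (- \<bar>b * real l - X\<bar>)) <= 2 / (1 - exp (- b))"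
proof -
 have "(\<Sum>l\<in>{1..L}. exp (- \<bar>b * real l - X\<bar>)) = (\<Sum>n\<in>int ` {1..L}. exp (- \<bar>b * of_int n - X\<bar>))"
  by (subst sum.reindex) auto
 also have "... <= 2 / (1 - exp (- b))" using assms by (intro sum_exp_dist_le) auto
 finally show ?thesis .
qed

lemma sum_pos_part_eq:
 fixes b X :: real
 assumes "0 < b" "0 <= X"
 shows "(\<Sum>l\<in>{1..L}. max 0 (X - b * real l)) =
   (let m = real (min L (nat \<lfloor>X / b\<rfloor>)) in m * X - b * m * (m + 1) / 2)"
proof -
 define k where "k = nat \<lfloor>X / b\<rfloor>"
 have k: "b * real k <= X" "X <= b * (real k + 1)"
 proof -
  have "0 <= X / b" using assms by simp
  hence "real k <= X / b" "X / b <= real k + 1" unfolding k_def by linarith+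
  thus "b * real k <= X" "X <= b * (real k + 1)" using assms by (auto simp: field_simps)
 qed
 have "(\<Sum>l\<in>{1..L}. max 0 (X - b * real l)) = (\<Sum>l\<in>{1..min L k}. X - b * real l)"
 proof (rule sum.mono_neutral_cong_right)
  show "\<forall>l\<in>{1..L} - {1..min L k}. max 0 (X - b * real l) = 0"
  proof
   fix l assume "l \<in> {1..L} - {1..min L k}"
   hence "real k + 1 <= real l" by auto
   hence "b * (real k + 1) <= b * real l" using assms by simp
   thus "max 0 (X - b * real l) = 0" using k by simp
  qed
  show "max 0 (X - b * real l) = X - b * real l" if "l \<in> {1..min L k}" for l
  proof -
   have "b * real l <= b * real k" using that assms by simp
   thus ?thesis using k by simp
  qed
 qed auto
 also have "... = real (min L k) * X - b * real (min L k) * (real (min L k) + 1) / 2"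
 proof -
  have "(\<Sum>l\<in>{1..m}. X - b * real l) = real m * X - b * real m * (real m + 1) / 2" for m
   by (induction m) (simp_all add: field_simps)
  thus ?thesis .
 qed
 finally show ?thesis by (simp add: k_def Let_def)
qed

text \<open>
  The sum is the logarithmic size of the products below; it is quadratic in \<open>X\<close> up to
  bounded terms.
\<close>

lemma sum_pos_part_le:
 fixes b X :: real
 assumes "0 < b" "0 <= X"
 shows "(\<Sum>l\<in>{1..L}. max 0 (X - b * real l)) <= X^2 / (2 * b) - X / 2 + b / 8"
proof -
 have "m * X - b * m * (m + 1) / 2 <= X^2 / (2 * b) - X / 2 + b / 8" for m
 proof -
  have "X^2 / (2 * b) - X / 2 + b / 8 - (m * X - b * m * (m + 1) / 2) = (X - b / 2 - b * m)^2 / (2 * b)"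
   using assms(1) by (simp add: field_simps power2_eq_square)
  moreover have "0 <= (X - b / 2 - b * m)^2 / (2 * b)" using assms(1) by simp
  ultimately show ?thesis by linarith
 qed
 thus ?thesis unfolding sum_pos_part_eq[OF assms] Let_def .
qed

lemma sum_pos_part_ge:
 fixes b X :: real
 assumes "0 < b" "0 <= X" "X <= b * (real L + 1)"
 shows "X^2 / (2 * b) - X / 2 <= (\<Sum>l\<in>{1..L}. max 0 (X - b * real l))"
proof -
 define m where "m = real (min L (nat \<lfloor>X / b\<rfloor>))"
 have m: "b * m <= X" "X <= b * (m + 1)"
 proof -
  have "0 <= X / b" using assms by simp
  hence "real (nat \<lfloor>X / b\<rfloor>) <= X / b" "X / b <= real (nat \<lfloor>X / b\<rfloor>) + 1" by linarith+
  moreover have "X / b <= real L + 1" using assms by (simp add: field_simps)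
  ultimately have "m <= X / b" "X / b <= m + 1" unfolding m_def by (auto simp: min_def)
  thus "b * m <= X" "X <= b * (m + 1)" using assms by (auto simp: field_simps)
 qed
 have "m * X - b * m * (m + 1) / 2 - (X^2 / (2 * b) - X / 2) = (X - b * m) * (b * (m + 1) - X) / (2 * b)"
  using assms(1) by (simp add: field_simps power2_eq_square)
 moreover have "0 <= (X - b * m) * (b * (m + 1) - X) / (2 * b)" using m assms(1) by simp
 ultimately show ?thesis unfolding sum_pos_part_eq[OF assms(1,2)] Let_def m_def[symmetric] by linarith
qed

lemma norm_sinh_squared: "(cmod (sinh z))^2 = (sinh (Re z))^2 + (sin (Im z))^2"
proof -
 have "Re (sinh z) = sinh (Re z) * cos (Im z)" "Im (sinh z) = cosh (Re z) * sin (Im z)"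
  by (simp_all add: sinh_field_def cosh_field_def Re_exp Im_exp left_diff_distrib distrib_right)
 hence "(cmod (sinh z))^2 = (sinh (Re z))^2 * (cos (Im z))^2 + (cosh (Re z))^2 * (sin (Im z))^2"
  by (simp add: cmod_power2 power_mult_distrib)
 also have "... = (sinh (Re z))^2 * ((cos (Im z))^2 + (sin (Im z))^2) + (sin (Im z))^2"
  unfolding cosh_square_eq by algebra
 finally show ?thesis by simp
qed

lemma norm_sinh_le: "cmod (sinh z) <= cosh (Re z)"
proof (rule power2_le_imp_le)
 have "(sin (Im z))^2 <= 1" by (simp add: abs_square_le_1)
 thus "(cmod (sinh z))^2 <= (cosh (Re z))^2" unfolding norm_sinh_squared cosh_square_eq by simp
qed simp

lemma norm_sinh_ge: "\<bar>sinh (Re z)\<bar> <= cmod (sinh z)"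
proof (rule power2_le_imp_le)
 show "\<bar>sinh (Re z)\<bar>^2 <= (cmod (sinh z))^2" unfolding norm_sinh_squared by simp
qed simp

lemma norm_sinh_eq_cosh:
 assumes "cos (Im z) = 0"
 shows "cmod (sinh z) = cosh (Re z)"
proof (rule power2_eq_imp_eq)
 have "(sin (Im z))^2 = 1" using assms sin_cos_squared_add[of "Im z"] by simp
 thus "(cmod (sinh z))^2 = (cosh (Re z))^2" unfolding norm_sinh_squared cosh_square_eq by simp
qed simp_all

lemma cosh_add_cosh:
 "2 * (cosh B + cosh X) = exp (max B X) * (1 + exp (- (B + X))) * (1 + exp (- \<bar>B - X\<bar>))" for B X :: real
proof (cases "B <= X")
 case True
 hence "exp (max B X) * (1 + exp (- (B + X))) * (1 + exp (- \<bar>B - X\<bar>)) =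
   exp X + exp (X + - (B + X)) + exp (X + - (X - B)) + exp (X + - (B + X) + - (X - B))"
  unfolding exp_add by (simp add: algebra_simps max_def)
 thus ?thesis by (simp add: cosh_field_def field_simps)
next
 case False
 hence "exp (max B X) * (1 + exp (- (B + X))) * (1 + exp (- \<bar>B - X\<bar>)) =
   exp B + exp (B + - (B + X)) + exp (B + - (B - X)) + exp (B + - (B + X) + - (B - X))"
  unfolding exp_add by (simp add: algebra_simps max_def)
 thus ?thesis by (simp add: cosh_field_def field_simps)
qed

lemma cosh_diff_cosh:
 "2 * \<bar>cosh B - cosh X\<bar> = exp (max B X) * (1 - exp (- (B + X))) * (1 - exp (- \<bar>B - X\<bar>))"
 if "0 <= B" "0 <= X" for B X :: real
proof (cases "B <= X")
 case True
 hence "exp (max B X) * (1 - exp (- (B + X))) * (1 - exp (- \<bar>B - X\<bar>)) =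
   exp X - exp (X + - (B + X)) - exp (X + - (X - B)) + exp (X + - (B + X) + - (X - B))"
  unfolding exp_add by (simp add: algebra_simps max_def)
 also have "... = 2 * (cosh X - cosh B)" by (simp add: cosh_field_def field_simps)
 also have "cosh X - cosh B = \<bar>cosh B - cosh X\<bar>" using True that by (simp add: cosh_real_nonneg_le_iff)
 finally show ?thesis by simp
next
 case False
 hence "exp (max B X) * (1 - exp (- (B + X))) * (1 - exp (- \<bar>B - X\<bar>)) =
   exp B - exp (B + - (B + X)) - exp (B + - (B - X)) + exp (B + - (B + X) + - (B - X))"
  unfolding exp_add by (simp add: algebra_simps max_def)
 also have "... = 2 * (cosh B - cosh X)" by (simp add: cosh_field_def field_simps)
 also have "cosh B - cosh X = \<bar>cosh B - cosh X\<bar>" using False that by (simp add: cosh_real_nonneg_le_iff)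
 finally show ?thesis by simp
qed

lemma exp_le_one_minus:
 fixes x y :: real
 assumes "x <= y" "y < 1" "0 <= x"
 shows "exp (- (x / (1 - y))) <= 1 - x"
proof -
 have "1 / (1 - x) = 1 + x / (1 - x)" using assms by (simp add: field_simps)
 also have "... <= 1 + x / (1 - y)" using assms by (intro add_left_mono divide_left_mono) auto
 also have "... <= exp (x / (1 - y))" by (rule exp_ge_add_one_self)
 finally show ?thesis using assms unfolding exp_minus by (simp add: field_simps)
qed

text \<open>
  An even function of \<open>w\<close>, normalised to \<open>1\<close> at \<open>0\<close>, with simple zeros at \<open>\<plusminus>tl + \<i>\<int>\<close>.
\<close>

definition sfac :: "real => nat => complex => complex" where
 "sfac t l w = sinh (of_real (pi * t * real l) + of_real pi * w) * sinh (of_real (pi * t * real l) - of_real pi * w)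
   / of_real ((sinh (pi * t * real l))^2)"

text \<open>
  Together with \<open>sinh (\<pi>w)\<close> this is a finite version of the sigma function of the lattice \<open>t\<int> + \<i>\<int>\<close>:
  it vanishes on the columns \<open>1 \<le> \<bar>l\<bar> \<le> L\<close> of the lattice.
\<close>

definition sprod :: "real => nat => complex => complex" where
 "sprod t L w = (\<Prod>l\<in>{1..L}. sfac t l w)"

context
 fixes t :: real
 assumes t: "0 < t"
begin

lemma sinh_half_squared: "2 * (sinh (pi * t * real l))^2 = (1 / 2) * (exp (2 * pi * t * real l) * (1 - exp (- (2 * pi * t * real l)))^2)"
proof -
 let ?B = "2 * pi * t * real l"
 have "2 * (sinh (pi * t * real l))^2 = cosh ?B - 1"
  using cosh_double[of "pi * t * real l"] cosh_square_eq[of "pi * t * real l"] by (simp add: mult.assoc)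
 also have "... = (1 / 2) * (exp ?B - 2 + exp (- ?B))" by (simp add: cosh_field_def)
 also have "exp ?B - 2 + exp (- ?B) = exp ?B * (1 - exp (- ?B))^2"
  by (simp add: power2_eq_square algebra_simps flip: exp_add)
 finally show ?thesis .
qed

text \<open>
  A factor has size \<open>1\<close> for \<open>\<bar>Re w\<bar> < tl\<close> and size \<open>exp (2\<pi> (\<bar>Re w\<bar> - tl))\<close> beyond, with errors that
  are summable over \<open>l\<close>.
\<close>

lemma norm_sfac_le:
 fixes w :: complex
 assumes l: "1 <= l"
 defines "B \<equiv> 2 * pi * t * real l" and "b \<equiv> 2 * pi * t" and "X \<equiv> 2 * pi * \<bar>Re w\<bar>"
 shows "cmod (sfac t l w) <= exp (max 0 (X - B) + ((1 + 2 / (1 - exp (- b))) * exp (- B) + exp (- \<bar>B - X\<bar>)))"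
proof -
 have b: "0 < b" "b <= B" using t l by (auto simp: b_def B_def)
 let ?y = "exp (- B)"
 have y: "?y <= exp (- b)" "exp (- b) < 1" "?y < 1" using b by auto
 have "cmod (sinh (of_real (pi * t * real l) + of_real pi * w) * sinh (of_real (pi * t * real l) - of_real pi * w)) \<le>
   cosh (pi * t * real l + pi * Re w) * cosh (pi * t * real l - pi * Re w)"
  unfolding norm_mult using norm_sinh_le[of "of_real (pi * t * real l) + of_real pi * w"]
   norm_sinh_le[of "of_real (pi * t * real l) - of_real pi * w"]
  by (intro mult_mono) auto
 also have "... = (cosh B + cosh X) / 2"
 proof -
  have "2 * (cosh (p + q) * cosh (p - q)) = cosh (2 * p) + cosh (2 * q)" for p q :: real
  proof -
   have "cosh ((p + q) + (p - q)) + cosh ((p + q) - (p - q)) = 2 * (cosh (p + q) * cosh (p - q))"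
    unfolding cosh_add[of "p + q" "p - q"] cosh_diff[of "p + q" "p - q"] by simp
   moreover have "(p + q) + (p - q) = 2 * p" "(p + q) - (p - q) = 2 * q" by simp_all
   ultimately show ?thesis by simp
  qed
  from this[of "pi * t * real l" "pi * Re w"] show ?thesis
   by (cases "0 <= Re w") (simp_all add: B_def X_def mult.assoc)
 qed
 finally have num: "2 * cmod (sinh (of_real (pi * t * real l) + of_real pi * w) * sinh (of_real (pi * t * real l) - of_real pi * w))
   <= (1 / 2) * (exp (max B X) * (1 + exp (- (B + X))) * (1 + exp (- \<bar>B - X\<bar>)))"
  using cosh_add_cosh[of B X] by simp
 have den: "2 * (sinh (pi * t * real l))^2 = (1 / 2) * (exp B * (1 - ?y)^2)"
  using sinh_half_squared[of l] by (simp add: B_def)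
 have "cmod (sfac t l w) = (2 * cmod (sinh (of_real (pi * t * real l) + of_real pi * w) * sinh (of_real (pi * t * real l) - of_real pi * w)))
   / (2 * (sinh (pi * t * real l))^2)"
  by (simp add: sfac_def norm_divide norm_power)
 also have "... <= ((1 / 2) * (exp (max B X) * (1 + exp (- (B + X))) * (1 + exp (- \<bar>B - X\<bar>)))) / ((1 / 2) * (exp B * (1 - ?y)^2))"
  unfolding den by (intro divide_right_mono num) auto
 also have "... = exp (max B X - B) * (1 + exp (- (B + X))) * (1 + exp (- \<bar>B - X\<bar>)) * (1 / (1 - ?y))^2"
 proof -
  have "(1 / 2 * (E * P * R)) / (1 / 2 * (F * Y^2)) = E / F * P * R * (1 / Y)^2" for E P R F Y :: real
   by (simp add: power_divide)
  thus ?thesis unfolding exp_diff .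
 qed
 also have "... <= exp (max 0 (X - B)) * exp ?y * exp (exp (- \<bar>B - X\<bar>)) * (exp (?y / (1 - exp (- b))))^2"
 proof (intro mult_mono power_mono)
  show "exp (max B X - B) <= exp (max 0 (X - B))" by simp
  have "exp (- (B + X)) <= ?y" by (simp add: X_def)
  thus "1 + exp (- (B + X)) <= exp ?y" using exp_ge_add_one_self[of ?y] by linarith
  show "1 + exp (- \<bar>B - X\<bar>) <= exp (exp (- \<bar>B - X\<bar>))" by (rule exp_ge_add_one_self)
  have "1 / (1 - ?y) = 1 + ?y / (1 - ?y)" using y by (simp add: field_simps)
  also have "... <= 1 + ?y / (1 - exp (- b))" using y by (intro add_left_mono divide_left_mono) auto
  also have "... <= exp (?y / (1 - exp (- b)))" by (rule exp_ge_add_one_self)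
  finally show "1 / (1 - ?y) <= exp (?y / (1 - exp (- b)))" .
 qed (use y in auto)
 also have "... = exp (max 0 (X - B) + ?y + exp (- \<bar>B - X\<bar>) + 2 * (?y / (1 - exp (- b))))"
  by (simp only: exp_add exp_double)
 also have "max 0 (X - B) + ?y + exp (- \<bar>B - X\<bar>) + 2 * (?y / (1 - exp (- b))) =
   max 0 (X - B) + ((1 + 2 / (1 - exp (- b))) * ?y + exp (- \<bar>B - X\<bar>))"
  by (simp add: algebra_simps)
 finally show ?thesis .
qed

lemma norm_sprod_le:
 defines "b \<equiv> 2 * pi * t"
 shows "cmod (sprod t L w) <= exp (pi * (Re w)^2 / t - pi * \<bar>Re w\<bar> + b / 8 +
   (1 + 2 / (1 - exp (- b))) * (2 / (1 - exp (- b))) + 2 / (1 - exp (- b)))"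
proof -
 define X where "X = 2 * pi * \<bar>Re w\<bar>"
 have b: "0 < b" using t by (simp add: b_def)
 have eb: "exp (- b) < 1" using b by simp
 have "cmod (sprod t L w) = (\<Prod>l\<in>{1..L}. cmod (sfac t l w))" by (simp add: sprod_def prod_norm)
 also have "... <= (\<Prod>l\<in>{1..L}. exp (max 0 (X - b * real l) + ((1 + 2 / (1 - exp (- b))) * exp (- (b * real l)) + exp (- \<bar>b * real l - X\<bar>))))"
  using norm_sfac_le[of _ w] by (intro prod_mono) (auto simp: b_def X_def)
 also have "... = exp ((\<Sum>l\<in>{1..L}. max 0 (X - b * real l)) + ((1 + 2 / (1 - exp (- b))) * (\<Sum>l\<in>{1..L}. exp (- (b * real l))) +
    (\<Sum>l\<in>{1..L}. exp (- \<bar>b * real l - X\<bar>))))"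
  by (simp add: exp_sum[symmetric] sum.distrib sum_distrib_left)
 also have "... <= exp ((X^2 / (2 * b) - X / 2 + b / 8) + ((1 + 2 / (1 - exp (- b))) * (2 / (1 - exp (- b))) + 2 / (1 - exp (- b))))"
 proof -
  have "(\<Sum>l\<in>{1..L}. max 0 (X - b * real l)) <= X^2 / (2 * b) - X / 2 + b / 8"
   by (rule sum_pos_part_le[OF b]) (simp add: X_def)
  moreover have "(\<Sum>l\<in>{1..L}. exp (- (b * real l))) <= 2 / (1 - exp (- b))"
   using sum_exp_dist_nat_le[OF b, where X=0 and L=L] b by simp
  hence "(1 + 2 / (1 - exp (- b))) * (\<Sum>l\<in>{1..L}. exp (- (b * real l))) <= (1 + 2 / (1 - exp (- b))) * (2 / (1 - exp (- b)))"
   using eb by (intro mult_left_mono) auto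
  moreover have "(\<Sum>l\<in>{1..L}. exp (- \<bar>b * real l - X\<bar>)) <= 2 / (1 - exp (- b))"
   by (rule sum_exp_dist_nat_le[OF b])
  ultimately show ?thesis unfolding exp_le_cancel_iff by linarith
 qed
 also have "X^2 / (2 * b) - X / 2 = pi * (Re w)^2 / t - pi * \<bar>Re w\<bar>"
  using t by (simp add: X_def b_def power_mult_distrib) (simp add: field_simps power2_eq_square)
 finally show ?thesis by (simp add: add.assoc)
qed

text \<open>
  The same size from below, away from the zeros: either on horizontal lines halfway between the rows of zeros,
  where \<open>\<bar>sinh\<bar>\<close> equals \<open>cosh\<close> of the real part, or on vertical lines halfway between columns.
\<close>

lemma norm_sfac_ge:
 fixes w :: complex
 assumes l: "1 <= l" and bdry: "cos (pi * Im w) = 0 \<or> (\<exists>K::nat. \<bar>Re w\<bar> = t * (real K + 1 / 2))"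
 defines "B \<equiv> 2 * pi * t * real l" and "b \<equiv> 2 * pi * t" and "X \<equiv> 2 * pi * \<bar>Re w\<bar>"
 shows "exp (max 0 (X - B) - exp (- \<bar>B - X\<bar>) / (1 - exp (- (b / 2)))) <= cmod (sfac t l w)"
proof -
 have b: "0 < b" "b <= B" using t l by (auto simp: b_def B_def)
 have X0: "0 <= X" by (simp add: X_def)
 let ?y = "exp (- B)" and ?d = "exp (- \<bar>B - X\<bar>)"
 have y: "0 < ?y" "?y < 1" using b by auto
 have den: "2 * (sinh (pi * t * real l))^2 = (1 / 2) * (exp B * (1 - ?y)^2)"
  using sinh_half_squared[of l] by (simp add: B_def)
 let ?s1 = "sinh (of_real (pi * t * real l) + of_real pi * w)" and ?s2 = "sinh (of_real (pi * t * real l) - of_real pi * w)"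
 have eq: "cmod (sfac t l w) = (2 * (cmod ?s1 * cmod ?s2)) / (2 * (sinh (pi * t * real l))^2)"
  by (simp add: sfac_def norm_divide norm_power norm_mult)
 have arith: "(1 / 2 * (E * P * R)) / (1 / 2 * (F * Y^2)) = E / F * (P / Y^2) * R" for E P R F Y :: real
  by simp
 have maxe: "exp (max B X) / exp B = exp (max 0 (X - B))" by (simp add: max_def flip: exp_diff)
 have Y2: "(1 - ?y)^2 <= 1 - ?y" using y power_le_one[of "1 - ?y"] by (simp add: power2_eq_square mult_left_le)
 have Yp: "0 < (1 - ?y)^2" using y by simp
 have cs: "cosh (2 * p) + cosh (2 * q) = 2 * (cosh (p + q) * cosh (p - q))" "cosh (2 * p) - cosh (2 * q) = 2 * (sinh (p + q) * sinh (p - q))" for p q :: real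
 proof -
  have e: "(p + q) + (p - q) = 2 * p" "(p + q) - (p - q) = 2 * q" by simp_all
  show "cosh (2 * p) + cosh (2 * q) = 2 * (cosh (p + q) * cosh (p - q))" "cosh (2 * p) - cosh (2 * q) = 2 * (sinh (p + q) * sinh (p - q))"
   unfolding e[symmetric] cosh_add[of "p + q" "p - q"] cosh_diff[of "p + q" "p - q"] by simp_all
 qed
 have BX: "2 * (pi * t * real l) = B" "cosh (2 * (pi * Re w)) = cosh X"
  by (simp add: B_def) (cases "0 <= Re w"; simp add: X_def mult.assoc)
 show ?thesis
 proof (cases "cos (pi * Im w) = 0")
  case True
  have "cmod ?s1 * cmod ?s2 = cosh (pi * t * real l + pi * Re w) * cosh (pi * t * real l - pi * Re w)"
   using norm_sinh_eq_cosh[of "of_real (pi * t * real l) + of_real pi * w"]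
    norm_sinh_eq_cosh[of "of_real (pi * t * real l) - of_real pi * w"] True by simp
  hence "2 * (cmod ?s1 * cmod ?s2) = (1 / 2) * (exp (max B X) * (1 + exp (- (B + X))) * (1 + ?d))"
   using cs(1)[of "pi * t * real l" "pi * Re w"] cosh_add_cosh[of B X] by (simp add: BX)
  hence "cmod (sfac t l w) = exp (max 0 (X - B)) * ((1 + exp (- (B + X))) / (1 - ?y)^2) * (1 + ?d)"
   unfolding eq den arith maxe[symmetric] by simp
  moreover have "1 <= (1 + exp (- (B + X))) / (1 - ?y)^2"
  proof -
   have "(1 - ?y)^2 <= 1 + exp (- (B + X))" using Y2 y exp_gt_zero[of "- (B + X)"] by linarith
   thus ?thesis using Yp by simp
  qed
  ultimately have "exp (max 0 (X - B)) * 1 * 1 <= cmod (sfac t l w)"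
   by (simp only:) (intro mult_mono, auto)
  moreover have "exp (max 0 (X - B) - ?d / (1 - exp (- (b / 2)))) <= exp (max 0 (X - B))" using b by simp
  ultimately show ?thesis by linarith
 next
  case False
  then obtain K :: nat where K: "\<bar>Re w\<bar> = t * (real K + 1 / 2)" using bdry by blast
  have XK: "X = b * (real K + 1 / 2)" by (simp add: X_def b_def K)
  have gap: "b / 2 <= \<bar>B - X\<bar>"
  proof -
   have "B - X = b * (real l - real K - 1 / 2)" by (simp add: XK B_def b_def algebra_simps)
   hence "\<bar>B - X\<bar> = b * \<bar>real l - real K - 1 / 2\<bar>" using b by (simp add: abs_mult)
   moreover have "1 / 2 <= \<bar>real l - real K - 1 / 2\<bar>"
   proof (cases "l <= K")
    case True hence "real l <= real K" by simp thus ?thesis by linarith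
   next
    case False hence "real K + 1 <= real l" by simp thus ?thesis by linarith
   qed
   ultimately show ?thesis using b mult_left_mono[of "1 / 2" "\<bar>real l - real K - 1 / 2\<bar>" b] by simp
  qed
  have "\<bar>sinh (pi * t * real l + pi * Re w)\<bar> * \<bar>sinh (pi * t * real l - pi * Re w)\<bar> <= cmod ?s1 * cmod ?s2"
   using norm_sinh_ge[of "of_real (pi * t * real l) + of_real pi * w"]
    norm_sinh_ge[of "of_real (pi * t * real l) - of_real pi * w"] by (intro mult_mono) auto
  moreover have "2 * (\<bar>sinh (pi * t * real l + pi * Re w)\<bar> * \<bar>sinh (pi * t * real l - pi * Re w)\<bar>) =
    (1 / 2) * (exp (max B X) * (1 - exp (- (B + X))) * (1 - ?d))"
   using cs(2)[of "pi * t * real l" "pi * Re w"] cosh_diff_cosh[of B X] b X0 by (simp add: BX abs_mult)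
  ultimately have "(1 / 2) * (exp (max B X) * (1 - exp (- (B + X))) * (1 - ?d)) <= 2 * (cmod ?s1 * cmod ?s2)" by linarith
  hence "(1 / 2) * (exp (max B X) * (1 - exp (- (B + X))) * (1 - ?d)) / ((1 / 2) * (exp B * (1 - ?y)^2)) <= cmod (sfac t l w)"
   unfolding eq den by (intro divide_right_mono) auto
  hence 1: "exp (max 0 (X - B)) * ((1 - exp (- (B + X))) / (1 - ?y)^2) * (1 - ?d) <= cmod (sfac t l w)"
   unfolding arith maxe .
  have d: "?d <= exp (- (b / 2))" "exp (- (b / 2)) < 1" using gap b by auto
  have "(1 - ?y)^2 <= 1 - exp (- (B + X))" using Y2 X0 by (intro order_trans[OF Y2]) simp
  hence "1 <= (1 - exp (- (B + X))) / (1 - ?y)^2" using Yp by simp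
  moreover have "0 <= 1 - ?d" using d by linarith
  ultimately have "exp (max 0 (X - B)) * 1 * (1 - ?d) <= exp (max 0 (X - B)) * ((1 - exp (- (B + X))) / (1 - ?y)^2) * (1 - ?d)"
   by (intro mult_right_mono mult_left_mono) (simp_all only: exp_ge_zero)
  moreover have "exp (max 0 (X - B)) * exp (- (?d / (1 - exp (- (b / 2))))) <= exp (max 0 (X - B)) * (1 - ?d)"
   by (intro mult_left_mono exp_le_one_minus d) simp_all
  ultimately have "exp (max 0 (X - B)) * exp (- (?d / (1 - exp (- (b / 2))))) <= cmod (sfac t l w)" using 1 by linarith
  thus ?thesis by (simp flip: exp_add)
 qed
qed

definition ssig_up :: real where
 "ssig_up = exp (2 * pi * t / 8 + (1 + 2 / (1 - exp (- (2 * pi * t)))) * (2 / (1 - exp (- (2 * pi * t)))) + 2 / (1 - exp (- (2 * pi * t))))"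

lemma ssig_up_pos: "0 < ssig_up" by (simp add: ssig_up_def)

lemma exp_mult_norm_sprod_le: "exp (pi * \<bar>Re w\<bar>) * cmod (sprod t L w) <= ssig_up * exp (pi * (Re w)^2 / t)"
proof -
 have "exp (pi * \<bar>Re w\<bar>) * cmod (sprod t L w) <= exp (pi * \<bar>Re w\<bar>) * exp (pi * (Re w)^2 / t - pi * \<bar>Re w\<bar> + 2 * pi * t / 8 +
   (1 + 2 / (1 - exp (- (2 * pi * t)))) * (2 / (1 - exp (- (2 * pi * t)))) + 2 / (1 - exp (- (2 * pi * t))))"
  by (intro mult_left_mono norm_sprod_le) auto
 also have "... = ssig_up * exp (pi * (Re w)^2 / t)"
  unfolding ssig_up_def exp_add[symmetric] by simp
 finally show ?thesis .
qed

definition ssig :: "nat => complex => complex" where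
 "ssig L w = sinh (of_real pi * w) * sprod t L w"

lemma norm_ssig_le: "cmod (ssig L w) <= ssig_up * exp (pi * (Re w)^2 / t)"
proof -
 have "cmod (sinh (of_real pi * w)) <= cosh (pi * \<bar>Re w\<bar>)"
  using norm_sinh_le[of "of_real pi * w"] by (cases "0 <= Re w") auto
 also have "... <= exp (pi * \<bar>Re w\<bar>)" by (simp add: cosh_field_def)
 finally have "cmod (ssig L w) <= exp (pi * \<bar>Re w\<bar>) * cmod (sprod t L w)"
  unfolding ssig_def norm_mult by (intro mult_right_mono) auto
 thus ?thesis using exp_mult_norm_sprod_le order_trans by blast
qed

definition ssig_low :: real where
 "ssig_low = (1 - exp (- (pi * t))) / 2 * exp (- (2 / (1 - exp (- (2 * pi * t))) / (1 - exp (- (pi * t)))))"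

lemma ssig_low_pos: "0 < ssig_low" using t by (simp add: ssig_low_def)

lemma norm_ssig_ge:
 assumes bdry: "cos (pi * Im w) = 0 \<or> (\<exists>K::nat. \<bar>Re w\<bar> = t * (real K + 1 / 2))" and L: "\<bar>Re w\<bar> <= t * (real L + 1)"
 shows "ssig_low * exp (pi * (Re w)^2 / t) <= cmod (ssig L w)"
proof -
 define b X where "b = 2 * pi * t" and "X = 2 * pi * \<bar>Re w\<bar>"
 have b: "0 < b" using t by (simp add: b_def)
 define \<kappa> where "\<kappa> = 1 - exp (- (b / 2))"
 have \<kappa>: "0 < \<kappa>" "\<kappa> <= 1" using b by (auto simp: \<kappa>_def)
 have XL: "X <= b * (real L + 1)" using L mult_left_mono[OF L, of "2 * pi"] by (simp add: X_def b_def mult.assoc)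
 have "exp ((X^2 / (2 * b) - X / 2) - 2 / (1 - exp (- b)) / \<kappa>) \<le>
   exp ((\<Sum>l\<in>{1..L}. max 0 (X - b * real l)) - (\<Sum>l\<in>{1..L}. exp (- \<bar>b * real l - X\<bar>)) / \<kappa>)"
 proof -
  have "X^2 / (2 * b) - X / 2 <= (\<Sum>l\<in>{1..L}. max 0 (X - b * real l))"
   by (rule sum_pos_part_ge[OF b _ XL]) (simp add: X_def)
  moreover have "(\<Sum>l\<in>{1..L}. exp (- \<bar>b * real l - X\<bar>)) / \<kappa> <= 2 / (1 - exp (- b)) / \<kappa>"
   using \<kappa> by (intro divide_right_mono sum_exp_dist_nat_le b) auto
  ultimately show ?thesis unfolding exp_le_cancel_iff by linarith
 qed
 also have "... = (\<Prod>l\<in>{1..L}. exp (max 0 (X - b * real l) - exp (- \<bar>b * real l - X\<bar>) / \<kappa>))"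
  by (simp add: exp_sum[symmetric] sum_subtractf sum_divide_distrib)
 also have "... <= (\<Prod>l\<in>{1..L}. cmod (sfac t l w))"
  using norm_sfac_ge[OF _ bdry] by (intro prod_mono) (auto simp: b_def X_def \<kappa>_def)
 also have "... = cmod (sprod t L w)" by (simp add: sprod_def prod_norm)
 finally have P: "exp ((X^2 / (2 * b) - X / 2) - 2 / (1 - exp (- b)) / \<kappa>) <= cmod (sprod t L w)" .
 have S: "\<kappa> / 2 * exp (X / 2) <= cmod (sinh (of_real pi * w))"
 proof (cases "cos (pi * Im w) = 0")
  case True
  have "cmod (sinh (of_real pi * w)) = cosh (pi * Re w)" using norm_sinh_eq_cosh[of "of_real pi * w"] True by simp
  also have "... = cosh (X / 2)" by (cases "0 <= Re w") (auto simp: X_def)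
  finally have "exp (X / 2) / 2 <= cmod (sinh (of_real pi * w))" by (simp add: cosh_field_def)
  moreover have "\<kappa> / 2 * exp (X / 2) <= 1 / 2 * exp (X / 2)" using \<kappa> by (intro mult_right_mono) auto
  ultimately show ?thesis by linarith
 next
  case False
  then obtain K :: nat where K: "\<bar>Re w\<bar> = t * (real K + 1 / 2)" using bdry by blast
  have XK: "X = b * (real K + 1 / 2)" by (simp add: X_def b_def K)
  have X2: "b / 2 <= X" unfolding XK using b by (simp add: algebra_simps)
  have "\<kappa> / 2 * exp (X / 2) <= (1 - exp (- X)) / 2 * exp (X / 2)"
   using X2 by (intro mult_right_mono) (auto simp: \<kappa>_def)
  also have "... = sinh (X / 2)" by (simp add: sinh_field_def left_diff_distrib diff_divide_distrib flip: exp_add)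
  also have "... = \<bar>sinh (pi * Re w)\<bar>" using b X2
   by (cases "0 <= Re w") (auto simp: X_def mult_nonneg_nonpos)
  also have "... <= cmod (sinh (of_real pi * w))" using norm_sinh_ge[of "of_real pi * w"] by simp
  finally show ?thesis .
 qed
 have "ssig_low * exp (pi * (Re w)^2 / t) = (\<kappa> / 2 * exp (X / 2)) * exp ((X^2 / (2 * b) - X / 2) - 2 / (1 - exp (- b)) / \<kappa>)"
 proof -
  have "X^2 / (2 * b) = pi * (Re w)^2 / t"
   using t by (simp add: X_def b_def power_mult_distrib) (simp add: field_simps power2_eq_square)
  moreover have "b / 2 = pi * t" by (simp add: b_def)
  ultimately show ?thesis unfolding ssig_low_def \<kappa>_def by (simp add: b_def mult.assoc flip: exp_add)
 qed
 also have "... <= cmod (sinh (of_real pi * w)) * cmod (sprod t L w)"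
  using \<kappa> by (intro mult_mono S P) auto
 finally show ?thesis by (simp add: ssig_def norm_mult)
qed

end

section \<open>Cross terms of two Brody curves\<close>

lemma eventually_nonzero_holomorphic:
 assumes "s holomorphic_on U" "open U" "z \<in> U" "s z ~= (0::complex)"
 shows "\<forall>\<^sub>F w in nhds z. s w ~= 0"
proof -
 have "isCont s z" using assms(1-3) by (meson holomorphic_on_imp_continuous_on continuous_on_eq_continuous_at)
 hence "(s \<longlongrightarrow> s z) (nhds z)" unfolding isCont_def tendsto_at_iff_tendsto_nhds .
 thus ?thesis by (rule tendsto_imp_eventually_ne) (rule assms(4))
qed

lemma divide_simple_zeros:
 assumes U: "open U" and h: "h holomorphic_on U" and s: "s holomorphic_on U"
  and zero: "!!z. z \<in> U ==> s z = 0 ==> h z = 0 & deriv s z ~= 0"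
 obtains H where "H holomorphic_on U" "!!z. z \<in> U ==> h z = H z * s z"
proof -
 define H where "H = (%z. if s z = 0 then deriv h z / deriv s z else h z / s z)"
 have "H analytic_on {z}" if z: "z \<in> U" for z
 proof (cases "s z = 0")
  case False
  have "(%w. h w / s w) analytic_on {z}"
   using False U h s z by (intro analytic_on_divide) (auto simp: analytic_on_open intro: analytic_on_subset[of _ U])
  moreover have "\<forall>\<^sub>F w in nhds z. s w ~= 0" by (rule eventually_nonzero_holomorphic[OF s U z False])
  hence "\<forall>\<^sub>F w in nhds z. h w / s w = H w" by eventually_elim (simp add: H_def)
  ultimately show ?thesis by (rule analytic_at_congD)
 next
  case True
  have hz: "h z = 0" "deriv s z ~= 0" using zero[OF z True] by auto
  define q where "q = (%f w. if w = z then deriv f z else (f w - f z) / (w - z))"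
  have q: "q h holomorphic_on U" "q s holomorphic_on U"
   unfolding q_def by (rule pole_lemma_open[OF h U], rule pole_lemma_open[OF s U])
  have qz: "q s z ~= 0" using hz by (simp add: q_def)
  have "(%w. q h w / q s w) analytic_on {z}"
   using U q z qz by (intro analytic_on_divide) (auto simp: analytic_on_open intro: analytic_on_subset[of _ U])
  moreover have "\<forall>\<^sub>F w in nhds z. q s w ~= 0"
   by (rule eventually_nonzero_holomorphic[OF q(2) U z qz])
  hence "\<forall>\<^sub>F w in nhds z. q h w / q s w = H w"
  proof eventually_elim
   case (elim w)
   thus ?case using True hz by (auto simp: q_def H_def split: if_splits)
  qed
  ultimately show ?thesis by (rule analytic_at_congD)
 qed
 hence "H analytic_on U" by (subst analytic_on_analytic_at) blast
 hence "H holomorphic_on U" by (rule analytic_imp_holomorphic)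
 moreover have "h z = H z * s z" if "z \<in> U" for z using zero[OF that] by (auto simp: H_def)
 ultimately show thesis by (rule that)
qed

lemma divide_disjoint_simple_zeros:
 fixes s :: "'i => complex => complex"
 assumes U: "open U" and h: "h holomorphic_on U" and "finite I"
  and s: "!!i. i \<in> I ==> s i holomorphic_on U"
  and zero: "!!i z. i \<in> I ==> z \<in> U ==> s i z = 0 ==> h z = 0 & deriv (s i) z ~= 0"
  and disj: "!!i j z. i \<in> I ==> j \<in> I ==> i ~= j ==> z \<in> U ==> s i z = 0 ==> s j z ~= 0"
 shows "\<exists>H. H holomorphic_on U & (\<forall>z\<in>U. h z = H z * (\<Prod>i\<in>I. s i z))"
 using \<open>finite I\<close> s zero disj
proof (induction I)
 case empty
 thus ?case using h by (intro exI[of _ h]) auto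
next
 case (insert i I)
 have "\<exists>H. H holomorphic_on U & (\<forall>z\<in>U. h z = H z * (\<Prod>i\<in>I. s i z))"
 proof (rule insert.IH, goal_cases)
  case (1 j) thus ?case by (intro insert.prems(1)) simp
 next
  case (2 j z) thus ?case by (intro insert.prems(2)) simp_all
 next
  case (3 j k z) thus ?case by (intro insert.prems(3)[of j k z]) simp_all
 qed
 then obtain H where H: "H holomorphic_on U" "\<forall>z\<in>U. h z = H z * (\<Prod>i\<in>I. s i z)" by (elim exE conjE)
 have "H z = 0 & deriv (s i) z ~= 0" if z: "z \<in> U" "s i z = 0" for z
 proof -
  have "h z = 0" "deriv (s i) z ~= 0" using insert.prems(2)[of i z] z by auto
  moreover have "s j z ~= 0" if "j \<in> I" for j using insert.prems(3)[of i j z] z that insert.hyps(2) by auto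
  hence "(\<Prod>i\<in>I. s i z) ~= 0" using insert.hyps(1) by simp
  ultimately show ?thesis using H(2) z(1) by auto
 qed
 then obtain H' where H': "H' holomorphic_on U" "!!z. z \<in> U ==> H z = H' z * s i z"
  by (rule divide_simple_zeros[OF U H(1) insert.prems(1)[OF insertI1]]) (assumption, assumption, rule that)
 show ?case using H' H(2) insert.hyps by (intro exI[of _ H']) (simp add: mult.assoc)
qed

lemma sinh_eq_0_complex_iff: "sinh (of_real pi * w) = 0 \<longleftrightarrow> (\<exists>k::int. w = of_int k * \<i>)"
proof
 assume 0: "sinh (of_real pi * w) = 0"
 have "\<bar>sinh (pi * Re w)\<bar> <= 0" using norm_sinh_ge[of "of_real pi * w"] 0 by simp
 hence re: "Re w = 0" by simp
 have "(sin (pi * Im w))^2 = 0" using norm_sinh_squared[of "of_real pi * w"] 0 re by simp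
 then obtain k :: int where "pi * Im w = of_int k * pi" by (auto simp: sin_zero_iff_int2)
 hence "Im w = of_int k" by simp
 thus "\<exists>k::int. w = of_int k * \<i>" using re by (intro exI[of _ k]) (simp add: complex_eq_iff)
next
 assume "\<exists>k::int. w = of_int k * \<i>"
 then obtain k :: int where k: "w = of_int k * \<i>" by blast
 have "(cmod (sinh (of_real pi * w)))^2 = 0" unfolding norm_sinh_squared using k by (simp add: mult.commute)
 thus "sinh (of_real pi * w) = 0" by simp
qed

lemma prod_sinh_eq_ssig:
 assumes t: "0 < t"
 shows "\<exists>c. c ~= 0 & (\<forall>w. (\<Prod>n\<in>{- int L..int L}. sinh (of_real pi * (w - of_real (t * of_int n)))) = c * ssig t L w)"
proof (induction L)
 case 0
 show ?case by (intro exI[of _ 1]) (simp add: ssig_def[OF t] sprod_def)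
next
 case (Suc L)
 obtain c where c: "c ~= 0" "!!w. (\<Prod>n\<in>{- int L..int L}. sinh (of_real pi * (w - of_real (t * of_int n)))) = c * ssig t L w"
  using Suc.IH by blast
 define d where "d = (complex_of_real (sinh (pi * t * real (Suc L))))^2"
 have "pi * t * real (Suc L) ~= 0" using t by simp
 hence d: "d ~= 0" by (simp add: d_def)
 have "(\<Prod>n\<in>{- int (Suc L)..int (Suc L)}. sinh (of_real pi * (w - of_real (t * of_int n)))) = - (c * d) * ssig t (Suc L) w" for w
 proof -
  let ?f = "%n::int. sinh (of_real pi * (w - of_real (t * of_int n)))"
  have set: "{- int (Suc L)..int (Suc L)} = insert (int (Suc L)) (insert (- int (Suc L)) {- int L..int L})" by auto
  have mem: "int (Suc L) \<notin> insert (- int (Suc L)) {- int L..int L}" "- int (Suc L) \<notin> {- int L..int L}" by auto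
  have "(\<Prod>n\<in>{- int (Suc L)..int (Suc L)}. ?f n) = ?f (int (Suc L)) * (?f (- int (Suc L)) * (\<Prod>n\<in>{- int L..int L}. ?f n))"
   unfolding set by (subst prod.insert[OF _ mem(1)], simp, subst prod.insert[OF _ mem(2)], simp, rule refl)
  also have "... = ?f (int (Suc L)) * (?f (- int (Suc L)) * (c * ssig t L w))" unfolding c(2) ..
  also have "?f (int (Suc L)) = - sinh (of_real (pi * t * real (Suc L)) - of_real pi * w)"
   by (subst sinh_minus[symmetric]) (simp add: algebra_simps)
  also have "?f (- int (Suc L)) = sinh (of_real (pi * t * real (Suc L)) + of_real pi * w)"
   by (simp add: algebra_simps)
  also have "sprod t (Suc L) w = sprod t L w * sfac t (Suc L) w" by (simp add: sprod_def)
  hence "ssig t (Suc L) w * d = ssig t L w * (sinh (of_real (pi * t * real (Suc L)) + of_real pi * w) * sinh (of_real (pi * t * real (Suc L)) - of_real pi * w))"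
   using d by (simp add: ssig_def[OF t] sfac_def d_def mult.assoc)
  hence "- sinh (of_real (pi * t * real (Suc L)) - of_real pi * w) * (sinh (of_real (pi * t * real (Suc L)) + of_real pi * w) * (c * ssig t L w))
    = - c * (ssig t (Suc L) w * d)" by (simp add: algebra_simps)
  finally show ?thesis by simp
 qed
 thus ?case using c(1) d by (intro exI[of _ "- (c * d)"]) auto
qed

lemma has_laplacian_quadratic:
 "has_laplacian (%z. A * (Re z - p)^2 - c * (cmod (z - z0))^2) z (2 * A - 4 * c)"
proof -
 have e: "A * (Re (z + of_real t * v) - p)^2 - c * (cmod (z + of_real t * v - z0))^2 =
   A * (Re z + t * Re v - p)^2 - c * ((Re z + t * Re v - Re z0)^2 + (Im z + t * Im v - Im z0)^2)" for t v
  by (simp add: cmod_power2)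
 let ?p = "%v t. 2 * A * (Re z + t * Re v - p) * Re v - 2 * c * ((Re z + t * Re v - Re z0) * Re v + (Im z + t * Im v - Im z0) * Im v)"
 have d1: "((%t. A * (Re (z + of_real t * v) - p)^2 - c * (cmod (z + of_real t * v - z0))^2) has_real_derivative ?p v t) (at t)" for v t
  unfolding e by (auto intro!: derivative_eq_intros simp: algebra_simps)
 have d2: "(?p v has_real_derivative 2 * A * (Re v)^2 - 2 * c * ((Re v)^2 + (Im v)^2)) (at 0)" for v
  by (auto intro!: derivative_eq_intros simp: algebra_simps power2_eq_square)
 have sd: "second_deriv (%t. A * (Re (z + of_real t * v) - p)^2 - c * (cmod (z + of_real t * v - z0))^2) (2 * A * (Re v)^2 - 2 * c * ((Re v)^2 + (Im v)^2))" for v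
  by (rule second_derivI[OF always_eventually[OF allI[OF d1]] d2])
 show ?thesis
  unfolding has_laplacian_def using sd[of 1] sd[of \<i>]
  by (intro exI[of _ "2 * A - 2 * c"] exI[of _ "- (2 * c)"] conjI) (simp, simp, linarith)
qed

lemma cross_term_le:
 assumes "i <= N" "j <= N"
 shows "(cmod (F i z * G j z - F j z * G i z))^2 <= 4 * (nsq N F z * nsq N G z)"
proof -
 have le: "cmod (F k z) <= sqrt (nsq N F z)" if "k <= N" for k and F :: "nat => complex => complex"
  unfolding nsq_def by (rule real_le_rsqrt) (use that in \<open>intro member_le_sum, auto\<close>)
 have nn: "0 <= nsq N F z" for F by (simp add: nsq_def sum_nonneg)
 have "cmod (F i z * G j z - F j z * G i z) <= cmod (F i z) * cmod (G j z) + cmod (F j z) * cmod (G i z)"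
  using norm_triangle_ineq4[of "F i z * G j z" "F j z * G i z"] by (simp add: norm_mult)
 also have "... <= sqrt (nsq N F z) * sqrt (nsq N G z) + sqrt (nsq N F z) * sqrt (nsq N G z)"
  using assms nn by (intro add_mono mult_mono le) auto
 finally have "cmod (F i z * G j z - F j z * G i z) <= 2 * sqrt (nsq N F z * nsq N G z)" by (simp add: real_sqrt_mult)
 hence "(cmod (F i z * G j z - F j z * G i z))^2 <= (2 * sqrt (nsq N F z * nsq N G z))^2" by (intro power_mono) auto
 thus ?thesis using nn by (simp add: power_mult_distrib)
qed

text \<open>
  The quotient \<open>H\<close> of the cross term by the product \<open>s\<close> of hyperbolic sines is holomorphic near the rectangle of common
  values. The function \<open>\<Phi> = \<bar>H\<bar>\<^sup>2 exp Q / (\<bar>F\<bar>\<^sup>2 \<bar>G\<bar>\<^sup>2)\<close> compares it with the largest size compatible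
  with the energy bounds. The Laplacian of \<open>log \<Phi>\<close> is at least \<open>4\<pi>/t - 4c - 8\<pi> = 4c > 0\<close> for
  \<open>c = (\<pi>/2) (1/t - 2)\<close>, so \<open>\<Phi>\<close> is maximal on the boundary. There \<open>s\<close> is as large as the Gaussian in
  \<open>Q\<close>, and the part \<open>-c \<bar>z - z0\<bar>\<^sup>2\<close> of \<open>Q\<close> supplies the small factor.
\<close>

theorem cross_term_small:
 assumes t: "0 < t" "t < 1 / 2"
  and F: "!!i. i <= N ==> F i holomorphic_on UNIV" "!!z. 0 < nsq N F z" "!!z. fs_density N F z <= pi"
  and G: "!!i. i <= N ==> G i holomorphic_on UNIV" "!!z. 0 < nsq N G z" "!!z. fs_density N G z <= pi"
  and ij: "i <= N" "j <= N" and K: "1 <= K"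
  and agree: "!!n k. \<bar>n\<bar> <= int K ==> \<bar>k\<bar> <= int K ==>
    (let z = p + Complex (t * of_int n) (of_int k) in F i z * G j z - F j z * G i z = 0)"
  and z0: "0 <= Re (z0 - p)" "Re (z0 - p) <= t" "0 <= Im (z0 - p)" "Im (z0 - p) <= 1"
 shows "(cmod (F i z0 * G j z0 - F j z0 * G i z0))^2 \<le>
   4 * (ssig_up t / ssig_low t)^2 * exp (- (pi / 2 * (1 / t - 2)) * (t * (real K - 1 / 2))^2) * (nsq N F z0 * nsq N G z0)"
proof -
 define h where "h = (%z. F i z * G j z - F j z * G i z)"
 define c where "c = pi / 2 * (1 / t - 2)"
 have c: "0 < c" unfolding c_def using t by (simp add: field_simps)
 have hh: "h holomorphic_on UNIV" unfolding h_def using F(1) G(1) ij by (intro holomorphic_intros) auto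
 define U where "U = {z. \<bar>Re (z - p)\<bar> < t * (real K + 3 / 4) & \<bar>Im (z - p)\<bar> < real K + 3 / 4}"
 define R where "R = {z. \<bar>Re (z - p)\<bar> <= t * (real K + 1 / 2) & \<bar>Im (z - p)\<bar> <= real K + 1 / 2}"
 have openU: "open U" unfolding U_def by (intro open_Collect_conj open_Collect_less continuous_intros)
 have RU: "R \<subseteq> U"
 proof -
  have "t * (real K + 1 / 2) < t * (real K + 3 / 4)" using t by simp
  thus ?thesis by (auto simp: R_def U_def)
 qed
 define s where "s = (%n z. sinh (of_real pi * ((z - p) - of_real (t * of_int n))))"
 have ds: "deriv (s n) z = of_real pi * cosh (of_real pi * ((z - p) - of_real (t * of_int n)))" for n z
  unfolding s_def by (rule DERIV_imp_deriv) (auto intro!: derivative_eq_intros)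
 have sh: "s n holomorphic_on A" for n A
  unfolding s_def sinh_field_def by (intro holomorphic_intros) auto
 have s0: "\<exists>k::int. z = p + Complex (t * of_int n) (of_int k)" if sz: "s n z = 0" for n z
 proof -
  obtain k :: int where "(z - p) - of_real (t * of_int n) = of_int k * \<i>" using sz unfolding s_def sinh_eq_0_complex_iff by (elim exE)
  thus ?thesis by (intro exI[of _ k]) (auto simp: complex_eq_iff algebra_simps)
 qed
 have "\<exists>H. H holomorphic_on U & (\<forall>z\<in>U. h z = H z * (\<Prod>n\<in>{- int K..int K}. s n z))"
 proof (rule divide_disjoint_simple_zeros[OF openU _ _ sh])
  show "h holomorphic_on U" using hh by (rule holomorphic_on_subset) auto
 next
  fix n z assume n: "n \<in> {- int K..int K}" and z: "z \<in> U" "s n z = 0"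
  obtain k :: int where k: "z = p + Complex (t * of_int n) (of_int k)" using s0[OF z(2)] by blast
  have "\<bar>real_of_int k\<bar> < real K + 3 / 4" using z(1) k by (simp add: U_def)
  hence "\<bar>k\<bar> <= int K" by linarith
  hence "h z = 0" using agree[of n k] n k by (simp add: h_def Let_def abs_le_iff)
  moreover have "deriv (s n) z ~= 0"
  proof
   assume "deriv (s n) z = 0"
   hence "cosh (of_real pi * ((z - p) - of_real (t * of_int n))) = 0" by (simp add: ds)
   thus False using z(2) hyperbolic_pythagoras[of "of_real pi * ((z - p) - of_real (t * of_int n))"]
    by (simp add: s_def)
  qed
  ultimately show "h z = 0 & deriv (s n) z ~= 0" ..
 next
  fix n m z assume "n ~= m" "z \<in> U" "s n z = 0"
  moreover have False if sm: "s m z = 0"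
  proof -
   obtain k k' :: int where "z = p + Complex (t * of_int n) (of_int k)" "z = p + Complex (t * of_int m) (of_int k')"
    using s0[OF \<open>s n z = 0\<close>] s0[OF sm] by (elim exE)
   hence "t * of_int n = t * of_int m" by (auto simp: complex_eq_iff)
   thus False using t \<open>n ~= m\<close> by simp
  qed
  ultimately show "s m z ~= 0" by blast
 qed auto
 then obtain H0 where H0: "H0 holomorphic_on U" "\<forall>z\<in>U. h z = H0 z * (\<Prod>n\<in>{- int K..int K}. s n z)" by (elim exE conjE)
 obtain d where d: "d ~= 0" "\<forall>w. (\<Prod>n\<in>{- int K..int K}. sinh (of_real pi * (w - of_real (t * of_int n)))) = d * ssig t K w"
  using prod_sinh_eq_ssig[OF t(1), of K] by (elim exE conjE)
 define H where "H = (%z. d * H0 z)"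
 have Hh: "H holomorphic_on U" unfolding H_def by (intro holomorphic_intros H0)
 have H: "h z = H z * ssig t K (z - p)" if "z \<in> U" for z
  using H0(2) that d(2)[rule_format, of "z - p"] by (simp add: s_def H_def)
 define Q where "Q = (%z. 2 * pi / t * (Re z - Re p)^2 - c * (cmod (z - z0))^2)"
 define \<Phi> where "\<Phi> = (%z. (cmod (H z))^2 * exp (Q z) / (nsq N F z * nsq N G z))"
 have nsqc: "continuous_on A (nsq N F)" if "!!i. i <= N ==> F i holomorphic_on UNIV" for F A
  unfolding nsq_def using that
  by (intro continuous_intros) (auto intro: continuous_on_subset[OF holomorphic_on_imp_continuous_on])
 have "continuous_on R \<Phi>"
  unfolding \<Phi>_def Q_def using F(2) G(2) t
  by (intro continuous_intros nsqc F G continuous_on_subset[OF holomorphic_on_imp_continuous_on[OF Hh] RU]) (auto simp: less_le)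
 moreover have "compact R"
 proof -
  have "R = cbox (p - Complex (t * (real K + 1 / 2)) (real K + 1 / 2)) (p + Complex (t * (real K + 1 / 2)) (real K + 1 / 2))"
   by (auto simp: R_def in_cbox_complex_iff abs_le_iff)
  thus ?thesis by simp
 qed
 moreover have tK: "t <= t * (real K + 1 / 2)" using t K by simp
 have z0R: "z0 \<in> R" using z0 tK K by (simp add: R_def)
 ultimately obtain zm where zm: "zm \<in> R" "!!z. z \<in> R ==> \<Phi> z <= \<Phi> zm"
  using continuous_attains_sup[of R \<Phi>] by blast
 let ?D = "t * (real K - 1 / 2)"
 have bound: "\<Phi> zm <= 4 / (ssig_low t)^2 * exp (- c * ?D^2)"
 proof (cases "\<Phi> zm <= 0")
  case True
  also have "0 <= 4 / (ssig_low t)^2 * exp (- c * ?D^2)" by simp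
  finally show ?thesis .
 next
  case False
  hence Hz: "H zm ~= 0" by (auto simp: \<Phi>_def)
  have nonint: "\<bar>Re (zm - p)\<bar> = t * (real K + 1 / 2) \<or> \<bar>Im (zm - p)\<bar> = real K + 1 / 2"
  proof (rule ccontr)
   assume "\<not> ?thesis"
   hence int: "\<bar>Re (zm - p)\<bar> < t * (real K + 1 / 2)" "\<bar>Im (zm - p)\<bar> < real K + 1 / 2"
    using zm(1) by (auto simp: R_def)
   define V where "V = {z. \<bar>Re (z - p)\<bar> < t * (real K + 1 / 2) & \<bar>Im (z - p)\<bar> < real K + 1 / 2}"
   have V: "open V" unfolding V_def by (intro open_Collect_conj open_Collect_less continuous_intros)
   have VR: "V \<subseteq> R" by (auto simp: V_def R_def)
   define V' where "V' = V \<inter> {z\<in>U. H z ~= 0}"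
   have "open {z\<in>U. H z ~= 0}"
   proof -
    have "{z\<in>U. H z ~= 0} = U \<inter> H -` (- {0})" by auto
    thus ?thesis
     using continuous_open_preimage[OF holomorphic_on_imp_continuous_on[OF Hh] openU open_Compl[OF closed_singleton[of 0]]] by simp
   qed
   hence V': "open V'" unfolding V'_def using V by blast
   have zV: "zm \<in> V'" using int Hz RU zm(1) by (auto simp: V'_def V_def)
   have HV: "H holomorphic_on V'" using Hh by (rule holomorphic_on_subset) (auto simp: V'_def)
   define u where "u = (%z. ln (nsq 0 (%_. H) z) + Q z + - ln (nsq N F z) + - ln (nsq N G z))"
   have "has_laplacian (%z. ln (nsq 0 (%_. H) z)) zm (4 * fs_density 0 (%_. H) zm)"
    by (rule has_laplacian_log_nsq[OF HV V' zV]) (auto simp: nsq_def V'_def)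
   moreover have "fs_density 0 (%_. H) zm = 0"
    by (simp add: fs_density_def nsq_def dinner_def norm_mult power_mult_distrib)
   moreover have "has_laplacian (%z. ln (nsq N F z)) zm (4 * fs_density N F zm)"
    by (rule has_laplacian_log_nsq[OF F(1) open_UNIV]) (auto simp: F(2))
   moreover have "has_laplacian (%z. ln (nsq N G z)) zm (4 * fs_density N G zm)"
    by (rule has_laplacian_log_nsq[OF G(1) open_UNIV]) (auto simp: G(2))
   moreover have "has_laplacian Q zm (2 * (2 * pi / t) - 4 * c)" unfolding Q_def by (rule has_laplacian_quadratic)
   ultimately have lap: "has_laplacian u zm (0 + (2 * (2 * pi / t) - 4 * c) + - (4 * fs_density N F zm) + - (4 * fs_density N G zm))"
    unfolding u_def by (intro has_laplacian_add has_laplacian_minus) auto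
   have u\<Phi>: "u z = ln (\<Phi> z)" "0 < \<Phi> z" if "z \<in> V'" for z
   proof -
    have "H z ~= 0" using that by (simp add: V'_def)
    thus "u z = ln (\<Phi> z)" "0 < \<Phi> z"
     using F(2)[of z] G(2)[of z] by (simp_all add: u_def \<Phi>_def nsq_def[of 0] ln_mult ln_div)
   qed
   have "\<forall>\<^sub>F z in nhds zm. z \<in> V'" by (rule eventually_nhds_in_open[OF V' zV])
   hence "\<forall>\<^sub>F z in nhds zm. u z <= u zm"
   proof eventually_elim
    case (elim z)
    have "\<Phi> z <= \<Phi> zm" using zm(2) elim VR by (auto simp: V'_def)
    thus ?case using u\<Phi>[OF elim] u\<Phi>[OF zV] by simp
   qed
   hence "0 + (2 * (2 * pi / t) - 4 * c) + - (4 * fs_density N F zm) + - (4 * fs_density N G zm) <= 0"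
    by (rule has_laplacian_local_max[OF lap])
   moreover have "2 * (2 * pi / t) - 4 * c = 8 * pi + 4 * c" by (simp add: c_def algebra_simps diff_divide_distrib)
   ultimately show False using F(3)[of zm] G(3)[of zm] c by linarith
  qed
  have zU: "zm \<in> U" using RU zm(1) by blast
  have "cos (pi * Im (zm - p)) = 0 \<or> (\<exists>K::nat. \<bar>Re (zm - p)\<bar> = t * (real K + 1 / 2))"
  proof (cases "\<bar>Im (zm - p)\<bar> = real K + 1 / 2")
   case True
   have "cos (pi * Im (zm - p)) = cos (pi * \<bar>Im (zm - p)\<bar>)"
    by (metis abs_mult abs_of_nonneg cos_abs_real pi_ge_zero)
   also have "... = cos (real K * pi + pi / 2)" unfolding True by (simp add: algebra_simps)
   also have "... = 0" by (simp add: cos_add sin_npi)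
   finally show ?thesis ..
  next
   case False thus ?thesis using nonint by blast
  qed
  hence low: "ssig_low t * exp (pi * (Re (zm - p))^2 / t) <= cmod (ssig t K (zm - p))"
  proof (rule norm_ssig_ge[OF t(1)])
   show "\<bar>Re (zm - p)\<bar> <= t * (real K + 1)" using zm(1) t(1) by (auto simp: R_def intro: order_trans)
  qed
  hence "(ssig_low t * exp (pi * (Re (zm - p))^2 / t))^2 <= (cmod (ssig t K (zm - p)))^2"
   using ssig_low_pos[OF t(1)] by (intro power_mono) auto
  hence low2: "(ssig_low t)^2 * exp (2 * pi / t * (Re zm - Re p)^2) <= (cmod (ssig t K (zm - p)))^2"
   by (simp add: power_mult_distrib exp_double[symmetric] mult.assoc)
  have "(cmod (H zm))^2 * (cmod (ssig t K (zm - p)))^2 = (cmod (h zm))^2" by (simp add: H[OF zU] norm_mult power_mult_distrib)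
  also have "... <= 4 * (nsq N F zm * nsq N G zm)" unfolding h_def by (rule cross_term_le[OF ij])
  finally have hb: "(cmod (H zm))^2 * (cmod (ssig t K (zm - p)))^2 <= 4 * (nsq N F zm * nsq N G zm)" .
  have "(cmod (H zm))^2 * ((ssig_low t)^2 * exp (2 * pi / t * (Re zm - Re p)^2)) <= 4 * (nsq N F zm * nsq N G zm)"
   by (rule order_trans[OF mult_left_mono[OF low2] hb]) simp
  hence "(cmod (H zm))^2 * exp (2 * pi / t * (Re zm - Re p)^2) / (nsq N F zm * nsq N G zm) <= 4 / (ssig_low t)^2"
   using F(2)[of zm] G(2)[of zm] ssig_low_pos[OF t(1)] by (simp add: field_simps)
  hence "(cmod (H zm))^2 * exp (2 * pi / t * (Re zm - Re p)^2) / (nsq N F zm * nsq N G zm) * exp (- c * (cmod (zm - z0))^2)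
    <= 4 / (ssig_low t)^2 * exp (- c * (cmod (zm - z0))^2)" by (rule mult_right_mono) simp
  moreover have "(cmod (H zm))^2 * exp (2 * pi / t * (Re zm - Re p)^2) / (nsq N F zm * nsq N G zm) * exp (- c * (cmod (zm - z0))^2) = \<Phi> zm"
   by (simp add: \<Phi>_def Q_def exp_diff exp_minus field_simps)
  moreover have "?D <= cmod (zm - z0)"
   using nonint
  proof
   assume "\<bar>Re (zm - p)\<bar> = t * (real K + 1 / 2)"
   hence "?D <= \<bar>Re (zm - z0)\<bar>" using z0 by (auto simp: algebra_simps abs_if split: if_splits)
   thus ?thesis using abs_Re_le_cmod order_trans by blast
  next
   assume "\<bar>Im (zm - p)\<bar> = real K + 1 / 2"
   hence "real K - 1 / 2 <= \<bar>Im (zm - z0)\<bar>" using z0 by (auto simp: abs_if split: if_splits)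
   moreover have "?D <= 1 * (real K - 1 / 2)" using t K by (intro mult_right_mono) auto
   ultimately show ?thesis using abs_Im_le_cmod[of "zm - z0"] unfolding mult_1 by (meson order_trans)
  qed
  hence "?D^2 <= (cmod (zm - z0))^2" using t K by (intro power_mono) auto
  hence "exp (- c * (cmod (zm - z0))^2) <= exp (- c * ?D^2)" using c by simp
  hence "4 / (ssig_low t)^2 * exp (- c * (cmod (zm - z0))^2) <= 4 / (ssig_low t)^2 * exp (- c * ?D^2)"
   by (intro mult_left_mono) auto
  ultimately show ?thesis by linarith
 qed
 have "\<Phi> z0 <= 4 / (ssig_low t)^2 * exp (- c * ?D^2)" using zm(2)[OF z0R] bound by linarith
 hence P: "(cmod (H z0))^2 * exp (2 * pi / t * (Re z0 - Re p)^2) <= 4 / (ssig_low t)^2 * exp (- c * ?D^2) * (nsq N F z0 * nsq N G z0)"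
  using F(2)[of z0] G(2)[of z0] by (simp add: \<Phi>_def Q_def pos_divide_le_eq)
 have "(cmod (ssig t K (z0 - p)))^2 <= (ssig_up t * exp (pi * (Re (z0 - p))^2 / t))^2"
  by (intro power_mono norm_ssig_le t) auto
 also have "... = (ssig_up t)^2 * exp (2 * pi / t * (Re z0 - Re p)^2)"
  by (simp add: power_mult_distrib exp_double[symmetric] mult.assoc)
 finally have S: "(cmod (ssig t K (z0 - p)))^2 <= (ssig_up t)^2 * exp (2 * pi / t * (Re z0 - Re p)^2)" .
 have "(cmod (h z0))^2 = (cmod (H z0))^2 * (cmod (ssig t K (z0 - p)))^2"
  using H RU z0R by (auto simp: norm_mult power_mult_distrib)
 also have "... <= (cmod (H z0))^2 * ((ssig_up t)^2 * exp (2 * pi / t * (Re z0 - Re p)^2))"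
  by (intro mult_left_mono S) auto
 also have "... = (ssig_up t)^2 * ((cmod (H z0))^2 * exp (2 * pi / t * (Re z0 - Re p)^2))" by simp
 also have "... <= (ssig_up t)^2 * (4 / (ssig_low t)^2 * exp (- c * ?D^2) * (nsq N F z0 * nsq N G z0))"
  by (intro mult_left_mono P) auto
 also have "... = 4 * (ssig_up t / ssig_low t)^2 * exp (- c * ?D^2) * (nsq N F z0 * nsq N G z0)"
  by (simp add: power_divide)
 finally show ?thesis unfolding h_def c_def .
qed

section \<open>Determination by values on a lattice\<close>

lemma sqrt_vnsq_ge: "k <= N ==> cmod (v k) <= sqrt (vnsq N v)"
 unfolding vnsq_def by (rule real_le_rsqrt) (intro member_le_sum, auto)

text \<open>
  Expanding \<open>\<bar>w\<bar>\<^sup>2\<close> and \<open>\<bar>v\<bar>\<^sup>2\<close> turns the difference of two projectors into a sum over \<open>k\<close> of terms with a factor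
  \<open>v\<^sub>i w\<^sub>k - v\<^sub>k w\<^sub>i\<close> or the conjugate of \<open>v\<^sub>j w\<^sub>k - v\<^sub>k w\<^sub>j\<close>.
\<close>

lemma projector_diff_le:
 fixes v w :: "nat => complex"
 assumes v: "0 < vnsq N v" and w: "0 < vnsq N w" and \<eta>: "0 <= \<eta>" and ij: "i <= N" "j <= N"
  and cross: "!!i k. i <= N ==> k <= N ==> cmod (v i * w k - v k * w i) <= \<eta> * sqrt (vnsq N v * vnsq N w)"
 shows "cmod (v i * cnj (v j) / of_real (vnsq N v) - w i * cnj (w j) / of_real (vnsq N w)) <= 2 * (real N + 1) * \<eta>"
proof -
 let ?a = "vnsq N v" and ?b = "vnsq N w"
 define s where "s = sqrt (?a * ?b)"
 have s: "s * s = ?a * ?b" "0 <= s" using v w by (auto simp: s_def)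
 have le: "cmod (x * y) <= s" if "cmod x <= sqrt ?a" "cmod y <= sqrt ?b" for x y
  unfolding norm_mult s_def real_sqrt_mult using that v by (intro mult_mono) auto
 have sq: "of_real (vnsq N u) = (\<Sum>k\<le>N. u k * cnj (u k))" for u
  by (simp only: vnsq_def of_real_sum complex_norm_square)
 have eq: "v i * cnj (v j) * of_real ?b - w i * cnj (w j) * of_real ?a =
   (\<Sum>k\<le>N. (v i * w k - v k * w i) * cnj (v j * w k) + v k * w i * cnj (v j * w k - v k * w j))"
  unfolding sq sum_distrib_left sum_subtractf[symmetric] by (intro sum.cong refl) (simp add: algebra_simps)
 have "cmod (v i * cnj (v j) * of_real ?b - w i * cnj (w j) * of_real ?a) <= (\<Sum>k\<le>N. \<eta> * s * s + s * (\<eta> * s))"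
  unfolding eq
 proof (rule sum_norm_le)
  fix k assume "k \<in> {..N}"
  hence k: "k <= N" by simp
  have "cmod ((v i * w k - v k * w i) * cnj (v j * w k)) <= \<eta> * s * s"
   unfolding norm_mult[of "v i * w k - v k * w i"] complex_mod_cnj using cross[OF ij(1) k] \<eta> s(2) ij k
   by (intro mult_mono le sqrt_vnsq_ge) (auto simp: s_def)
  moreover have "cmod (v k * w i * cnj (v j * w k - v k * w j)) <= s * (\<eta> * s)"
   unfolding norm_mult[of "v k * w i"] complex_mod_cnj using cross[OF ij(2) k] \<eta> s(2) ij k
   by (intro mult_mono le sqrt_vnsq_ge) (auto simp: s_def)
  ultimately show "cmod ((v i * w k - v k * w i) * cnj (v j * w k) + v k * w i * cnj (v j * w k - v k * w j)) <= \<eta> * s * s + s * (\<eta> * s)"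
   by (rule order_trans[OF norm_triangle_ineq add_mono])
 qed
 also have "... = 2 * (real N + 1) * \<eta> * (?a * ?b)" unfolding s(1)[symmetric] by (simp add: algebra_simps)
 finally have "cmod (v i * cnj (v j) * of_real ?b - w i * cnj (w j) * of_real ?a) / (?a * ?b) <= 2 * (real N + 1) * \<eta>"
  using v w by (simp add: divide_le_eq)
 moreover have "v i * cnj (v j) / of_real ?a - w i * cnj (w j) / of_real ?b =
   (v i * cnj (v j) * of_real ?b - w i * cnj (w j) * of_real ?a) / of_real (?a * ?b)"
  using v w by (simp add: field_simps)
 ultimately show ?thesis using v w by (simp add: norm_divide norm_mult)
qed

lemma pdist_le_cross_terms:
 assumes F: "homogeneous_coords N F f" and G: "homogeneous_coords N G g" and \<eta>: "0 <= \<eta>"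
  and cross: "!!i k. i <= N ==> k <= N ==> (cmod (F i z * G k z - F k z * G i z))^2 <= \<eta>^2 * (nsq N F z * nsq N G z)"
 shows "pdist N (f z) (g z) <= (real N + 1)^2 * (2 * (real N + 1) * \<eta>)"
proof (rule pdist_leI)
 fix i j assume ij: "i <= N" "j <= N"
 have n: "nsq N H z = vnsq N (%i. H i z)" for H by (simp add: nsq_def vnsq_def)
 have "cmod (F i z * cnj (F j z) / of_real (vnsq N (%i. F i z)) - G i z * cnj (G j z) / of_real (vnsq N (%i. G i z))) <= 2 * (real N + 1) * \<eta>"
 proof (rule projector_diff_le[where v="%i. F i z" and w="%i. G i z"])
  show "0 < vnsq N (%i. F i z)" "0 < vnsq N (%i. G i z)"
   using homogeneous_coords_props(2)[OF F, of z] homogeneous_coords_props(2)[OF G, of z] by (simp_all add: n)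
  fix i k assume "i <= N" "k <= N"
  hence "cmod (F i z * G k z - F k z * G i z) <= sqrt (\<eta>^2 * (nsq N F z * nsq N G z))"
   by (intro real_le_rsqrt cross)
  thus "cmod (F i z * G k z - F k z * G i z) <= \<eta> * sqrt (vnsq N (%i. F i z) * vnsq N (%i. G i z))"
   using \<eta> by (simp add: real_sqrt_mult n)
 qed (use \<eta> ij in auto)
 thus "cmod (pcoord N (f z) i j - pcoord N (g z) i j) <= 2 * (real N + 1) * \<eta>"
  using homogeneous_coords_pcoord[OF F ij, of z] homogeneous_coords_pcoord[OF G ij, of z] by (simp add: n)
qed

lemma cross_term_eq_0:
 assumes F: "homogeneous_coords N F f" and G: "homogeneous_coords N G g" and eq: "f z = g z"
  and ij: "i <= N" "j <= N"
 shows "F i z * G j z - F j z * G i z = 0"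
proof -
 have "\<exists>i\<le>N. F i z ~= 0" using F by (auto simp: homogeneous_coords_def)
 hence "(\<lambda>i\<in>{..N}. F i z) \<in> proj_point N (\<lambda>i\<in>{..N}. F i z)"
  unfolding proj_point_def punctured_vectors_def by (auto intro!: exI[of _ "1::complex"])
 hence "(\<lambda>i\<in>{..N}. F i z) \<in> proj_point N (\<lambda>i\<in>{..N}. G i z)"
  using eq F G by (simp add: homogeneous_coords_def)
 then obtain c where "\<forall>i\<le>N. (\<lambda>i\<in>{..N}. F i z) i = c * (\<lambda>i\<in>{..N}. G i z) i"
  unfolding proj_point_def mem_Collect_eq by (elim conjE exE)
 hence "F i z = c * G i z" "F j z = c * G j z" using ij by auto
 thus ?thesis by simp
qed

lemma gaussian_small:
 assumes c: "0 < c" and t: "0 < t" and A: "0 <= A" and \<eta>: "0 < (\<eta>::real)"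
 shows "\<exists>K::nat. 1 <= K & A * exp (- c * (t * (real K - 1 / 2))^2) <= \<eta>"
proof -
 have "((%K. A * exp (- c * (t * (real K - 1 / 2))^2)) \<longlongrightarrow> A * 0) sequentially"
 proof (intro tendsto_intros filterlim_compose[OF exp_at_bot])
  have 1: "filterlim (%K. real K - 1 / 2) at_top sequentially"
   using filterlim_tendsto_add_at_top[OF tendsto_const[of "- (1 / 2)"] filterlim_real_sequentially]
   by (simp add: add.commute)
  have 2: "filterlim (%K. c * t^2 * ((real K - 1 / 2))^2) at_top sequentially"
   by (intro filterlim_tendsto_pos_mult_at_top[OF tendsto_const] filterlim_pow_at_top 1) (use c t in auto)
  hence "filterlim (%K. - (c * t^2 * ((real K - 1 / 2))^2)) at_bot sequentially"
   by (simp add: filterlim_uminus_at_top[symmetric])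
  thus "filterlim (%K. - c * (t * (real K - 1 / 2))^2) at_bot sequentially"
   by (simp add: power_mult_distrib mult.assoc)
 qed
 hence "\<forall>\<^sub>F K in sequentially. A * exp (- c * (t * (real K - 1 / 2))^2) < \<eta>"
  using \<eta> by (intro order_tendstoD(2)) auto
 hence "\<forall>\<^sub>F K in sequentially. 1 <= K & A * exp (- c * (t * (real K - 1 / 2))^2) <= \<eta>"
  using eventually_ge_at_top[of 1] by eventually_elim auto
 thus ?thesis by (rule eventually_happens'[OF sequentially_bot])
qed

text \<open>
  The accuracy \<open>e\<close> determines the number of rows and columns that \<open>cross_term_small\<close> needs, and
  \<open>r0\<close> leaves room for such a rectangle around each point of the disc.
\<close>

theorem brody_curves_agree_on_lattice:
 assumes t: "0 < t" "t < 1 / 2" and e: "0 < e"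
 shows "\<exists>r0>0. \<forall>R f g. brody_curve N f --> brody_curve N g -->
   (\<forall>(a,b)\<in>lattice_disc t 1 (R + r0). f (Complex (t * of_int a) (of_int b)) = g (Complex (t * of_int a) (of_int b))) -->
   (\<forall>z. cmod z <= R --> pdist N (f z) (g z) <= e)"
proof -
 define \<eta> where "\<eta> = e / ((real N + 1)^2 * (2 * (real N + 1)))"
 have \<eta>: "0 < \<eta>" using e by (simp add: \<eta>_def)
 define c where "c = pi / 2 * (1 / t - 2)"
 have c: "0 < c" using t by (simp add: c_def field_simps)
 have "0 < \<eta>^2" using \<eta> by simp
 then obtain K where K: "1 <= K" "4 * (ssig_up t / ssig_low t)^2 * exp (- c * (t * (real K - 1 / 2))^2) <= \<eta>^2"
  using gaussian_small[OF c t(1), of "4 * (ssig_up t / ssig_low t)^2" "\<eta>^2"] by auto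
 \<comment> \<open>A rectangle of \<open>2K + 1\<close> rows and columns around \<open>z\<close> stays within this distance, as \<open>t < 1\<close>.\<close>
 define r0 where "r0 = 2 * (real K + 1)"
 show ?thesis
 proof (intro exI[of _ r0] conjI allI impI)
  show "0 < r0" by (simp add: r0_def)
  fix R f g and z :: complex
  assume f: "brody_curve N f" and g: "brody_curve N g" and z: "cmod z <= R"
   and agree: "\<forall>(a,b)\<in>lattice_disc t 1 (R + r0). f (Complex (t * of_int a) (of_int b)) = g (Complex (t * of_int a) (of_int b))"
  obtain F where F: "homogeneous_coords N F f" "\<forall>z. fs_density N F z <= pi" using f unfolding brody_curve_iff by (elim exE conjE)
  obtain G where G: "homogeneous_coords N G g" "\<forall>z. fs_density N G z <= pi" using g unfolding brody_curve_iff by (elim exE conjE)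
  define a b where "a = \<lfloor>Re z / t\<rfloor>" and "b = \<lfloor>Im z\<rfloor>"
  have ta: "t * of_int a <= Re z" "Re z <= t * of_int a + t"
  proof -
   have "of_int a <= Re z / t" "Re z / t <= of_int a + 1" unfolding a_def by linarith+
   thus "t * of_int a <= Re z" "Re z <= t * of_int a + t" using t(1) by (auto simp: field_simps)
  qed
  have tb: "of_int b <= Im z" "Im z <= of_int b + 1" unfolding b_def by linarith+
  define p where "p = Complex (t * of_int a) (of_int b)"
  have "pdist N (f z) (g z) <= (real N + 1)^2 * (2 * (real N + 1) * \<eta>)"
  proof (rule pdist_le_cross_terms[OF F(1) G(1)])
   fix i j assume ij: "i <= N" "j <= N"
   have "(cmod (F i z * G j z - F j z * G i z))^2 <= 4 * (ssig_up t / ssig_low t)^2 * exp (- (pi / 2 * (1 / t - 2)) * (t * (real K - 1 / 2))^2) * (nsq N F z * nsq N G z)"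
   proof (rule cross_term_small[where p=p])
    fix n k assume nk: "\<bar>n\<bar> <= int K" "\<bar>k\<bar> <= int K"
    let ?w = "Complex (t * of_int (a + n)) (1 * of_int (b + k))"
    have "cmod (?w - z) <= \<bar>Re (?w - z)\<bar> + \<bar>Im (?w - z)\<bar>" by (rule cmod_le)
    also have "... <= r0"
    proof -
     have nr: "\<bar>real_of_int n\<bar> <= real K" "\<bar>real_of_int k\<bar> <= real K" using nk by linarith+
     have "\<bar>t * of_int n\<bar> <= 1 * real K" unfolding abs_mult using t nr by (intro mult_mono) auto
     hence "\<bar>Re (?w - z)\<bar> <= real K + 1" using ta t by (simp add: distrib_left)
     moreover have "\<bar>Im (?w - z)\<bar> <= real K + 1" using tb nr by simp
     ultimately show ?thesis by (simp add: r0_def)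
    qed
    finally have "cmod ?w <= R + r0" using z norm_triangle_ineq[of z "?w - z"] by simp
    hence "(a + n, b + k) \<in> lattice_disc t 1 (R + r0)" unfolding lattice_disc_def by simp
    hence "f (Complex (t * of_int (a + n)) (of_int (b + k))) = g (Complex (t * of_int (a + n)) (of_int (b + k)))"
     using agree by blast
    moreover have "p + Complex (t * of_int n) (of_int k) = Complex (t * of_int (a + n)) (of_int (b + k))"
     by (simp add: p_def complex_eq_iff distrib_left)
    ultimately have "f (p + Complex (t * of_int n) (of_int k)) = g (p + Complex (t * of_int n) (of_int k))" by simp
    from cross_term_eq_0[OF F(1) G(1) this ij]
    show "let z = p + Complex (t * of_int n) (of_int k) in F i z * G j z - F j z * G i z = 0" by (simp add: Let_def)
   qed (use homogeneous_coords_props[OF F(1)] homogeneous_coords_props[OF G(1)] F(2) G(2) ij K(1) ta tb t in \<open>auto simp: p_def\<close>)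
   also have "... <= \<eta>^2 * (nsq N F z * nsq N G z)"
    using K(2) homogeneous_coords_props(2)[OF F(1), of z] homogeneous_coords_props(2)[OF G(1), of z]
    by (intro mult_right_mono) (auto simp: c_def)
   finally show "(cmod (F i z * G j z - F j z * G i z))^2 <= \<eta>^2 * (nsq N F z * nsq N G z)" .
  qed (use \<eta> in simp)
  also have "... = e" by (simp add: \<eta>_def)
  finally show "pdist N (f z) (g z) <= e" .
 qed
qed

lemma box_dim_le_sum:
 fixes h :: "'i => 'c => 'b" and X :: "'c set" and S :: "'b set" and \<rho> :: "'b => 'b => real"
 assumes box: "box_dim_le S \<rho> k" and fin: "finite I" and h: "!!i x. i \<in> I ==> x \<in> X ==> h i x \<in> S"
 shows "box_dim_le X (%x y. \<Sum>i\<in>I. \<rho> (h i x) (h i y)) (k * card I)"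
proof -
 obtain C where C: "\<forall>q::nat. 1 <= q --> (\<exists>\<kappa> :: 'b => nat. finite (\<kappa> ` S) & real (card (\<kappa> ` S)) <= C * real q ^ k &
   (\<forall>x\<in>S. \<forall>y\<in>S. \<kappa> x = \<kappa> y --> \<rho> x y <= C / real q))" using box unfolding box_dim_le_def by (elim exE)
 have "\<forall>q. \<exists>\<kappa> :: 'b => nat. 1 <= q --> finite (\<kappa> ` S) & real (card (\<kappa> ` S)) <= C * real q ^ k &
   (\<forall>x\<in>S. \<forall>y\<in>S. \<kappa> x = \<kappa> y --> \<rho> x y <= C / real q)" using C by simp
 from choice[OF this] obtain \<kappa> :: "nat => 'b => nat"
  where \<kappa>: "\<forall>q. 1 <= q --> finite (\<kappa> q ` S) & real (card (\<kappa> q ` S)) <= C * real q ^ k &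
   (\<forall>x\<in>S. \<forall>y\<in>S. \<kappa> q x = \<kappa> q y --> \<rho> x y <= C / real q)" by (elim exE)
 show ?thesis
 proof (rule box_dim_leI[where \<kappa>="%q x. \<lambda>i\<in>I. \<kappa> q (h i x)" and T="%q. PiE I (%_. \<kappa> q ` S)" and ?C1.0="C ^ card I" and ?C2.0="real (card I) * C"])
  fix q :: nat assume q: "1 <= q"
  have "real (card (\<kappa> q ` S)) ^ card I <= (C * real q ^ k) ^ card I" using \<kappa> q by (intro power_mono) auto
  hence "real (card (PiE I (%_. \<kappa> q ` S))) <= C ^ card I * real q ^ (k * card I)"
   by (simp add: card_PiE fin power_mult_distrib power_mult)
  thus "finite (PiE I (%_. \<kappa> q ` S)) & (%x. \<lambda>i\<in>I. \<kappa> q (h i x)) ` X \<subseteq> PiE I (%_. \<kappa> q ` S) &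
    real (card (PiE I (%_. \<kappa> q ` S))) <= C ^ card I * real q ^ (k * card I)"
   using \<kappa> q fin h by (auto intro!: finite_PiE)
 next
  fix q :: nat and x y assume q: "1 <= q" and xy: "x \<in> X" "y \<in> X" and eq: "(\<lambda>i\<in>I. \<kappa> q (h i x)) = (\<lambda>i\<in>I. \<kappa> q (h i y))"
  have "\<rho> (h i x) (h i y) <= C / real q" if i: "i \<in> I" for i
  proof -
   have "\<kappa> q (h i x) = \<kappa> q (h i y)" using fun_cong[OF eq, of i] i by simp
   thus ?thesis using \<kappa> q h[OF i xy(1)] h[OF i xy(2)] by blast
  qed
  hence "(\<Sum>i\<in>I. \<rho> (h i x) (h i y)) <= (\<Sum>i\<in>I. C / real q)" by (rule sum_mono)
  thus "(\<Sum>i\<in>I. \<rho> (h i x) (h i y)) <= real (card I) * C / real q" by simp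
 qed
qed

lemma pcoord_diagonal_large:
 assumes "p \<in> topspace (CP N)"
 shows "\<exists>j\<le>N. 1 / (real N + 1) <= Re (pcoord N p j j)"
proof (rule ccontr)
 assume "\<not> ?thesis"
 hence "(\<Sum>j\<le>N. Re (pcoord N p j j)) < (\<Sum>j\<le>N. 1 / (real N + 1))" by (intro sum_strict_mono) auto
 also have "... = 1" by simp
 finally show False using arg_cong[OF pcoord_trace[OF assms], of Re] by simp
qed

text \<open>
  In the affine chart of a coordinate \<open>j\<close> that is bounded away from zero, \<open>pdist\<close> is Lipschitz.
\<close>

lemma pdist_le_affine:
 assumes p: "p \<in> topspace (CP N)" and q: "q \<in> topspace (CP N)" and j: "j <= N"
  and pj: "1 / (real N + 1) <= Re (pcoord N p j j)" and qj: "1 / (real N + 1) <= Re (pcoord N q j j)"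
  and d: "!!i. i <= N ==> cmod (pcoord N p i j / pcoord N p j j - pcoord N q i j / pcoord N q j j) <= d"
 shows "pdist N p q <= (real N + 1)^2 * (2 * (real N + 1) * (2 * d * (real N + 1)))"
proof (rule pdist_leI)
 fix i k assume ik: "i <= N" "k <= N"
 define v where "v = (%p i. pcoord N p i j / pcoord N p j j)"
 have v: "vnsq N (v p) >= 1 & cmod (v p i) <= real N + 1 &
   pcoord N p i k = v p i * cnj (v p k) / of_real (vnsq N (v p))"
  if p: "p \<in> topspace (CP N)" and pj: "1 / (real N + 1) <= Re (pcoord N p j j)" and ik: "i <= N" "k <= N" for p i k
 proof -
  obtain u where u: "\<exists>i\<le>N. u i ~= 0" "\<forall>i j. i <= N --> j <= N --> pcoord N p i j = u i * cnj (u j) / of_real (vnsq N u)"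
   by (rule CP_cases[OF p]) blast
  have nz: "pcoord N p j j ~= 0" using pj by (auto simp: field_simps)
  hence uj: "u j ~= 0" using u(2) j by auto
  have u0: "0 < vnsq N u" using u(1) by (rule vec_norm_pos)
  have vu: "v p i = u i / u j" if "i <= N" for i
   using u(2) that j uj u0 by (simp add: v_def)
  have nv: "vnsq N (v p) = vnsq N u / (cmod (u j))^2"
   by (simp add: vnsq_def vu norm_divide power_divide sum_divide_distrib)
  have "(cmod (u j))^2 <= vnsq N u" unfolding vnsq_def using j by (intro member_le_sum) auto
  hence 1: "1 <= vnsq N (v p)" unfolding nv using uj by simp
  have 2: "cmod (v p i) <= real N + 1"
  proof -
   have "1 / (real N + 1) <= cmod (pcoord N p j j)" using pj complex_Re_le_cmod[of "pcoord N p j j"] by linarith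
   hence "cmod (v p i) <= 1 / (1 / (real N + 1))"
    unfolding v_def norm_divide by (intro frac_le norm_pcoord_le p ik j) auto
   thus ?thesis by simp
  qed
  have "v p i * cnj (v p k) / of_real (vnsq N (v p)) = u i * cnj (u k) / of_real (vnsq N u)"
   using uj u0 ik unfolding vu[OF ik(1)] vu[OF ik(2)] nv of_real_divide complex_norm_square[of "u j"] by (simp add: divide_simps)
  thus ?thesis using 1 2 u(2) ik by simp
 qed
 have d0: "0 <= d" using order_trans[OF norm_ge_zero d[of 0]] by simp
 have "cmod (v p i * cnj (v p k) / of_real (vnsq N (v p)) - v q i * cnj (v q k) / of_real (vnsq N (v q))) <= 2 * (real N + 1) * (2 * d * (real N + 1))"
 proof (rule projector_diff_le[OF _ _ _ ik])
  show "0 < vnsq N (v p)" "0 < vnsq N (v q)" using v[OF p pj ik] v[OF q qj ik] by auto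
  show "0 <= 2 * d * (real N + 1)" using d0 by simp
  fix i k assume ik: "i <= N" "k <= N"
  have dd: "cmod (v p i - v q i) <= d" if "i <= N" for i using d[OF that] by (simp add: v_def)
  have e: "v p i * v q k - v p k * v q i = (v p i - v q i) * v q k + v q i * (v q k - v p k)" by (simp add: algebra_simps)
  have "cmod (v p i * v q k - v p k * v q i) <= cmod (v p i - v q i) * cmod (v q k) + cmod (v q i) * cmod (v q k - v p k)"
   unfolding e norm_mult[symmetric] by (rule norm_triangle_ineq)
  also have "... <= d * (real N + 1) + (real N + 1) * d"
   using dd[OF ik(1)] dd[OF ik(2)] v[OF q qj ik] v[OF q qj ik(2) ik(1)] d0
   by (intro add_mono mult_mono) (auto simp: norm_minus_commute)
  also have "... = 2 * d * (real N + 1) * 1" by simp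
  also have "... <= 2 * d * (real N + 1) * sqrt (vnsq N (v p) * vnsq N (v q))"
  proof (rule mult_left_mono)
   have "1 * 1 <= vnsq N (v p) * vnsq N (v q)" using v[OF p pj ik] v[OF q qj ik] by (intro mult_mono) auto
   thus "1 <= sqrt (vnsq N (v p) * vnsq N (v q))" by simp
  qed (use d0 in simp)
  finally show "cmod (v p i * v q k - v p k * v q i) <= 2 * d * (real N + 1) * sqrt (vnsq N (v p) * vnsq N (v q))" .
 qed
 thus "cmod (pcoord N p i k - pcoord N q i k) <= 2 * (real N + 1) * (2 * d * (real N + 1))"
  using v[OF p pj ik] v[OF q qj ik] by simp
qed

lemma floor_eq_imp_close:
 fixes a b :: real
 assumes q: "0 < q" and eq: "\<lfloor>q * a\<rfloor> = \<lfloor>q * b\<rfloor>"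
 shows "\<bar>a - b\<bar> <= 1 / q"
proof -
 have "\<bar>q * a - q * b\<bar> <= 1" using eq by linarith
 hence "q * \<bar>a - b\<bar> <= 1" using q by (simp add: abs_mult right_diff_distrib[symmetric])
 thus ?thesis using q by (simp add: field_simps)
qed

text \<open>
  A code of a point is the index \<open>j\<close> of a large coordinate together with the rounded real and imaginary
  parts of the \<open>N\<close> remaining affine coordinates.
\<close>

lemma box_dim_CP: "box_dim_le (topspace (CP N)) (pdist N) (2 * N)"
proof -
 define J where "J = (%p. SOME j. j <= N & 1 / (real N + 1) <= Re (pcoord N p j j))"
 have J: "J p <= N & 1 / (real N + 1) <= Re (pcoord N p (J p) (J p))" if "p \<in> topspace (CP N)" for p
  unfolding J_def using pcoord_diagonal_large[OF that] by (rule someI_ex)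
 define v where "v = (%p i. pcoord N p i (J p) / pcoord N p (J p) (J p))"
 have vle: "cmod (v p i) <= real N + 1" if p: "p \<in> topspace (CP N)" and i: "i <= N" for p i
 proof -
  have "1 / (real N + 1) <= cmod (pcoord N p (J p) (J p))" using J[OF p] complex_Re_le_cmod[of "pcoord N p (J p) (J p)"] by linarith
  hence "cmod (v p i) <= 1 / (1 / (real N + 1))"
   unfolding v_def norm_divide using J[OF p] by (intro frac_le norm_pcoord_le p i) auto
  thus ?thesis by simp
 qed
 define I where "I = (%q::nat. {- int ((N + 1) * q)..int ((N + 1) * q)})"
 define T where "T = (%q. SIGMA j:{..N}. PiE ({..N} - {j}) (%_. I q \<times> I q))"
 define \<kappa> where "\<kappa> = (%(q::nat) p. (J p, \<lambda>i\<in>{..N} - {J p}. (\<lfloor>real q * Re (v p i)\<rfloor>, \<lfloor>real q * Im (v p i)\<rfloor>)))"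
 show ?thesis
 proof (rule box_dim_leI[where \<kappa>=\<kappa> and T=T and ?C1.0="real (N + 1) * real (2 * (N + 2)) ^ (2 * N)"
    and ?C2.0="(real N + 1)^2 * (2 * (real N + 1) * (2 * 2 * (real N + 1)))"])
  fix q :: nat assume q: "1 <= q"
  have fin: "finite (T q)" unfolding T_def I_def by (intro finite_SigmaI finite_PiE) auto
  have "card (T q) = (\<Sum>j\<le>N. (card (I q) * card (I q)) ^ N)"
   unfolding T_def by (subst card_SigmaI) (auto simp: card_PiE I_def card_cartesian_product intro!: finite_PiE sum.cong)
  also have "... = (N + 1) * card (I q) ^ (2 * N)" by (simp add: power_mult power2_eq_square)
  also have "... <= (N + 1) * (2 * (N + 2) * q) ^ (2 * N)"
  proof (intro mult_left_mono power_mono)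
   have "card (I q) = 2 * ((N + 1) * q) + 1"
   proof -
    have "nat (int m - - int m + 1) = 2 * m + 1" for m by linarith
    thus ?thesis unfolding I_def card_atLeastAtMost_int .
   qed
   thus "card (I q) <= 2 * (N + 2) * q" using q by (simp add: algebra_simps)
  qed simp_all
  finally have "real (card (T q)) <= real ((N + 1) * (2 * (N + 2) * q) ^ (2 * N))" by (rule of_nat_mono)
  also have "... = real (N + 1) * real (2 * (N + 2)) ^ (2 * N) * real q ^ (2 * N)"
   by (simp only: of_nat_mult of_nat_power power_mult_distrib mult.assoc)
  finally have card: "real (card (T q)) <= real (N + 1) * real (2 * (N + 2)) ^ (2 * N) * real q ^ (2 * N)" .
  have inI: "\<lfloor>real q * x\<rfloor> \<in> I q" if "\<bar>x\<bar> <= real N + 1" for x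
  proof -
   have "\<bar>real q * x\<bar> <= real q * (real N + 1)" unfolding abs_mult using that by (intro mult_mono) auto
   hence "\<bar>real q * x\<bar> <= real_of_int (int ((N + 1) * q))" by (simp add: algebra_simps)
   thus ?thesis unfolding I_def atLeastAtMost_iff by linarith
  qed
  have "\<kappa> q p \<in> T q" if p: "p \<in> topspace (CP N)" for p
  proof -
   have "(\<lfloor>real q * Re (v p i)\<rfloor>, \<lfloor>real q * Im (v p i)\<rfloor>) \<in> I q \<times> I q" if "i <= N" for i
    using vle[OF p that] abs_Re_le_cmod[of "v p i"] abs_Im_le_cmod[of "v p i"] by (intro SigmaI inI) linarith+
   thus ?thesis unfolding \<kappa>_def T_def using J[OF p] by auto
  qed
  thus "finite (T q) & \<kappa> q ` topspace (CP N) \<subseteq> T q & real (card (T q)) <= real (N + 1) * real (2 * (N + 2)) ^ (2 * N) * real q ^ (2 * N)"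
   using fin card by blast
 next
  fix q :: nat and x y assume q: "1 <= q" and xy: "x \<in> topspace (CP N)" "y \<in> topspace (CP N)" and eq: "\<kappa> q x = \<kappa> q y"
  have Jeq: "J x = J y" using eq by (simp add: \<kappa>_def)
  have feq: "(\<lambda>i\<in>{..N} - {J x}. (\<lfloor>real q * Re (v x i)\<rfloor>, \<lfloor>real q * Im (v x i)\<rfloor>)) = (\<lambda>i\<in>{..N} - {J y}. (\<lfloor>real q * Re (v y i)\<rfloor>, \<lfloor>real q * Im (v y i)\<rfloor>))"
   using eq unfolding \<kappa>_def by (rule Pair_inject)
  have "pdist N x y <= (real N + 1)^2 * (2 * (real N + 1) * (2 * (2 / real q) * (real N + 1)))"
  proof (rule pdist_le_affine[OF xy, of "J x"])
   show "J x <= N" "1 / (real N + 1) <= Re (pcoord N x (J x) (J x))" "1 / (real N + 1) <= Re (pcoord N y (J x) (J x))"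
    using J[OF xy(1)] J[OF xy(2)] Jeq by auto
   fix i assume i: "i <= N"
   show "cmod (pcoord N x i (J x) / pcoord N x (J x) (J x) - pcoord N y i (J x) / pcoord N y (J x) (J x)) <= 2 / real q"
   proof (cases "i = J x")
    case True
    have "pcoord N x (J x) (J x) ~= 0" "pcoord N y (J x) (J x) ~= 0"
     using J[OF xy(1)] J[OF xy(2)] Jeq by (auto simp: field_simps)
    thus ?thesis unfolding True by simp
   next
    case False
    have "\<lfloor>real q * Re (v x i)\<rfloor> = \<lfloor>real q * Re (v y i)\<rfloor>" "\<lfloor>real q * Im (v x i)\<rfloor> = \<lfloor>real q * Im (v y i)\<rfloor>"
     using fun_cong[OF feq, of i] False i Jeq by auto
    hence "\<bar>Re (v x i) - Re (v y i)\<bar> <= 1 / real q" "\<bar>Im (v x i) - Im (v y i)\<bar> <= 1 / real q"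
     using floor_eq_imp_close[of "real q"] q by auto
    hence "cmod (v x i - v y i) <= 1 / real q + 1 / real q" using cmod_le[of "v x i - v y i"] by simp
    thus ?thesis by (simp add: v_def Jeq)
   qed
  qed
  moreover have "A * (B * (2 * (2 / Q) * D)) = A * (B * (2 * 2 * D)) / Q" for A B D Q :: real by simp
  ultimately show "pdist N x y <= (real N + 1)^2 * (2 * (real N + 1) * (2 * 2 * (real N + 1))) / real q" by metis
 qed
qed

section \<open>A theta curve of small energy\<close>

text \<open>
  Multiplying by \<open>exp (-c (w - z))\<close> turns the derivative at \<open>z\<close> into \<open>G' - c G\<close> and, for
  \<open>c = 2\<pi>a Re z\<close>, the weight \<open>exp (\<pi> a (Re w)\<^sup>2)\<close> into one that is nearly constant on the unit disc around \<open>z\<close>.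
\<close>

lemma covariant_Cauchy:
 fixes G :: "complex => complex"
 assumes G: "G holomorphic_on UNIV" and a: "0 <= a"
  and M: "!!w. cmod (w - z) <= 1 ==> cmod (G w) <= M * exp (pi * a * (Re w)^2)"
 shows "cmod (deriv G z - of_real (2 * pi * a * Re z) * G z) <= M * exp (pi * a) * exp (pi * a * (Re z)^2)"
proof -
 define c where "c = complex_of_real (2 * pi * a * Re z)"
 define H where "H = (%w. G w * exp (- c * (w - z)))"
 have H: "H holomorphic_on A" for A
  unfolding H_def by (intro holomorphic_intros holomorphic_on_subset[OF G]) auto
 have "(G has_field_derivative deriv G z) (at z)"
  using G by (simp add: holomorphic_derivI[OF _ open_UNIV])
 hence "(H has_field_derivative deriv G z - c * G z) (at z)"
  unfolding H_def by (auto intro!: derivative_eq_intros)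
 hence d: "deriv H z = deriv G z - c * G z" by (rule DERIV_imp_deriv)
 have M0: "0 <= M"
  using order_trans[OF norm_ge_zero M[of z]] by (simp add: zero_le_mult_iff)
 have "cmod ((deriv ^^ 1) H z) <= fact 1 * (M * exp (pi * a) * exp (pi * a * (Re z)^2)) / 1 ^ 1"
 proof (rule Cauchy_inequality)
  show "H holomorphic_on ball z 1" by (rule H)
  show "continuous_on (cball z 1) H" by (rule holomorphic_on_imp_continuous_on[OF H])
  fix w assume w: "cmod (z - w) = 1"
  define u where "u = Re (w - z)"
  have u: "\<bar>u\<bar> <= 1" unfolding u_def using abs_Re_le_cmod[of "w - z"] w by (simp add: norm_minus_commute)
  have "cmod (H w) <= (M * exp (pi * a * (Re w)^2)) * exp (- (2 * pi * a * Re z * u))"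
   unfolding H_def norm_mult norm_exp_eq_Re using w M[of w]
   using M0 by (intro mult_mono) (auto simp: norm_minus_commute c_def u_def)
  also have "... = M * exp (pi * a * (Re z)^2 + pi * a * u^2)"
  proof -
   have "pi * a * (Re w)^2 + - (2 * pi * a * Re z * u) = pi * a * (Re z)^2 + pi * a * u^2"
    by (simp add: u_def power2_eq_square algebra_simps)
   thus ?thesis by (simp only: mult.assoc[of M] exp_add[symmetric])
  qed
  also have "... <= M * exp (pi * a * (Re z)^2 + pi * a * 1)"
  proof -
   have "u^2 <= 1" using u by (simp add: abs_square_le_1)
   hence "pi * a * u^2 <= pi * a * 1" using a by (intro mult_left_mono) auto
   thus ?thesis using M0 by (intro mult_left_mono) auto
  qed
  also have "... = M * exp (pi * a) * exp (pi * a * (Re z)^2)" by (simp add: exp_add)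
  finally show "cmod (H w) <= M * exp (pi * a) * exp (pi * a * (Re z)^2)" .
 qed simp
 thus ?thesis using d by (simp add: c_def)
qed

text \<open>
  The operator \<open>G \<mapsto> G' - 2\<pi>a Re z G\<close> is the covariant derivative for the weight \<open>exp (-\<pi> a x\<^sup>2)\<close>; unlike \<open>G'\<close> its size
  relative to the weight does not grow with \<open>z\<close>.
\<close>

definition covariant_energy :: "real => nat => (nat => complex => complex) => complex => real" where
 "covariant_energy a N F z = (\<Sum>i\<le>N. (cmod (deriv (F i) z - of_real (2 * pi * a * Re z) * F i z))^2)"

lemma covariant_energy_nonneg: "0 <= covariant_energy a N F z"
 by (simp add: covariant_energy_def sum_nonneg)

text \<open>
  Adding a multiple of \<open>F\<close> to \<open>F'\<close> does not change the tangential part, which has the smallest norm.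
\<close>

lemma fs_density_le_covariant:
 fixes c :: complex
 assumes pos: "0 < nsq N F z"
 shows "fs_density N F z <= (\<Sum>i\<le>N. (cmod (deriv (F i) z - c * F i z))^2) / nsq N F z"
proof -
 define u where "u = dinner N F z / of_real (nsq N F z)"
 define T where "T = (%i. deriv (F i) z - F i z * u)"
 define d where "d = u - c"
 have e: "deriv (F i) z - c * F i z = T i + d * F i z" for i by (simp add: T_def d_def algebra_simps)
 have nn: "of_real (nsq N F z) = (\<Sum>i\<le>N. F i z * cnj (F i z))"
  by (simp only: nsq_def of_real_sum complex_norm_square)
 have "(\<Sum>i\<le>N. T i * cnj (F i z)) = dinner N F z - u * of_real (nsq N F z)"
  unfolding nn dinner_def T_def sum_distrib_left sum_subtractf[symmetric] by (simp add: algebra_simps)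
 also have "... = 0" using pos by (simp add: u_def)
 finally have T0: "(\<Sum>i\<le>N. T i * cnj (F i z)) = 0" .
 have sq: "(cmod (x + y))^2 = (cmod x)^2 + (cmod y)^2 + 2 * Re (x * cnj y)" for x y
  unfolding cmod_power2 by (simp add: power2_eq_square algebra_simps)
 have "2 * Re (T i * cnj (d * F i z)) = 2 * Re (cnj d * (T i * cnj (F i z)))" for i
  by (simp only: complex_cnj_mult mult.left_commute)
 hence cross: "(\<Sum>i\<le>N. 2 * Re (T i * cnj (d * F i z))) = 0"
  by (simp only: sum_distrib_left[symmetric] Re_sum[symmetric] T0) simp
 have "(\<Sum>i\<le>N. (cmod (deriv (F i) z - c * F i z))^2) =
   (\<Sum>i\<le>N. (cmod (T i))^2) + (\<Sum>i\<le>N. (cmod (d * F i z))^2)"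
  unfolding e sq sum.distrib cross by simp
 hence "(\<Sum>i\<le>N. (cmod (T i))^2) <= (\<Sum>i\<le>N. (cmod (deriv (F i) z - c * F i z))^2)" by (simp add: sum_nonneg)
 moreover have "fs_density N F z = (\<Sum>i\<le>N. (cmod (T i))^2) / nsq N F z"
  unfolding fs_density_eq_tangential[OF pos] T_def u_def by simp
 ultimately show ?thesis using pos by (simp add: divide_right_mono)
qed

text \<open>
  Relative to \<open>exp (\<pi> a x\<^sup>2)\<close> these functions are Gaussians of unit height, centred on the line \<open>a x = k\<close> (see \<open>norm_gexp\<close>).
\<close>

definition gexp :: "real => real => complex => complex" where
 "gexp a k z = exp (of_real (2 * pi * k) * z - of_real (pi * k^2 / a))"

lemma norm_gexp:
 assumes "0 < a"
 shows "cmod (gexp a k z) = exp (pi * a * (Re z)^2) * exp (- (pi / a * (k - a * Re z)^2))"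
proof -
 have "2 * pi * k * Re z - pi * k^2 / a = pi * a * (Re z)^2 + - (pi / a * (k - a * Re z)^2)"
  using assms by (simp add: field_simps power2_eq_square)
 thus ?thesis unfolding gexp_def norm_exp_eq_Re exp_add[symmetric] by simp
qed

lemma gexp_holomorphic: "gexp a k holomorphic_on A"
 unfolding gexp_def by (intro holomorphic_intros)

lemma deriv_gexp: "deriv (gexp a k) z = of_real (2 * pi * k) * gexp a k z"
 unfolding gexp_def by (rule DERIV_imp_deriv) (auto intro!: derivative_eq_intros)

lemma norm_gexp_le:
 assumes a: "0 < a" and r: "cmod z <= r"
 shows "cmod (gexp a k z) <= exp (a * (2 * pi * r + 1)^2 / (4 * pi)) * exp (- \<bar>k\<bar>)"
proof -
 let ?b = "2 * pi * r + 1"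
 have "2 * pi * k * Re z <= \<bar>2 * pi * k\<bar> * \<bar>Re z\<bar>" unfolding abs_mult[symmetric] by (rule abs_ge_self)
 also have "... <= 2 * pi * \<bar>k\<bar> * r"
  using r abs_Re_le_cmod[of z] by (intro mult_mono) (auto simp: abs_mult)
 finally have 1: "2 * pi * k * Re z <= ?b * \<bar>k\<bar> - \<bar>k\<bar>" by (simp add: algebra_simps)
 have "0 <= pi / a * (\<bar>k\<bar> - a * ?b / (2 * pi))^2" using a by simp
 also have "... = pi * k^2 / a - ?b * \<bar>k\<bar> + a * ?b^2 / (4 * pi)"
 proof -
  have "pi / a * (y - a * b / (2 * pi))^2 = pi * y^2 / a - b * y + a * b^2 / (4 * pi)" for y b
   using a by (simp add: field_simps power2_eq_square)
  from this[of "\<bar>k\<bar>" ?b] show ?thesis by simp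
 qed
 finally show ?thesis using 1 unfolding gexp_def norm_exp_eq_Re exp_add[symmetric] by simp
qed

lemma exp_int_summable:
 fixes b X :: real
 assumes b: "0 < b"
 shows "(%n::int. exp (- \<bar>b * of_int n - X\<bar>)) summable_on A"
proof (rule nonneg_bdd_above_summable_on)
 show "bdd_above (sum (%n::int. exp (- \<bar>b * of_int n - X\<bar>)) ` {F. F \<subseteq> A & finite F})"
  by (rule bdd_aboveI2[where M="2 / (1 - exp (- b))"]) (use sum_exp_dist_le[OF b] in auto)
qed simp

text \<open>
  The frequencies \<open>s p\<close>, \<open>p \<in> \<int>\<close>, are distributed over the residue classes of \<open>p\<close> modulo \<open>m\<close>, so that at
  each point every one of the \<open>m\<close> functions is dominated by one term.
\<close>

definition theta :: "real => real => nat => nat => complex => complex" where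
 "theta a s m j z = (\<Sum>\<^sub>\<infinity>n::int. gexp a (s * (real j + real m * of_int n)) z)"

lemma theta_terms_bound:
 assumes a: "0 < a" and r: "cmod z <= r"
 shows "cmod (gexp a (s * (real j + real m * of_int n)) z) \<le>
   exp (a * (2 * pi * r + 1)^2 / (4 * pi)) * exp (- \<bar>s * real m * of_int n - (- s * real j)\<bar>)"
proof -
 have "s * (real j + real m * of_int n) = s * real m * of_int n - (- s * real j)" by (simp add: algebra_simps)
 thus ?thesis using norm_gexp_le[OF a r] by metis
qed

lemma theta_abs_summable:
 assumes a: "0 < a" and sm: "0 < s" "0 < m"
 shows "(%n::int. cmod (gexp a (s * (real j + real m * of_int n)) z)) summable_on A"
proof (rule summable_on_comparison_test)
 show "(%n::int. exp (a * (2 * pi * cmod z + 1)^2 / (4 * pi)) * exp (- \<bar>s * real m * of_int n - (- s * real j)\<bar>)) summable_on A"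
  using sm by (intro summable_on_cmult_right exp_int_summable) simp
qed (use theta_terms_bound[where z=z, OF a order_refl] in auto)

lemma theta_holomorphic:
 assumes a: "0 < a" and sm: "0 < s" "0 < m"
 shows "theta a s m j holomorphic_on UNIV"
proof -
 have "theta a s m j holomorphic_on ball 0 r" for r
 proof (rule holomorphic_uniform_limit)
  show "uniform_limit (cball 0 r) (%X z. \<Sum>n\<in>X. gexp a (s * (real j + real m * of_int n)) z) (theta a s m j) (finite_subsets_at_top (UNIV :: int set))"
   unfolding theta_def
  proof (rule Weierstrass_m_test_general)
   show "(%n::int. exp (a * (2 * pi * r + 1)^2 / (4 * pi)) * exp (- \<bar>s * real m * of_int n - (- s * real j)\<bar>)) summable_on UNIV"
    using sm by (intro summable_on_cmult_right exp_int_summable) simp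
  qed (use theta_terms_bound[OF a] in auto)
  show "\<forall>\<^sub>F X in finite_subsets_at_top (UNIV :: int set).
    continuous_on (cball 0 r) (%z. \<Sum>n\<in>X. gexp a (s * (real j + real m * of_int n)) z) &
    (%z. \<Sum>n\<in>X. gexp a (s * (real j + real m * of_int n)) z) holomorphic_on ball 0 r"
   by (intro always_eventually allI conjI holomorphic_on_imp_continuous_on holomorphic_intros gexp_holomorphic)
 qed (auto simp: finite_subsets_at_top_neq_bot)
 hence "theta a s m j field_differentiable at z" for z
  by (rule holomorphic_on_imp_differentiable_at[of _ "ball 0 (cmod z + 1)"]) auto
 thus ?thesis by (simp add: holomorphic_on_def field_differentiable_at_within)
qed

definition theta_tail :: "real => real" where
 "theta_tail T = exp (2 * pi) * (exp (- (pi * T / 4)) * (2 / (1 - exp (- (pi * T / 4)))))"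

text \<open>
  The other frequencies are further away by multiples of the period \<open>T\<close>, so their total is
  exponentially small in \<open>T\<close>, uniformly on the unit disc around \<open>z\<close>.
\<close>

lemma theta_near_term:
 assumes a: "0 < a" "a < 1" and sm: "0 < s" "0 < m" and T: "T = s * real m"
  and n0: "\<bar>s * (real j + real m * of_int n0) - a * Re z\<bar> <= T / 2" and w: "cmod (w - z) <= 1"
 shows "cmod (theta a s m j w - gexp a (s * (real j + real m * of_int n0)) w) <= theta_tail T * exp (pi * a * (Re w)^2)"
proof -
 let ?k = "%n::int. s * (real j + real m * of_int n)"
 have T0: "0 < T" using T sm by simp
 have summ: "(%n. cmod (gexp a (?k n) w)) summable_on A" for A by (rule theta_abs_summable[OF a(1) sm])
 have "theta a s m j w = infsum (%n. gexp a (?k n) w) (insert n0 (UNIV - {n0}))" by (simp add: theta_def)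
 also have "... = gexp a (?k n0) w + infsum (%n. gexp a (?k n) w) (UNIV - {n0})"
  by (rule infsum_insert[OF abs_summable_summable[OF summ]]) simp
 finally have "cmod (theta a s m j w - gexp a (?k n0) w) = cmod (infsum (%n. gexp a (?k n) w) (UNIV - {n0}))" by simp
 also have "... <= infsum (%n. cmod (gexp a (?k n) w)) (UNIV - {n0})" by (rule norm_infsum_bound[OF summ])
 also have "... <= theta_tail T * exp (pi * a * (Re w)^2)"
 proof (rule infsum_le_finite_sums[OF summ])
  fix S :: "int set" assume S: "finite S" "S \<subseteq> UNIV - {n0}"
  have "(\<Sum>n\<in>S. cmod (gexp a (?k n) w)) \<le>
    (\<Sum>n\<in>S. exp (pi * a * (Re w)^2) * (exp (2 * pi) * exp (- (pi * T / 4)) * exp (- \<bar>pi * T / 4 * of_int n - pi * T / 4 * of_int n0\<bar>)))"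
  proof (rule sum_mono)
   fix n assume "n \<in> S"
   hence "n ~= n0" using S by blast
   hence d: "1 <= \<bar>real_of_int n - of_int n0\<bar>" by linarith
   define D where "D = \<bar>real_of_int n - of_int n0\<bar>"
   define \<xi> where "\<xi> = ?k n - a * Re w"
   have "?k n - ?k n0 = T * (of_int n - of_int n0)" by (simp add: T algebra_simps)
   hence kk: "\<bar>?k n - ?k n0\<bar> = T * D" using T0 by (simp add: abs_mult D_def)
   have "\<bar>a * Re z - a * Re w\<bar> = a * \<bar>Re (w - z)\<bar>" using a by (simp add: right_diff_distrib[symmetric] abs_mult abs_minus_commute)
   also have "... <= 1 * 1" using a w abs_Re_le_cmod[of "w - z"] by (intro mult_mono) auto
   finally have "\<bar>\<xi>\<bar> >= T * D - T / 2 - 1" using kk n0 unfolding \<xi>_def by linarith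
   moreover have "T * 1 <= T * D" using d T0 by (intro mult_left_mono) (auto simp: D_def)
   ultimately have x1: "T / 4 + T * D / 4 - 1 <= \<bar>\<xi>\<bar>" by linarith
   have "\<bar>\<xi>\<bar> - 1 <= \<xi>^2"
   proof -
    have "0 <= (\<bar>\<xi>\<bar> - 1 / 2)^2" by simp
    thus ?thesis by (simp add: power2_diff field_simps)
   qed
   also have "\<xi>^2 <= \<xi>^2 / a" using a by (simp add: pos_le_divide_eq mult_left_le)
   finally have "T / 4 + T * D / 4 - 2 <= \<xi>^2 / a" using x1 by linarith
   hence "pi * (T / 4 + T * D / 4 - 2) <= pi * (\<xi>^2 / a)" by (intro mult_left_mono) auto
   hence x2: "- (pi / a * \<xi>^2) <= 2 * pi + - (pi * T / 4) + - (pi * T / 4 * D)" by (simp add: algebra_simps)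
   have "pi * T / 4 * D = \<bar>pi * T / 4 * (of_int n - of_int n0)\<bar>" using T0 by (simp add: D_def abs_mult)
   hence DD: "\<bar>pi * T / 4 * of_int n - pi * T / 4 * of_int n0\<bar> = pi * T / 4 * D" by (simp only: right_diff_distrib)
   show "cmod (gexp a (?k n) w) <= exp (pi * a * (Re w)^2) * (exp (2 * pi) * exp (- (pi * T / 4)) * exp (- \<bar>pi * T / 4 * of_int n - pi * T / 4 * of_int n0\<bar>))"
    unfolding norm_gexp[OF a(1)] DD exp_add[symmetric] exp_le_cancel_iff using x2 by (simp add: \<xi>_def)
  qed
  also have "... = exp (pi * a * (Re w)^2) * (exp (2 * pi) * exp (- (pi * T / 4)) * (\<Sum>n\<in>S. exp (- \<bar>pi * T / 4 * of_int n - pi * T / 4 * of_int n0\<bar>)))"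
   by (simp only: sum_distrib_left)
  also have "... <= exp (pi * a * (Re w)^2) * (exp (2 * pi) * exp (- (pi * T / 4)) * (2 / (1 - exp (- (pi * T / 4)))))"
   using T0 S by (intro mult_left_mono sum_exp_dist_le) auto
  also have "... = theta_tail T * exp (pi * a * (Re w)^2)" by (simp add: theta_tail_def)
  finally show "(\<Sum>n\<in>S. cmod (gexp a (?k n) w)) <= theta_tail T * exp (pi * a * (Re w)^2)" .
 qed
 finally show ?thesis .
qed

lemma theta_tail_nonneg: "0 < T ==> 0 <= theta_tail T"
 by (simp add: theta_tail_def)

lemma exp_add_exp_minus_ge: "2 + x^2 <= exp x + exp (- x)" for x :: real
proof -
 define y where "y = \<bar>x\<bar> / 2"
 have y: "0 <= y" by (simp add: y_def)
 have "sinh 0 - 0 <= sinh y - y"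
 proof (rule DERIV_nonneg_imp_nondecreasing[OF y])
  fix u :: real
  have "((%u. sinh u - u) has_real_derivative cosh u - 1) (at u)" by (auto intro!: derivative_eq_intros)
  moreover have "0 <= cosh u - 1" using cosh_real_ge_1[of u] by simp
  ultimately show "\<exists>d. ((%u. sinh u - u) has_real_derivative d) (at u) & 0 <= d" by blast
 qed
 hence "y^2 <= (sinh y)^2" using y by (intro power_mono) auto
 moreover have "cosh (2 * y) = 1 + 2 * (sinh y)^2" using cosh_double_cosh[of y] cosh_square_eq[of y] by simp
 moreover have "cosh (2 * y) = (exp x + exp (- x)) / 2" unfolding y_def by (cases "0 <= x") (auto simp: cosh_field_def)
 ultimately have "exp x + exp (- x) >= 2 + 4 * y^2" by simp
 thus ?thesis by (simp add: y_def power_divide)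
qed

text \<open>
  For a Gaussian \<open>\<phi>\<close> the sum of two neighbours is \<open>exp (-\<beta>s\<^sup>2) \<phi> \<cdot> 2 cosh (2\<beta>s\<xi>)\<close>, at least
  \<open>exp (-\<beta>s\<^sup>2) \<phi> (2 + 4\<beta>\<^sup>2 s\<^sup>2 \<xi>\<^sup>2)\<close>. Summation shifts the neighbours back, up to the two ends of the
  window. As \<open>s \<rightarrow> 0\<close> this gives the variance \<open>1 / (2\<beta>)\<close> of the continuous Gaussian.
\<close>

lemma discrete_gaussian_second_moment:
 fixes p0 :: int and \<beta> s X :: real
 assumes \<beta>: "0 < \<beta>" and s: "0 < s" and T: "T = s * real m"
  and lo: "s * of_int p0 - X >= - (T / 2)" and hi: "s * of_int p0 - X < - (T / 2) + s"
 defines "\<phi> \<equiv> (%p::int. exp (- (\<beta> * (s * of_int p - X)^2)))"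
 shows "4 * \<beta>^2 * s^2 * (\<Sum>p\<in>{p0..<p0 + int m}. (s * of_int p - X)^2 * \<phi> p) \<le>
   exp (\<beta> * s^2) * (2 * (\<Sum>p\<in>{p0..<p0 + int m}. \<phi> p) + 2 * exp (- (\<beta> * (T / 2)^2))) - 2 * (\<Sum>p\<in>{p0..<p0 + int m}. \<phi> p)"
proof -
 let ?W = "{p0..<p0 + int m}"
 define \<xi> where "\<xi> = (%p::int. s * of_int p - X)"
 have T0: "0 <= T" using T s by simp
 have \<phi>: "\<phi> p = exp (- (\<beta> * (\<xi> p)^2))" for p by (simp add: \<phi>_def \<xi>_def)
 have \<phi>0: "0 < \<phi> p" for p by (simp add: \<phi>_def)
 have key: "exp (- (\<beta> * s^2)) * (2 * \<phi> p + 4 * \<beta>^2 * s^2 * ((\<xi> p)^2 * \<phi> p)) <= \<phi> (p + 1) + \<phi> (p - 1)" for p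
 proof -
  have "\<phi> (p + 1) = exp (- (\<beta> * s^2)) * \<phi> p * exp (- (2 * \<beta> * s * \<xi> p))"
   "\<phi> (p - 1) = exp (- (\<beta> * s^2)) * \<phi> p * exp (2 * \<beta> * s * \<xi> p)"
   unfolding \<phi> exp_add[symmetric] by (simp_all add: \<xi>_def power2_eq_square algebra_simps)
  hence "\<phi> (p + 1) + \<phi> (p - 1) = exp (- (\<beta> * s^2)) * \<phi> p * (exp (2 * \<beta> * s * \<xi> p) + exp (- (2 * \<beta> * s * \<xi> p)))"
   by (simp only: distrib_left add.commute)
  also have "... >= exp (- (\<beta> * s^2)) * \<phi> p * (2 + (2 * \<beta> * s * \<xi> p)^2)"
   using \<phi>0[of p] by (intro mult_left_mono exp_add_exp_minus_ge) auto
  finally show ?thesis by (simp add: power_mult_distrib algebra_simps)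
 qed
 have end1: "\<phi> (p0 + int m) <= exp (- (\<beta> * (T / 2)^2))"
 proof -
  have "T / 2 <= \<xi> (p0 + int m)" using lo by (simp add: \<xi>_def T distrib_left)
  hence "(T / 2)^2 <= (\<xi> (p0 + int m))^2" using T0 by (intro power_mono) auto
  thus ?thesis unfolding \<phi> using \<beta> by simp
 qed
 have end2: "\<phi> (p0 - 1) <= exp (- (\<beta> * (T / 2)^2))"
 proof -
  have "T / 2 <= - \<xi> (p0 - 1)" using hi by (simp add: \<xi>_def right_diff_distrib)
  hence "(T / 2)^2 <= (- \<xi> (p0 - 1))^2" using T0 by (intro power_mono) auto
  thus ?thesis unfolding \<phi> using \<beta> by simp
 qed
 have tel: "(\<Sum>p\<in>{p0..<p0 + int m}. \<phi> (p + 1)) = (\<Sum>p\<in>{p0..<p0 + int m}. \<phi> p) - \<phi> p0 + \<phi> (p0 + int m)"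
  "(\<Sum>p\<in>{p0..<p0 + int m}. \<phi> (p - 1)) = (\<Sum>p\<in>{p0..<p0 + int m}. \<phi> p) - \<phi> (p0 + int m - 1) + \<phi> (p0 - 1)"
 proof (induction m)
  case 0
  { case 1 show ?case by simp }
  { case 2 show ?case by simp }
 next
  case (Suc m)
  have set: "{p0..<p0 + int (Suc m)} = insert (p0 + int m) {p0..<p0 + int m}" by auto
  { case 1 show ?case unfolding set using Suc.IH(1) by (simp add: algebra_simps) }
  { case 2 show ?case unfolding set using Suc.IH(2) by (simp add: algebra_simps) }
 qed
 have "exp (- (\<beta> * s^2)) * (2 * (\<Sum>p\<in>?W. \<phi> p) + 4 * \<beta>^2 * s^2 * (\<Sum>p\<in>?W. (\<xi> p)^2 * \<phi> p)) =
   (\<Sum>p\<in>?W. exp (- (\<beta> * s^2)) * (2 * \<phi> p + 4 * \<beta>^2 * s^2 * ((\<xi> p)^2 * \<phi> p)))"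
  by (simp only: sum_distrib_left[symmetric] sum.distrib)
 also have "... <= (\<Sum>p\<in>?W. \<phi> (p + 1) + \<phi> (p - 1))" by (intro sum_mono key)
 also have "... <= 2 * (\<Sum>p\<in>?W. \<phi> p) + 2 * exp (- (\<beta> * (T / 2)^2))"
  unfolding sum.distrib tel using end1 end2 \<phi>0[of p0] \<phi>0[of "p0 + int m - 1"] by linarith
 finally have "exp (\<beta> * s^2) * (exp (- (\<beta> * s^2)) * (2 * (\<Sum>p\<in>?W. \<phi> p) + 4 * \<beta>^2 * s^2 * (\<Sum>p\<in>?W. (\<xi> p)^2 * \<phi> p)))
   <= exp (\<beta> * s^2) * (2 * (\<Sum>p\<in>?W. \<phi> p) + 2 * exp (- (\<beta> * (T / 2)^2)))" by (intro mult_left_mono) auto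
 thus ?thesis unfolding mult.assoc[of "exp (\<beta> * s^2)", symmetric] exp_minus_inverse by (simp add: \<xi>_def)
qed

lemma sum_window:
 fixes h :: "int => real"
 assumes m: "m = Suc N"
 shows "(\<Sum>j\<le>N. h (p0 + (int j - p0) mod int m)) = (\<Sum>p\<in>{p0..<p0 + int m}. h p)"
proof (rule sum.reindex_bij_witness[of _ "%p. nat (p mod int m)" "%j. p0 + (int j - p0) mod int m"])
 fix j assume "j \<in> {..N}"
 hence j: "int j < int m" using m by simp
 show "nat ((p0 + (int j - p0) mod int m) mod int m) = j" using j by (simp add: mod_add_right_eq)
 show "p0 + (int j - p0) mod int m \<in> {p0..<p0 + int m}" using m by simp
next
 fix p assume p: "p \<in> {p0..<p0 + int m}"
 have "0 <= p mod int m" "p mod int m < int m" using m by simp_all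
 hence "nat (p mod int m) < m" by linarith
 thus "nat (p mod int m) \<in> {..N}" using m by auto
 have "(int (nat (p mod int m)) - p0) mod int m = (p - p0) mod int m" using m by (simp add: mod_diff_left_eq)
 also have "... = p - p0" using p by (simp add: mod_pos_pos_trivial)
 finally show "p0 + (int (nat (p mod int m)) - p0) mod int m = p" by simp
qed simp

text \<open>
  In the frame \<open>exp (\<pi> a x\<^sup>2)\<close> the coordinates are \<open>exp (-\<pi>\<xi>\<^sup>2/a)\<close> at \<open>m\<close> equidistant points \<open>\<xi>\<close>,
  and the covariant derivative multiplies them by \<open>2\<pi>\<xi>\<close>. The energy density is therefore at most \<open>4\<pi>\<^sup>2\<close> times the
  second moment of the weights \<open>exp (-2\<pi>\<xi>\<^sup>2/a)\<close>, which is \<open>\<pi>a\<close> up to the error of the discretization with step \<open>s\<close>.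
  The step is fixed first, in terms of \<open>a'\<close>; then the period \<open>T = s m\<close> tends to infinity with \<open>N\<close>, and the tails vanish.
\<close>

theorem theta_curve:
 assumes a: "0 < a" "a < a'" "a < 1"
 shows "\<forall>\<^sub>F N in sequentially. \<exists>F. (\<forall>i\<le>N. F i holomorphic_on UNIV) &
   (\<forall>z. exp (2 * (pi * a * (Re z)^2)) / 16 <= nsq N F z) &
   (\<forall>i\<le>N. \<forall>z. cmod (F i z) <= 2 * exp (pi * a * (Re z)^2)) &
   (\<forall>z. covariant_energy a N F z <= pi * a' * nsq N F z)"
proof -
 define y where "y = min 1 ((a' / a - 1) / 2)"
 have y: "0 < y" "y <= 1" using a by (auto simp: y_def field_simps)
 have ay: "a * (1 + y) < a'"
 proof -
  have "y <= (a' / a - 1) / 2" unfolding y_def by (rule min.cobounded2)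
  hence "a * y <= a * ((a' / a - 1) / 2)" using a by (intro mult_left_mono) auto
  also have "... = (a' - a) / 2" using a by (simp add: field_simps)
  finally show ?thesis using a by (simp add: distrib_left)
 qed
 define \<beta> where "\<beta> = 2 * pi / a"
 have \<beta>: "0 < \<beta>" using a by (simp add: \<beta>_def)
 define s where "s = sqrt (y / \<beta>)"
 have s: "0 < s" "\<beta> * s^2 = y" using y \<beta> by (simp_all add: s_def)
 define T where "T = (%N. s * real (Suc N))"
 define \<kappa> where "\<kappa> = (%N. exp (- (\<beta> * (T N / 2)^2)))"
 define \<sigma> where "\<sigma> = (%N. theta_tail (T N) * sqrt (real (Suc N)))"
 have l\<kappa>: "\<kappa> \<longlonglongrightarrow> 0"
 proof -
  define c where "c = \<beta> * s^2 / 4"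
  have c: "0 < c" using s y by (simp add: c_def)
  have "\<kappa> = (%N. exp (- (c * (real (Suc N))^2)))"
   by (simp add: \<kappa>_def T_def c_def power_mult_distrib power_divide fun_eq_iff)
  moreover have "(%N. exp (- (c * (real (Suc N))^2))) \<longlonglongrightarrow> 0" using c by real_asymp
  ultimately show ?thesis by simp
 qed
 have l\<sigma>: "\<sigma> \<longlonglongrightarrow> 0"
 proof -
  define c where "c = pi * s / 4"
  have c: "0 < c" using s by (simp add: c_def)
  have "(%N. exp (2 * pi) * ((exp (- (c * real (Suc N))) * sqrt (real (Suc N))) * (2 / (1 - exp (- (c * real (Suc N))))))) \<longlonglongrightarrow> exp (2 * pi) * (0 * 2)"
   by (intro tendsto_intros) (use c in real_asymp)+
  moreover have "\<sigma> = (%N. exp (2 * pi) * ((exp (- (c * real (Suc N))) * sqrt (real (Suc N))) * (2 / (1 - exp (- (c * real (Suc N)))))))"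
   by (simp add: \<sigma>_def T_def theta_tail_def c_def fun_eq_iff mult_ac)
  ultimately show ?thesis by simp
 qed
 have "(%N. sqrt (pi * a * (1 + y + 9 * \<kappa> N / y)) + 2 * exp pi * \<sigma> N + 2 * sqrt (pi * a') * \<sigma> N) \<longlonglongrightarrow> sqrt (pi * a * (1 + y + 9 * 0 / y)) + 2 * exp pi * 0 + 2 * sqrt (pi * a') * 0"
  by (intro tendsto_intros l\<kappa> l\<sigma>) (use y in auto)
 moreover have "sqrt (pi * a * (1 + y + 9 * 0 / y)) + 2 * exp pi * 0 + 2 * sqrt (pi * a') * 0 < sqrt (pi * a')"
  using ay by (simp add: mult.assoc)
 ultimately have E1: "\<forall>\<^sub>F N in sequentially. sqrt (pi * a * (1 + y + 9 * \<kappa> N / y)) + 2 * exp pi * \<sigma> N + 2 * sqrt (pi * a') * \<sigma> N < sqrt (pi * a')"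
  by (rule order_tendstoD(2))
 have E2: "\<forall>\<^sub>F N in sequentially. \<sigma> N < 1 / 4" using l\<sigma> by (rule order_tendstoD(2)) simp
 show ?thesis
  using E1 E2 eventually_ge_at_top[of 1]
 proof eventually_elim
  case (elim N)
  define m where "m = Suc N"
  define \<tau> where "\<tau> = theta_tail (T N)"
  define F where "F = theta a s m"
  have m: "0 < m" "2 <= m" using elim(3) by (auto simp: m_def)
  have Tm: "T N = s * real m" by (simp add: T_def m_def)
  have T0: "0 < T N" using s by (simp add: T_def)
  have \<tau>0: "0 <= \<tau>" unfolding \<tau>_def by (rule theta_tail_nonneg[OF T0])
  have \<sigma>: "\<sigma> N = \<tau> * sqrt (real m)" by (simp add: \<sigma>_def \<tau>_def m_def)
  have \<tau>4: "\<tau> <= 1"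
  proof -
   have "\<tau> * 1 <= \<tau> * sqrt (real m)" using \<tau>0 m by (intro mult_left_mono) auto
   thus ?thesis using elim(2) \<sigma> by linarith
  qed
  have Fh: "F i holomorphic_on UNIV" for i unfolding F_def by (rule theta_holomorphic[OF a(1) s(1) m(1)])
  have main: "exp (pi * a * (Re z)^2) / 4 <= sqrt (nsq N F z) &
    (\<forall>i\<le>N. cmod (F i z) <= 2 * exp (pi * a * (Re z)^2)) &
    sqrt (covariant_energy a N F z) <= sqrt (pi * a') * sqrt (nsq N F z)" for z
  proof -
   define X where "X = a * Re z"
   define E where "E = exp (pi * a * (Re z)^2)"
   have E: "0 < E" by (simp add: E_def)
   \<comment> \<open>The \<open>m\<close> frequencies of the window around \<open>a x\<close> represent each residue class once.\<close>
   define p0 where "p0 = \<lceil>(X - T N / 2) / s\<rceil>"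
   have p0: "s * of_int p0 - X >= - (T N / 2)" "s * of_int p0 - X < - (T N / 2) + s"
   proof -
    have "(X - T N / 2) / s <= of_int p0" "of_int p0 < (X - T N / 2) / s + 1" unfolding p0_def by linarith+
    thus "s * of_int p0 - X >= - (T N / 2)" "s * of_int p0 - X < - (T N / 2) + s"
     using s(1) by (auto simp: field_simps)
   qed
   define p where "p = (%j::nat. p0 + (int j - p0) mod int m)"
   define \<xi> where "\<xi> = (%p::int. s * of_int p - X)"
   define g where "g = (%p::int. exp (- (pi / a * (\<xi> p)^2)))"
   define \<phi> where "\<phi> = (%p::int. exp (- (\<beta> * (s * of_int p - X)^2)))"
   have g\<phi>: "(g p)^2 = \<phi> p" for p
    unfolding g_def \<phi>_def exp_double[symmetric] by (simp add: \<beta>_def \<xi>_def)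
   have g1: "0 < g p" "g p <= 1" for p using a by (auto simp: g_def)
   let ?W = "{p0..<p0 + int m}"
   have pW: "p j \<in> ?W" for j using m by (simp add: p_def)
   have \<xi>T: "\<bar>\<xi> (p j)\<bar> <= T N / 2" for j
   proof -
    have "s * of_int p0 <= s * of_int (p j)" "s * of_int (p j) <= s * of_int (p0 + int m - 1)"
     using pW[of j] s(1) by (auto intro!: mult_left_mono)
    moreover have "s * of_int (p0 + int m - 1) = s * of_int p0 + T N - s" by (simp add: Tm algebra_simps)
    ultimately show ?thesis using p0 unfolding \<xi>_def abs_le_iff by linarith
   qed
   have near: "cmod (F j z) <= E * g (p j) + E * \<tau> & E * g (p j) <= cmod (F j z) + E * \<tau> &
     cmod (deriv (F j) z - of_real (2 * pi * a * Re z) * F j z) <= E * (2 * pi * \<bar>\<xi> (p j)\<bar> * g (p j)) + E * (\<tau> * exp pi)" for j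
   proof -
    have "int m dvd p j - int j"
    proof -
     have "p j mod int m = int j mod int m" by (simp add: p_def mod_add_right_eq)
     thus ?thesis by (simp add: mod_eq_dvd_iff)
    qed
    then obtain n0 where n0: "p j = int j + int m * n0" by (metis dvdE diff_add_cancel add.commute)
    define k where "k = s * (real j + real m * of_int n0)"
    have k: "k = s * of_int (p j)" unfolding k_def n0 by simp
    have near: "cmod (F j w - gexp a k w) <= \<tau> * exp (pi * a * (Re w)^2)" if "cmod (w - z) <= 1" for w
     unfolding F_def k_def \<tau>_def
    proof (rule theta_near_term[OF a(1) a(3) s(1) m(1) Tm _ that])
     show "\<bar>s * (real j + real m * of_int n0) - a * Re z\<bar> <= T N / 2"
      using \<xi>T[of j] unfolding \<xi>_def X_def k[symmetric] k_def .
    qed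
    have nf: "cmod (gexp a k z) = E * g (p j)"
     unfolding norm_gexp[OF a(1)] by (simp add: E_def g_def \<xi>_def k X_def)
    have n0': "cmod (F j z - gexp a k z) <= E * \<tau>" using near[of z] by (simp add: E_def mult.commute)
    have 1: "cmod (F j z) <= E * g (p j) + E * \<tau>"
     using norm_triangle_ineq[of "F j z - gexp a k z" "gexp a k z"] n0' nf by simp
    have 2: "E * g (p j) <= cmod (F j z) + E * \<tau>"
     using norm_triangle_ineq[of "gexp a k z - F j z" "F j z"] n0' nf by (simp add: norm_minus_commute)
    define R where "R = (%w. F j w - gexp a k w)"
    have "cmod (deriv R z - of_real (2 * pi * a * Re z) * R z) <= \<tau> * exp (pi * a) * exp (pi * a * (Re z)^2)"
     using a by (intro covariant_Cauchy) (auto simp: R_def intro!: holomorphic_intros Fh gexp_holomorphic near)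
    also have "... <= E * (\<tau> * exp pi)"
     using a \<tau>0 by (simp add: E_def mult.commute[of "\<tau> * _"] mult_left_mono)
    finally have 3: "cmod (deriv R z - of_real (2 * pi * a * Re z) * R z) <= E * (\<tau> * exp pi)" .
    have "deriv R z = deriv (F j) z - deriv (gexp a k) z"
     unfolding R_def using Fh[of j] gexp_holomorphic[of a k UNIV]
     by (intro deriv_diff) (auto intro: holomorphic_on_imp_differentiable_at[OF _ open_UNIV])
    hence "deriv (F j) z - of_real (2 * pi * a * Re z) * F j z =
      (deriv R z - of_real (2 * pi * a * Re z) * R z) + of_real (2 * pi * \<xi> (p j)) * gexp a k z"
     by (simp add: deriv_gexp R_def \<xi>_def X_def k algebra_simps)
    hence "cmod (deriv (F j) z - of_real (2 * pi * a * Re z) * F j z) <= E * (\<tau> * exp pi) + cmod (of_real (2 * pi * \<xi> (p j)) * gexp a k z)"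
     using norm_triangle_mono[OF 3 order_refl] by simp
    also have "cmod (of_real (2 * pi * \<xi> (p j)) * gexp a k z) = E * (2 * pi * \<bar>\<xi> (p j)\<bar> * g (p j))"
     unfolding norm_mult nf norm_of_real by (simp add: abs_mult)
    finally show ?thesis using 1 2 by simp
   qed
   define S where "S = (\<Sum>p\<in>?W. \<phi> p)"
   define V where "V = (\<Sum>p\<in>?W. (s * of_int p - X)^2 * \<phi> p)"
   have sw: "(\<Sum>j\<le>N. h (p j)) = (\<Sum>p\<in>?W. h p)" for h :: "int => real"
    unfolding p_def by (rule sum_window[OF m_def])
   have S3: "1 / 3 <= S"
   proof -
    define q where "q = \<lfloor>X / s\<rfloor>"
    have q: "of_int q <= X / s" "X / s < of_int q + 1" unfolding q_def by linarith+
    hence q': "s * of_int q <= X" "X < s * of_int q + s" using s(1) by (auto simp: field_simps)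
    have "T N / 2 >= s" using m s(1) by (simp add: Tm)
    hence "s * of_int p0 < s * (of_int q + 1)" "s * of_int q < s * (of_int p0 + real m)"
     unfolding distrib_left mult_1_right Tm[symmetric] using p0 q' T0 by linarith+
    hence "real_of_int p0 < real_of_int q + 1" "real_of_int q < real_of_int p0 + real m"
     unfolding mult_less_cancel_left_pos[OF s(1)] by auto
    hence qW: "q \<in> ?W" by auto
    have "(s * of_int q - X)^2 <= s^2" using q' s(1) by (intro abs_le_square_iff[THEN iffD1]) auto
    hence "\<beta> * (s * of_int q - X)^2 <= 1" using y(2) s(2) \<beta> mult_left_mono[of "(s * of_int q - X)^2" "s^2" \<beta>] by linarith
    hence "exp (- 1) <= \<phi> q" unfolding \<phi>_def by simp
    moreover have "(1::real) / 3 <= exp (- 1)" using exp_le by (simp add: exp_minus field_simps)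
    moreover have "\<phi> q <= S" unfolding S_def using qW by (intro member_le_sum) (auto simp: \<phi>_def)
    ultimately show ?thesis by linarith
   qed
   have \<kappa>0: "0 <= \<kappa> N" by (simp add: \<kappa>_def)
   have VS: "4 * pi^2 * V <= pi * a * (1 + y + 9 * \<kappa> N / y) * S"
   proof -
    have "4 * \<beta>^2 * s^2 * V <= exp (\<beta> * s^2) * (2 * S + 2 * \<kappa> N) - 2 * S"
     unfolding V_def S_def \<phi>_def \<kappa>_def by (rule discrete_gaussian_second_moment[OF \<beta> s(1) Tm p0])
    moreover have "4 * \<beta>^2 * s^2 = 4 * \<beta> * y" using s(2) by (simp add: power2_eq_square)
    ultimately have 1: "4 * \<beta> * y * V <= exp y * (2 * S + 2 * \<kappa> N) - 2 * S" using s(2) by simp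
    have ey: "exp y <= 1 + y + y^2" using exp_bound[of y] y by simp
    have "exp y * (2 * S) <= (1 + y + y^2) * (2 * S)" using ey S3 by (intro mult_right_mono) auto
    moreover have "exp y * (2 * \<kappa> N) <= 3 * (2 * \<kappa> N)"
    proof -
     have "exp y <= exp 1" using y by simp
     hence "exp y <= 3" using exp_le by linarith
     thus ?thesis using \<kappa>0 by (intro mult_right_mono) auto
    qed
    moreover have "6 * \<kappa> N <= 18 * \<kappa> N * S" using S3 \<kappa>0 mult_left_mono[of "1/3" S "18 * \<kappa> N"] by simp
    ultimately have "4 * \<beta> * y * V <= 2 * y * S + 2 * y^2 * S + 18 * \<kappa> N * S"
     using 1 by (simp add: algebra_simps)
    hence "2 * \<beta> * V <= (1 + y + 9 * \<kappa> N / y) * S" using y(1) by (simp add: field_simps power2_eq_square)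
    hence "pi * a * (2 * \<beta> * V) <= pi * a * ((1 + y + 9 * \<kappa> N / y) * S)" using a by (intro mult_left_mono) auto
    moreover have "pi * a * (2 * \<beta> * V) = 4 * pi^2 * V" using a by (simp add: \<beta>_def power2_eq_square)
    ultimately show ?thesis
     unfolding mult.assoc[of "pi * a" "1 + y + 9 * \<kappa> N / y" S] by linarith
   qed
   have const: "L2_set (%_. c) {..N} = sqrt (real m) * c" if "0 <= c" for c :: real
    using that by (simp add: L2_set_constant m_def)
   have L1: "E * sqrt S <= sqrt (nsq N F z) + E * \<sigma> N"
   proof -
    have "E * sqrt S = L2_set (%j. E * g (p j)) {..N}"
     unfolding L2_set_def power_mult_distrib g\<phi> sum_distrib_left[symmetric] sw S_def using E by (simp add: real_sqrt_mult)
    also have "... <= L2_set (%j. cmod (F j z) + E * \<tau>) {..N}" using near E g1 by (intro L2_set_mono) (auto simp: less_imp_le)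
    also have "... <= L2_set (%j. cmod (F j z)) {..N} + L2_set (%_. E * \<tau>) {..N}" by (rule L2_set_triangle_ineq)
    also have "L2_set (%j. cmod (F j z)) {..N} = sqrt (nsq N F z)" by (simp add: L2_set_def nsq_def)
    also have "L2_set (%_. E * \<tau>) {..N} = E * \<sigma> N" using E \<tau>0 by (simp add: const \<sigma>)
    finally show ?thesis by simp
   qed
   have L2: "sqrt (covariant_energy a N F z) <= E * sqrt (4 * pi^2 * V) + E * (\<sigma> N * exp pi)"
   proof -
    have "sqrt (covariant_energy a N F z) =
      L2_set (%i. cmod (deriv (F i) z - of_real (2 * pi * a * Re z) * F i z)) {..N}" by (simp add: L2_set_def covariant_energy_def)
    also have "... <= L2_set (%j. E * (2 * pi * \<bar>\<xi> (p j)\<bar> * g (p j)) + E * (\<tau> * exp pi)) {..N}" using near by (intro L2_set_mono) auto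
    also have "... <= L2_set (%j. E * (2 * pi * \<bar>\<xi> (p j)\<bar> * g (p j))) {..N} + L2_set (%_. E * (\<tau> * exp pi)) {..N}" by (rule L2_set_triangle_ineq)
    also have "L2_set (%_. E * (\<tau> * exp pi)) {..N} = E * (\<sigma> N * exp pi)" using E \<tau>0 by (simp add: const \<sigma>)
    also have "L2_set (%j. E * (2 * pi * \<bar>\<xi> (p j)\<bar> * g (p j))) {..N} = E * sqrt (4 * pi^2 * V)"
    proof -
     have "(E * (2 * pi * \<bar>\<xi> q\<bar> * g q))^2 = E^2 * (4 * pi^2) * ((s * of_int q - X)^2 * \<phi> q)" for q
      unfolding g\<phi>[symmetric] by (simp add: power_mult_distrib \<xi>_def)
     hence "L2_set (%j. E * (2 * pi * \<bar>\<xi> (p j)\<bar> * g (p j))) {..N} = sqrt (\<Sum>j\<le>N. E^2 * (4 * pi^2) * ((s * of_int (p j) - X)^2 * \<phi> (p j)))"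
      by (simp only: L2_set_def)
     also have "... = sqrt (E^2 * (4 * pi^2) * V)"
      unfolding sum_distrib_left[symmetric] V_def using sw[of "%p. (s * of_int p - X)^2 * \<phi> p"] by simp
     also have "... = E * sqrt (4 * pi^2 * V)" using E by (simp add: real_sqrt_mult mult.assoc)
     finally show ?thesis .
    qed
    finally show ?thesis by simp
   qed
   have \<sigma>0: "0 <= \<sigma> N" using \<tau>0 \<sigma> by simp
   have S2: "1 <= 2 * sqrt S"
   proof -
    have "sqrt (1 / 4) <= sqrt S" using S3 by (intro real_sqrt_le_mono) auto
    thus ?thesis by (simp add: real_sqrt_divide)
   qed
   have "sqrt (4 * pi^2 * V) <= sqrt (pi * a * (1 + y + 9 * \<kappa> N / y) * S)" using VS by (rule real_sqrt_le_mono)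
   hence v1: "sqrt (4 * pi^2 * V) <= sqrt (pi * a * (1 + y + 9 * \<kappa> N / y)) * sqrt S" by (simp only: real_sqrt_mult)
   define r where "r = sqrt (pi * a')"
   have r0: "0 <= r" using a by (simp add: r_def)
   have e1: "sqrt (pi * a * (1 + y + 9 * \<kappa> N / y)) <= r - 2 * exp pi * \<sigma> N - 2 * r * \<sigma> N" using elim(1) by (simp add: r_def)
   have v2: "sqrt (4 * pi^2 * V) <= (r - 2 * exp pi * \<sigma> N - 2 * r * \<sigma> N) * sqrt S"
    by (rule order_trans[OF v1 mult_right_mono[OF e1]]) (use S3 in simp)
   have "(exp pi * \<sigma> N) * 1 <= (exp pi * \<sigma> N) * (2 * sqrt S)" "(r * \<sigma> N) * 1 <= (r * \<sigma> N) * (2 * sqrt S)"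
    using S2 \<sigma>0 r0 by (intro mult_left_mono; simp)+
   moreover have "(r - 2 * exp pi * \<sigma> N - 2 * r * \<sigma> N) * sqrt S = r * sqrt S - (exp pi * \<sigma> N) * (2 * sqrt S) - (r * \<sigma> N) * (2 * sqrt S)"
    by (simp add: algebra_simps)
   ultimately have "sqrt (4 * pi^2 * V) + \<sigma> N * exp pi <= r * (sqrt S - \<sigma> N)"
    using v2 unfolding right_diff_distrib mult_1_right mult.commute[of "\<sigma> N" "exp pi"] by linarith
   hence "E * (sqrt (4 * pi^2 * V) + \<sigma> N * exp pi) <= E * (r * (sqrt S - \<sigma> N))" using E by (intro mult_left_mono) auto
   also have "... = r * (E * sqrt S - E * \<sigma> N)" by (simp add: algebra_simps)
   also have "... <= r * sqrt (nsq N F z)" using L1 r0 by (intro mult_left_mono) auto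
   finally have D: "sqrt (covariant_energy a N F z) <= r * sqrt (nsq N F z)"
    using L2 by (simp add: distrib_left)
   have "E * (1 / 4) <= E * (sqrt S - \<sigma> N)" using E S2 elim(2) by (intro mult_left_mono) auto
   also have "... <= sqrt (nsq N F z)" using L1 by (simp add: right_diff_distrib)
   finally have L: "E / 4 <= sqrt (nsq N F z)" by simp
   have U: "cmod (F i z) <= 2 * E" for i
   proof -
    have "E * g (p i) <= E * 1" "E * \<tau> <= E * 1" using E g1 \<tau>4 by (intro mult_left_mono; simp)+
    thus ?thesis using near[of i] by linarith
   qed
   show ?thesis using D L U by (auto simp: E_def r_def)
  qed
  have nn: "0 <= nsq N F z" for z by (simp add: nsq_def sum_nonneg)
  show ?case
  proof (intro exI[of _ F] conjI allI impI)
   fix z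
   have "(exp (pi * a * (Re z)^2) / 4)^2 <= (sqrt (nsq N F z))^2" using main[of z] by (intro power_mono) auto
   thus "exp (2 * (pi * a * (Re z)^2)) / 16 <= nsq N F z" using nn by (simp only: power_divide exp_double) simp
   have "(sqrt (covariant_energy a N F z))^2 <= (sqrt (pi * a') * sqrt (nsq N F z))^2"
    using main[of z] by (intro power_mono) (auto simp: covariant_energy_nonneg)
   moreover have "0 <= pi * a'" using a by simp
   ultimately show "covariant_energy a N F z <= pi * a' * nsq N F z"
    using nn by (simp add: power_mult_distrib covariant_energy_nonneg)
  qed (use Fh main in auto)
 qed
qed

section \<open>Perturbations of the theta curve\<close>

text \<open>
  Dividing by \<open>w\<close> removes the zero of \<open>sinh (\<pi>w)\<close> at the origin and no other.
\<close>

definition sinhc :: "complex => complex" where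
 "sinhc w = (if w = 0 then 1 else sinh (of_real pi * w) / (of_real pi * w))"

lemma sinhc_holomorphic: "sinhc holomorphic_on UNIV"
proof -
 let ?f = "%w. sinh (of_real pi * w)"
 have h: "?f holomorphic_on UNIV" unfolding sinh_field_def by (intro holomorphic_intros) auto
 have d: "deriv ?f 0 = of_real pi" by (rule DERIV_imp_deriv) (auto intro!: derivative_eq_intros)
 have "(%z. if z = 0 then deriv ?f 0 else (?f z - ?f 0) / (z - 0)) holomorphic_on UNIV"
  by (rule pole_lemma_open[OF h open_UNIV])
 hence "(%z. (if z = 0 then deriv ?f 0 else (?f z - ?f 0) / (z - 0)) / of_real pi) holomorphic_on UNIV"
  by (intro holomorphic_intros) auto
 moreover have "(%z. (if z = 0 then deriv ?f 0 else (?f z - ?f 0) / (z - 0)) / of_real pi) = sinhc"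
  unfolding d by (auto simp: sinhc_def fun_eq_iff)
 ultimately show ?thesis by simp
qed

lemma norm_sinhc_le: "cmod (sinhc w) <= exp (pi * \<bar>Re w\<bar>)"
proof -
 let ?S = "{v. \<bar>Re v\<bar> <= pi * \<bar>Re w\<bar>}"
 have "?S = {v. Re v <= pi * \<bar>Re w\<bar>} \<inter> {v. Re v >= - (pi * \<bar>Re w\<bar>)}" by (auto simp: abs_le_iff)
 hence conv: "convex ?S" by (simp add: convex_Int convex_halfspace_Re_le convex_halfspace_Re_ge)
 have "cmod (sinh (of_real pi * w) - sinh 0) <= exp (pi * \<bar>Re w\<bar>) * cmod (of_real pi * w - 0)"
 proof (rule field_differentiable_bound[OF conv, where f=sinh and f'=cosh])
  fix v :: complex assume v: "v \<in> ?S"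
  show "(sinh has_field_derivative cosh v) (at v within ?S)" by (auto intro!: derivative_eq_intros)
  have "cmod (cosh v) <= (cmod (exp v) + cmod (exp (- v))) / 2"
   unfolding cosh_field_def norm_divide using norm_triangle_ineq[of "exp v" "exp (- v)"] by simp
  also have "... = (exp (Re v) + exp (- Re v)) / 2" by simp
  also have "... <= exp (pi * \<bar>Re w\<bar>)"
  proof -
   have "exp (Re v) <= exp (pi * \<bar>Re w\<bar>)" "exp (- Re v) <= exp (pi * \<bar>Re w\<bar>)" using v by auto
   moreover have "(x + y) / 2 <= C" if "x <= C" "y <= C" for x y C :: real using that by simp
   ultimately show ?thesis by blast
  qed
  finally show "cmod (cosh v) <= exp (pi * \<bar>Re w\<bar>)" .
 qed (auto simp: abs_mult)
 thus ?thesis by (auto simp: sinhc_def norm_divide divide_le_eq)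
qed

text \<open>
  Equal to \<open>1\<close> at the origin and \<open>0\<close> at the other points of the lattice \<open>t\<int> + \<i>\<int>\<close> in the columns \<open>\<bar>l\<bar> \<le> L\<close>.
\<close>

definition interp :: "real => nat => complex => complex" where
 "interp t L w = sinhc w * sprod t L w"

lemma interp_holomorphic: "interp t L holomorphic_on UNIV"
 unfolding interp_def sprod_def sfac_def sinh_field_def
 by (intro holomorphic_intros sinhc_holomorphic) auto

lemma interp_0:
 assumes "0 < t"
 shows "interp t L 0 = 1"
proof -
 have "sfac t l 0 = 1" if "l \<in> {1..L}" for l
 proof -
  define r where "r = pi * t * real l"
  have "r ~= 0" using assms that by (simp add: r_def)
  moreover have "sinh (complex_of_real r) = of_real (sinh r)" by (simp add: sinh_field_def flip: exp_of_real)
  ultimately show ?thesis unfolding sfac_def r_def[symmetric] by (simp add: power2_eq_square)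
 qed
 thus ?thesis by (simp add: interp_def sinhc_def sprod_def)
qed

lemma interp_lattice:
 assumes l: "\<bar>l\<bar> <= int L" and nz: "(l, k) ~= (0, 0)"
 shows "interp t L (Complex (t * of_int l) (of_int k)) = 0"
proof -
 let ?w = "Complex (t * of_int l) (of_int k)"
 show ?thesis
 proof (cases "l = 0")
  case True
  hence "?w ~= 0" using nz by (simp add: complex_eq_iff)
  moreover have "sinh (of_real pi * ?w) = 0" unfolding sinh_eq_0_complex_iff
   by (rule exI[of _ k]) (simp add: complex_eq_iff True)
  ultimately show ?thesis by (simp add: interp_def sinhc_def)
 next
  case False
  define n where "n = nat \<bar>l\<bar>"
  have n: "n \<in> {1..L}" "real n = \<bar>of_int l\<bar>" using False l by (auto simp: n_def)
  have "sfac t n ?w = 0"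
  proof (cases "0 < l")
   case True
   hence "of_real (pi * t * real n) - of_real pi * ?w = of_real pi * (of_int (- k) * \<i>)"
    by (simp add: n complex_eq_iff)
   moreover have "sinh (of_real pi * (of_int (- k) * \<i>)) = 0" unfolding sinh_eq_0_complex_iff by blast
   ultimately show ?thesis by (simp add: sfac_def)
  next
   case False
   hence "of_real (pi * t * real n) + of_real pi * ?w = of_real pi * (of_int k * \<i>)"
    by (simp add: n complex_eq_iff)
   moreover have "sinh (of_real pi * (of_int k * \<i>)) = 0" unfolding sinh_eq_0_complex_iff by blast
   ultimately show ?thesis by (simp add: sfac_def)
  qed
  hence "sprod t L ?w = 0" unfolding sprod_def using n(1) by (intro prod_zero) auto
  thus ?thesis by (simp add: interp_def)
 qed
qed

lemma norm_interp_le: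
 assumes t: "0 < t"
 shows "cmod (interp t L w) <= ssig_up t * exp (pi * (Re w)^2 / t)"
proof -
 have "cmod (interp t L w) <= exp (pi * \<bar>Re w\<bar>) * cmod (sprod t L w)"
  unfolding interp_def norm_mult by (intro mult_right_mono norm_sinhc_le) auto
 thus ?thesis using exp_mult_norm_sprod_le[OF t, of w L] by linarith
qed

text \<open>
  The interpolating function grows like \<open>exp (\<pi>u\<^sup>2/t)\<close> with \<open>u = Re (z - \<omega>)\<close>. The first two terms of the exponent move the weight
  \<open>exp (\<pi> a x\<^sup>2)\<close> to the column of \<open>\<omega>\<close>, which leaves \<open>exp (-\<pi> (a - 1/t) u\<^sup>2)\<close>; the last one has
  real part proportional to \<open>u\<^sup>2 - v\<^sup>2\<close> and splits this decay evenly between the two directions.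
\<close>

definition bump :: "real => real => nat => complex => complex => complex" where
 "bump a t L \<omega> z = exp (of_real (pi * a * (Re \<omega>)^2) + of_real (2 * pi * a * Re \<omega>) * (z - \<omega>) +
   of_real (pi * (a - 1 / t) / 2) * (z - \<omega>)^2) * interp t L (z - \<omega>)"

lemma bump_holomorphic: "bump a t L \<omega> holomorphic_on A"
proof -
 have "(interp t L \<circ> (%z. z - \<omega>)) holomorphic_on A"
  by (rule holomorphic_on_compose_gen[OF _ interp_holomorphic]) (auto intro!: holomorphic_intros)
 hence "(%z. interp t L (z - \<omega>)) holomorphic_on A" by (simp add: o_def)
 thus ?thesis unfolding bump_def by (intro holomorphic_intros)
qed

lemma norm_bump_le:
 assumes t: "0 < t"
 shows "cmod (bump a t L \<omega> z) <= ssig_up t * exp (- (pi * (a - 1 / t) / 2 * (cmod (z - \<omega>))^2)) * exp (pi * a * (Re z)^2)"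
proof -
 define u v x c where "u = Re (z - \<omega>)" and "v = Im (z - \<omega>)" and "x = Re \<omega>" and "c = a - 1 / t"
 have rs: "Re ((z - \<omega>)^2) = u^2 - v^2" by (simp add: u_def v_def power2_eq_square)
 have "cmod (bump a t L \<omega> z) <= exp (pi * a * x^2 + 2 * pi * a * x * u + pi * c / 2 * (u^2 - v^2)) * (ssig_up t * exp (pi * u^2 / t))"
  unfolding bump_def norm_mult norm_exp_eq_Re u_def[symmetric]
 proof (intro mult_mono)
  show "exp (Re (of_real (pi * a * (Re \<omega>)^2) + of_real (2 * pi * a * Re \<omega>) * (z - \<omega>) + of_real (pi * (a - 1 / t) / 2) * (z - \<omega>)^2))
    <= exp (pi * a * x^2 + 2 * pi * a * x * u + pi * c / 2 * (u^2 - v^2))"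
  proof -
   have g: "Re (of_real A + of_real B * W + of_real C * V) = A + B * Re W + C * Re V" for A B C W V by simp
   show ?thesis unfolding g rs by (simp add: u_def x_def c_def)
  qed
  show "cmod (interp t L (z - \<omega>)) <= ssig_up t * exp (pi * u^2 / t)" unfolding u_def by (rule norm_interp_le[OF t])
 qed auto
 also have "... = ssig_up t * exp ((pi * a * x^2 + 2 * pi * a * x * u + pi * c / 2 * (u^2 - v^2)) + pi * u^2 / t)"
  by (simp add: exp_add)
 also have "(pi * a * x^2 + 2 * pi * a * x * u + pi * c / 2 * (u^2 - v^2)) + pi * u^2 / t = - (pi * c / 2 * (u^2 + v^2)) + pi * a * (x + u)^2"
 proof -
  have "pi * u^2 / t = pi * a * u^2 - pi * c * u^2" by (simp add: c_def algebra_simps)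
  thus ?thesis by (simp only:) (simp add: power2_sum field_simps)
 qed
 also have "x + u = Re z" by (simp add: x_def u_def)
 also have "u^2 + v^2 = (cmod (z - \<omega>))^2" by (simp add: cmod_power2 u_def v_def)
 finally show ?thesis unfolding exp_add c_def by (simp only: mult.assoc)
qed

lemma bump_self: "0 < t ==> bump a t L \<omega> \<omega> = of_real (exp (pi * a * (Re \<omega>)^2))"
 unfolding exp_of_real[symmetric] by (simp add: bump_def interp_0)

definition lpt :: "real => int \<times> int => complex" where
 "lpt t \<omega> = Complex (t * of_int (fst \<omega>)) (of_int (snd \<omega>))"

lemma bump_other:
 assumes "\<omega> ~= \<mu>" "\<bar>fst \<mu> - fst \<omega>\<bar> <= int L"
 shows "bump a t L (lpt t \<omega>) (lpt t \<mu>) = 0"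
proof -
 have "lpt t \<mu> - lpt t \<omega> = Complex (t * of_int (fst \<mu> - fst \<omega>)) (of_int (snd \<mu> - snd \<omega>))"
  by (simp add: lpt_def complex_eq_iff right_diff_distrib)
 moreover have "(fst \<mu> - fst \<omega>, snd \<mu> - snd \<omega>) ~= (0, 0)" using assms(1) by (auto simp: prod_eq_iff)
 ultimately have "interp t L (lpt t \<mu> - lpt t \<omega>) = 0" using interp_lattice assms(2) by metis
 thus ?thesis by (simp add: bump_def)
qed

definition lattice_sum_bound :: "real => real => real" where
 "lattice_sum_bound \<gamma> t = exp (\<gamma> / 2) * ((2 / (1 - exp (- (\<gamma> * t)))) * (2 / (1 - exp (- \<gamma>))))"

text \<open>
  Completing the square, \<open>\<bar>u\<bar> - 1/4 \<le> u\<^sup>2\<close>, replaces the Gaussian by a product of two exponentials.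
\<close>

lemma gaussian_lattice_sum_le:
 assumes \<gamma>: "0 < \<gamma>" and t: "0 < t" and \<Lambda>: "finite \<Lambda>"
 shows "(\<Sum>\<omega>\<in>\<Lambda>. exp (- (\<gamma> * (cmod (z - lpt t \<omega>))^2))) <= lattice_sum_bound \<gamma> t"
proof -
 let ?f = "%l::int. exp (- \<bar>\<gamma> * t * of_int l - \<gamma> * Re z\<bar>)" and ?g = "%k::int. exp (- \<bar>\<gamma> * of_int k - \<gamma> * Im z\<bar>)"
 have sq: "\<bar>u\<bar> - 1 / 4 <= u^2" for u :: real
 proof -
  have "0 <= (\<bar>u\<bar> - 1 / 2)^2" by simp
  thus ?thesis by (simp add: power2_diff field_simps)
 qed
 have le: "exp (- (\<gamma> * (cmod (z - lpt t \<omega>))^2)) <= exp (\<gamma> / 2) * (?f (fst \<omega>) * ?g (snd \<omega>))" for \<omega>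
 proof -
  let ?u = "t * of_int (fst \<omega>) - Re z" and ?v = "of_int (snd \<omega>) - Im z"
  have n: "(cmod (z - lpt t \<omega>))^2 = ?u^2 + ?v^2" by (simp add: lpt_def cmod_power2 power2_commute)
  have "\<gamma> * (\<bar>?u\<bar> + \<bar>?v\<bar> - 1 / 2) <= \<gamma> * (cmod (z - lpt t \<omega>))^2"
   unfolding n using \<gamma> sq[of ?u] sq[of ?v] by (intro mult_left_mono) auto
  moreover have "\<bar>\<gamma> * t * of_int (fst \<omega>) - \<gamma> * Re z\<bar> = \<gamma> * \<bar>?u\<bar>" "\<bar>\<gamma> * of_int (snd \<omega>) - \<gamma> * Im z\<bar> = \<gamma> * \<bar>?v\<bar>"
   using \<gamma> by (simp_all add: mult.assoc right_diff_distrib[symmetric] abs_mult)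
  ultimately show ?thesis unfolding exp_add[symmetric] exp_le_cancel_iff by (simp add: algebra_simps)
 qed
 have "(\<Sum>\<omega>\<in>\<Lambda>. exp (- (\<gamma> * (cmod (z - lpt t \<omega>))^2))) <= (\<Sum>\<omega>\<in>\<Lambda>. exp (\<gamma> / 2) * (?f (fst \<omega>) * ?g (snd \<omega>)))"
  by (intro sum_mono le)
 also have "... <= (\<Sum>\<omega>\<in>fst ` \<Lambda> \<times> snd ` \<Lambda>. exp (\<gamma> / 2) * (?f (fst \<omega>) * ?g (snd \<omega>)))"
  using \<Lambda> by (intro sum_mono2[OF _ subset_fst_snd]) auto
 also have "... = exp (\<gamma> / 2) * ((\<Sum>l\<in>fst ` \<Lambda>. ?f l) * (\<Sum>k\<in>snd ` \<Lambda>. ?g k))"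
 proof -
  have "(\<Sum>l\<in>fst ` \<Lambda>. ?f l) * (\<Sum>k\<in>snd ` \<Lambda>. ?g k) = (\<Sum>\<omega>\<in>fst ` \<Lambda> \<times> snd ` \<Lambda>. ?f (fst \<omega>) * ?g (snd \<omega>))"
   by (simp add: sum_product sum.cartesian_product case_prod_unfold)
  thus ?thesis by (simp only: sum_distrib_left)
 qed
 also have "... <= lattice_sum_bound \<gamma> t"
  unfolding lattice_sum_bound_def using \<gamma> t \<Lambda>
  by (intro mult_left_mono mult_mono sum_exp_dist_le sum_nonneg) auto
 finally show ?thesis .
qed

definition curve_of :: "nat => (nat => complex => complex) => complex => (nat => complex) set" where
 "curve_of N G z = proj_point N (\<lambda>i\<in>{..N}. G i z)"

lemma homogeneous_coords_curve_of:
 assumes "!!i. i <= N ==> G i holomorphic_on UNIV" "!!z. 0 < nsq N G z"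
 shows "homogeneous_coords N G (curve_of N G)"
 using assms by (auto simp: homogeneous_coords_def curve_of_def nsq_pos_iff)

text \<open>
  Both \<open>\<bar>F\<bar>\<close> and the covariant derivative change by small multiples of the weight, hence of \<open>\<bar>F\<bar>\<close>, and the factor \<open>a'\<close> in the
  energy of \<open>F\<close> leaves room for this.
\<close>

lemma perturbed_curve:
 fixes F P :: "nat => complex => complex"
 assumes F: "!!i. i <= N ==> F i holomorphic_on UNIV" and P: "!!i. i <= N ==> P i holomorphic_on UNIV"
  and a: "0 <= a" "a <= 1" "0 < a'"
  and low: "!!z. exp (2 * (pi * a * (Re z)^2)) / 16 <= nsq N F z"
  and D: "!!z. covariant_energy a N F z <= pi * a' * nsq N F z"
  and small: "!!i z. i <= N ==> cmod (P i z) <= \<kappa> * exp (pi * a * (Re z)^2)"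
  and \<theta>: "4 * sqrt (real N + 1) * \<kappa> <= \<theta>" "\<theta> <= 1 / 2" "\<theta> * (exp pi + sqrt pi) <= sqrt pi * (1 - sqrt a')"
 defines "G \<equiv> %i z. F i z + P i z"
 shows "exp (pi * a * (Re z)^2) / 8 <= sqrt (nsq N G z)" "fs_density N G z <= pi"
proof -
 define E where "E = exp (pi * a * (Re z)^2)"
 have E: "0 < E" by (simp add: E_def)
 define n where "n = sqrt (nsq N F z)"
 have \<kappa>0: "0 <= \<kappa>" using order_trans[OF norm_ge_zero small[of 0 z]] by (simp add: zero_le_mult_iff)
 have "sqrt ((E / 4)^2) <= n"
  unfolding n_def using low[of z] by (intro real_sqrt_le_mono) (simp add: E_def power_divide exp_double)
 hence En: "E <= 4 * n" using E by simp
 have n0: "0 < n" using En E by linarith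
 have const: "L2_set (%_. c) {..N} = sqrt (real N + 1) * c" if "0 <= c" for c :: real
  using that by (simp add: L2_set_constant add.commute)
 have sm: "sqrt (real N + 1) * (\<kappa> * E) <= \<theta> * n"
 proof -
  have "sqrt (real N + 1) * (\<kappa> * E) <= sqrt (real N + 1) * (\<kappa> * (4 * n))" using \<kappa>0 En by (intro mult_left_mono) auto
  also have "... = 4 * sqrt (real N + 1) * \<kappa> * n" by simp
  also have "... <= \<theta> * n" using \<theta>(1) n0 by (intro mult_right_mono) auto
  finally show ?thesis .
 qed
 have "n = L2_set (%i. cmod (F i z)) {..N}" by (simp add: n_def nsq_def L2_set_def)
 also have "... <= L2_set (%i. cmod (G i z) + \<kappa> * E) {..N}"
 proof (rule L2_set_mono)
  fix i assume "i \<in> {..N}"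
  thus "cmod (F i z) <= cmod (G i z) + \<kappa> * E"
   using small[of i z] norm_triangle_ineq4[of "G i z" "P i z"] by (simp add: G_def E_def)
 qed simp
 also have "... <= L2_set (%i. cmod (G i z)) {..N} + L2_set (%_. \<kappa> * E) {..N}" by (rule L2_set_triangle_ineq)
 also have "L2_set (%i. cmod (G i z)) {..N} = sqrt (nsq N G z)" by (simp add: nsq_def L2_set_def)
 finally have nG: "(1 - \<theta>) * n <= sqrt (nsq N G z)" using sm \<kappa>0 E by (simp add: const left_diff_distrib)
 have "(1 / 2) * (E / 4) <= (1 - \<theta>) * n" using \<theta>(2) En E by (intro mult_mono) auto
 thus "exp (pi * a * (Re z)^2) / 8 <= sqrt (nsq N G z)" using nG by (simp add: E_def)
 hence "0 < sqrt (nsq N G z)" using E unfolding E_def by (meson less_le_trans zero_less_divide_iff zero_less_numeral)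
 hence Gpos: "0 < nsq N G z" by simp
 define c where "c = complex_of_real (2 * pi * a * Re z)"
 have DP: "cmod (deriv (P i) z - c * P i z) <= \<kappa> * exp pi * E" if i: "i <= N" for i
 proof -
  have "cmod (deriv (P i) z - c * P i z) <= \<kappa> * exp (pi * a) * exp (pi * a * (Re z)^2)"
   unfolding c_def by (rule covariant_Cauchy[OF P[OF i] a(1) small[OF i]])
  also have "... <= \<kappa> * exp pi * E"
   unfolding E_def using a \<kappa>0 by (intro mult_right_mono mult_left_mono) auto
  finally show ?thesis .
 qed
 have "L2_set (%i. cmod (deriv (G i) z - c * G i z)) {..N} <= L2_set (%i. cmod (deriv (F i) z - c * F i z) + \<kappa> * exp pi * E) {..N}"
 proof (rule L2_set_mono)
  fix i assume "i \<in> {..N}"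
  hence i: "i <= N" by simp
  have "deriv (G i) z = deriv (F i) z + deriv (P i) z"
   unfolding G_def using F[OF i] P[OF i]
   by (intro deriv_add) (auto intro: holomorphic_on_imp_differentiable_at[OF _ open_UNIV])
  hence "deriv (G i) z - c * G i z = (deriv (F i) z - c * F i z) + (deriv (P i) z - c * P i z)"
   by (simp add: G_def algebra_simps)
  thus "cmod (deriv (G i) z - c * G i z) <= cmod (deriv (F i) z - c * F i z) + \<kappa> * exp pi * E"
   using norm_triangle_mono[OF order_refl DP[OF i], of "deriv (F i) z - c * F i z"] by simp
 qed simp
 also have "... <= L2_set (%i. cmod (deriv (F i) z - c * F i z)) {..N} + L2_set (%_. \<kappa> * exp pi * E) {..N}" by (rule L2_set_triangle_ineq)
 also have "L2_set (%i. cmod (deriv (F i) z - c * F i z)) {..N} <= sqrt (pi * a') * n"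
  unfolding L2_set_def n_def real_sqrt_mult[symmetric] c_def using D[of z] by (intro real_sqrt_le_mono) (simp add: covariant_energy_def)
 also have "L2_set (%_. \<kappa> * exp pi * E) {..N} = exp pi * (sqrt (real N + 1) * (\<kappa> * E))" using \<kappa>0 E by (simp add: const)
 also have "exp pi * (sqrt (real N + 1) * (\<kappa> * E)) <= exp pi * (\<theta> * n)" by (intro mult_left_mono sm) auto
 finally have "L2_set (%i. cmod (deriv (G i) z - c * G i z)) {..N} <= (sqrt pi * sqrt a' + exp pi * \<theta>) * n"
  by (simp add: real_sqrt_mult distrib_right)
 also have "... <= (sqrt pi * (1 - \<theta>)) * n" using \<theta>(3) n0 by (intro mult_right_mono) (auto simp: algebra_simps)
 also have "... <= sqrt pi * sqrt (nsq N G z)" using nG by (simp add: mult.assoc)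
 finally have "(L2_set (%i. cmod (deriv (G i) z - c * G i z)) {..N})^2 <= (sqrt pi * sqrt (nsq N G z))^2" by (intro power_mono) auto
 hence "(\<Sum>i\<le>N. (cmod (deriv (G i) z - c * G i z))^2) <= pi * nsq N G z"
  using Gpos by (simp add: L2_set_def power_mult_distrib sum_nonneg)
 hence "(\<Sum>i\<le>N. (cmod (deriv (G i) z - c * G i z))^2) / nsq N G z <= pi" using Gpos by (simp add: divide_le_eq)
 thus "fs_density N G z <= pi" using fs_density_le_covariant[OF Gpos, of c] by linarith
qed

lemma pdist_ge_affine:
 assumes p: "p \<in> topspace (CP N)" and q: "q \<in> topspace (CP N)" and ij: "i <= N" "j <= N"
  and \<rho>: "0 < \<rho>" "\<rho> <= cmod (pcoord N p j j)" "\<rho> <= cmod (pcoord N q j j)"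
 shows "\<rho> / (1 + 1 / \<rho>) * cmod (pcoord N p i j / pcoord N p j j - pcoord N q i j / pcoord N q j j) <= pdist N p q"
proof -
 define D where "D = pdist N p q"
 have nz: "pcoord N p j j ~= 0" "pcoord N q j j ~= 0" using \<rho> by auto
 have D: "cmod (pcoord N p i j - pcoord N q i j) <= D" "cmod (pcoord N q j j - pcoord N p j j) <= D" "0 <= D"
  using pcoord_diff_le_pdist[OF ij, of p q] pcoord_diff_le_pdist[OF ij(2) ij(2), of p q] pdist_metric(1)
  by (auto simp: D_def norm_minus_commute)
 have "pcoord N p i j / pcoord N p j j - pcoord N q i j / pcoord N q j j =
   (pcoord N p i j - pcoord N q i j) / pcoord N p j j + pcoord N q i j * (pcoord N q j j - pcoord N p j j) / (pcoord N p j j * pcoord N q j j)"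
  using nz by (simp add: field_simps)
 hence "cmod (pcoord N p i j / pcoord N p j j - pcoord N q i j / pcoord N q j j) \<le>
   cmod ((pcoord N p i j - pcoord N q i j) / pcoord N p j j) + cmod (pcoord N q i j * (pcoord N q j j - pcoord N p j j) / (pcoord N p j j * pcoord N q j j))"
  by (metis norm_triangle_ineq)
 also have "... <= D / \<rho> + 1 * D / (\<rho> * \<rho>)"
  unfolding norm_divide norm_mult using D \<rho> norm_pcoord_le[OF q ij] by (intro add_mono frac_le mult_mono) auto
 also have "... = D * ((1 + 1 / \<rho>) / \<rho>)" using \<rho> by (simp add: field_simps)
 finally have "\<rho> / (1 + 1 / \<rho>) * cmod (pcoord N p i j / pcoord N p j j - pcoord N q i j / pcoord N q j j) <= \<rho> / (1 + 1 / \<rho>) * (D * ((1 + 1 / \<rho>) / \<rho>))"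
  using \<rho> by (intro mult_left_mono) auto
 also have "... = D"
 proof -
  have "1 + 1 / \<rho> ~= 0" using \<rho>(1) by (smt (verit) divide_pos_pos)
  thus ?thesis using \<rho>(1) by simp
 qed
 finally show ?thesis by (simp add: D_def)
qed

text \<open>
  A cube of Brody curves with \<open>2N\<close> parameters for each point of \<open>\<Lambda>\<close>: \<open>\<nu> i\<close> is the lattice point at which the \<open>i\<close>-th
  pair of opposite faces is separated. The constants \<open>\<delta>\<close> and \<open>C\<close> must not depend on \<open>\<Lambda>\<close>.
\<close>

definition separated_family :: "nat => real => real => real => (int \<times> int) set =>
  ((nat => real) => complex => (nat => complex) set) => (nat => int \<times> int) => bool" where
 "separated_family N t \<delta> C \<Lambda> c \<nu> \<longleftrightarrow> (let n = 2 * N * card \<Lambda> in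
   (\<forall>x\<in>cube n. brody_curve N (c x)) &
   (\<forall>x\<in>cube n. \<forall>y\<in>cube n. \<forall>\<tau>>0.
    (\<forall>j<n. \<bar>x j - y j\<bar> < \<tau>) --> (\<forall>z. pdist N (c x z) (c y z) <= C * \<tau>)) &
   (\<forall>i<n. \<nu> i \<in> \<Lambda> & (\<forall>x\<in>cube n. \<forall>y\<in>cube n. x i = 0 --> y i = 1 -->
    \<delta> <= pdist N (c x (lpt t (\<nu> i))) (c y (lpt t (\<nu> i))))))"

text \<open>
  At each lattice point \<open>\<omega>\<close> the largest coordinate \<open>i0\<close> of \<open>F\<close> is left unperturbed and serves as the reference
  coordinate of an affine chart; there the other \<open>N\<close> coordinates are moved by the parameters of
  \<open>\<omega>\<close> only, all other bumps being zero at \<open>\<omega>\<close>. Since the bumps have a bounded sum, relative to the weight, one size \<open>\<eta>\<close> of the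
  perturbation is small enough for every finite \<open>\<Lambda>\<close>.
\<close>

theorem perturbation_family:
 fixes F :: "nat => complex => complex"
 assumes a: "0 < a" "a < 1" "0 < a'" "a' < 1" and t: "0 < t" "1 / t < a"
  and F: "!!i. i <= N ==> F i holomorphic_on UNIV"
  and low: "!!z. exp (2 * (pi * a * (Re z)^2)) / 16 <= nsq N F z"
  and up: "!!i z. i <= N ==> cmod (F i z) <= 2 * exp (pi * a * (Re z)^2)"
  and D: "!!z. covariant_energy a N F z <= pi * a' * nsq N F z"
 shows "\<exists>\<delta>>0. \<exists>C\<ge>0. \<forall>\<Lambda>. finite \<Lambda> --> (\<exists>c \<nu>. separated_family N t \<delta> C \<Lambda> c \<nu>)"
proof -
 define E where "E = (%z. exp (pi * a * (Re z)^2))"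
 have E: "0 < E z" for z by (simp add: E_def)
 define m where "m = real N + 1"
 have m: "1 <= m" by (simp add: m_def)
 define \<gamma> where "\<gamma> = pi * (a - 1 / t) / 2"
 have \<gamma>: "0 < \<gamma>" using t by (simp add: \<gamma>_def)
 define M where "M = 2 * (ssig_up t * lattice_sum_bound \<gamma> t)"
 have M: "0 < M" using ssig_up_pos[OF t(1)] \<gamma> t(1) by (simp add: M_def lattice_sum_bound_def)
 \<comment> \<open>The largest relative perturbation that \<open>perturbed_curve\<close> permits.\<close>
 define \<theta> where "\<theta> = min (1 / 2) (sqrt pi * (1 - sqrt a') / (exp pi + sqrt pi))"
 have ep: "0 < exp pi + sqrt pi" by (intro add_pos_pos) auto
 have \<theta>: "0 < \<theta>" "\<theta> <= 1 / 2" "\<theta> * (exp pi + sqrt pi) <= sqrt pi * (1 - sqrt a')"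
 proof -
  show "0 < \<theta>" using a ep by (simp add: \<theta>_def)
  show "\<theta> <= 1 / 2" unfolding \<theta>_def by (rule min.cobounded1)
  have "\<theta> <= sqrt pi * (1 - sqrt a') / (exp pi + sqrt pi)" unfolding \<theta>_def by (rule min.cobounded2)
  thus "\<theta> * (exp pi + sqrt pi) <= sqrt pi * (1 - sqrt a')" using ep by (simp only: pos_le_divide_eq)
 qed
 define \<eta> where "\<eta> = min 1 (\<theta> / (4 * sqrt m * M))"
 have \<eta>: "0 < \<eta>" "\<eta> <= 1" "4 * sqrt m * (\<eta> * M) <= \<theta>"
 proof -
  have p: "0 < 4 * sqrt m * M" using m M by simp
  show "0 < \<eta>" using p \<theta> by (simp add: \<eta>_def)
  show "\<eta> <= 1" unfolding \<eta>_def by (rule min.cobounded1)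
  have "\<eta> <= \<theta> / (4 * sqrt m * M)" unfolding \<eta>_def by (rule min.cobounded2)
  hence "\<eta> * (4 * sqrt m * M) <= \<theta>" using p by (simp only: pos_le_divide_eq)
  thus "4 * sqrt m * (\<eta> * M) <= \<theta>" by (simp only: mult_ac)
 qed
 \<comment> \<open>In units of the weight, the reference coordinate is at least \<open>1 / (4 sqrt m)\<close> and all coordinates are at most \<open>4\<close>.\<close>
 define \<rho> where "\<rho> = 1 / (256 * m^2)"
 have \<rho>: "0 < \<rho>" using m by (simp add: \<rho>_def)
 define \<delta> where "\<delta> = \<rho> / (1 + 1 / \<rho>) * (\<eta> / 2)"
 have \<delta>: "0 < \<delta>" unfolding \<delta>_def using \<rho> \<eta> by (intro mult_pos_pos divide_pos_pos add_pos_pos) auto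
 define C where "C = m^2 * (2 * m * (16 * M))"
 have C: "0 <= C" using m M by (simp add: C_def)
 have "\<exists>c \<nu>. separated_family N t \<delta> C \<Lambda> c \<nu>" if \<Lambda>: "finite \<Lambda>" for \<Lambda> :: "(int \<times> int) set"
 proof -
  define n where "n = 2 * N * card \<Lambda>"
  obtain L :: nat where L: "\<forall>\<omega>\<in>\<Lambda>. \<forall>\<mu>\<in>\<Lambda>. \<bar>fst \<mu> - fst \<omega>\<bar> <= int L"
  proof
   define S where "S = (%(\<omega>, \<mu>). nat \<bar>fst \<mu> - fst \<omega>\<bar>) ` (\<Lambda> \<times> \<Lambda>)"
   show "\<forall>\<omega>\<in>\<Lambda>. \<forall>\<mu>\<in>\<Lambda>. \<bar>fst \<mu> - fst \<omega>\<bar> <= int (Max S)"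
   proof (intro ballI)
    fix \<omega> \<mu> assume "\<omega> \<in> \<Lambda>" "\<mu> \<in> \<Lambda>"
    hence "nat \<bar>fst \<mu> - fst \<omega>\<bar> <= Max S" using \<Lambda> by (intro Max_ge) (auto simp: S_def)
    thus "\<bar>fst \<mu> - fst \<omega>\<bar> <= int (Max S)" by linarith
   qed
  qed
  have "\<forall>z. \<exists>i. i <= N & (\<forall>j\<le>N. cmod (F j z) <= cmod (F i z))"
  proof
   fix z
   have "Max ((%i. cmod (F i z)) ` {..N}) \<in> (%i. cmod (F i z)) ` {..N}" by (intro Max_in) auto
   hence "\<exists>i\<in>{..N}. Max ((%i. cmod (F i z)) ` {..N}) = cmod (F i z)" unfolding image_iff .
   then obtain i where "i \<in> {..N}" "Max ((%i. cmod (F i z)) ` {..N}) = cmod (F i z)" by (rule bexE)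
   moreover have "cmod (F j z) <= Max ((%i. cmod (F i z)) ` {..N})" if "j <= N" for j using that by (intro Max_ge) auto
   ultimately show "\<exists>i. i <= N & (\<forall>j\<le>N. cmod (F j z) <= cmod (F i z))" by auto
  qed
  from choice[OF this] obtain i0 where i0: "\<forall>z. i0 z <= N & (\<forall>j\<le>N. cmod (F j z) <= cmod (F (i0 z) z))" by (elim exE)
  define I where "I = (SIGMA \<omega>:\<Lambda>. ({..N} - {i0 (lpt t \<omega>)}) \<times> (UNIV :: bool set))"
  have "card I = (\<Sum>\<omega>\<in>\<Lambda>. card (({..N} - {i0 (lpt t \<omega>)}) \<times> (UNIV :: bool set)))"
   unfolding I_def using \<Lambda> by (intro card_SigmaI) auto
  also have "... = (\<Sum>\<omega>\<in>\<Lambda>. 2 * N)" using i0 by (intro sum.cong) (auto simp: card_cartesian_product)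
  finally have cI: "card I = n" by (simp add: n_def mult.commute)
  have fI: "finite I" unfolding I_def using \<Lambda> by (intro finite_SigmaI) auto
  obtain e where e: "bij_betw e {0..<n} I" using ex_bij_betw_nat_finite[OF fI] unfolding cI by (elim exE)
  define e' where "e' = inv_into {0..<n} e"
  have e': "e' k < n" "e (e' k) = k" if "k \<in> I" for k
   using bij_betw_inv_into[OF e] bij_betw_inv_into_right[OF e that] that
   by (auto simp: e'_def bij_betw_def)
  have e'e: "e' (e i) = i" "e i \<in> I" if "i < n" for i
   using bij_betw_inv_into_left[OF e, of i] that e by (auto simp: e'_def bij_betw_def)
  define A where "A = (%(x :: nat => real) j \<omega>. if \<omega> \<in> \<Lambda> & j <= N & j ~= i0 (lpt t \<omega>)
    then Complex (x (e' (\<omega>, j, False))) (x (e' (\<omega>, j, True))) else 0)"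
  have inI: "(\<omega>, j, b) \<in> I" if "\<omega> \<in> \<Lambda>" "j <= N" "j ~= i0 (lpt t \<omega>)" for \<omega> j b using that by (auto simp: I_def)
  have A2: "cmod (A x j \<omega>) <= 2" if x: "x \<in> cube n" for x j \<omega>
  proof (cases "\<omega> \<in> \<Lambda> & j <= N & j ~= i0 (lpt t \<omega>)")
   case True
   have "\<bar>x (e' (\<omega>, j, b))\<bar> <= 1" for b using x e'(1)[OF inI] True by (auto simp: cube_def)
   from this[of False] this[of True] show ?thesis using True cmod_le[of "A x j \<omega>"] by (simp add: A_def)
  qed (auto simp: A_def)
  have A\<tau>: "cmod (A x j \<omega> - A y j \<omega>) <= 2 * \<tau>" if xy: "\<forall>j<n. \<bar>x j - y j\<bar> < \<tau>" and \<tau>: "0 < \<tau>" for x y j \<omega> \<tau>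
  proof (cases "\<omega> \<in> \<Lambda> & j <= N & j ~= i0 (lpt t \<omega>)")
   case True
   have "\<bar>x (e' (\<omega>, j, b)) - y (e' (\<omega>, j, b))\<bar> <= \<tau>" for b using xy e'(1)[OF inI] True by (intro less_imp_le) auto
   from this[of False] this[of True] show ?thesis using True cmod_le[of "A x j \<omega> - A y j \<omega>"] by (simp add: A_def)
  qed (use \<tau> in \<open>auto simp: A_def\<close>)
  define \<psi> where "\<psi> = (\<lambda>\<omega>. bump a t L (lpt t \<omega>))"
  have sum\<psi>: "cmod (\<Sum>\<omega>\<in>\<Lambda>. B \<omega> * \<psi> \<omega> z) <= b / 2 * M * E z" if B: "!!\<omega>. cmod (B \<omega>) <= b" for B b z
  proof -
   have b0: "0 <= b" using order_trans[OF norm_ge_zero B] .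
   have "cmod (\<Sum>\<omega>\<in>\<Lambda>. B \<omega> * \<psi> \<omega> z) <= (\<Sum>\<omega>\<in>\<Lambda>. b * (ssig_up t * exp (- (\<gamma> * (cmod (z - lpt t \<omega>))^2)) * E z))"
   proof (rule sum_norm_le)
    fix \<omega>
    show "cmod (B \<omega> * \<psi> \<omega> z) <= b * (ssig_up t * exp (- (\<gamma> * (cmod (z - lpt t \<omega>))^2)) * E z)"
     unfolding norm_mult \<psi>_def using B[of \<omega>] norm_bump_le[OF t(1), of a L "lpt t \<omega>" z] b0
     by (intro mult_mono) (auto simp: E_def \<gamma>_def)
   qed
   also have "... = b * ssig_up t * E z * (\<Sum>\<omega>\<in>\<Lambda>. exp (- (\<gamma> * (cmod (z - lpt t \<omega>))^2)))"
    unfolding sum_distrib_left by (intro sum.cong) auto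
   also have "... <= b * ssig_up t * E z * lattice_sum_bound \<gamma> t"
    using b0 ssig_up_pos[OF t(1)] E[of z] by (intro mult_left_mono gaussian_lattice_sum_le \<gamma> t \<Lambda>) auto
   also have "... = b / 2 * M * E z" by (simp add: M_def)
   finally show ?thesis .
  qed
  define P where "P = (%x j z. of_real \<eta> * (\<Sum>\<omega>\<in>\<Lambda>. A x j \<omega> * \<psi> \<omega> z))"
  define G where "G = (%x j z. F j z + P x j z)"
  have Ph: "P x j holomorphic_on UNIV" for x j
   unfolding P_def \<psi>_def by (intro holomorphic_intros bump_holomorphic)
  have Ps: "cmod (P x j z) <= \<eta> * M * exp (pi * a * (Re z)^2)" if x: "x \<in> cube n" for x j z
   using sum\<psi>[of "A x j" 2 z] A2[OF x] \<eta> by (simp add: P_def norm_mult E_def mult.assoc)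
  have Gh: "G x i holomorphic_on UNIV" if "i <= N" for x i
   unfolding G_def using F[OF that] Ph by (intro holomorphic_intros)
  have \<eta>3: "4 * sqrt (real N + 1) * (\<eta> * M) <= \<theta>" using \<eta>(3) by (simp add: m_def)
  have G: "E z / 8 <= sqrt (nsq N (G x) z)" "fs_density N (G x) z <= pi" if x: "x \<in> cube n" for x z
   unfolding G_def E_def
   using perturbed_curve[OF F Ph _ _ a(3) low D Ps[OF x] \<eta>3 \<theta>(2) \<theta>(3)] a by auto
  have Gpos: "0 < nsq N (G x) z" if x: "x \<in> cube n" for x z
  proof -
   have "0 < E z / 8" using E[of z] by simp
   hence "0 < sqrt (nsq N (G x) z)" using G(1)[OF x, of z] by linarith
   thus ?thesis by simp
  qed
  define c where "c = (%x. curve_of N (G x))"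
  have hc: "homogeneous_coords N (G x) (c x)" if x: "x \<in> cube n" for x
   unfolding c_def by (intro homogeneous_coords_curve_of Gh Gpos x)
  have brody: "brody_curve N (c x)" if x: "x \<in> cube n" for x
   unfolding brody_curve_iff using hc[OF x] G(2)[OF x] by blast
  have Gle: "cmod (G x j z) <= sqrt (nsq N (G x) z)" if "j <= N" for x j z
   unfolding nsq_def by (rule real_le_rsqrt) (use that in \<open>intro member_le_sum, auto\<close>)
  have cont: "pdist N (c x z) (c y z) <= C * \<tau>" if x: "x \<in> cube n" and y: "y \<in> cube n" and \<tau>: "0 < \<tau>"
    and xy: "\<forall>j<n. \<bar>x j - y j\<bar> < \<tau>" for x y \<tau> z
  proof -
   have dG: "cmod (G x j z - G y j z) <= \<tau> * M * E z" for j
   proof -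
    have "G x j z - G y j z = of_real \<eta> * (\<Sum>\<omega>\<in>\<Lambda>. (A x j \<omega> - A y j \<omega>) * \<psi> \<omega> z)"
     by (simp add: G_def P_def left_diff_distrib sum_subtractf right_diff_distrib)
    hence "cmod (G x j z - G y j z) = \<eta> * cmod (\<Sum>\<omega>\<in>\<Lambda>. (A x j \<omega> - A y j \<omega>) * \<psi> \<omega> z)"
     using \<eta> by (simp add: norm_mult)
    also have "... <= 1 * (2 * \<tau> / 2 * M * E z)"
     using \<eta> by (intro mult_mono sum\<psi> A\<tau>[OF xy \<tau>]) auto
    finally show ?thesis by simp
   qed
   have "pdist N (c x z) (c y z) <= (real N + 1)^2 * (2 * (real N + 1) * (16 * M * \<tau>))"
   proof (rule pdist_le_cross_terms[OF hc[OF x] hc[OF y]])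
    show "0 <= 16 * M * \<tau>" using M \<tau> by simp
    fix i k assume ik: "i <= N" "k <= N"
    define X Y where "X = sqrt (nsq N (G x) z)" and "Y = sqrt (nsq N (G y) z)"
    have X: "E z <= 8 * X" "0 <= Y" "0 <= X" using G(1)[OF x, of z] Gpos[OF y, of z] Gpos[OF x, of z] by (auto simp: X_def Y_def)
    have "G x i z * G y k z - G x k z * G y i z = (G x i z - G y i z) * G y k z + G y i z * (G y k z - G x k z)"
     by (simp add: algebra_simps)
    hence "cmod (G x i z * G y k z - G x k z * G y i z) <= cmod (G x i z - G y i z) * cmod (G y k z) + cmod (G y i z) * cmod (G x k z - G y k z)"
     by (metis norm_triangle_ineq norm_mult norm_minus_commute)
    also have "... <= (\<tau> * M * E z) * Y + Y * (\<tau> * M * E z)"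
     unfolding Y_def using \<tau> M E[of z] ik Gpos[OF y, of z] by (intro add_mono mult_mono dG Gle) auto
    also have "... = (2 * \<tau> * M * Y) * E z" by simp
    also have "... <= (2 * \<tau> * M * Y) * (8 * X)" using X \<tau> M by (intro mult_left_mono) auto
    also have "... = 16 * M * \<tau> * (X * Y)" by simp
    finally have "(cmod (G x i z * G y k z - G x k z * G y i z))^2 <= (16 * M * \<tau> * (X * Y))^2" by (intro power_mono) auto
    also have "... = (16 * M * \<tau>)^2 * (nsq N (G x) z * nsq N (G y) z)"
     using Gpos[OF x, of z] Gpos[OF y, of z] unfolding power_mult_distrib X_def Y_def by simp
    finally show "(cmod (G x i z * G y k z - G x k z * G y i z))^2 <= (16 * M * \<tau>)^2 * (nsq N (G x) z * nsq N (G y) z)" .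
   qed
   also have "... = C * \<tau>" by (simp add: C_def m_def)
   finally show ?thesis .
  qed
  define \<nu> where "\<nu> = (%i. fst (e i))"
  have sep: "\<nu> i \<in> \<Lambda> & (\<forall>x\<in>cube n. \<forall>y\<in>cube n. x i = 0 --> y i = 1 --> \<delta> <= pdist N (c x (lpt t (\<nu> i))) (c y (lpt t (\<nu> i))))"
   if i: "i < n" for i
  proof -
   obtain \<omega> j b where ei: "e i = (\<omega>, j, b)" by (rule prod_cases3)
   have mem: "\<omega> \<in> \<Lambda>" "j <= N" "j ~= i0 (lpt t \<omega>)" using e'e(2)[OF i] unfolding ei I_def by auto
   have ei': "e' (\<omega>, j, b) = i" using e'e(1)[OF i] ei by simp
   define p where "p = lpt t \<omega>"
   define k where "k = i0 p"
   have k: "k <= N" "!!j. j <= N ==> cmod (F j p) <= cmod (F k p)" using i0 by (auto simp: k_def)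
   have Gp: "G x j p = F j p + of_real (\<eta> * E p) * A x j \<omega>" for x j
   proof -
    have "(\<Sum>\<mu>\<in>\<Lambda>. A x j \<mu> * \<psi> \<mu> p) = (\<Sum>\<mu>\<in>\<Lambda>. if \<mu> = \<omega> then A x j \<omega> * of_real (E p) else 0)"
    proof (rule sum.cong[OF refl])
     fix \<mu> assume \<mu>: "\<mu> \<in> \<Lambda>"
     show "A x j \<mu> * \<psi> \<mu> p = (if \<mu> = \<omega> then A x j \<omega> * of_real (E p) else 0)"
      using bump_self[OF t(1), of a L p] bump_other[of \<mu> \<omega> L a t] L \<mu> mem(1) by (auto simp: \<psi>_def p_def E_def)
    qed
    also have "... = A x j \<omega> * of_real (E p)" using \<Lambda> mem(1) by simp
    finally show ?thesis by (simp add: G_def P_def)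
   qed
   have Gk: "G x k p = F k p" for x unfolding Gp by (simp add: A_def k_def p_def)
   have Fk: "E p / (4 * sqrt m) <= cmod (F k p)"
   proof -
    have "nsq N F p <= (\<Sum>i\<le>N. (cmod (F k p))^2)" unfolding nsq_def using k(2) by (intro sum_mono power_mono) auto
    hence "(E p / 4)^2 <= m * (cmod (F k p))^2" using low[of p] by (simp add: m_def E_def power_divide exp_double add.commute)
    hence "sqrt ((E p / 4)^2) <= sqrt (m * (cmod (F k p))^2)" by (rule real_sqrt_le_mono)
    hence "E p / 4 <= sqrt m * cmod (F k p)" using E[of p] by (simp add: real_sqrt_mult)
    thus ?thesis using m by (simp add: field_simps)
   qed
   have Fk0: "F k p ~= 0" using Fk E[of p] m by (auto simp: divide_le_0_iff)
   have cp: "c x p \<in> topspace (CP N)" if "x \<in> cube n" for x by (rule brody_curve_in_CP[OF brody[OF that]])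
   have P00: "\<rho> <= cmod (pcoord N (c x p) k k)" if x: "x \<in> cube n" for x
   proof -
    have "cmod (G x j p) <= 4 * E p" if j: "j <= N" for j
    proof -
     have "cmod (G x j p) <= cmod (F j p) + cmod (of_real (\<eta> * E p) * A x j \<omega>)" unfolding Gp by (rule norm_triangle_ineq)
     also have "cmod (of_real (\<eta> * E p) * A x j \<omega>) = \<eta> * E p * cmod (A x j \<omega>)" using \<eta> E[of p] unfolding norm_mult norm_of_real by simp
     also have "... <= 1 * E p * 2" using \<eta> E[of p] A2[OF x] by (intro mult_mono) auto
     finally show ?thesis using up[OF j, of p] by (simp add: E_def)
    qed
    hence "nsq N (G x) p <= (\<Sum>j\<le>N. (4 * E p)^2)" unfolding nsq_def by (intro sum_mono power_mono) auto
    hence up: "nsq N (G x) p <= 16 * m * (E p)^2" by (simp add: m_def power_mult_distrib algebra_simps)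
    have "(E p / (4 * sqrt m))^2 <= (cmod (F k p))^2" using Fk E[of p] m by (intro power_mono) auto
    hence lo: "(E p)^2 / (16 * m) <= (cmod (F k p))^2" using m by (simp add: power_divide power_mult_distrib)
    have "\<rho> = ((E p)^2 / (16 * m)) / (16 * m * (E p)^2)" using E[of p] m by (simp add: \<rho>_def field_simps power2_eq_square)
    also have "... <= (cmod (F k p))^2 / nsq N (G x) p" using lo up Gpos[OF x, of p] by (intro frac_le) auto
    also have "... = cmod (pcoord N (c x p) k k)"
     unfolding homogeneous_coords_pcoord[OF hc[OF x] k(1) k(1)] Gk using Gpos[OF x, of p]
     by (simp add: norm_divide norm_mult power2_eq_square)
    finally show ?thesis .
   qed
   have ratio: "pcoord N (c x p) j k / pcoord N (c x p) k k = G x j p / F k p" if x: "x \<in> cube n" for x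
    unfolding homogeneous_coords_pcoord[OF hc[OF x] mem(2) k(1)] homogeneous_coords_pcoord[OF hc[OF x] k(1) k(1)] Gk
    using Fk0 Gpos[OF x, of p] by simp
   have "\<delta> <= pdist N (c x p) (c y p)" if x: "x \<in> cube n" and y: "y \<in> cube n" and xi: "x i = 0" "y i = 1" for x y
   proof -
    have dA: "1 <= cmod (A x j \<omega> - A y j \<omega>)"
    proof (cases b)
     case True
     hence "\<bar>Im (A x j \<omega> - A y j \<omega>)\<bar> = 1" using mem ei' xi by (simp add: A_def)
     thus ?thesis using abs_Im_le_cmod[of "A x j \<omega> - A y j \<omega>"] by simp
    next
     case False
     hence "\<bar>Re (A x j \<omega> - A y j \<omega>)\<bar> = 1" using mem ei' xi by (simp add: A_def)
     thus ?thesis using abs_Re_le_cmod[of "A x j \<omega> - A y j \<omega>"] by simp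
    qed
    have "G x j p / F k p - G y j p / F k p = of_real (\<eta> * E p) * (A x j \<omega> - A y j \<omega>) / F k p"
     unfolding Gp by (simp add: diff_divide_distrib[symmetric] algebra_simps)
    hence "cmod (G x j p / F k p - G y j p / F k p) = \<eta> * E p * cmod (A x j \<omega> - A y j \<omega>) / cmod (F k p)"
     using \<eta> E[of p] by (simp only: norm_divide norm_mult[of "of_real (\<eta> * E p)"] norm_of_real) simp
    also have "... >= \<eta> * E p * 1 / (2 * E p)"
     using \<eta> E[of p] dA up[OF k(1), of p] Fk0 by (intro frac_le mult_left_mono) (auto simp: E_def)
    finally have "\<eta> / 2 <= cmod (pcoord N (c x p) j k / pcoord N (c x p) k k - pcoord N (c y p) j k / pcoord N (c y p) k k)"
     unfolding ratio[OF x] ratio[OF y] using E[of p] by simp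
    hence "\<delta> <= \<rho> / (1 + 1 / \<rho>) * cmod (pcoord N (c x p) j k / pcoord N (c x p) k k - pcoord N (c y p) j k / pcoord N (c y p) k k)"
     unfolding \<delta>_def using \<rho> by (intro mult_left_mono) auto
    also have "... <= pdist N (c x p) (c y p)"
     by (rule pdist_ge_affine[OF cp[OF x] cp[OF y] mem(2) k(1) \<rho> P00[OF x] P00[OF y]])
    finally show ?thesis .
   qed
   thus ?thesis using mem(1) by (simp add: \<nu>_def ei p_def)
  qed
  show ?thesis
   unfolding separated_family_def Let_def n_def[symmetric] using brody cont sep by (intro exI[of _ c] exI[of _ \<nu>]) blast
 qed
 thus ?thesis using \<delta> C by blast
qed

section \<open>Mean dimension of the space of Brody curves\<close>

lemma brody_curve_translate:
 assumes "brody_curve N f"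
 shows "brody_curve N (translate a f)"
proof -
 obtain F where F: "homogeneous_coords N F f" "\<forall>z. fs_density N F z <= pi" using assms unfolding brody_curve_iff by (elim exE conjE)
 define G where "G = (%i z. F i (z + a))"
 have d: "deriv (G i) z = deriv (F i) (z + a)" for i z by (simp add: G_def deriv_def DERIV_shift)
 have Fh: "F i holomorphic_on UNIV" if "i <= N" for i using F(1) that by (simp add: homogeneous_coords_def)
 have "G i holomorphic_on UNIV" if "i <= N" for i
 proof -
  have "(F i \<circ> (%z. z + a)) holomorphic_on UNIV"
   by (rule holomorphic_on_compose_gen[of _ _ _ UNIV]) (use Fh[OF that] in \<open>auto intro!: holomorphic_intros\<close>)
  thus ?thesis by (simp add: G_def o_def)
 qed
 hence "homogeneous_coords N G (translate a f)"
  using F(1) by (auto simp: homogeneous_coords_def G_def translate_def)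
 moreover have "fs_density N G z = fs_density N F (z + a)" for z
  by (simp add: fs_density_def nsq_def dinner_def d) (simp add: G_def)
 ultimately show ?thesis unfolding brody_curve_iff using F(2) by metis
qed

lemma translate_translate: "translate a (translate b f) = translate (a + b) f"
 by (simp add: translate_def add.assoc fun_eq_iff)

lemma translate_0: "translate 0 f = f"
 by (simp add: translate_def)

lemma cdist_translate_le:
 assumes f: "brody_curve N f" and g: "brody_curve N g"
 shows "cdist N (translate a f) (translate a g) <= exp (cmod a) * cdist N f g"
proof (rule cdist_le[OF brody_curve_translate[OF f] brody_curve_translate[OF g]])
 fix z
 have "exp (- cmod z) * pdist N (translate a f z) (translate a g z) <= exp (cmod a - cmod (z + a)) * pdist N (f (z + a)) (g (z + a))"
  unfolding translate_def using norm_triangle_ineq[of z a] by (intro mult_right_mono) (auto simp: pdist_metric)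
 also have "... = exp (cmod a) * (exp (- cmod (z + a)) * pdist N (f (z + a)) (g (z + a)))"
  by (simp add: exp_diff exp_minus divide_inverse)
 also have "... <= exp (cmod a) * cdist N f g" by (intro mult_left_mono le_cdist f g) auto
 finally show "exp (- cmod z) * pdist N (translate a f z) (translate a g z) <= exp (cmod a) * cdist N f g" .
qed

abbreviation brody_metric :: "nat => (complex => (nat => complex) set) metric" where
 "brody_metric N \<equiv> metric ({f. brody_curve N f}, cdist N)"

lemma brody_metric_simps: "mspace (brody_metric N) = {f. brody_curve N f}" "mdist (brody_metric N) = cdist N"
 by (simp_all add: Metric_space.mspace_metric[OF Metric_space_cdist] Metric_space.mdist_metric[OF Metric_space_cdist])

lemma cont_pmet_cdist: "cont_pmet (brody_space N) (cdist N)"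
 using cont_pmet_mdist[of "brody_metric N"] unfolding mtopology_cdist brody_metric_simps .

lemma continuous_map_translate: "continuous_map (brody_space N) (brody_space N) (translate a)"
proof -
 have "Lipschitz_continuous_map (brody_metric N) (brody_metric N) (translate a)"
  unfolding Lipschitz_continuous_map_def brody_metric_simps
  by (auto simp: brody_curve_translate intro!: exI[of _ "exp (cmod a)"] cdist_translate_le)
 hence "continuous_map (mtopology_of (brody_metric N)) (mtopology_of (brody_metric N)) (translate a)"
  by (rule Lipschitz_continuous_imp_continuous_map)
 thus ?thesis unfolding mtopology_cdist .
qed

lemma cont_pmet_evaluation: "cont_pmet (brody_space N) (%f g. pdist N (f z) (g z))"
 unfolding cont_pmet_def
proof (intro conjI ballI)
 fix p assume p: "p \<in> topspace (brody_space N)"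
 have "Lipschitz_continuous_map (brody_metric N) euclidean_metric (%f. pdist N (f z) (p z))"
  unfolding Lipschitz_continuous_map_def brody_metric_simps
 proof (intro conjI exI[of _ "exp (cmod z)"] ballI)
  fix f g assume "f \<in> {f. brody_curve N f}" "g \<in> {f. brody_curve N f}"
  hence fg: "brody_curve N f" "brody_curve N g" by auto
  have "\<bar>pdist N (f z) (p z) - pdist N (g z) (p z)\<bar> <= pdist N (f z) (g z)"
   using pdist_metric(4)[of N "f z" "p z" "g z"] pdist_metric(4)[of N "g z" "p z" "f z"] pdist_metric(3)[of N "f z" "g z"] by linarith
  thus "mdist euclidean_metric (pdist N (f z) (p z)) (pdist N (g z) (p z)) <= exp (cmod z) * cdist N f g"
   using pdist_le_cdist[OF fg, of z] by (simp add: dist_real_def)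
 qed auto
 hence "continuous_map (mtopology_of (brody_metric N)) (mtopology_of euclidean_metric) (%f. pdist N (f z) (p z))"
  by (rule Lipschitz_continuous_imp_continuous_map)
 thus "continuous_map (brody_space N) euclideanreal (%f. pdist N (f z) (p z))" unfolding mtopology_cdist by simp
qed (auto simp: pdist_metric(1,2) intro: pdist_metric(3,4))

lemma cont_pmet_uniform:
 assumes X: "compact_space X" and d: "cont_pmet X d" and r: "cont_pmet X r"
  and zero: "!!x y. x \<in> topspace X ==> y \<in> topspace X ==> r x y = 0 ==> d x y = 0" and e: "0 < e"
 shows "\<exists>\<delta>>0. \<forall>x\<in>topspace X. \<forall>y\<in>topspace X. r x y < \<delta> --> d x y < e"
proof -
 have z: "d x y <= 0" if "x \<in> topspace X" "y \<in> topspace X" "r x y = 0" for x y using zero[OF that] by simp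
 show ?thesis by (rule cont_pmet_fibre_uniform[OF X d r z e]) blast+
qed

context
 fixes N :: nat and m :: "(complex => (nat => complex) set) metric"
 assumes m: "mtopology_of m = brody_space N"
begin

lemma mspace_brody: "mspace m = {f. brody_curve N f}"
 using arg_cong[OF m, of topspace] by (simp add: topspace_brody_space)

lemma cont_pmet_m: "cont_pmet (brody_space N) (mdist m)"
 using cont_pmet_mdist[of m] by (simp add: m)

lemma mdist_0_iff: "brody_curve N f ==> brody_curve N g ==> mdist m f g = 0 \<longleftrightarrow> f = g"
 by (simp add: mspace_brody mdist_zero)

lemma cdist_0_iff: "brody_curve N f ==> brody_curve N g ==> cdist N f g = 0 \<longleftrightarrow> f = g"
 using Metric_space.zero[OF Metric_space_cdist, of f N g] by simp

lemma cdist_imp_mdist: "0 < e ==> \<exists>\<delta>>0. \<forall>f g. brody_curve N f --> brody_curve N g --> cdist N f g < \<delta> --> mdist m f g < e"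
 using cont_pmet_uniform[OF compact_brody_space[of N] cont_pmet_m cont_pmet_cdist]
 by (simp add: topspace_brody_space cdist_0_iff mdist_0_iff)

lemma mdist_imp_cdist: "0 < e ==> \<exists>\<delta>>0. \<forall>f g. brody_curve N f --> brody_curve N g --> mdist m f g < \<delta> --> cdist N f g < e"
 using cont_pmet_uniform[OF compact_brody_space[of N] cont_pmet_cdist cont_pmet_m]
 by (simp add: topspace_brody_space cdist_0_iff mdist_0_iff)

lemma mdist_translate_uniform:
 assumes e: "0 < e"
 shows "\<exists>\<delta>>0. \<forall>f g z. brody_curve N f --> brody_curve N g --> mdist m f g < \<delta> --> cmod z <= R -->
   mdist m (translate z f) (translate z g) < e"
proof -
 obtain \<delta>1 where 1: "0 < \<delta>1" "\<forall>f g. brody_curve N f --> brody_curve N g --> cdist N f g < \<delta>1 --> mdist m f g < e"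
  using cdist_imp_mdist[OF e] by (elim exE conjE)
 have "0 < exp (- R) * \<delta>1" using 1 by simp
 from mdist_imp_cdist[OF this] obtain \<delta> where 2: "0 < \<delta>"
  "\<forall>f g. brody_curve N f --> brody_curve N g --> mdist m f g < \<delta> --> cdist N f g < exp (- R) * \<delta>1" by (elim exE conjE)
 show ?thesis
 proof (intro exI[of _ \<delta>] conjI 2(1) allI impI)
  fix f g z assume fg: "brody_curve N f" "brody_curve N g" and d: "mdist m f g < \<delta>" and z: "cmod z <= R"
  have c: "cdist N f g < exp (- R) * \<delta>1" using 2(2) fg d by blast
  have "cdist N (translate z f) (translate z g) <= exp (cmod z) * cdist N f g" by (rule cdist_translate_le[OF fg])
  also have "... <= exp R * cdist N f g"
   using z Metric_space.nonneg[OF Metric_space_cdist, of N f g] by (intro mult_right_mono) auto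
  also have "... < exp R * (exp (- R) * \<delta>1)" using c by simp
  also have "... = \<delta>1" by (simp add: mult.assoc[symmetric] exp_minus_inverse)
  finally show "mdist m (translate z f) (translate z g) < e"
   using 1(2) brody_curve_translate[OF fg(1)] brody_curve_translate[OF fg(2)] by blast
 qed
qed

lemma mdist_bounded: "\<exists>B. \<forall>f g. brody_curve N f --> brody_curve N g --> mdist m f g <= B"
proof -
 interpret M: Metric_space "mspace m" "mdist m" by (rule Metric_space_mspace_mdist)
 have "compactin M.mtopology (mspace m)"
  using compact_brody_space[of N] m unfolding compact_space_def mtopology_of_def
  by (simp add: mspace_brody topspace_brody_space)
 hence "M.mbounded (mspace m)" by (rule M.compactin_imp_mbounded)
 thus ?thesis unfolding M.mbounded_alt by (auto simp: mspace_brody)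
qed

text \<open>
  The relation for a set \<open>\<Omega>\<close> of translations, so that the least dimension for \<open>\<Omega>\<close> becomes a set function.
\<close>

definition orbit_close :: "real => complex set => (complex => (nat => complex) set) => (complex => (nat => complex) set) => bool" where
 "orbit_close \<epsilon> \<Omega> f g \<longleftrightarrow> (\<forall>z\<in>\<Omega>. mdist m (translate z f) (translate z g) <= \<epsilon>)"

definition orbit_dist :: "real => (complex => (nat => complex) set) => (complex => (nat => complex) set) => real" where
 "orbit_dist R f g = (if f \<in> mspace m & g \<in> mspace m
      then SUP z\<in>cball 0 R. mdist m (translate z f) (translate z g) else 0)"

abbreviation orbit_emb :: "real => complex set => nat => bool" where
 "orbit_emb e \<Omega> \<equiv> emb_dim_le (brody_space N) (orbit_close e \<Omega>)"

lemma orbit_metric_eq: "orbit_metric translate R m = metric ({f. brody_curve N f}, orbit_dist R)"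
 unfolding orbit_metric_def orbit_dist_def mspace_brody ..

lemma orbit_bdd: "brody_curve N f ==> brody_curve N g ==> bdd_above ((%z. mdist m (translate z f) (translate z g)) ` cball 0 R)"
 using mdist_bounded brody_curve_translate by (meson bdd_aboveI2)

lemma orbit_dist_le_iff:
 assumes R: "0 <= R" and f: "brody_curve N f" and g: "brody_curve N g"
 shows "orbit_dist R f g <= e \<longleftrightarrow> orbit_close e (cball 0 R) f g"
 unfolding orbit_dist_def orbit_close_def mspace_brody using R f g orbit_bdd[OF f g]
 by (simp add: cSUP_le_iff)

lemma mdist_translate_le_orbit_dist:
 assumes "cmod z <= R" "brody_curve N f" "brody_curve N g"
 shows "mdist m (translate z f) (translate z g) <= orbit_dist R f g"
 unfolding orbit_dist_def mspace_brody using assms by (auto intro!: cSUP_upper orbit_bdd)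

lemma Metric_space_orbit_dist:
 assumes R: "0 <= R"
 shows "Metric_space {f. brody_curve N f} (orbit_dist R)"
proof
 have up: "mdist m f g <= orbit_dist R f g" if "brody_curve N f" "brody_curve N g" for f g
  using mdist_translate_le_orbit_dist[of 0 R f g] R that by (simp add: translate_0)
 fix f g
 show "0 <= orbit_dist R f g"
 proof (cases "brody_curve N f & brody_curve N g")
  case True thus ?thesis using up[of f g] mdist_nonneg[of m f g] by linarith
 qed (auto simp: orbit_dist_def mspace_brody)
 show "orbit_dist R f g = orbit_dist R g f" by (auto simp: orbit_dist_def mdist_commute)
 {
  assume "f \<in> {f. brody_curve N f}" "g \<in> {f. brody_curve N f}"
  hence fg: "brody_curve N f" "brody_curve N g" by auto
  show "orbit_dist R f g = 0 \<longleftrightarrow> f = g"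
  proof
   assume "orbit_dist R f g = 0"
   hence "mdist m f g = 0" using up[OF fg] mdist_nonneg[of m f g] by linarith
   thus "f = g" using mdist_0_iff[OF fg] by simp
  next
   assume "f = g"
   hence "mdist m (translate z f) (translate z g) = 0" for z
    using mdist_0_iff[OF brody_curve_translate brody_curve_translate] fg by simp
   thus "orbit_dist R f g = 0" using R by (simp add: orbit_dist_def)
  qed
 }
 fix h
 assume "f \<in> {f. brody_curve N f}" "g \<in> {f. brody_curve N f}" "h \<in> {f. brody_curve N f}"
 hence fgh: "brody_curve N f" "brody_curve N g" "brody_curve N h" by auto
 show "orbit_dist R f h <= orbit_dist R f g + orbit_dist R g h"
  unfolding orbit_dist_le_iff[OF R fgh(1,3)] orbit_close_def
 proof
  fix z :: complex assume "z \<in> cball 0 R"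
  hence z: "cmod z <= R" by simp
  have "mdist m (translate z f) (translate z h) <= mdist m (translate z f) (translate z g) + mdist m (translate z g) (translate z h)"
   using cont_pmetD(1)[OF cont_pmet_m] fgh brody_curve_translate by (simp add: topspace_brody_space)
  also have "... <= orbit_dist R f g + orbit_dist R g h"
   by (intro add_mono mdist_translate_le_orbit_dist z fgh)
  finally show "mdist m (translate z f) (translate z h) <= orbit_dist R f g + orbit_dist R g h" .
 qed
qed

lemma orbit_metric_simps:
 assumes "0 <= R"
 shows "mspace (orbit_metric translate R m) = {f. brody_curve N f}" "mdist (orbit_metric translate R m) = orbit_dist R"
 unfolding orbit_metric_eq
 by (simp_all add: Metric_space.mspace_metric[OF Metric_space_orbit_dist[OF assms]] Metric_space.mdist_metric[OF Metric_space_orbit_dist[OF assms]])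

text \<open>
  Translations by \<open>\<bar>z\<bar> \<le> R\<close> are uniformly equicontinuous, so the supremum metric has the same topology.
\<close>

lemma mtopology_orbit_metric:
 assumes R: "0 <= R"
 shows "mtopology_of (orbit_metric translate R m) = brody_space N"
proof -
 let ?M = "orbit_metric translate R m"
 have ts: "topspace (mtopology_of ?M) = topspace (mtopology_of m)"
  by (simp add: orbit_metric_simps[OF R] mspace_brody)
 have "Lipschitz_continuous_map ?M m (%f. f)"
  unfolding Lipschitz_continuous_map_def orbit_metric_simps[OF R] mspace_brody
 proof (intro conjI exI[of _ 1] ballI)
  fix f g assume "f \<in> {f. brody_curve N f}" "g \<in> {f. brody_curve N f}"
  thus "mdist m f g <= 1 * orbit_dist R f g"
   using mdist_translate_le_orbit_dist[of 0 R f g] R by (simp add: translate_0)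
 qed auto
 hence c1: "continuous_map (mtopology_of ?M) (mtopology_of m) (%f. f)" by (rule Lipschitz_continuous_imp_continuous_map)
 have "uniformly_continuous_map m ?M (%f. f)"
  unfolding uniformly_continuous_map_def orbit_metric_simps[OF R] mspace_brody
 proof (intro conjI allI impI)
  fix e :: real assume e: "0 < e"
  hence "0 < e / 2" by simp
  from mdist_translate_uniform[OF this, of R] obtain \<delta> where \<delta>: "0 < \<delta>"
   "\<forall>f g z. brody_curve N f --> brody_curve N g --> mdist m f g < \<delta> --> cmod z <= R --> mdist m (translate z f) (translate z g) < e / 2"
   by (elim exE conjE)
  show "\<exists>\<delta>>0. \<forall>f\<in>{f. brody_curve N f}. \<forall>g\<in>{f. brody_curve N f}. mdist m g f < \<delta> --> orbit_dist R g f < e"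
  proof (intro exI[of _ \<delta>] conjI \<delta>(1) ballI impI)
   fix f g assume "f \<in> {f. brody_curve N f}" "g \<in> {f. brody_curve N f}" and d: "mdist m g f < \<delta>"
   hence fg: "brody_curve N f" "brody_curve N g" by auto
   have "orbit_dist R g f <= e / 2"
    unfolding orbit_dist_le_iff[OF R fg(2,1)] orbit_close_def using \<delta>(2) fg d by (auto intro: less_imp_le)
   thus "orbit_dist R g f < e" using e by simp
  qed
 qed auto
 hence c2: "continuous_map (mtopology_of m) (mtopology_of ?M) (%f. f)" by (rule uniformly_continuous_imp_continuous_map)
 have sub: "openin S U" if c: "continuous_map S T (%f. f)" and t: "topspace S = topspace T" and U: "openin T U" for S T :: "'z topology" and U
 proof -
  have "openin S {x \<in> topspace S. x \<in> U}" using openin_continuous_map_preimage[OF c U] by simp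
  moreover have "{x \<in> topspace S. x \<in> U} = U" using openin_subset[OF U] t by auto
  ultimately show ?thesis by simp
 qed
 have "openin (mtopology_of ?M) U \<longleftrightarrow> openin (mtopology_of m) U" for U
  using sub[OF c1 ts, of U] sub[OF c2 ts[symmetric], of U] by blast
 thus ?thesis unfolding m[symmetric] by (simp add: topology_eq)
qed

text \<open>
  If two curves agree on the lattice points of a disc slightly larger than that of the translations,
  all these translates are close. By compactness almost equal values on the lattice are enough, and
  these values have box dimension at most \<open>2N\<close> per lattice point.
\<close>

lemma orbit_dim_upper:
 assumes e: "0 < e" and t: "0 < t" "t < 1 / 2"
 shows "\<exists>r0>0. \<forall>R\<ge>0. orbit_emb e (cball 0 R) (2 * N * card (lattice_disc t 1 (R + r0)))"
proof -
 have e2: "0 < e / 2" using e by simp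
 obtain \<delta>1 where 1: "0 < \<delta>1" "\<forall>f g. brody_curve N f --> brody_curve N g --> cdist N f g < \<delta>1 --> mdist m f g < e / 2"
  using cdist_imp_mdist[OF e2] by (elim exE conjE)
 obtain Z \<delta>2 where Z: "finite Z" "0 < \<delta>2" "\<forall>f g. brody_curve N f --> brody_curve N g --> (\<forall>z\<in>Z. pdist N (f z) (g z) < \<delta>2) --> cdist N f g < \<delta>1"
  using cdist_less_criterion[OF 1(1), of N] by (elim exE conjE)
 have "bounded Z" using Z(1) by (rule finite_imp_bounded)
 then obtain \<rho>0 where \<rho>0: "0 < \<rho>0" "\<forall>z\<in>Z. cmod z <= \<rho>0" unfolding bounded_pos by (elim exE conjE)
 have d2: "0 < \<delta>2 / 2" using Z by simp
 obtain r1 where r1: "0 < r1" "\<forall>R f g. brody_curve N f --> brody_curve N g -->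
   (\<forall>(a,b)\<in>lattice_disc t 1 (R + r1). f (Complex (t * of_int a) (of_int b)) = g (Complex (t * of_int a) (of_int b))) -->
   (\<forall>z. cmod z <= R --> pdist N (f z) (g z) <= \<delta>2 / 2)"
  using brody_curves_agree_on_lattice[OF t d2, of N] by (elim exE conjE)
 show ?thesis
 proof (intro exI[of _ "\<rho>0 + r1"] conjI allI impI)
  show "0 < \<rho>0 + r1" using \<rho>0 r1 by simp
  fix R :: real assume R: "0 <= R"
  define \<Lambda> where "\<Lambda> = lattice_disc t 1 (R + (\<rho>0 + r1))"
  have f\<Lambda>: "finite \<Lambda>" unfolding \<Lambda>_def by (rule finite_lattice_disc) (use t in auto)
  define \<rho> where "\<rho> = (%f g. \<Sum>\<omega>\<in>\<Lambda>. pdist N (f (lpt t \<omega>)) (g (lpt t \<omega>)))"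
  have c\<rho>: "cont_pmet (brody_space N) \<rho>" unfolding \<rho>_def by (intro cont_pmet_sum f\<Lambda> cont_pmet_evaluation)
  have cD: "cont_pmet (brody_space N) (orbit_dist R)"
   using cont_pmet_mdist[of "orbit_metric translate R m"] unfolding mtopology_orbit_metric[OF R] orbit_metric_simps[OF R] .
  have fib: "orbit_dist R f g <= e / 2" if f: "f \<in> topspace (brody_space N)" and g: "g \<in> topspace (brody_space N)" and z: "\<rho> f g = 0" for f g
  proof -
   have fg: "brody_curve N f" "brody_curve N g" using f g by (auto simp: topspace_brody_space)
   have "pdist N (f (lpt t \<omega>)) (g (lpt t \<omega>)) = 0" if "\<omega> \<in> \<Lambda>" for \<omega>
    using z that f\<Lambda> unfolding \<rho>_def by (subst (asm) sum_nonneg_eq_0_iff) (auto simp: pdist_metric)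
   hence "f (lpt t \<omega>) = g (lpt t \<omega>)" if "\<omega> \<in> \<Lambda>" for \<omega>
    using pdist_eq_0D[OF brody_curve_in_CP[OF fg(1)] brody_curve_in_CP[OF fg(2)]] that by blast
   hence agree: "\<forall>(a,b)\<in>lattice_disc t 1 ((R + \<rho>0) + r1). f (Complex (t * of_int a) (of_int b)) = g (Complex (t * of_int a) (of_int b))"
    by (auto simp: \<Lambda>_def lpt_def add.assoc)
   have close: "pdist N (f w) (g w) <= \<delta>2 / 2" if "cmod w <= R + \<rho>0" for w
    using r1(2)[rule_format, of f g "R + \<rho>0" w] fg agree that by blast
   show ?thesis
    unfolding orbit_dist_le_iff[OF R fg] orbit_close_def
   proof
    fix z :: complex assume "z \<in> cball 0 R"
    hence zR: "cmod z <= R" by simp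
    have "pdist N (translate z f w) (translate z g w) < \<delta>2" if w: "w \<in> Z" for w
    proof -
     have "cmod w <= \<rho>0" using \<rho>0 w by blast
     hence "cmod (w + z) <= R + \<rho>0" using zR norm_triangle_ineq[of w z] by linarith
     thus ?thesis using close[of "w + z"] Z(2) by (simp add: translate_def)
    qed
    hence "cdist N (translate z f) (translate z g) < \<delta>1"
     using Z(3) brody_curve_translate[OF fg(1)] brody_curve_translate[OF fg(2)] by blast
    thus "mdist m (translate z f) (translate z g) <= e / 2"
     using 1(2) brody_curve_translate[OF fg(1)] brody_curve_translate[OF fg(2)] by (blast intro: less_imp_le)
   qed
  qed
  have "e / 2 < e" using e by simp
  from cont_pmet_fibre_uniform[OF compact_brody_space cD c\<rho> fib this] obtain \<delta> where \<delta>: "0 < \<delta>"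
   "!!x y. x \<in> topspace (brody_space N) ==> y \<in> topspace (brody_space N) ==> \<rho> x y < \<delta> ==> orbit_dist R x y < e"
   by blast
  have box: "box_dim_le (topspace (brody_space N)) \<rho> (2 * N * card \<Lambda>)"
   unfolding \<rho>_def by (rule box_dim_le_sum[OF box_dim_CP f\<Lambda>]) (auto simp: topspace_brody_space intro: brody_curve_in_CP)
  have "emb_dim_le (brody_space N) (%x y. \<rho> x y <= \<delta> / 2) (2 * N * card \<Lambda>)"
   by (rule emb_dim_le_box_dim[OF _ _ _ box]) (use cont_pmetD[OF c\<rho>] \<delta>(1) in auto)
  thus "orbit_emb e (cball 0 R) (2 * N * card (lattice_disc t 1 (R + (\<rho>0 + r1))))"
   unfolding \<Lambda>_def[symmetric]
  proof (rule emb_dim_le_mono)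
   fix f g assume fg: "f \<in> topspace (brody_space N)" "g \<in> topspace (brody_space N)" and "\<rho> f g <= \<delta> / 2"
   hence "\<rho> f g < \<delta>" using \<delta>(1) by linarith
   hence "orbit_dist R f g <= e" using \<delta>(2)[OF fg] by (simp add: less_imp_le)
   thus "orbit_close e (cball 0 R) f g" using orbit_dist_le_iff[OF R, of f g e] fg by (simp add: topspace_brody_space)
  qed simp
 qed
qed

text \<open>
  The translate by a lattice point \<open>\<nu> i\<close> of the disc moves the separation of the \<open>i\<close>-th faces to the
  origin, where it is bounded below in terms of the metric \<open>m\<close> by compactness, independently of \<open>R\<close>.
\<close>

lemma orbit_dim_lower:
 assumes t: "0 < t" and \<delta>: "0 < \<delta>" and C: "0 <= C"
  and fam: "\<forall>\<Lambda>. finite \<Lambda> --> (\<exists>c \<nu>. separated_family N t \<delta> C \<Lambda> c \<nu>)"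
 shows "\<exists>e'>0. \<forall>e R k. e < e' --> orbit_emb e (cball 0 R) k --> 2 * N * card (lattice_disc t 1 R) <= k"
proof -
 have "\<exists>e'>0. \<forall>f\<in>topspace (brody_space N). \<forall>g\<in>topspace (brody_space N). mdist m f g < e' --> pdist N (f 0) (g 0) < \<delta>"
  by (rule cont_pmet_uniform[OF compact_brody_space cont_pmet_evaluation cont_pmet_m _ \<delta>])
    (auto simp: topspace_brody_space mdist_0_iff pdist_metric)
 then obtain e' where e': "0 < e'" "\<forall>f\<in>topspace (brody_space N). \<forall>g\<in>topspace (brody_space N). mdist m f g < e' --> pdist N (f 0) (g 0) < \<delta>"
  by (elim exE conjE)
 show ?thesis
 proof (intro exI[of _ e'] conjI e'(1) allI impI)
  fix e R k assume e: "e < e'" and emb: "orbit_emb e (cball 0 R) k"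
  define \<Lambda> where "\<Lambda> = lattice_disc t 1 R"
  define n where "n = 2 * N * card \<Lambda>"
  have "finite \<Lambda>" unfolding \<Lambda>_def by (rule finite_lattice_disc) (use t in auto)
  from fam[rule_format, OF this] obtain c \<nu> where
   c: "\<forall>x\<in>cube n. brody_curve N (c x)"
   and lip: "\<forall>x\<in>cube n. \<forall>y\<in>cube n. \<forall>\<tau>>0. (\<forall>j<n. \<bar>x j - y j\<bar> < \<tau>) --> (\<forall>z. pdist N (c x z) (c y z) <= C * \<tau>)"
   and sep: "\<forall>i<n. \<nu> i \<in> \<Lambda> & (\<forall>x\<in>cube n. \<forall>y\<in>cube n. x i = 0 --> y i = 1 --> \<delta> <= pdist N (c x (lpt t (\<nu> i))) (c y (lpt t (\<nu> i))))"
   unfolding separated_family_def Let_def n_def[symmetric] by (elim exE conjE)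
  have "n <= k"
  proof (rule emb_dim_lower_bound[where m=m and c=c and d="%i f g. mdist m (translate (lpt t (\<nu> i)) f) (translate (lpt t (\<nu> i)) g)"
     and E="orbit_close e (cball 0 R)" and \<epsilon>=e and \<epsilon>'=e'])
   show "compact_space (mtopology_of m)" unfolding m by (rule compact_brody_space)
   show "c x \<in> mspace m" if "x \<in> cube n" for x using c that by (simp add: mspace_brody)
   show "e < e'" by (rule e)
   show "emb_dim_le (mtopology_of m) (orbit_close e (cball 0 R)) k" unfolding m by (rule emb)
   fix \<delta>' :: real assume "0 < \<delta>'"
   from cdist_imp_mdist[OF this] obtain \<delta>1 where 1: "0 < \<delta>1"
    "\<forall>f g. brody_curve N f --> brody_curve N g --> cdist N f g < \<delta>1 --> mdist m f g < \<delta>'" by (elim exE conjE)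
   define \<tau> where "\<tau> = \<delta>1 / (2 * (C + 1))"
   have \<tau>: "0 < \<tau>" "C * \<tau> < \<delta>1"
   proof -
    show "0 < \<tau>" using 1 C by (simp add: \<tau>_def)
    hence "C * \<tau> <= (C + 1) * \<tau>" by simp
    also have "... = \<delta>1 / 2" using C by (simp add: \<tau>_def field_simps)
    also have "... < \<delta>1" using 1 by simp
    finally show "C * \<tau> < \<delta>1" .
   qed
   show "\<exists>\<tau>>0. \<forall>a\<in>cube n. \<forall>b\<in>cube n. (\<forall>j<n. \<bar>a j - b j\<bar> < \<tau>) --> mdist m (c a) (c b) < \<delta>'"
   proof (intro exI[of _ \<tau>] conjI \<tau>(1) ballI impI)
    fix a b assume ab: "a \<in> cube n" "b \<in> cube n" and "\<forall>j<n. \<bar>a j - b j\<bar> < \<tau>"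
    hence p: "pdist N (c a z) (c b z) <= C * \<tau>" for z using lip \<tau>(1) by blast
    have "cdist N (c a) (c b) <= C * \<tau>"
    proof (rule cdist_le)
     fix z
     have "exp (- cmod z) * pdist N (c a z) (c b z) <= 1 * (C * \<tau>)"
      using p[of z] pdist_metric(1)[of N "c a z" "c b z"] by (intro mult_mono) auto
     thus "exp (- cmod z) * pdist N (c a z) (c b z) <= C * \<tau>" by simp
    qed (use c ab in auto)
    hence "cdist N (c a) (c b) < \<delta>1" using \<tau>(2) by linarith
    thus "mdist m (c a) (c b) < \<delta>'" using 1(2) c ab by blast
   qed
  next
   fix i assume i: "i < n"
   show "cont_pmet (mtopology_of m) (%f g. mdist m (translate (lpt t (\<nu> i)) f) (translate (lpt t (\<nu> i)) g))"
    unfolding m by (rule cont_pmet_pullback[OF cont_pmet_m continuous_map_translate])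
   have "lpt t (\<nu> i) \<in> cball 0 R"
    using sep i unfolding \<Lambda>_def lattice_disc_def by (auto simp: lpt_def)
   thus "mdist m (translate (lpt t (\<nu> i)) x) (translate (lpt t (\<nu> i)) y) <= e" if "orbit_close e (cball 0 R) x y" for x y
    using that unfolding orbit_close_def by blast
   fix a b assume ab: "a \<in> cube n" "b \<in> cube n" "a i = 0" "b i = 1"
   let ?f = "translate (lpt t (\<nu> i)) (c a)" and ?g = "translate (lpt t (\<nu> i)) (c b)"
   have "\<delta> <= pdist N (?f 0) (?g 0)" using sep i ab by (simp add: translate_def)
   moreover have "?f \<in> topspace (brody_space N)" "?g \<in> topspace (brody_space N)"
    using c ab by (auto simp: topspace_brody_space brody_curve_translate)
   ultimately have "\<not> mdist m ?f ?g < e'" using e'(2) by force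
   thus "e' <= mdist m ?f ?g" by simp
  qed
  thus "2 * N * card (lattice_disc t 1 R) <= k" by (simp add: n_def \<Lambda>_def)
 qed
qed

definition orbit_dim :: "real => complex set => nat" where
 "orbit_dim e \<Omega> = (LEAST n. orbit_emb e \<Omega> n)"

lemma orbit_dim_le_iff:
 assumes e: "0 < e" and b: "bounded \<Omega>"
 shows "orbit_dim e \<Omega> <= n \<longleftrightarrow> orbit_emb e \<Omega> n"
proof -
 obtain R where R: "0 < R" "\<forall>z\<in>\<Omega>. cmod z <= R" using b unfolding bounded_pos by (elim exE conjE)
 have "\<exists>n. orbit_emb e (cball 0 R) n"
  using orbit_dim_upper[OF e, of "1/4"] R(1) by (auto dest!: spec[of _ R])
 then obtain n0 where "orbit_emb e (cball 0 R) n0" by (elim exE)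
 hence "orbit_emb e \<Omega> n0"
  by (rule emb_dim_le_mono) (use R in \<open>auto simp: orbit_close_def\<close>)
 hence L: "orbit_emb e \<Omega> (orbit_dim e \<Omega>)" unfolding orbit_dim_def by (rule LeastI)
 show ?thesis
 proof
  assume "orbit_dim e \<Omega> <= n" thus "orbit_emb e \<Omega> n" using L by (auto intro: emb_dim_le_mono)
 next
  assume "orbit_emb e \<Omega> n" thus "orbit_dim e \<Omega> <= n" unfolding orbit_dim_def by (rule Least_le)
 qed
qed

lemma emb_dim_le_orbit_dim:
 assumes "0 < e" "bounded \<Omega>"
 shows "orbit_emb e \<Omega> (orbit_dim e \<Omega>)"
 by (rule orbit_dim_le_iff[OF assms, THEN iffD1]) (rule order_refl)

lemma orbit_close_mono: "e <= e' ==> A \<subseteq> B ==> orbit_close e B f g ==> orbit_close e' A f g"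
 unfolding orbit_close_def by (meson order_trans subsetD)

lemma Widim_orbit_metric:
 assumes e: "0 < e" and R: "0 <= R"
 shows "Widim e (orbit_metric translate R m) = orbit_dim e (cball 0 R)"
proof -
 let ?M = "orbit_metric translate R m"
 have iff: "emb_dim_le (mtopology_of ?M) (%x y. mdist ?M x y <= e) n \<longleftrightarrow> orbit_emb e (cball 0 R) n" for n
  unfolding mtopology_orbit_metric[OF R] orbit_metric_simps[OF R]
  by (auto elim!: emb_dim_le_mono simp: orbit_dist_le_iff[OF R] topspace_brody_space)
 have c: "compact_space (mtopology_of ?M)" unfolding mtopology_orbit_metric[OF R] by (rule compact_brody_space)
 have ex: "emb_dim_le (mtopology_of ?M) (%x y. mdist ?M x y <= e) (orbit_dim e (cball 0 R))"
  unfolding iff by (rule emb_dim_le_orbit_dim[OF e bounded_cball])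
 have "Widim e ?M <= n \<longleftrightarrow> orbit_dim e (cball 0 R) <= n" for n
  unfolding Widim_le_iff[OF c less_imp_le[OF e] ex] iff orbit_dim_le_iff[OF e bounded_cball] ..
 from this[of "Widim e ?M"] this[of "orbit_dim e (cball 0 R)"] show ?thesis by simp
qed

text \<open>
  Subadditivity is \<open>emb_dim_le_conj\<close>, and translating the set of translations is a pullback along a translation of curves.
\<close>

lemma orbit_dim_limit:
 assumes e: "0 < e"
 shows "\<exists>L\<ge>0. ((%R. real (orbit_dim e (cball 0 R)) / (pi * R^2)) \<longlongrightarrow> L) at_top"
proof (rule Ornstein_Weiss_disc[where W="orbit_dim e"])
 fix A B :: "complex set" assume AB: "A \<subseteq> B" "bounded B"
 hence b: "bounded A" using bounded_subset by blast
 show "orbit_dim e A <= orbit_dim e B"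
  unfolding orbit_dim_le_iff[OF e b]
  by (rule emb_dim_le_mono[OF emb_dim_le_orbit_dim[OF e AB(2)] order_refl]) (rule orbit_close_mono[OF order_refl AB(1)])
next
 have "orbit_emb e {} 0"
 proof (rule emb_dim_le_nerve[where \<phi>="%_ _. 1" and n=1])
  show "card {i::nat. i < 1 & (0::real) < 1} <= Suc 0" by simp
 qed (auto simp: orbit_close_def)
 thus "orbit_dim e {} = 0" using orbit_dim_le_iff[OF e, of "{}" 0] by simp
next
 fix A B :: "complex set" assume AB: "bounded A" "bounded B"
 have "emb_dim_le (brody_space N) (%f g. orbit_close e A f g & orbit_close e B f g) (orbit_dim e A + orbit_dim e B)"
  by (intro emb_dim_le_conj emb_dim_le_orbit_dim e AB)
 hence "orbit_emb e (A \<union> B) (orbit_dim e A + orbit_dim e B)"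
  by (rule emb_dim_le_mono) (auto simp: orbit_close_def)
 thus "orbit_dim e (A \<union> B) <= orbit_dim e A + orbit_dim e B" using AB orbit_dim_le_iff[OF e, of "A \<union> B"] by simp
next
 fix A :: "complex set" and c assume A: "bounded A"
 have "orbit_emb e A (orbit_dim e A)" by (rule emb_dim_le_orbit_dim[OF e A])
 from emb_dim_le_pullback[OF this continuous_map_translate[of N c]]
 have "orbit_emb e ((+) c ` A) (orbit_dim e A)"
  by (rule emb_dim_le_mono) (auto simp: orbit_close_def translate_translate add.commute)
 moreover have "bounded ((+) c ` A)" using A by (rule bounded_translation)
 ultimately show "orbit_dim e ((+) c ` A) <= orbit_dim e A" using orbit_dim_le_iff[OF e] by blast
qed blast

lemma Widim_rate_eq:
 assumes e: "0 < e" and L: "((%R. real (orbit_dim e (cball 0 R)) / (pi * R^2)) \<longlongrightarrow> L) at_top"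
 shows "Widim_rate e translate m = ereal L"
 unfolding Widim_rate_def
proof (rule tendsto_Lim)
 have "((%R. ereal (real (orbit_dim e (cball 0 R)) / (pi * R^2))) \<longlongrightarrow> ereal L) at_top" using L by simp
 moreover have "\<forall>\<^sub>F R in at_top. ereal (real (orbit_dim e (cball 0 R)) / (pi * R^2)) = ereal (real (Widim e (orbit_metric translate R m)) / (pi * R^2))"
  using eventually_ge_at_top[of 0] by eventually_elim (simp add: Widim_orbit_metric[OF e])
 ultimately show "((%R. ereal (real (Widim e (orbit_metric translate R m)) / (pi * R^2))) \<longlongrightarrow> ereal L) at_top"
  by (rule Lim_transform_eventually)
qed (rule trivial_limit_at_top_linorder)

lemma Widim_rate_mono:
 assumes e: "0 < e1" "e1 <= e2"
 shows "Widim_rate e2 translate m <= Widim_rate e1 translate m"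
proof -
 have e2: "0 < e2" using e by simp
 obtain L1 where L1: "((%R. real (orbit_dim e1 (cball 0 R)) / (pi * R^2)) \<longlongrightarrow> L1) at_top" using orbit_dim_limit[OF e(1)] by blast
 obtain L2 where L2: "((%R. real (orbit_dim e2 (cball 0 R)) / (pi * R^2)) \<longlongrightarrow> L2) at_top" using orbit_dim_limit[OF e2] by blast
 have "orbit_dim e2 (cball 0 R) <= orbit_dim e1 (cball 0 R)" for R
  unfolding orbit_dim_le_iff[OF e2 bounded_cball]
  by (rule emb_dim_le_mono[OF emb_dim_le_orbit_dim[OF e(1) bounded_cball] order_refl]) (rule orbit_close_mono[OF e(2) subset_refl])
 hence "L2 <= L1"
  by (intro tendsto_le[OF trivial_limit_at_top_linorder L1 L2] always_eventually allI divide_right_mono) auto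
 thus ?thesis unfolding Widim_rate_eq[OF e(1) L1] Widim_rate_eq[OF e2 L2] by simp
qed

lemma square_ratio_tendsto: "((%R::real. c * (pi * (R + s)^2) / (pi * R^2)) \<longlongrightarrow> c) at_top"
proof -
 have "((%R::real. c * ((R + s)^2 / R^2)) \<longlongrightarrow> c * 1) at_top"
  by (intro tendsto_intros) real_asymp
 moreover have "c * ((R + s)^2 / R^2) = c * (pi * (R + s)^2) / (pi * R^2)" for R by simp
 ultimately show ?thesis by simp
qed

text \<open>
  The lattice density \<open>1/t\<close> may be any number greater than \<open>2\<close>.
\<close>

lemma Widim_rate_le:
 assumes e: "0 < e"
 shows "Widim_rate e translate m <= ereal (4 * real N)"
proof -
 obtain L where L: "((%R. real (orbit_dim e (cball 0 R)) / (pi * R^2)) \<longlongrightarrow> L) at_top" using orbit_dim_limit[OF e] by blast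
 have le: "L <= 2 * real N / t" if t: "0 < t" "t < 1 / 2" for t
 proof -
  obtain r0 where r0: "0 < r0" "\<forall>R\<ge>0. orbit_emb e (cball 0 R) (2 * N * card (lattice_disc t 1 (R + r0)))"
   using orbit_dim_upper[OF e t] by (elim exE conjE)
  have "\<forall>\<^sub>F R in at_top. real (orbit_dim e (cball 0 R)) / (pi * R^2) <= 2 * real N / t * (pi * (R + (r0 + t + 1))^2) / (pi * R^2)"
   using eventually_ge_at_top[of 0]
  proof eventually_elim
   case (elim R)
   have "t * 1 * real (card (lattice_disc t 1 (R + r0))) <= pi * (R + r0 + (t + 1))^2"
    using card_lattice_disc(2)[of t 1 "R + r0"] t r0 elim by simp
   hence c: "real (card (lattice_disc t 1 (R + r0))) <= pi * (R + (r0 + t + 1))^2 / t"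
    using t by (simp add: pos_le_divide_eq add.assoc mult.commute)
   have "orbit_dim e (cball 0 R) <= 2 * N * card (lattice_disc t 1 (R + r0))"
    using r0(2) elim orbit_dim_le_iff[OF e bounded_cball] by blast
   hence "real (orbit_dim e (cball 0 R)) <= real (2 * N * card (lattice_disc t 1 (R + r0)))" by (rule of_nat_mono)
   also have "... = 2 * real N * real (card (lattice_disc t 1 (R + r0)))" by simp
   also have "... <= 2 * real N * (pi * (R + (r0 + t + 1))^2 / t)" by (intro mult_left_mono c) auto
   also have "... = 2 * real N / t * (pi * (R + (r0 + t + 1))^2)" by simp
   finally show ?case by (intro divide_right_mono) auto
  qed
  thus ?thesis by (rule tendsto_le[OF trivial_limit_at_top_linorder square_ratio_tendsto L])
 qed
 have "((%t. 2 * real N / t) \<longlongrightarrow> 2 * real N / (1 / 2)) (at_left (1 / 2))" by (intro tendsto_intros) auto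
 moreover have "\<forall>\<^sub>F t in at_left (1 / 2). L <= 2 * real N / t"
 proof -
  have "\<forall>\<^sub>F t in at_left (1 / 2). t \<in> {0<..<1 / 2::real}" by (rule eventually_at_left_real) simp
  thus ?thesis by eventually_elim (auto intro: le)
 qed
 ultimately have "L <= 2 * real N / (1 / 2)" by (intro tendsto_lowerbound[of _ _ "at_left (1/2)"]) auto
 thus ?thesis unfolding Widim_rate_eq[OF e L] by simp
qed

lemma Widim_rate_ge:
 assumes e: "0 < e" and t: "0 < t"
  and low: "\<forall>R k. orbit_emb e (cball 0 R) k --> 2 * N * card (lattice_disc t 1 R) <= k"
 shows "ereal (2 * real N / t) <= Widim_rate e translate m"
proof -
 obtain L where L: "((%R. real (orbit_dim e (cball 0 R)) / (pi * R^2)) \<longlongrightarrow> L) at_top" using orbit_dim_limit[OF e] by blast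
 have "\<forall>\<^sub>F R in at_top. 2 * real N / t * (pi * (R + (- (t + 1)))^2) / (pi * R^2) <= real (orbit_dim e (cball 0 R)) / (pi * R^2)"
  using eventually_ge_at_top[of "t + 1"]
 proof eventually_elim
  case (elim R)
  have "pi * (R - (t + 1))^2 <= t * 1 * real (card (lattice_disc t 1 R))" using card_lattice_disc(1)[of t 1 R] t elim by simp
  moreover have "R + (- (t + 1)) = R - (t + 1)" by simp
  ultimately have c: "pi * (R + (- (t + 1)))^2 / t <= real (card (lattice_disc t 1 R))"
   unfolding pos_divide_le_eq[OF t] by (simp only: mult_1_right mult.commute)
  have "2 * real N / t * (pi * (R + (- (t + 1)))^2) = 2 * real N * (pi * (R + (- (t + 1)))^2 / t)" by simp
  also have "... <= 2 * real N * real (card (lattice_disc t 1 R))" by (intro mult_left_mono c) auto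
  also have "... = real (2 * N * card (lattice_disc t 1 R))" by simp
  also have "... <= real (orbit_dim e (cball 0 R))"
   using low orbit_dim_le_iff[OF e bounded_cball, of 0 R "orbit_dim e (cball 0 R)"] by (intro of_nat_mono) blast
  finally show ?case by (intro divide_right_mono) auto
 qed
 hence "2 * real N / t <= L" by (rule tendsto_le[OF trivial_limit_at_top_linorder L square_ratio_tendsto])
 thus ?thesis unfolding Widim_rate_eq[OF e L] by simp
qed

lemma Widim_rate_tendsto: "((\<lambda>\<epsilon>. Widim_rate \<epsilon> translate m) \<longlongrightarrow> (SUP \<epsilon>\<in>{0<..}. Widim_rate \<epsilon> translate m)) (at_right 0)"
proof (rule order_tendstoI)
 fix y assume "y < (SUP \<epsilon>\<in>{0<..}. Widim_rate \<epsilon> translate m)"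
 then obtain e0 where e0: "e0 \<in> {0<..}" "y < Widim_rate e0 translate m" unfolding less_SUP_iff by (elim bexE)
 have "\<forall>\<^sub>F \<epsilon> in at_right 0. \<epsilon> \<in> {0<..<e0}" using e0(1) by (intro eventually_at_right_real) auto
 thus "\<forall>\<^sub>F \<epsilon> in at_right 0. y < Widim_rate \<epsilon> translate m"
  by eventually_elim (use e0(2) Widim_rate_mono in \<open>auto intro: less_le_trans\<close>)
next
 fix y assume y: "(SUP \<epsilon>\<in>{0<..}. Widim_rate \<epsilon> translate m) < y"
 have "\<forall>\<^sub>F \<epsilon> in at_right 0. \<epsilon> \<in> {0<..<1::real}" by (intro eventually_at_right_real) auto
 thus "\<forall>\<^sub>F \<epsilon> in at_right 0. Widim_rate \<epsilon> translate m < y"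
 proof eventually_elim
  case (elim \<epsilon>)
  have "Widim_rate \<epsilon> translate m <= (SUP \<epsilon>\<in>{0<..}. Widim_rate \<epsilon> translate m)" using elim by (intro SUP_upper) auto
  thus ?case using y by (rule le_less_trans)
 qed
qed

lemma metric_mean_dim_eq: "metric_mean_dim translate m = (SUP \<epsilon>\<in>{0<..}. Widim_rate \<epsilon> translate m)"
 unfolding metric_mean_dim_def by (rule tendsto_Lim[OF _ Widim_rate_tendsto]) simp

lemma metric_mean_dim_le: "metric_mean_dim translate m <= ereal (4 * real N)"
 unfolding metric_mean_dim_eq by (rule SUP_least) (use Widim_rate_le in auto)

lemma metric_mean_dim_ge:
 assumes t: "0 < t" and e': "0 < e'"
  and low: "\<forall>e R k. e < e' --> orbit_emb e (cball 0 R) k --> 2 * N * card (lattice_disc t 1 R) <= k"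
 shows "ereal (2 * real N / t) <= metric_mean_dim translate m"
proof -
 have "ereal (2 * real N / t) <= Widim_rate (e' / 2) translate m"
  by (rule Widim_rate_ge[OF _ t]) (use e' low[THEN spec, of "e' / 2"] in \<open>simp_all\<close>)
 also have "... <= metric_mean_dim translate m" unfolding metric_mean_dim_eq by (rule SUP_upper) (use e' in auto)
 finally show ?thesis .
qed

end

definition some_brody_metric :: "nat => (complex => (nat => complex) set) metric" where
 "some_brody_metric N = (SOME m. mtopology_of m = brody_space N)"

lemma some_brody_metric: "mtopology_of (some_brody_metric N) = brody_space N"
 unfolding some_brody_metric_def by (rule someI[of _ "brody_metric N"]) (rule mtopology_cdist)

lemma mean_dim_brody_le: "mean_dim (brody_space N) translate <= ereal (4 * real N)"
 unfolding mean_dim_def some_brody_metric_def[symmetric] by (rule metric_mean_dim_le[OF some_brody_metric])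

text \<open>
  The numbers \<open>\<alpha> < a < a' < 1\<close> leave room first for the decay of the bumps and then for the energy of the perturbation.
\<close>

lemma mean_dim_brody_ge:
 assumes \<alpha>: "0 < \<alpha>" "\<alpha> < 1"
 shows "\<forall>\<^sub>F N in sequentially. ereal (2 * \<alpha> * real N) <= mean_dim (brody_space N) translate"
proof -
 define a a' t where "a = (\<alpha> + 1) / 2" and "a' = (\<alpha> + 3) / 4" and "t = 1 / \<alpha>"
 have a: "0 < a" "a < a'" "a < 1" "0 < a'" "a' < 1" "0 < t" "1 / t < a" using \<alpha> by (auto simp: a_def a'_def t_def)
 show ?thesis
  using theta_curve[OF a(1,2,3)]
 proof eventually_elim
  case (elim N)
  then obtain F where F: "\<forall>i\<le>N. F i holomorphic_on UNIV" "\<forall>z. exp (2 * (pi * a * (Re z)^2)) / 16 <= nsq N F z"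
   "\<forall>i\<le>N. \<forall>z. cmod (F i z) <= 2 * exp (pi * a * (Re z)^2)"
   "\<forall>z. covariant_energy a N F z <= pi * a' * nsq N F z"
   by (elim exE conjE)
  have "\<exists>\<delta>>0. \<exists>C\<ge>0. \<forall>\<Lambda>. finite \<Lambda> --> (\<exists>c \<nu>. separated_family N t \<delta> C \<Lambda> c \<nu>)"
   using F by (intro perturbation_family[OF a(1,3,4,5,6,7), of N F]) auto
  then obtain \<delta> C where \<delta>: "0 < \<delta>" and C: "0 <= C"
   and fam': "\<forall>\<Lambda>. finite \<Lambda> --> (\<exists>c \<nu>. separated_family N t \<delta> C \<Lambda> c \<nu>)"
   by (elim exE conjE)
  obtain e' where e': "0 < e'" "\<forall>e R k. e < e' --> emb_dim_le (brody_space N) (orbit_close (some_brody_metric N) e (cball 0 R)) k --> 2 * N * card (lattice_disc t 1 R) <= k"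
   using orbit_dim_lower[OF some_brody_metric a(6) \<delta> C fam'] by (elim exE conjE)
  have "ereal (2 * real N / t) <= metric_mean_dim translate (some_brody_metric N)"
   by (rule metric_mean_dim_ge[OF some_brody_metric a(6) e'])
  moreover have "2 * real N / t = 2 * \<alpha> * real N" by (simp add: t_def)
  ultimately show ?case unfolding mean_dim_def some_brody_metric_def[symmetric] by simp
 qed
qed

theorem theorem1p3:
  shows "2 \<le> liminf (\<lambda>N. mean_dim (brody_space N) translate / ereal (real N)) \<and>
         liminf (\<lambda>N. mean_dim (brody_space N) translate / ereal (real N))
           \<le> limsup (\<lambda>N. mean_dim (brody_space N) translate / ereal (real N)) \<and>
         limsup (\<lambda>N. mean_dim (brody_space N) translate / ereal (real N)) \<le> 4"
proof (intro conjI)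
  let ?q = "\<lambda>N. mean_dim (brody_space N) translate / ereal (real N)"
  show "liminf ?q \<le> limsup ?q" by (rule Liminf_le_Limsup) simp
  show "limsup ?q \<le> 4"
  proof (rule Limsup_bounded)
    show "\<forall>\<^sub>F N in sequentially. ?q N \<le> 4"
      using eventually_gt_at_top[of 0]
    proof eventually_elim
      case (elim N)
      then have "?q N \<le> ereal (4 * real N) / ereal (real N)" by (intro ereal_divide_right_mono mean_dim_brody_le) auto
      also have "\<dots> = 4" using elim by simp
      finally show ?case .
    qed
  qed
  have low: "ereal (2 * \<alpha>) \<le> liminf ?q" if \<alpha>: "0 < \<alpha>" "\<alpha> < 1" for \<alpha>
  proof (rule Liminf_bounded)
    show "\<forall>\<^sub>F N in sequentially. ereal (2 * \<alpha>) \<le> ?q N"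
      using mean_dim_brody_ge[OF \<alpha>] eventually_gt_at_top[of 0]
    proof eventually_elim
      case (elim N)
      have "ereal (2 * \<alpha>) = ereal (2 * \<alpha> * real N) / ereal (real N)" using elim(2) by simp
      also have "\<dots> \<le> ?q N" using elim by (intro ereal_divide_right_mono) auto
      finally show ?case .
    qed
  qed
  show "2 \<le> liminf ?q"
  proof (rule dense_le)
    fix x :: ereal assume x: "x < 2"
    show "x \<le> liminf ?q"
    proof (cases x)
      case (real r)
      define \<alpha> where "\<alpha> = (max 1 r + 2) / 4"
      have r: "r < 2" using x real by simp
      then have "0 < \<alpha>" "\<alpha> < 1" "r \<le> 2 * \<alpha>" by (auto simp: \<alpha>_def max_def)
      then have "x \<le> ereal (2 * \<alpha>)" "ereal (2 * \<alpha>) \<le> liminf ?q" using real low by auto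
      then show ?thesis by (rule order_trans)
    qed (use x in auto)
  qed
qed

end
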